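(* Assume that $(n-d)/\sqrt{d} \to \rho$ for some $\rho \in [0,\infty)$ as $n\to\infty$. Then $$ d\, H_{\mathrm{typ}} - \rho\sqrt{2/\pi} \xrightarrow{D} Z, $$ where $Z$ is a standard normal random variable and $\xrightarrow{D}$ denotes convergence in distribution.
   Context: Asymptotic setting: $\mathbb{N}\ni n\to\infty$ and $d=d(n)\in\{2,\ldots,n-1\}$ is a function of $n$ which is either constant or tends to infinity. All limits are as $n\to\infty$. Let $X_1,\ldots,X_n$ be i.i.d. random vectors uniformly distributed on the unit sphere $\mathbb{S}^{d-1}\subset\mathbb{R}^d$, and let $P_{n,d}=[X_1,\ldots,X_n]$ be their convex hull. A facet ($(d-1)$-dimensional face) of $P_{n,d}$ has height $h\in[-1,1]$ if its supporting hyperplane is $\{x\in\mathbb{R}^d:\langle x,u\rangle=h\}$ for some $u\in\mathbb{S}^{d-1}$ and $P_{n,d}\subset\{x:\langle x,u\rangle\le h\}$ (heights can be negative). The typical height $H_{\mathrm{typ}}$ (depending on $n,d$) is the random variable with distribution $$\mathbb{P}(H_{\mathrm{typ}}\in\cdot)=\mathbb{P}\big([X_1,\ldots,X_d]\text{ has height in }\cdot \;\big|\; [X_1,\ldots,X_d]\text{ is a facet of }P_{n,d}\big).$$ *)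

theory Defs
  imports "HOL-Probability.Probability" "HOL-Library.Function_Algebras"
begin

text \<open>
  The dimension \<open>d\<close> varies with \<open>n\<close>, so it cannot be a type.  We identify \<open>\<real>\<^sup>d\<close> with the linear
  subspace of \<open>nat \<Rightarrow> real\<close> of all \<open>x\<close> with \<open>x i = 0\<close> for \<open>i \<ge> d\<close>.  Pointwise scalar multiplication
  makes \<open>nat \<Rightarrow> real\<close> a real vector space, so that the library's convex hull, affine hull and
  \<open>face_of\<close> apply.
\<close>

instantiation "fun" :: (type, real_vector) real_vector
begin

definition scaleR_fun :: "real \<Rightarrow> ('a \<Rightarrow> 'b) \<Rightarrow> 'a \<Rightarrow> 'b"
  where "scaleR_fun c f = (\<lambda>x. c *\<^sub>R f x)"

instance
  by standard
    (simp_all add: scaleR_fun_def fun_eq_iff scaleR_add_right scaleR_add_left)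

end

definition euclid :: "nat \<Rightarrow> (nat \<Rightarrow> real) set"
  where "euclid d = {x. \<forall>i\<ge>d. x i = 0}"

definition euclid_inner :: "nat \<Rightarrow> (nat \<Rightarrow> real) \<Rightarrow> (nat \<Rightarrow> real) \<Rightarrow> real"
  where "euclid_inner d x y = (\<Sum>i<d. x i * y i)"

definition euclid_norm :: "nat \<Rightarrow> (nat \<Rightarrow> real) \<Rightarrow> real"
  where "euclid_norm d x = sqrt (euclid_inner d x x)"

definition unit_sphere :: "nat \<Rightarrow> (nat \<Rightarrow> real) set"
  where "unit_sphere d = {x \<in> euclid d. euclid_norm d x = 1}"

text \<open>
  The uniform distribution on the unit sphere of \<open>\<real>\<^sup>d\<close> is the normalised surface measure.  It is
  given here by the cone construction: the probability of \<open>A\<close> is the Lebesgue measure of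
  \<open>{t x | x \<in> A, 0 < t \<le> 1}\<close> divided by that of the unit ball, that is, the image of the uniform
  distribution on the ball under \<open>x \<mapsto> x / \<parallel>x\<parallel>\<close>.  (The origin, sent to \<open>0\<close>, is a null set for
  \<open>d \<ge> 1\<close>.)  Elements of the product measure are \<open>undefined\<close> outside \<open>{..<d}\<close>; the projection
  also replaces these values by \<open>0\<close>.
\<close>

definition uniform_ball :: "nat \<Rightarrow> (nat \<Rightarrow> real) measure"
  where "uniform_ball d =
    uniform_measure (\<Pi>\<^sub>M i\<in>{..<d}. lborel)
      {x \<in> space (\<Pi>\<^sub>M i\<in>{..<d}. lborel). euclid_norm d x \<le> 1}"

definition uniform_sphere :: "nat \<Rightarrow> (nat \<Rightarrow> real) measure"
  where "uniform_sphere d =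
    distr (uniform_ball d) borel (\<lambda>x i. if i < d then x i / euclid_norm d x else 0)"

text \<open>
  The library's \<open>aff_dim\<close> is restricted to types of class \<open>euclidean_space\<close>; the following is its
  defining condition for arbitrary real vector spaces.
\<close>

definition has_aff_dim :: "'a::real_vector set \<Rightarrow> nat \<Rightarrow> bool"
  where "has_aff_dim S k \<longleftrightarrow>
    (\<exists>B. finite B \<and> affine hull B = affine hull S \<and> \<not> affine_dependent B \<and> card B = k + 1)"

definition is_facet :: "nat \<Rightarrow> (nat \<Rightarrow> real) set \<Rightarrow> (nat \<Rightarrow> real) set \<Rightarrow> bool"
  where "is_facet d F P \<longleftrightarrow> F face_of P \<and> has_aff_dim F (d - 1)"

text \<open>
  The supporting hyperplane at a facet \<open>F\<close> of \<open>P\<close> is the one that meets \<open>P\<close> in \<open>F\<close> and has \<open>P\<close> on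
  one side.
\<close>

definition has_height :: "nat \<Rightarrow> (nat \<Rightarrow> real) set \<Rightarrow> (nat \<Rightarrow> real) set \<Rightarrow> real \<Rightarrow> bool"
  where "has_height d F P h \<longleftrightarrow>
    (\<exists>u\<in>unit_sphere d.
      P \<inter> {x \<in> euclid d. euclid_inner d x u = h} = F \<and>
      P \<subseteq> {x \<in> euclid d. euclid_inner d x u \<le> h})"

text \<open>
  \<open>X 1, \<dots>, X n\<close> are the random points, defined on \<open>M\<close>; \<open>H\<close> is a random variable on a possibly
  different probability space \<open>N\<close> whose law is the conditional one.
\<close>

definition typical_height ::
  "'a measure \<Rightarrow> nat \<Rightarrow> nat \<Rightarrow> (nat \<Rightarrow> 'a \<Rightarrow> nat \<Rightarrow> real) \<Rightarrow> 'b measure \<Rightarrow> ('b \<Rightarrow> real) \<Rightarrow> bool"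
  where "typical_height M n d X N H \<longleftrightarrow>
    prob_space N \<and> H \<in> borel_measurable N \<and>
    (\<forall>A\<in>sets borel.
      \<P>(y in N. H y \<in> A) =
      \<P>(\<omega> in M.
          \<exists>h\<in>A. has_height d (convex hull ((\<lambda>i. X i \<omega>) ` {1..d}))
                            (convex hull ((\<lambda>i. X i \<omega>) ` {1..n})) h
        \<bar> is_facet d (convex hull ((\<lambda>i. X i \<omega>) ` {1..d}))
                     (convex hull ((\<lambda>i. X i \<omega>) ` {1..n}))))"

end

theory Submission
  imports Defs "Jordan_Normal_Form.Char_Poly" "HOL-Real_Asymp.Real_Asymp"
begin

text \<open>
  A constant \<open>d\<close> would make \<open>(n - d) / sqrt d\<close> unbounded, so \<open>d \<longlongrightarrow> \<infinity>\<close>.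

  Let \<open>h\<close> be the distance from the origin to the hyperplane through \<open>X 1, \<dots>, X d\<close>.  If the rows of a
  matrix are independent centred Gaussian vectors with covariances \<open>I / s i\<close>, then a rotation of the
  index space shows that this distance is distributed as \<open>\<bar>Z\<bar> / sqrt (\<Sum>i. s i)\<close> with a standard normal \<open>Z\<close>.
  Linear combinations over \<open>s\<close> localise the squared norm of each row at \<open>1\<close> and give
  the even moments of \<open>h\<close> for rows on the sphere.  They are the moments of the density proportional to
  \<open>(1 - t\<^sup>2) powr ((d\<^sup>2 - 2 d - 1) / 2)\<close>; similarly \<open>\<langle>X j, u\<rangle>\<close> has a density proportional to
  \<open>(1 - t\<^sup>2) powr ((d - 3) / 2)\<close> for every unit vector \<open>u\<close>.  Let \<open>F\<close> be its distribution function.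

  Almost surely \<open>X 1, \<dots>, X d\<close> span a facet iff the other \<open>n - d\<close> points lie on one side of their
  hyperplane.  So the typical height has a density proportional to
  \<open>F t ^ (n - d) * (1 - t\<^sup>2) powr ((d\<^sup>2 - 2 d - 1) / 2)\<close>.  For \<open>t = y / d\<close> the second factor tends to
  \<open>exp (- y\<^sup>2 / 2)\<close>, and \<open>(2 * F (y / d)) ^ (n - d)\<close> tends to \<open>exp (\<rho> * sqrt (2 / pi) * y)\<close>.  By dominated
  convergence the limit law of \<open>d\<close> times the height is normal with mean \<open>\<rho> * sqrt (2 / pi)\<close>.
\<close>

section \<open>Lebesgue measure on finite products\<close>

text \<open>Polar coordinates pass from Gaussian rows to directions; the difficulty is to remove the
  radii again. The Gaussian identity contains \<open>(\<Sum>i<d. s i) powr (- q)\<close>, which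
  couples the rows. Written as an integral over \<tau> of exponentials it becomes a product over the
  rows, in which \<tau> only shifts each squared radius. Once the squared radii are forced to 1,
  every row contributes \<open>(1 - \<tau>) powr (d / 2 - 1)\<close>, whence the power
  \<open>(d / 2 - 1) * d\<close> and the exponent of the height density. This takes the place of an
  affine Blaschke-Petkantschin formula and uses no measure on the set of hyperplanes.

  Two scales explain the limit. The exponent of the height density is about
  \<open>d\<^sup>2 / 2\<close>, so heights are of order \<open>1 / d\<close>. A coordinate of a
  single point is of order \<open>1 / sqrt d\<close>, with density about
  \<open>sqrt (d / (2 * pi))\<close> at 0. Hence \<open>2 * F (y / d) - 1\<close> is about
  \<open>y * sqrt (2 / (pi * d))\<close>, and since \<open>(n - d) / sqrt d\<close> tends to \<rho>,
  the power \<open>n - d\<close> produces the constant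
  \<open>\<rho> * sqrt (2 / pi)\<close>.\<close>

abbreviation leb :: "'i set \<Rightarrow> ('i \<Rightarrow> real) measure"
  where "leb I \<equiv> \<Pi>\<^sub>M i\<in>I. lborel"

interpretation leb: product_sigma_finite "\<lambda>_::'i. lborel :: real measure"
  by standard

lemma emeasure_lborel_affine:
  fixes A :: "real set"
  assumes "s \<noteq> 0" "A \<in> sets borel"
  shows "emeasure lborel A = ennreal \<bar>s\<bar> * emeasure lborel ((\<lambda>x. s * x + c) -` A)"
proof -
  have "emeasure lborel A = emeasure (density (distr lborel borel (\<lambda>x. c + s * x)) (\<lambda>_. \<bar>s\<bar>)) A"
    using lborel_real_affine[OF assms(1), of c] by simp
  also have "\<dots> = ennreal \<bar>s\<bar> * emeasure lborel ((\<lambda>x. c + s * x) -` A)"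
    using assms by (simp add: emeasure_density nn_integral_cmult emeasure_distr)
  finally show ?thesis by (simp add: add.commute)
qed

text \<open>Product measures are determined by boxes, and the preimage of a box under a
  coordinatewise affine map is a box, so the one-dimensional rule applies in every factor.
  Translations, point reflections and dilations are instances.\<close>

lemma nn_integral_leb_affine:
  assumes I: "finite I" and f[measurable]: "f \<in> borel_measurable (leb I)"
    and s: "\<And>i. i \<in> I \<Longrightarrow> s i \<noteq> 0"
  shows "(\<integral>\<^sup>+x. f x \<partial>leb I) = (\<Prod>i\<in>I. ennreal \<bar>s i\<bar>) * (\<integral>\<^sup>+x. f (\<lambda>i\<in>I. s i * x i + c i) \<partial>leb I)"
proof -
  let ?T = "\<lambda>x. \<lambda>i\<in>I. s i * x i + c i"
  let ?k = "\<Prod>i\<in>I. ennreal \<bar>s i\<bar>"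
  have T[measurable]: "?T \<in> measurable (leb I) (leb I)" by measurable
  have "scale_measure ?k (distr (leb I) (leb I) ?T) = leb I"
  proof (rule leb.PiM_eqI)
    fix A assume A: "\<And>i. i \<in> I \<Longrightarrow> A i \<in> sets (lborel :: real measure)"
    have eq: "?T -` (Pi\<^sub>E I A) \<inter> space (leb I) = Pi\<^sub>E I (\<lambda>i. (\<lambda>x. s i * x + c i) -` A i)"
      by (auto simp: space_PiM PiE_iff)
    have m: "(\<lambda>x. s i * x + c i) -` A i \<in> sets borel" if "i \<in> I" for i
      using A[OF that] measurable_sets[of "\<lambda>x. s i * x + c i" borel borel "A i"] by auto
    have "emeasure (scale_measure ?k (distr (leb I) (leb I) ?T)) (Pi\<^sub>E I A)
        = ?k * emeasure (leb I) (Pi\<^sub>E I (\<lambda>i. (\<lambda>x. s i * x + c i) -` A i))"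
      using A I by (subst emeasure_scale_measure, subst emeasure_distr) (auto simp: eq intro!: sets_PiM_I_finite)
    also have "\<dots> = ?k * (\<Prod>i\<in>I. emeasure lborel ((\<lambda>x. s i * x + c i) -` A i))"
      using m by (subst leb.emeasure_PiM) (auto simp: I)
    also have "\<dots> = (\<Prod>i\<in>I. emeasure lborel (A i))"
      unfolding prod.distrib[symmetric]
      by (intro prod.cong refl) (use A s in \<open>simp add: emeasure_lborel_affine[symmetric]\<close>)
    finally show "emeasure (scale_measure ?k (distr (leb I) (leb I) ?T)) (Pi\<^sub>E I A) = (\<Prod>i\<in>I. emeasure lborel (A i))" .
  qed (use I in auto)
  then have "(\<integral>\<^sup>+x. f x \<partial>leb I) = (\<integral>\<^sup>+x. f x \<partial>scale_measure ?k (distr (leb I) (leb I) ?T))" by simp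
  also have "\<dots> = ?k * (\<integral>\<^sup>+x. f (?T x) \<partial>leb I)"
    by (subst nn_integral_scale_measure) (auto simp: nn_integral_distr)
  finally show ?thesis .
qed

lemma nn_integral_leb_translate:
  assumes I: "finite I" and f[measurable]: "f \<in> borel_measurable (leb I)"
  shows "(\<integral>\<^sup>+x. f (\<lambda>i\<in>I. x i + c i) \<partial>leb I) = (\<integral>\<^sup>+x. f x \<partial>leb I)"
  using nn_integral_leb_affine[OF I f, of "\<lambda>_. 1" c] by simp

lemma nn_integral_leb_reflect:
  assumes I: "finite I" and f[measurable]: "f \<in> borel_measurable (leb I)"
  shows "(\<integral>\<^sup>+x. f (\<lambda>i\<in>I. c i - x i) \<partial>leb I) = (\<integral>\<^sup>+x. f x \<partial>leb I)"
  using nn_integral_leb_affine[OF I f, of "\<lambda>_. -1" c] by simp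

text \<open>The ball lies in one box and contains another. Finiteness and positivity allow its
  measure to be cancelled in the isometry argument and divided by in the definition of the sphere
  measure.\<close>

lemma emeasure_leb_ball:
  assumes I: "finite I"
  shows "emeasure (leb I) {x \<in> space (leb I). (\<Sum>i\<in>I. (x i)\<^sup>2) \<le> 1} < \<infinity>" (is "emeasure _ ?B < _")
    and "emeasure (leb I) {x \<in> space (leb I). (\<Sum>i\<in>I. (x i)\<^sup>2) \<le> 1} > 0"
proof -
  have sub: "?B \<subseteq> Pi\<^sub>E I (\<lambda>_. {-1..1})"
  proof
    fix x assume x: "x \<in> ?B"
    have "(x i)\<^sup>2 \<le> 1" if "i \<in> I" for i
    proof -
      have "(x i)\<^sup>2 \<le> (\<Sum>i\<in>I. (x i)\<^sup>2)"
        using I that by (intro member_le_sum) auto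
      with x show ?thesis by auto
    qed
    then have "x i \<in> {-1..1}" if "i \<in> I" for i
      using that by (auto simp: abs_square_le_1 abs_le_iff)
    with x show "x \<in> Pi\<^sub>E I (\<lambda>_. {-1..1})" by (auto simp: space_PiM PiE_iff)
  qed
  have "emeasure (leb I) ?B \<le> emeasure (leb I) (Pi\<^sub>E I (\<lambda>_. {-1..1}))"
    using I by (intro emeasure_mono[OF sub] sets_PiM_I_finite) auto
  also have "\<dots> = (\<Prod>i\<in>I. ennreal 2)" using I by (subst leb.emeasure_PiM) auto
  also have "\<dots> < \<infinity>" by (simp add: power_less_top_ennreal)
  finally show "emeasure (leb I) ?B < \<infinity>" .
  \<comment> \<open>The summand 1 keeps the denominator positive for empty \<open>I\<close>.\<close>
  define r where "r = 1 / (real (card I) + 1)"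
  have r: "r > 0" "real (card I) * r\<^sup>2 \<le> 1"
  proof -
    have "real (card I) * r\<^sup>2 \<le> (real (card I) + 1) * r\<^sup>2" by (intro mult_right_mono) auto
    also have "\<dots> = r" by (simp add: r_def power2_eq_square)
    also have "\<dots> \<le> 1" by (simp add: r_def)
    finally show "real (card I) * r\<^sup>2 \<le> 1" .
  qed (simp add: r_def add_nonneg_pos)
  have sub: "Pi\<^sub>E I (\<lambda>_. {-r..r}) \<subseteq> ?B"
  proof
    fix x assume x: "x \<in> Pi\<^sub>E I (\<lambda>_. {-r..r})"
    have "(\<Sum>i\<in>I. (x i)\<^sup>2) \<le> (\<Sum>i\<in>I. r\<^sup>2)"
      using x by (intro sum_mono) (auto simp: PiE_iff abs_le_square_iff[symmetric] abs_le_iff r_def)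
    also have "\<dots> \<le> 1" using r by simp
    finally show "x \<in> ?B" using x by (auto simp: space_PiM PiE_iff)
  qed
  have "0 < (\<Prod>i\<in>I. ennreal (2 * r))"
    using r I by (simp add: ennreal_power zero_less_iff_neq_zero)
  also have "\<dots> = emeasure (leb I) (Pi\<^sub>E I (\<lambda>_. {-r..r}))"
    using I r by (subst leb.emeasure_PiM) auto
  also have "\<dots> \<le> emeasure (leb I) ?B"
    using I by (intro emeasure_mono[OF sub]) measurable
  finally show "emeasure (leb I) ?B > 0" .
qed

text \<open>
  The translation invariance of \<open>leb I\<close> gives
  \<open>\<integral>\<integral> f (T x) 1\<^sub>B y = \<integral>\<integral> f (T x) 1\<^sub>B (y + T x) = \<integral>\<integral> f (T x - y) 1\<^sub>B (T x)\<close>,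
  where \<open>x\<close> was replaced by \<open>x - T y\<close>, and \<open>T\<close> preserves the unit ball \<open>B\<close>.
\<close>

lemma nn_integral_leb_isometry:
  assumes I: "finite I" and T[measurable]: "T \<in> measurable (leb I) (leb I)"
    and lin: "\<And>x y. x \<in> space (leb I) \<Longrightarrow> y \<in> space (leb I) \<Longrightarrow>
      T (\<lambda>i\<in>I. x i - T y i) = (\<lambda>i\<in>I. T x i - y i)"
    and iso: "\<And>x. x \<in> space (leb I) \<Longrightarrow> (\<Sum>i\<in>I. (T x i)\<^sup>2) = (\<Sum>i\<in>I. (x i)\<^sup>2)"
    and f[measurable]: "f \<in> borel_measurable (leb I)"
  shows "(\<integral>\<^sup>+x. f (T x) \<partial>leb I) = (\<integral>\<^sup>+x. f x \<partial>leb I)"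
proof -
  interpret L: sigma_finite_measure "leb I" by (rule leb.sigma_finite[OF I])
  interpret LL: pair_sigma_finite "leb I" "leb I" ..
  define B where "B = {x \<in> space (leb I). (\<Sum>i\<in>I. (x i)\<^sup>2) \<le> 1}"
  have B[measurable]: "B \<in> sets (leb I)" unfolding B_def using I by measurable
  have Ti[measurable (raw)]: "(\<lambda>x. T (g x) i) \<in> borel_measurable N"
    if "i \<in> I" "g \<in> measurable N (leb I)" for i N and g :: "'b \<Rightarrow> 'a \<Rightarrow> real"
  proof -
    have "(\<lambda>x. T x i) \<in> borel_measurable (leb I)"
      using measurable_compose[OF T measurable_component_singleton[OF that(1)]] by simp
    from measurable_compose[OF that(2) this] show ?thesis .
  qed
  have Ts: "T x \<in> space (leb I)" if "x \<in> space (leb I)" for x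
    using measurable_space[OF T that] .
  have "(\<integral>\<^sup>+x. f (T x) \<partial>leb I) * emeasure (leb I) B
      = (\<integral>\<^sup>+x. \<integral>\<^sup>+y. f (T x) * indicator B y \<partial>leb I \<partial>leb I)"
    by (simp add: nn_integral_cmult nn_integral_multc)
  also have "\<dots> = (\<integral>\<^sup>+x. \<integral>\<^sup>+y. f (T x) * indicator B (\<lambda>i\<in>I. y i + T x i) \<partial>leb I \<partial>leb I)"
  proof (rule nn_integral_cong)
    fix x assume x: "x \<in> space (leb I)"
    show "(\<integral>\<^sup>+y. f (T x) * indicator B y \<partial>leb I)
      = (\<integral>\<^sup>+y. f (T x) * indicator B (\<lambda>i\<in>I. y i + T x i) \<partial>leb I)"
      by (rule nn_integral_leb_translate[OF I, where f="\<lambda>y. f (T x) * indicator B y", symmetric]) measurable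
  qed
  also have "\<dots> = (\<integral>\<^sup>+y. \<integral>\<^sup>+x. f (T x) * indicator B (\<lambda>i\<in>I. y i + T x i) \<partial>leb I \<partial>leb I)"
    by (rule LL.Fubini') measurable
  also have "\<dots> = (\<integral>\<^sup>+y. \<integral>\<^sup>+x. f (\<lambda>i\<in>I. T x i - y i) * indicator B (T x) \<partial>leb I \<partial>leb I)"
  proof (rule nn_integral_cong)
    fix y assume y: "y \<in> space (leb I)"
    have "(\<integral>\<^sup>+x. f (T x) * indicator B (\<lambda>i\<in>I. y i + T x i) \<partial>leb I)
      = (\<integral>\<^sup>+x. f (T (\<lambda>i\<in>I. x i + (- T y i))) * indicator B (\<lambda>i\<in>I. y i + T (\<lambda>i\<in>I. x i + (- T y i)) i) \<partial>leb I)"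
      using y by (subst nn_integral_leb_translate[OF I, where c="\<lambda>i. - T y i" and f="\<lambda>x. f (T x) * indicator B (\<lambda>i\<in>I. y i + T x i)"])
        (auto intro!: measurable_restrict)
    also have "\<dots> = (\<integral>\<^sup>+x. f (\<lambda>i\<in>I. T x i - y i) * indicator B (T x) \<partial>leb I)"
    proof (rule nn_integral_cong)
      fix x assume x: "x \<in> space (leb I)"
      have "(\<lambda>i\<in>I. y i + (\<lambda>i\<in>I. T x i - y i) i) = T x"
        using Ts[OF x] by (auto simp: space_PiM PiE_iff extensional_def fun_eq_iff)
      then show "f (T (\<lambda>i\<in>I. x i + (- T y i))) * indicator B (\<lambda>i\<in>I. y i + T (\<lambda>i\<in>I. x i + (- T y i)) i)
        = f (\<lambda>i\<in>I. T x i - y i) * indicator B (T x)"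
        using lin[OF x y] by simp
    qed
    finally show "(\<integral>\<^sup>+x. f (T x) * indicator B (\<lambda>i\<in>I. y i + T x i) \<partial>leb I)
      = (\<integral>\<^sup>+x. f (\<lambda>i\<in>I. T x i - y i) * indicator B (T x) \<partial>leb I)" .
  qed
  also have "\<dots> = (\<integral>\<^sup>+x. \<integral>\<^sup>+y. f (\<lambda>i\<in>I. T x i - y i) * indicator B (T x) \<partial>leb I \<partial>leb I)"
    by (rule LL.Fubini'[symmetric]) measurable
  also have "\<dots> = (\<integral>\<^sup>+x. (\<integral>\<^sup>+y. f y \<partial>leb I) * indicator B (T x) \<partial>leb I)"
    by (intro nn_integral_cong) (subst nn_integral_multc, auto simp: nn_integral_leb_reflect[OF I f])
  also have "\<dots> = (\<integral>\<^sup>+x. (\<integral>\<^sup>+y. f y \<partial>leb I) * indicator B x \<partial>leb I)"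
    by (intro nn_integral_cong) (auto simp: B_def indicator_def iso Ts)
  also have "\<dots> = (\<integral>\<^sup>+y. f y \<partial>leb I) * emeasure (leb I) B"
    by (simp add: nn_integral_cmult)
  finally show ?thesis
    using emeasure_leb_ball[OF I] unfolding B_def[symmetric]
    by (metis ennreal_mult_divide_eq infinity_ennreal_def not_less_iff_gr_or_eq)
qed

section \<open>Householder reflections\<close>

text \<open>The reflection in the hyperplane orthogonal to \<open>w\<close>. One reflection moves a
  vector to any other of equal length, so these are the only orthogonal maps used. Restricting to
  \<open>I\<close> keeps the image in the space of \<open>leb I\<close>.\<close>

definition hyper_reflect :: "'i set \<Rightarrow> ('i \<Rightarrow> real) \<Rightarrow> ('i \<Rightarrow> real) \<Rightarrow> ('i \<Rightarrow> real)"
  where "hyper_reflect I w x = (\<lambda>i\<in>I. x i - 2 * (\<Sum>k\<in>I. w k * x k) / (\<Sum>k\<in>I. (w k)\<^sup>2) * w i)"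

text \<open>For \<open>w = 0\<close> the reflection is the identity, because \<open>x / 0 = 0\<close>.\<close>

lemma hyper_reflect_inner:
  assumes I: "finite I"
  shows "(\<Sum>i\<in>I. hyper_reflect I w x i * hyper_reflect I w y i) = (\<Sum>i\<in>I. x i * y i)"
proof (cases "(\<Sum>k\<in>I. (w k)\<^sup>2) = 0")
  case True
  then show ?thesis by (auto simp: hyper_reflect_def)
next
  case False
  define s where "s = (\<Sum>k\<in>I. (w k)\<^sup>2)"
  define p q where "p = (\<Sum>k\<in>I. w k * x k)" "q = (\<Sum>k\<in>I. w k * y k)"
  have "(\<Sum>i\<in>I. hyper_reflect I w x i * hyper_reflect I w y i)
      = (\<Sum>i\<in>I. x i * y i - (2 * q / s) * (w i * x i) - (2 * p / s) * (w i * y i) + (2 * p / s) * (2 * q / s) * (w i)\<^sup>2)"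
    unfolding hyper_reflect_def s_def[symmetric] p_q_def[symmetric]
    by (intro sum.cong refl) (simp add: algebra_simps power2_eq_square)
  also have "\<dots> = (\<Sum>i\<in>I. x i * y i) - (2 * q / s) * p - (2 * p / s) * q + (2 * p / s) * (2 * q / s) * s"
    unfolding sum.distrib sum_subtractf sum_distrib_left[symmetric] s_def p_q_def ..
  also have "\<dots> = (\<Sum>i\<in>I. x i * y i)" using False by (simp add: s_def[symmetric] field_simps)
  finally show ?thesis .
qed

lemma hyper_reflect_involution:
  assumes I: "finite I" and x: "x \<in> extensional I"
  shows "hyper_reflect I w (hyper_reflect I w x) = x"
proof (cases "(\<Sum>k\<in>I. (w k)\<^sup>2) = 0")
  case True
  with x show ?thesis by (auto simp: hyper_reflect_def fun_eq_iff extensional_def)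
next
  case False
  define s where "s = (\<Sum>k\<in>I. (w k)\<^sup>2)"
  define p where "p = (\<Sum>k\<in>I. w k * x k)"
  have "(\<Sum>k\<in>I. w k * hyper_reflect I w x k) = (\<Sum>k\<in>I. w k * x k - (2 * p / s) * (w k)\<^sup>2)"
    unfolding hyper_reflect_def s_def[symmetric] p_def[symmetric]
    by (intro sum.cong refl) (simp add: algebra_simps power2_eq_square)
  also have "\<dots> = p - (2 * p / s) * s"
    unfolding sum_subtractf sum_distrib_left[symmetric] s_def p_def ..
  also have "\<dots> = - p" using False by (simp add: s_def[symmetric])
  finally have *: "(\<Sum>k\<in>I. w k * hyper_reflect I w x k) = - p" .
  show ?thesis
    using x by (subst hyper_reflect_def, unfold *) (auto simp: hyper_reflect_def fun_eq_iff extensional_def s_def p_def)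
qed

lemma hyper_reflect_diff: "hyper_reflect I w (\<lambda>i\<in>I. x i - y i) = (\<lambda>i\<in>I. hyper_reflect I w x i - hyper_reflect I w y i)"
proof -
  have "(\<Sum>k\<in>I. w k * (\<lambda>i\<in>I. x i - y i) k) = (\<Sum>k\<in>I. w k * x k) - (\<Sum>k\<in>I. w k * y k)"
    unfolding sum_subtractf[symmetric] by (intro sum.cong refl) (auto simp: algebra_simps)
  then show ?thesis
    unfolding hyper_reflect_def by (intro ext) (simp add: ring_distribs diff_divide_distrib del: sum_subtractf)
qed

lemma hyper_reflect_cong: "(\<And>i. i \<in> I \<Longrightarrow> x i = y i) \<Longrightarrow> hyper_reflect I w x = hyper_reflect I w y"
  unfolding hyper_reflect_def by (intro restrict_ext) (simp cong: sum.cong)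

lemma hyper_reflect_measurable[measurable]: "hyper_reflect I w \<in> measurable (leb I) (leb I)"
  unfolding hyper_reflect_def by measurable

lemma hyper_reflect_space: "hyper_reflect I w x \<in> space (leb I)"
  by (auto simp: hyper_reflect_def space_PiM)

lemma nn_integral_leb_hyper_reflect:
  assumes I: "finite I" and f[measurable]: "f \<in> borel_measurable (leb I)"
  shows "(\<integral>\<^sup>+x. f (hyper_reflect I w x) \<partial>leb I) = (\<integral>\<^sup>+x. f x \<partial>leb I)"
proof (rule nn_integral_leb_isometry[OF I _ _ _ f])
  fix x y assume x: "x \<in> space (leb I)" and y: "y \<in> space (leb I)"
  show "hyper_reflect I w (\<lambda>i\<in>I. x i - hyper_reflect I w y i) = (\<lambda>i\<in>I. hyper_reflect I w x i - y i)"
    using y by (simp add: hyper_reflect_diff hyper_reflect_involution I space_PiM PiE_iff)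
  show "(\<Sum>i\<in>I. (hyper_reflect I w x i)\<^sup>2) = (\<Sum>i\<in>I. (x i)\<^sup>2)"
    using hyper_reflect_inner[OF I, of w x x] by (simp add: power2_eq_square)
qed measurable

text \<open>For \<open>w = u - v\<close> with \<open>u\<close> and \<open>v\<close> of equal length,
  \<open>2 * <w,u>\<close> equals the squared length of \<open>w\<close>, so the reflection
  subtracts exactly \<open>w\<close> from \<open>u\<close>. If \<open>u = v\<close>, the degenerate
  reflection is already the identity.\<close>

lemma hyper_reflect_swap:
  assumes I: "finite I" and uv: "(\<Sum>i\<in>I. (u i)\<^sup>2) = (\<Sum>i\<in>I. (v i)\<^sup>2)"
  shows "hyper_reflect I (\<lambda>i. u i - v i) u = (\<lambda>i\<in>I. v i)"
proof -
  define w where "w = (\<lambda>i. u i - v i)"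
  define s where "s = (\<Sum>k\<in>I. (w k)\<^sup>2)"
  define c where "c = (\<Sum>k\<in>I. u k * v k)"
  define n where "n = (\<Sum>i\<in>I. (u i)\<^sup>2)"
  have s: "s = 2 * (n - c)"
  proof -
    have "s = (\<Sum>k\<in>I. (u k)\<^sup>2 + (v k)\<^sup>2 - 2 * (u k * v k))"
      unfolding s_def w_def by (intro sum.cong refl) (simp add: algebra_simps power2_eq_square)
    also have "\<dots> = n + n - 2 * c"
      unfolding sum_subtractf sum.distrib sum_distrib_left[symmetric] n_def c_def uv ..
    finally show ?thesis by simp
  qed
  have p: "(\<Sum>k\<in>I. w k * u k) = n - c"
    unfolding n_def c_def sum_subtractf[symmetric] w_def
    by (intro sum.cong refl) (simp add: algebra_simps power2_eq_square)
  show ?thesis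
  proof (cases "s = 0")
    case True
    then have "w k = 0" if "k \<in> I" for k
      using that I unfolding s_def by (auto simp: sum_nonneg_eq_0_iff)
    then have "u k = v k" if "k \<in> I" for k using that by (auto simp: w_def)
    with True show ?thesis
      by (auto simp: hyper_reflect_def fun_eq_iff s_def[unfolded w_def])
  next
    case False
    then have "2 * (n - c) / s = 1" using s by simp
    then show ?thesis
      unfolding w_def[symmetric] hyper_reflect_def p s_def[symmetric]
      by (auto simp: fun_eq_iff w_def)
  qed
qed

section \<open>Polar coordinates\<close>

definition nsq :: "nat \<Rightarrow> (nat \<Rightarrow> real) \<Rightarrow> real"
  where "nsq d x = (\<Sum>i<d. (x i)\<^sup>2)"

definition dir :: "nat \<Rightarrow> (nat \<Rightarrow> real) \<Rightarrow> nat \<Rightarrow> real"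
  where "dir d x = (\<lambda>i. if i < d then x i / euclid_norm d x else 0)"

definition ball_vol :: "nat \<Rightarrow> ennreal"
  where "ball_vol d = emeasure (leb {..<d}) {x \<in> space (leb {..<d}). nsq d x \<le> 1}"

lemma euclid_norm_nsq: "euclid_norm d x = sqrt (nsq d x)"
  by (simp add: euclid_norm_def euclid_inner_def nsq_def power2_eq_square)

lemma nsq_nonneg: "0 \<le> nsq d x"
  by (simp add: nsq_def sum_nonneg)

lemma euclid_norm_le_1_iff: "euclid_norm d x \<le> 1 \<longleftrightarrow> nsq d x \<le> 1"
  by (simp add: euclid_norm_nsq)

text \<open>The sphere measure lives on the Borel sets of the product topology on
  \<open>nat \<Rightarrow> real\<close>; as there are countably many coordinates, measurability can
  be tested coordinatewise.\<close>

lemma measurable_into_fun_borel: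
  fixes f :: "'a \<Rightarrow> nat \<Rightarrow> real"
  assumes "\<And>i. (\<lambda>x. f x i) \<in> borel_measurable M"
  shows "f \<in> borel_measurable M"
  by (rule measurable_coordinatewise_then_product) (use assms in auto)

lemma measurable_coord: "(\<lambda>x::nat \<Rightarrow> real. x i) \<in> borel_measurable borel"
  by (rule measurable_product_coordinates)

lemma nsq_measurable[measurable]: "nsq d \<in> borel_measurable borel"
  unfolding nsq_def using measurable_coord by measurable

lemma nsq_measurable_leb[measurable]: "nsq d \<in> borel_measurable (leb {..<d})"
  unfolding nsq_def by measurable

lemma dir_measurable_leb[measurable]: "dir d \<in> borel_measurable (leb {..<d})"
proof (rule measurable_into_fun_borel)
  fix i
  show "(\<lambda>x. dir d x i) \<in> borel_measurable (leb {..<d})"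
    by (cases "i < d") (simp_all add: dir_def euclid_norm_nsq)
qed

lemma ball_vol_pos: "ball_vol d > 0" and ball_vol_finite: "ball_vol d < \<infinity>"
  using emeasure_leb_ball[of "{..<d}"] by (simp_all add: ball_vol_def nsq_def)

lemma emeasure_uniform_sphere:
  assumes [measurable]: "A \<in> sets borel"
  shows "emeasure (uniform_sphere d) A =
    emeasure (leb {..<d}) {x \<in> space (leb {..<d}). nsq d x \<le> 1 \<and> dir d x \<in> A} / ball_vol d"
proof -
  have B[measurable]: "{x \<in> space (leb {..<d}). nsq d x \<le> 1} \<in> sets (leb {..<d})" by measurable
  have "emeasure (uniform_sphere d) A
      = emeasure (uniform_measure (leb {..<d}) {x \<in> space (leb {..<d}). nsq d x \<le> 1}) (dir d -` A \<inter> space (leb {..<d}))"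
    unfolding uniform_sphere_def uniform_ball_def euclid_norm_le_1_iff dir_def[symmetric]
    by (subst emeasure_distr) auto
  also have "\<dots> = emeasure (leb {..<d}) ({x \<in> space (leb {..<d}). nsq d x \<le> 1} \<inter> (dir d -` A \<inter> space (leb {..<d}))) / ball_vol d"
    by (subst emeasure_uniform_measure) (auto simp: ball_vol_def)
  also have "{x \<in> space (leb {..<d}). nsq d x \<le> 1} \<inter> (dir d -` A \<inter> space (leb {..<d}))
    = {x \<in> space (leb {..<d}). nsq d x \<le> 1 \<and> dir d x \<in> A}" by auto
  finally show ?thesis .
qed

lemma sets_uniform_sphere[measurable_cong, simp]: "sets (uniform_sphere d) = sets borel"
  by (simp add: uniform_sphere_def)

lemma space_uniform_sphere[simp]: "space (uniform_sphere d) = UNIV"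
  by (simp add: uniform_sphere_def)

lemma prob_space_uniform_sphere: "prob_space (uniform_sphere d)"
proof
  have "emeasure (uniform_sphere d) UNIV = ball_vol d / ball_vol d"
    by (subst emeasure_uniform_sphere) (auto simp: ball_vol_def)
  then show "emeasure (uniform_sphere d) (space (uniform_sphere d)) = 1"
    using ball_vol_pos[of d] ball_vol_finite[of d] by (simp add: ennreal_divide_self)
qed

lemma nsq_restrict_scale: "nsq d (\<lambda>i\<in>{..<d}. r * x i) = r\<^sup>2 * nsq d x"
  by (simp add: nsq_def power_mult_distrib sum_distrib_left)

lemma dir_restrict_scale: "0 < r \<Longrightarrow> dir d (\<lambda>i\<in>{..<d}. r * x i) = dir d x"
  by (auto simp: dir_def euclid_norm_nsq nsq_restrict_scale real_sqrt_mult fun_eq_iff)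

text \<open>A dilation by \<open>r\<close> keeps directions and multiplies Lebesgue measure by
  \<open>r ^ d\<close>; the case \<open>r = 1\<close> is the cone construction of the sphere
  measure.\<close>

lemma emeasure_leb_cone:
  assumes [measurable]: "A \<in> sets borel" and r: "0 < r"
  shows "emeasure (leb {..<d}) {x \<in> space (leb {..<d}). nsq d x \<le> r\<^sup>2 \<and> dir d x \<in> A}
    = ennreal (r ^ d) * (ball_vol d * emeasure (uniform_sphere d) A)"
proof -
  let ?f = "indicator {x \<in> space (leb {..<d}). nsq d x \<le> r\<^sup>2 \<and> dir d x \<in> A} :: (nat \<Rightarrow> real) \<Rightarrow> ennreal"
  have "emeasure (leb {..<d}) {x \<in> space (leb {..<d}). nsq d x \<le> r\<^sup>2 \<and> dir d x \<in> A} = (\<integral>\<^sup>+x. ?f x \<partial>leb {..<d})"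
    by simp
  also have "\<dots> = ennreal (r ^ d) * (\<integral>\<^sup>+x. ?f (\<lambda>i\<in>{..<d}. r * x i) \<partial>leb {..<d})"
    using r by (subst nn_integral_leb_affine[where s="\<lambda>_. r" and c="\<lambda>_. 0"]) (auto simp: ennreal_power)
  also have "(\<integral>\<^sup>+x. ?f (\<lambda>i\<in>{..<d}. r * x i) \<partial>leb {..<d})
    = (\<integral>\<^sup>+x. indicator {x \<in> space (leb {..<d}). nsq d x \<le> 1 \<and> dir d x \<in> A} x \<partial>leb {..<d})"
    using r by (intro nn_integral_cong) (auto simp: indicator_def nsq_restrict_scale dir_restrict_scale space_PiM)
  also have "\<dots> = ball_vol d * emeasure (uniform_sphere d) A"
    unfolding emeasure_uniform_sphere[OF assms(1)] using ball_vol_pos[of d] ball_vol_finite[of d]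
    by (simp add: ennreal_times_divide mult.commute[of "ball_vol d"] less_top del: nn_integral_indicator)
      (subst ennreal_mult_divide_eq, auto)
  finally show ?thesis .
qed

text \<open>The image of Lebesgue measure under \<open>nsq d\<close>: radii are squared throughout.\<close>

definition radial :: "nat \<Rightarrow> real measure"
  where "radial d = density lborel (\<lambda>t. ball_vol d * ennreal (d / 2 * t powr (d / 2 - 1)) * indicator {0<..} t)"

lemma sets_radial[measurable_cong, simp]: "sets (radial d) = sets borel"
  by (simp add: radial_def)

lemma space_radial[simp]: "space (radial d) = UNIV"
  by (simp add: radial_def)

lemma emeasure_radial_atMost:
  assumes d: "0 < d"
  shows "emeasure (radial d) {..s} = (if s > 0 then ball_vol d * ennreal (s powr (d / 2)) else 0)"
proof -
  have "emeasure (radial d) {..s} = ball_vol d * (\<integral>\<^sup>+t. ennreal (d / 2 * t powr (d / 2 - 1)) * indicator {0<..} t * indicator {..s} t \<partial>lborel)"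
    by (simp add: radial_def emeasure_density nn_integral_cmult mult.assoc)
  also have "(\<integral>\<^sup>+t. ennreal (d / 2 * t powr (d / 2 - 1)) * indicator {0<..} t * indicator {..s} t \<partial>lborel)
     = (if s > 0 then ennreal (s powr (d / 2)) else 0)"
  proof (cases "s > 0")
    case True
    have "((\<lambda>x. x powr (d / 2 - 1)) has_integral (s powr (d / 2 - 1 + 1) / (d / 2 - 1 + 1))) {0..s}"
      using d True by (intro has_integral_powr_from_0) auto
    from has_integral_mult_right[OF this, of "d / 2"]
    have I: "((\<lambda>x. d / 2 * x powr (d / 2 - 1)) has_integral s powr (d / 2)) {0..s}"
      using d by simp
    have "(\<integral>\<^sup>+t. ennreal (d / 2 * t powr (d / 2 - 1)) * indicator {0<..} t * indicator {..s} t \<partial>lborel)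
      = (\<integral>\<^sup>+t. ennreal (d / 2 * t powr (d / 2 - 1) * indicator {0..s} t) \<partial>lborel)"
      by (intro nn_integral_cong) (auto simp: indicator_def)
    also have "\<dots> = ennreal (s powr (d / 2))"
      using nn_integral_has_integral_lebesgue[OF _ I] by (simp add: mult.commute)
    finally show ?thesis using True by simp
  next
    case False
    then have "(\<integral>\<^sup>+t. ennreal (d / 2 * t powr (d / 2 - 1)) * indicator {0<..} t * indicator {..s} t \<partial>lborel)
      = (\<integral>\<^sup>+t. 0 \<partial>(lborel :: real measure))"
      by (intro nn_integral_cong) (auto simp: indicator_def)
    with False show ?thesis by simp
  qed
  finally show ?thesis by auto
qed

text \<open>The half-lines \<open>{..s}\<close> are stable under intersection and generate the Borel
  sets; finiteness of \<open>c\<close> makes their measures finite, so the uniqueness theorem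
  applies.\<close>

lemma radial_unique:
  fixes N :: "real measure"
  assumes d: "0 < d" and N: "sets N = sets borel" and c: "c < \<infinity>"
    and le: "\<And>s. emeasure N {..s} = c * emeasure (radial d) {..s}"
  shows "N = scale_measure c (radial d)"
proof (rule measure_eqI_generator_eq[where E="range atMost" and A="\<lambda>n. {..real n}" and \<Omega>=UNIV])
  show "Int_stable (range atMost :: real set set)"
    by (auto simp: Int_stable_def)
  show "sets N = sigma_sets UNIV (range atMost)"
    using N by (simp add: borel_eq_atMost)
  show "sets (scale_measure c (radial d)) = sigma_sets UNIV (range atMost)"
    by (simp add: borel_eq_atMost)
  show "(\<Union>n. {..real n}) = UNIV" by (auto simp: real_arch_simple)
  show "emeasure N {..real n} \<noteq> \<infinity>" for n
    using c ball_vol_finite[of d]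
    by (auto simp: le emeasure_radial_atMost[OF d] ennreal_mult_eq_top_iff)
qed (auto simp: le)

lemma sigma_finite_radial:
  assumes d: "0 < d"
  shows "sigma_finite_measure (radial d)"
proof
  show "\<exists>A. countable A \<and> A \<subseteq> sets (radial d) \<and> \<Union> A = space (radial d) \<and> (\<forall>a\<in>A. emeasure (radial d) a \<noteq> \<infinity>)"
    using ball_vol_finite[of d]
    by (intro exI[of _ "range (\<lambda>n. {..real n})"])
      (auto simp: emeasure_radial_atMost[OF d] ennreal_mult_eq_top_iff real_arch_simple)
qed

text \<open>The origin, where \<open>dir\<close> is degenerate, lies in this coordinate hyperplane;
  this is how it is discarded as a null set.\<close>

lemma emeasure_leb_zero_coord:
  fixes d :: nat
  assumes d: "0 < d"
  shows "emeasure (leb {..<d}) {x \<in> space (leb {..<d}). x 0 \<in> {0}} = 0"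
proof -
  have eq: "{x \<in> space (leb {..<d}). x 0 \<in> {0}} = Pi\<^sub>E {..<d} (\<lambda>i. if i = 0 then {0} else UNIV)"
  proof (intro Set.set_eqI iffI)
    fix x :: "nat \<Rightarrow> real" assume "x \<in> Pi\<^sub>E {..<d} (\<lambda>i. if i = 0 then {0} else UNIV)"
    from PiE_mem[OF this, of 0] this have "x \<in> extensional {..<d}" "x 0 \<in> {0}"
      using d by (auto simp: PiE_iff)
    then show "x \<in> {x \<in> space (leb {..<d}). x 0 \<in> {0}}" by (simp add: space_PiM PiE_iff)
  qed (simp add: space_PiM PiE_iff)
  have "(\<Prod>i<d. emeasure lborel (if i = 0 then {0} else UNIV :: real set)) = 0"
    using d by (intro prod_zero) (auto intro!: bexI[of _ 0])
  then show ?thesis unfolding eq by (subst leb.emeasure_PiM) simp_all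
qed

text \<open>For fixed \<open>A\<close> both sides are measures in \<open>B\<close>, so it suffices
  to compare them on half-lines, where the cone formula with \<open>r = sqrt s\<close> gives the
  value. The square root is due to squared radii.\<close>

lemma emeasure_leb_polar:
  assumes d: "0 < d" and [measurable]: "A \<in> sets borel" "B \<in> sets borel"
  shows "emeasure (leb {..<d}) {x \<in> space (leb {..<d}). dir d x \<in> A \<and> nsq d x \<in> B}
    = emeasure (uniform_sphere d) A * emeasure (radial d) B"
proof -
  define P where "P = {x \<in> space (leb {..<d}). dir d x \<in> A}"
  have P[measurable]: "P \<in> sets (leb {..<d})" unfolding P_def by measurable
  define N where "N = distr (density (leb {..<d}) (indicator P)) borel (nsq d)"
  have N: "emeasure N B = emeasure (leb {..<d}) {x \<in> space (leb {..<d}). dir d x \<in> A \<and> nsq d x \<in> B}"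
    if B[measurable]: "B \<in> sets borel" for B
  proof -
    have "emeasure N B = emeasure (density (leb {..<d}) (indicator P)) (nsq d -` B \<inter> space (leb {..<d}))"
      unfolding N_def by (subst emeasure_distr) (simp_all add: B)
    also have "\<dots> = (\<integral>\<^sup>+x. indicator P x * indicator (nsq d -` B \<inter> space (leb {..<d})) x \<partial>leb {..<d})"
      by (rule emeasure_density) measurable
    also have "\<dots> = (\<integral>\<^sup>+x. indicator {x \<in> space (leb {..<d}). dir d x \<in> A \<and> nsq d x \<in> B} x \<partial>leb {..<d})"
      by (intro nn_integral_cong) (simp add: indicator_def P_def)
    also have "\<dots> = emeasure (leb {..<d}) {x \<in> space (leb {..<d}). dir d x \<in> A \<and> nsq d x \<in> B}"
      by (rule nn_integral_indicator) measurable
    finally show ?thesis .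
  qed
  have "N = scale_measure (emeasure (uniform_sphere d) A) (radial d)"
  proof (rule radial_unique[OF d])
    show "emeasure (uniform_sphere d) A < \<infinity>"
      using prob_space.emeasure_le_1[OF prob_space_uniform_sphere, of d A]
      by (metis ennreal_one_less_top infinity_ennreal_def order_le_less_trans)
    fix s :: real
    have Ns: "emeasure N {..s} = emeasure (leb {..<d}) {x \<in> space (leb {..<d}). nsq d x \<le> s \<and> dir d x \<in> A}"
      unfolding N[OF atMost_borel] by (simp add: conj_commute)
    consider "s > 0" | "s = 0" | "s < 0" by linarith
    then show "emeasure N {..s} = emeasure (uniform_sphere d) A * emeasure (radial d) {..s}"
    proof cases
      case 1
      have "emeasure N {..s} = emeasure (leb {..<d}) {x \<in> space (leb {..<d}). nsq d x \<le> (sqrt s)\<^sup>2 \<and> dir d x \<in> A}"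
        using 1 unfolding Ns by simp
      also have "\<dots> = ennreal (sqrt s ^ d) * (ball_vol d * emeasure (uniform_sphere d) A)"
        using 1 by (intro emeasure_leb_cone) auto
      also have "sqrt s ^ d = s powr (d / 2)"
        using 1 by (simp add: powr_half_sqrt[symmetric] powr_realpow[symmetric] powr_powr)
      finally show ?thesis
        using 1 by (simp add: emeasure_radial_atMost[OF d] mult_ac)
    next
      case 2
      have "{x \<in> space (leb {..<d}). nsq d x \<le> s \<and> dir d x \<in> A} \<subseteq> {x \<in> space (leb {..<d}). x 0 \<in> {0}}"
      proof
        fix x assume "x \<in> {x \<in> space (leb {..<d}). nsq d x \<le> s \<and> dir d x \<in> A}"
        then have x: "x \<in> space (leb {..<d})" and "nsq d x = 0"
          using 2 nsq_nonneg[of d x] by auto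
        then have "x 0 = 0" using d by (simp add: nsq_def sum_nonneg_eq_0_iff)
        with x show "x \<in> {x \<in> space (leb {..<d}). x 0 \<in> {0}}" by simp
      qed
      moreover have "{x \<in> space (leb {..<d}). x 0 \<in> {0}} \<in> sets (leb {..<d})"
      proof -
        have [measurable]: "0 \<in> {..<d}" using d by simp
        show ?thesis by measurable
      qed
      ultimately have "emeasure N {..s} = 0"
        unfolding Ns using emeasure_leb_zero_coord[OF d] by (rule emeasure_eq_0[rotated 2])
      with 2 show ?thesis by (simp add: emeasure_radial_atMost[OF d])
    next
      case 3
      then have empty: "{x \<in> space (leb {..<d}). nsq d x \<le> s \<and> dir d x \<in> A} = {}"
        using nsq_nonneg[of d] by (auto simp: not_le intro: less_le_trans)
      from 3 show ?thesis unfolding Ns empty by (simp add: emeasure_radial_atMost[OF d])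
    qed
  qed (simp add: N_def)
  with N[of B] show ?thesis by simp
qed

lemma distr_leb_polar:
  assumes d: "0 < d"
  shows "distr (leb {..<d}) (borel \<Otimes>\<^sub>M borel) (\<lambda>x. (dir d x, nsq d x)) = uniform_sphere d \<Otimes>\<^sub>M radial d"
proof (rule pair_measure_eqI[symmetric])
  show "sigma_finite_measure (uniform_sphere d)"
    by (intro finite_measure.sigma_finite_measure prob_space.finite_measure prob_space_uniform_sphere)
  show "sigma_finite_measure (radial d)" by (rule sigma_finite_radial[OF d])
  show "sets (uniform_sphere d \<Otimes>\<^sub>M radial d) = sets (distr (leb {..<d}) (borel \<Otimes>\<^sub>M borel) (\<lambda>x. (dir d x, nsq d x)))"
    by (simp cong: sets_pair_measure_cong)
  fix A B assume "A \<in> sets (uniform_sphere d)" "B \<in> sets (radial d)"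
  then have [measurable]: "A \<in> sets borel" "B \<in> sets borel" by auto
  have "emeasure (distr (leb {..<d}) (borel \<Otimes>\<^sub>M borel) (\<lambda>x. (dir d x, nsq d x))) (A \<times> B)
    = emeasure (leb {..<d}) {x \<in> space (leb {..<d}). dir d x \<in> A \<and> nsq d x \<in> B}"
    by (subst emeasure_distr) (auto intro!: arg_cong[where f="emeasure (leb {..<d})"])
  then show "emeasure (uniform_sphere d) A * emeasure (radial d) B
     = emeasure (distr (leb {..<d}) (borel \<Otimes>\<^sub>M borel) (\<lambda>x. (dir d x, nsq d x))) (A \<times> B)"
    using emeasure_leb_polar[OF d, of A B] by simp
qed

section \<open>Products of polar decompositions and of densities\<close>

text \<open>Applied with Lebesgue measure as \<open>P\<close>, it introduces polar coordinates in
  all rows of a matrix at once. The induction peels off one row and uses Fubini to collect the radii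
  outside and the directions inside.\<close>

lemma nn_integral_PiM_pair:
  fixes f :: "'a \<Rightarrow> 'b" and g :: "'a \<Rightarrow> 'c"
  assumes M: "sigma_finite_measure M" and N: "sigma_finite_measure N" and P: "sigma_finite_measure P"
    and f[measurable]: "f \<in> measurable P M" and g[measurable]: "g \<in> measurable P N"
    and distr: "distr P (M \<Otimes>\<^sub>M N) (\<lambda>x. (f x, g x)) = M \<Otimes>\<^sub>M N"
    and I: "finite I"
    and G: "G \<in> borel_measurable ((\<Pi>\<^sub>M i\<in>I. M) \<Otimes>\<^sub>M (\<Pi>\<^sub>M i\<in>I. N))"
  shows "(\<integral>\<^sup>+x. G (\<lambda>i\<in>I. f (x i), \<lambda>i\<in>I. g (x i)) \<partial>(\<Pi>\<^sub>M i\<in>I. P))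
    = (\<integral>\<^sup>+t. \<integral>\<^sup>+\<theta>. G (\<theta>, t) \<partial>(\<Pi>\<^sub>M i\<in>I. M) \<partial>(\<Pi>\<^sub>M i\<in>I. N))"
  using I G
proof (induction I arbitrary: G)
  case empty
  then show ?case
    by (simp add: nn_integral_count_space_finite PiM_empty restrict_def)
next
  case (insert i I)
  interpret M: product_sigma_finite "\<lambda>_::'d. M" by (simp add: product_sigma_finite_def M)
  interpret N: product_sigma_finite "\<lambda>_::'d. N" by (simp add: product_sigma_finite_def N)
  interpret P: product_sigma_finite "\<lambda>_::'d. P" by (simp add: product_sigma_finite_def P)
  interpret M1: sigma_finite_measure M by fact
  interpret N1: sigma_finite_measure N by fact
  interpret MI: sigma_finite_measure "Pi\<^sub>M I (\<lambda>_. M)" by (rule M.sigma_finite) fact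
  interpret NI: sigma_finite_measure "Pi\<^sub>M I (\<lambda>_. N)" by (rule N.sigma_finite) fact
  interpret MII: sigma_finite_measure "Pi\<^sub>M (insert i I) (\<lambda>_. M)" by (rule M.sigma_finite) (use insert.hyps in simp)
  interpret NM: pair_sigma_finite M N ..
  interpret NM': pair_sigma_finite M "Pi\<^sub>M I (\<lambda>_. N)" ..
  note insert.prems[measurable] insert.hyps(1)[simp]
  have "(\<integral>\<^sup>+x. G (\<lambda>j\<in>insert i I. f (x j), \<lambda>j\<in>insert i I. g (x j)) \<partial>Pi\<^sub>M (insert i I) (\<lambda>_. P))
    = (\<integral>\<^sup>+y. \<integral>\<^sup>+x. G (\<lambda>j\<in>insert i I. f ((x(i := y)) j), \<lambda>j\<in>insert i I. g ((x(i := y)) j)) \<partial>Pi\<^sub>M I (\<lambda>_. P) \<partial>P)"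
    using insert.hyps by (intro P.product_nn_integral_insert_rev) measurable
  also have "\<dots> = (\<integral>\<^sup>+y. \<integral>\<^sup>+x. G ((\<lambda>j\<in>I. f (x j))(i := f y), (\<lambda>j\<in>I. g (x j))(i := g y)) \<partial>Pi\<^sub>M I (\<lambda>_. P) \<partial>P)"
  proof (intro nn_integral_cong arg_cong[where f=G])
    fix y x
    show "(\<lambda>j\<in>insert i I. f ((x(i := y)) j), \<lambda>j\<in>insert i I. g ((x(i := y)) j))
      = ((\<lambda>j\<in>I. f (x j))(i := f y), (\<lambda>j\<in>I. g (x j))(i := g y))"
      using insert.hyps by (auto simp: fun_eq_iff)
  qed
  also have "\<dots> = (\<integral>\<^sup>+y. \<integral>\<^sup>+t. \<integral>\<^sup>+\<theta>. G (\<theta>(i := f y), t(i := g y)) \<partial>Pi\<^sub>M I (\<lambda>_. M) \<partial>Pi\<^sub>M I (\<lambda>_. N) \<partial>P)"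
  proof (rule nn_integral_cong)
    fix y assume [measurable]: "y \<in> space P"
    have [measurable]: "f y \<in> space M" "g y \<in> space N"
      using measurable_space[OF f] measurable_space[OF g] \<open>y \<in> space P\<close> by auto
    show "(\<integral>\<^sup>+x. G ((\<lambda>j\<in>I. f (x j))(i := f y), (\<lambda>j\<in>I. g (x j))(i := g y)) \<partial>Pi\<^sub>M I (\<lambda>_. P))
      = (\<integral>\<^sup>+t. \<integral>\<^sup>+\<theta>. G (\<theta>(i := f y), t(i := g y)) \<partial>Pi\<^sub>M I (\<lambda>_. M) \<partial>Pi\<^sub>M I (\<lambda>_. N))"
      using insert.IH[of "\<lambda>(\<theta>, t). G (\<theta>(i := f y), t(i := g y))", unfolded prod.case]
      by (rule meta_mp) measurable
  qed
  also have "\<dots> = (\<integral>\<^sup>+z. \<integral>\<^sup>+t. \<integral>\<^sup>+\<theta>. G (\<theta>(i := fst z), t(i := snd z)) \<partial>Pi\<^sub>M I (\<lambda>_. M) \<partial>Pi\<^sub>M I (\<lambda>_. N) \<partial>distr P (M \<Otimes>\<^sub>M N) (\<lambda>x. (f x, g x)))"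
    by (subst nn_integral_distr) auto
  also have "\<dots> = (\<integral>\<^sup>+s. \<integral>\<^sup>+\<phi>. \<integral>\<^sup>+t. \<integral>\<^sup>+\<theta>. G (\<theta>(i := \<phi>), t(i := s)) \<partial>Pi\<^sub>M I (\<lambda>_. M) \<partial>Pi\<^sub>M I (\<lambda>_. N) \<partial>M \<partial>N)"
    unfolding distr by (subst NM.nn_integral_snd[symmetric]) auto
  also have "\<dots> = (\<integral>\<^sup>+s. \<integral>\<^sup>+t. \<integral>\<^sup>+\<phi>. \<integral>\<^sup>+\<theta>. G (\<theta>(i := \<phi>), t(i := s)) \<partial>Pi\<^sub>M I (\<lambda>_. M) \<partial>M \<partial>Pi\<^sub>M I (\<lambda>_. N) \<partial>N)"
    by (intro nn_integral_cong NM'.Fubini'[symmetric]) measurable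
  also have "\<dots> = (\<integral>\<^sup>+s. \<integral>\<^sup>+t. \<integral>\<^sup>+\<theta>. G (\<theta>, t(i := s)) \<partial>Pi\<^sub>M (insert i I) (\<lambda>_. M) \<partial>Pi\<^sub>M I (\<lambda>_. N) \<partial>N)"
    using insert.hyps
    by (intro nn_integral_cong M.product_nn_integral_insert_rev[symmetric]) measurable
  also have "\<dots> = (\<integral>\<^sup>+t. \<integral>\<^sup>+\<theta>. G (\<theta>, t) \<partial>Pi\<^sub>M (insert i I) (\<lambda>_. M) \<partial>Pi\<^sub>M (insert i I) (\<lambda>_. N))"
    using insert.hyps
    by (intro N.product_nn_integral_insert_rev[symmetric]) measurable
  finally show ?case .
qed

lemma PiM_density:
  assumes I: "finite I" and M: "product_sigma_finite M"
    and D: "product_sigma_finite (\<lambda>i. density (M i) (f i))"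
    and f[measurable]: "\<And>i. f i \<in> borel_measurable (M i)"
  shows "Pi\<^sub>M I (\<lambda>i. density (M i) (f i)) = density (Pi\<^sub>M I M) (\<lambda>x. \<Prod>i\<in>I. f i (x i))"
proof -
  interpret M: product_sigma_finite M by fact
  interpret D: product_sigma_finite "\<lambda>i. density (M i) (f i)" by fact
  show ?thesis
  proof (rule D.PiM_eqI[OF I, symmetric])
    show "sets (density (Pi\<^sub>M I M) (\<lambda>x. \<Prod>i\<in>I. f i (x i))) = sets (Pi\<^sub>M I (\<lambda>i. density (M i) (f i)))"
      by (simp cong: sets_PiM_cong)
    fix A assume "\<And>i. i \<in> I \<Longrightarrow> A i \<in> sets (density (M i) (f i))"
    then have A[measurable]: "\<And>i. i \<in> I \<Longrightarrow> A i \<in> sets (M i)" by simp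
    have "emeasure (density (Pi\<^sub>M I M) (\<lambda>x. \<Prod>i\<in>I. f i (x i))) (Pi\<^sub>E I A)
      = (\<integral>\<^sup>+x. (\<Prod>i\<in>I. f i (x i)) * indicator (Pi\<^sub>E I A) x \<partial>Pi\<^sub>M I M)"
      using I A by (subst emeasure_density) (auto intro!: sets_PiM_I_finite)
    also have "\<dots> = (\<integral>\<^sup>+x. (\<Prod>i\<in>I. f i (x i) * indicator (A i) (x i)) \<partial>Pi\<^sub>M I M)"
    proof (rule nn_integral_cong)
      fix x assume x: "x \<in> space (Pi\<^sub>M I M)"
      have "indicator (Pi\<^sub>E I A) x = (\<Prod>i\<in>I. indicator (A i) (x i) :: ennreal)"
      proof (cases "x \<in> Pi\<^sub>E I A")
        case True
        then have "\<forall>i\<in>I. x i \<in> A i" by auto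
        with True show ?thesis by simp
      next
        case False
        with x obtain i where "i \<in> I" "x i \<notin> A i" by (auto simp: space_PiM PiE_iff)
        then have "(\<Prod>i\<in>I. indicator (A i) (x i) :: ennreal) = 0"
          by (intro prod_zero[OF I] bexI[of _ i]) simp_all
        with False show ?thesis by simp
      qed
      then show "(\<Prod>i\<in>I. f i (x i)) * indicator (Pi\<^sub>E I A) x = (\<Prod>i\<in>I. f i (x i) * indicator (A i) (x i))"
        by (simp add: prod.distrib)
    qed
    also have "\<dots> = (\<Prod>i\<in>I. \<integral>\<^sup>+x. f i x * indicator (A i) x \<partial>M i)"
      using I A by (intro M.product_nn_integral_prod) auto
    also have "\<dots> = (\<Prod>i\<in>I. emeasure (density (M i) (f i)) (A i))"
      using A by (intro prod.cong refl) (auto simp: emeasure_density)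
    finally show "emeasure (density (Pi\<^sub>M I M) (\<lambda>x. \<Prod>i\<in>I. f i (x i))) (Pi\<^sub>E I A)
      = (\<Prod>i\<in>I. emeasure (density (M i) (f i)) (A i))" .
  qed
qed

section \<open>The hyperplane through the rows of a matrix\<close>

definition row_mat :: "nat \<Rightarrow> (nat \<Rightarrow> nat \<Rightarrow> real) \<Rightarrow> real mat"
  where "row_mat d x = mat d d (\<lambda>(i, j). x i j)"

definition row_det :: "nat \<Rightarrow> (nat \<Rightarrow> nat \<Rightarrow> real) \<Rightarrow> real"
  where "row_det d x = det (row_mat d x)"

definition row_cof :: "nat \<Rightarrow> (nat \<Rightarrow> nat \<Rightarrow> real) \<Rightarrow> nat \<Rightarrow> nat \<Rightarrow> real"
  where "row_cof d x i j = cofactor (row_mat d x) i j"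

lemma row_mat_carrier[simp]: "row_mat d x \<in> carrier_mat d d"
  by (simp add: row_mat_def)

lemma row_mat_cong: "(\<And>i j. i < d \<Longrightarrow> j < d \<Longrightarrow> x i j = y i j) \<Longrightarrow> row_mat d x = row_mat d y"
  unfolding row_mat_def by (intro eq_matI) auto

lemma row_det_cong: "(\<And>i j. i < d \<Longrightarrow> j < d \<Longrightarrow> x i j = y i j) \<Longrightarrow> row_det d x = row_det d y"
  unfolding row_det_def by (simp cong: row_mat_cong)

lemma row_cof_cong: "(\<And>i j. i < d \<Longrightarrow> j < d \<Longrightarrow> x i j = y i j) \<Longrightarrow> row_cof d x k l = row_cof d y k l"
  unfolding row_cof_def using row_mat_cong[of d x y] by simp

lemma row_cof_left_inverse:
  assumes "j < d" "k < d"
  shows "(\<Sum>i<d. row_cof d x i j * x i k) = (if j = k then row_det d x else 0)"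
proof -
  have "(adj_mat (row_mat d x) * row_mat d x) $$ (j, k) = (det (row_mat d x) \<cdot>\<^sub>m 1\<^sub>m d) $$ (j, k)"
    using adj_mat(3)[OF row_mat_carrier[of d x]] by simp
  then show ?thesis
    using assms by (simp add: adj_mat_def row_mat_def scalar_prod_def row_cof_def row_det_def lessThan_atLeast0 if_distrib cong: if_cong)
qed

lemma row_cof_right_inverse:
  assumes "i < d" "k < d"
  shows "(\<Sum>j<d. x i j * row_cof d x k j) = (if i = k then row_det d x else 0)"
proof -
  have "(row_mat d x * adj_mat (row_mat d x)) $$ (i, k) = (det (row_mat d x) \<cdot>\<^sub>m 1\<^sub>m d) $$ (i, k)"
    using adj_mat(2)[OF row_mat_carrier[of d x]] by simp
  then show ?thesis
    using assms by (simp add: adj_mat_def row_mat_def scalar_prod_def row_cof_def row_det_def lessThan_atLeast0 if_distrib cong: if_cong)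
qed

text \<open>Singularity in terms of plain functions: in this form it is visibly unaffected by
  scaling or reflecting the rows.\<close>

lemma row_det_eq_0_iff:
  "row_det d x = 0 \<longleftrightarrow> (\<exists>w. (\<exists>j<d. w j \<noteq> 0) \<and> (\<forall>i<d. (\<Sum>j<d. x i j * w j) = 0))"
proof
  assume "row_det d x = 0"
  then obtain v where v: "v \<in> carrier_vec d" "v \<noteq> 0\<^sub>v d" "row_mat d x *\<^sub>v v = 0\<^sub>v d"
    using det_0_iff_vec_prod_zero[OF row_mat_carrier[of d x]] by (auto simp: row_det_def)
  have "\<exists>j<d. v $ j \<noteq> 0"
  proof (rule ccontr)
    assume "\<not> ?thesis"
    then have "v = 0\<^sub>v d" using v(1) by (intro eq_vecI) auto
    with v(2) show False by simp
  qed
  moreover have "(\<Sum>j<d. x i j * v $ j) = 0" if "i < d" for i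
  proof -
    have "(row_mat d x *\<^sub>v v) $ i = 0\<^sub>v d $ i" using v(3) by simp
    then show ?thesis using that v(1) by (simp add: row_mat_def scalar_prod_def lessThan_atLeast0)
  qed
  ultimately show "\<exists>w. (\<exists>j<d. w j \<noteq> 0) \<and> (\<forall>i<d. (\<Sum>j<d. x i j * w j) = 0)"
    by (intro exI[of _ "\<lambda>j. v $ j"]) auto
next
  assume "\<exists>w. (\<exists>j<d. w j \<noteq> 0) \<and> (\<forall>i<d. (\<Sum>j<d. x i j * w j) = 0)"
  then obtain w j where w: "j < d" "w j \<noteq> 0" "\<And>i. i < d \<Longrightarrow> (\<Sum>j<d. x i j * w j) = 0" by blast
  have "row_det d x * w j = (\<Sum>k<d. (if j = k then row_det d x else 0) * w k)"
    using w(1) by (simp add: if_distrib[where f="\<lambda>z. z * _"] cong: if_cong)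
  also have "\<dots> = (\<Sum>k<d. (\<Sum>i<d. row_cof d x i j * x i k) * w k)"
    using w(1) by (intro sum.cong refl) (simp add: row_cof_left_inverse)
  also have "\<dots> = (\<Sum>i<d. row_cof d x i j * (\<Sum>k<d. x i k * w k))"
    unfolding sum_distrib_right sum_distrib_left mult.assoc by (rule sum.swap)
  also have "\<dots> = 0" using w(3) by simp
  finally show "row_det d x = 0" using w(2) by simp
qed

section \<open>Linear systems and Cramer's rule\<close>

text \<open>Cramer's rule for the system with coefficient rows \<open>x i\<close> and right side
  \<open>a\<close>; meaningful only if \<open>row_det d x\<close> is not 0.\<close>

definition sol :: "nat \<Rightarrow> (nat \<Rightarrow> nat \<Rightarrow> real) \<Rightarrow> (nat \<Rightarrow> real) \<Rightarrow> nat \<Rightarrow> real"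
  where "sol d x a j = (\<Sum>i<d. row_cof d x i j * a i) / row_det d x"

lemma sol:
  assumes "row_det d x \<noteq> 0" "i < d"
  shows "(\<Sum>j<d. x i j * sol d x a j) = a i"
proof -
  have "(\<Sum>j<d. x i j * sol d x a j) = (\<Sum>j<d. \<Sum>k<d. x i j * row_cof d x k j * a k) / row_det d x"
    by (simp add: sol_def sum_divide_distrib sum_distrib_left mult.assoc)
  also have "(\<Sum>j<d. \<Sum>k<d. x i j * row_cof d x k j * a k) = (\<Sum>k<d. (\<Sum>j<d. x i j * row_cof d x k j) * a k)"
    unfolding sum_distrib_right by (rule sum.swap)
  also have "\<dots> = (\<Sum>k<d. (if i = k then row_det d x else 0) * a k)"
    using assms(2) by (intro sum.cong refl) (simp add: row_cof_right_inverse)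
  also have "\<dots> = row_det d x * a i"
    using assms(2) by (simp add: if_distrib[where f="\<lambda>z. z * _"] cong: if_cong)
  finally show ?thesis using assms(1) by simp
qed

lemma sol_unique:
  assumes "row_det d x \<noteq> 0" "j < d" and w: "\<And>i. i < d \<Longrightarrow> (\<Sum>j<d. x i j * w j) = a i"
  shows "w j = sol d x a j"
proof (rule ccontr)
  assume "w j \<noteq> sol d x a j"
  then have "\<exists>v. (\<exists>j<d. v j \<noteq> 0) \<and> (\<forall>i<d. (\<Sum>j<d. x i j * v j) = 0)"
    using assms by (intro exI[of _ "\<lambda>j. w j - sol d x a j"]) (auto simp: right_diff_distrib sum_subtractf sol)
  with assms(1) show False by (simp add: row_det_eq_0_iff)
qed

text \<open>
  The reciprocal length of the solution \<open>w\<close> of \<open>x w = a\<close>, by Cramer's rule.  For \<open>a = 1\<close> this is the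
  distance from the origin to the hyperplane through the rows of \<open>x\<close>.
\<close>

definition plane_dist :: "nat \<Rightarrow> (nat \<Rightarrow> nat \<Rightarrow> real) \<Rightarrow> (nat \<Rightarrow> real) \<Rightarrow> real"
  where "plane_dist d x a = \<bar>row_det d x\<bar> / sqrt (\<Sum>j<d. (\<Sum>i<d. row_cof d x i j * a i)\<^sup>2)"

lemma plane_dist_nonneg: "0 \<le> plane_dist d x a"
  by (simp add: plane_dist_def sum_nonneg)

lemma plane_dist_cong:
  "(\<And>i j. i < d \<Longrightarrow> j < d \<Longrightarrow> x i j = y i j) \<Longrightarrow> (\<And>i. i < d \<Longrightarrow> a i = b i) \<Longrightarrow> plane_dist d x a = plane_dist d y b"
  unfolding plane_dist_def using row_det_cong[of d x y] row_cof_cong[of d x y] by simp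

lemma plane_dist_eq:
  assumes "row_det d x \<noteq> 0" and w: "\<And>i. i < d \<Longrightarrow> (\<Sum>j<d. x i j * w j) = a i"
  shows "plane_dist d x a = 1 / sqrt (nsq d w)"
proof -
  have "nsq d w = (\<Sum>j<d. (sol d x a j)\<^sup>2)"
    unfolding nsq_def using sol_unique[OF assms(1) _ w] by (intro sum.cong) auto
  also have "\<dots> = (\<Sum>j<d. (\<Sum>i<d. row_cof d x i j * a i)\<^sup>2) / (row_det d x)\<^sup>2"
    unfolding sol_def power_divide sum_divide_distrib[symmetric] ..
  finally show ?thesis by (simp add: plane_dist_def real_sqrt_divide)
qed

text \<open>The distance depends only on the solution of the system, so every change of the
  equations that keeps the solution keeps \<open>plane_dist\<close>.\<close>

lemma plane_dist_transfer:
  assumes "row_det d x \<noteq> 0" "row_det d y \<noteq> 0"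
    and "\<And>w i. i < d \<Longrightarrow> (\<And>i. i < d \<Longrightarrow> (\<Sum>j<d. x i j * w j) = a i) \<Longrightarrow> (\<Sum>j<d. y i j * w j) = b i"
  shows "plane_dist d x a = plane_dist d y b"
  using plane_dist_eq[OF assms(1), of "sol d x a" a] plane_dist_eq[OF assms(2), of "sol d x a" b]
    sol[OF assms(1), of _ a] assms(3)[of _ "sol d x a"] by metis

lemma row_det_measurable:
  assumes "\<And>i j. i < d \<Longrightarrow> j < d \<Longrightarrow> (\<lambda>\<omega>. X \<omega> i j) \<in> borel_measurable M"
  shows "(\<lambda>\<omega>. row_det d (X \<omega>)) \<in> borel_measurable M"
proof -
  have "row_det d (X \<omega>) = (\<Sum>p | p permutes {0..<d}. signof p * (\<Prod>i = 0..<d. X \<omega> i (p i)))" for \<omega>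
  proof -
    have "p i < d" if "p permutes {0..<d}" "i < d" for p i
      using permutes_in_image[OF that(1), of i] that(2) by simp
    then show ?thesis
      unfolding row_det_def det_def'[OF row_mat_carrier]
      by (intro sum.cong refl arg_cong2[where f="(*)"] prod.cong) (auto simp: row_mat_def)
  qed
  moreover have "(\<lambda>\<omega>. \<Sum>p | p permutes {0..<d}. signof p * (\<Prod>i = 0..<d. X \<omega> i (p i))) \<in> borel_measurable M"
  proof (intro borel_measurable_sum borel_measurable_times borel_measurable_prod borel_measurable_const)
    fix p i assume "p \<in> {p. p permutes {0..<d}}" "i \<in> {0..<d}"
    then show "(\<lambda>\<omega>. X \<omega> i (p i)) \<in> borel_measurable M"
      using permutes_in_image[of p "{0..<d}" i] by (intro assms) auto
  qed
  ultimately show ?thesis by simp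
qed

text \<open>Minors as determinants of smaller arrays: measurability carries over from determinants,
  and the cofactors of a row are seen not to involve that row.\<close>

lemma row_cof_eq_row_det:
  assumes "i < d" "j < d"
  shows "row_cof d x i j = (-1) ^ (i + j) *
    row_det (d - 1) (\<lambda>k l. x (if k < i then k else Suc k) (if l < j then l else Suc l))"
proof -
  have "mat_delete (row_mat d x) i j = row_mat (d - 1) (\<lambda>k l. x (if k < i then k else Suc k) (if l < j then l else Suc l))"
    using assms by (intro eq_matI) (auto simp: mat_delete_def row_mat_def)
  then show ?thesis by (simp add: row_cof_def cofactor_def row_det_def)
qed

lemma row_cof_measurable:
  assumes "\<And>i j. i < d \<Longrightarrow> j < d \<Longrightarrow> (\<lambda>\<omega>. X \<omega> i j) \<in> borel_measurable M" and "k < d" "l < d"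
  shows "(\<lambda>\<omega>. row_cof d (X \<omega>) k l) \<in> borel_measurable M"
  unfolding row_cof_eq_row_det[OF assms(2,3)]
  by (intro borel_measurable_times borel_measurable_const row_det_measurable assms(1)) auto

lemma plane_dist_measurable:
  assumes "\<And>i j. i < d \<Longrightarrow> j < d \<Longrightarrow> (\<lambda>\<omega>. X \<omega> i j) \<in> borel_measurable M"
  shows "(\<lambda>\<omega>. plane_dist d (X \<omega>) a) \<in> borel_measurable M"
proof -
  have [measurable]: "(\<lambda>\<omega>. row_det d (X \<omega>)) \<in> borel_measurable M" by (rule row_det_measurable[OF assms])
  have [measurable]: "(\<lambda>\<omega>. row_cof d (X \<omega>) i j) \<in> borel_measurable M" if "i < d" "j < d" for i j
    by (rule row_cof_measurable[OF assms that])
  show ?thesis unfolding plane_dist_def by measurable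
qed

lemma row_cof_update_row:
  assumes "j < d" "0 < d"
  shows "row_cof d (x(0 := y)) 0 j = row_cof d x 0 j"
  unfolding row_cof_eq_row_det[OF assms(2,1)] by (intro arg_cong2[where f="(*)"] refl row_det_cong) auto

lemma row_det_row_0:
  assumes "0 < d"
  shows "row_det d x = (\<Sum>j<d. x 0 j * row_cof d x 0 j)"
  using row_cof_right_inverse[of 0 d 0 x] assms by simp

section \<open>Almost every matrix is nonsingular\<close>

text \<open>Adding \<open>t\<close> to the diagonal gives a singular matrix only if
  \<open>- t\<close> is a root of the characteristic polynomial, which is monic and hence has
  finitely many roots.\<close>

lemma finite_row_det_shift_zeros: "finite {t. row_det d (\<lambda>i j. x i j + (if i = j then t else 0)) = 0}"
proof -
  let ?A = "row_mat d x"
  have "char_poly ?A \<noteq> 0"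
    using degree_monic_char_poly[OF row_mat_carrier[of d x]] by auto
  then have "finite {k. poly (char_poly ?A) k = 0}" by (rule poly_roots_finite)
  then have "finite (uminus ` {k. poly (char_poly ?A) k = 0})" by (rule finite_imageI)
  moreover have "{t. row_det d (\<lambda>i j. x i j + (if i = j then t else 0)) = 0} \<subseteq> uminus ` {k. poly (char_poly ?A) k = 0}"
  proof
    fix t assume t: "t \<in> {t. row_det d (\<lambda>i j. x i j + (if i = j then t else 0)) = 0}"
    have "row_mat d (\<lambda>i j. x i j + (if i = j then t else 0)) = char_matrix ?A (- t)"
      by (intro eq_matI) (auto simp: row_mat_def char_matrix_def)
    with t have "det (char_matrix ?A (- t)) = 0" by (simp add: row_det_def)
    then have "poly (char_poly ?A) (- t) = 0"
      using eigenvalue_root_char_poly[OF row_mat_carrier[of d x], of "- t"] eigenvalue_det[OF row_mat_carrier[of d x], of "- t"] by simp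
    then show "t \<in> uminus ` {k. poly (char_poly ?A) k = 0}" by (intro image_eqI[of _ _ "- t"]) auto
  qed
  ultimately show ?thesis by (rule finite_subset[rotated])
qed

text \<open>
  By translation invariance the measure of \<open>{det = 0}\<close> equals that of \<open>{x. det (x + t I) = 0}\<close>
  for every \<open>t\<close>, and for fixed \<open>x\<close> only finitely many \<open>t\<close> give a singular matrix.
\<close>

lemma AE_leb_row_det: "AE z in leb ({..<d} \<times> {..<d}). row_det d (\<lambda>i j. z (i, j)) \<noteq> 0"
proof -
  let ?Q = "{..<d} \<times> {..<d} :: (nat \<times> nat) set"
  interpret Q: sigma_finite_measure "leb ?Q" by (rule leb.sigma_finite) simp
  interpret QR: pair_sigma_finite "leb ?Q" "lborel :: real measure" ..
  define S where "S = {z \<in> space (leb ?Q). row_det d (\<lambda>i j. z (i, j)) = 0}"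
  have dtm[measurable]: "(\<lambda>z. row_det d (\<lambda>i j. z (i, j))) \<in> borel_measurable (leb ?Q)"
    by (rule row_det_measurable) measurable
  have S[measurable]: "S \<in> sets (leb ?Q)" unfolding S_def by measurable
  define T where "T = (\<lambda>(t::real) (z::nat \<times> nat \<Rightarrow> real). \<lambda>p\<in>?Q. z p + (if fst p = snd p then t else 0))"
  have T[measurable]: "(\<lambda>p. T (snd p) (fst p)) \<in> measurable (leb ?Q \<Otimes>\<^sub>M lborel) (leb ?Q)"
    unfolding T_def by measurable
  \<comment> \<open>Averaging over an interval of length 1 introduces the variable \<open>t\<close>
    without changing the value.\<close>
  have "emeasure (leb ?Q) S = (\<integral>\<^sup>+t. emeasure (leb ?Q) S * indicator {0..1::real} t \<partial>lborel)"
    by (simp add: nn_integral_cmult)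
  also have "\<dots> = (\<integral>\<^sup>+t. (\<integral>\<^sup>+z. indicator S (T t z) * indicator {0..1} t \<partial>leb ?Q) \<partial>lborel)"
  proof (rule nn_integral_cong)
    fix t :: real
    have Tt: "T t \<in> measurable (leb ?Q) (leb ?Q)" unfolding T_def by measurable
    have "emeasure (leb ?Q) S = (\<integral>\<^sup>+z. indicator S (T t z) \<partial>leb ?Q)"
      unfolding T_def by (subst nn_integral_leb_translate) auto
    then show "emeasure (leb ?Q) S * indicator {0..1} t = (\<integral>\<^sup>+z. indicator S (T t z) * indicator {0..1} t \<partial>leb ?Q)"
      using Tt by (simp add: nn_integral_multc)
  qed
  also have "\<dots> = (\<integral>\<^sup>+z. (\<integral>\<^sup>+t. indicator S (T t z) * indicator {0..1} t \<partial>lborel) \<partial>leb ?Q)"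
  proof (rule QR.Fubini')
    show "(\<lambda>(z, t). indicator S (T t z) * indicator {0..1} t :: ennreal) \<in> borel_measurable (leb ?Q \<Otimes>\<^sub>M lborel)"
      unfolding case_prod_beta by measurable
  qed
  also have "\<dots> = (\<integral>\<^sup>+z. 0 \<partial>leb ?Q)"
  proof (rule nn_integral_cong)
    fix z :: "nat \<times> nat \<Rightarrow> real"
    let ?F = "{t. row_det d (\<lambda>i j. z (i, j) + (if i = j then t else 0)) = 0}"
    have "T t z \<in> S \<Longrightarrow> t \<in> ?F" for t
      using row_det_cong[of d "\<lambda>i j. T t z (i, j)" "\<lambda>i j. z (i, j) + (if i = j then t else 0)"]
      by (simp add: S_def T_def)
    then have "(\<integral>\<^sup>+t. indicator S (T t z) * indicator {0..1} t \<partial>lborel) \<le> (\<integral>\<^sup>+t. indicator ?F t \<partial>lborel)"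
      by (intro nn_integral_mono) (auto simp: indicator_def)
    also have "\<dots> = 0"
      using finite_row_det_shift_zeros[of d "\<lambda>i j. z (i, j)"]
      by (subst nn_integral_indicator) (auto intro: emeasure_lborel_countable countable_finite finite_imp_closed borel_closed)
    finally show "(\<integral>\<^sup>+t. indicator S (T t z) * indicator {0..1} t \<partial>lborel) = 0" by simp
  qed
  finally have "S \<in> null_sets (leb ?Q)" using S by (auto intro: null_setsI)
  from AE_not_in[OF this] AE_space show ?thesis
    by eventually_elim (simp add: S_def)
qed

text \<open>A matrix is needed in two guises: as one vector indexed by pairs, for isometries and the
  nonsingularity argument, and as a family of rows, for polar coordinates and conditioning on
  rows.\<close>

lemma nn_integral_leb_nested:
  assumes I: "finite I" and J: "finite J" and f[measurable]: "f \<in> borel_measurable (leb (I \<times> J))"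
  shows "(\<integral>\<^sup>+z. f z \<partial>leb (I \<times> J)) = (\<integral>\<^sup>+x. f (\<lambda>p\<in>I \<times> J. x (fst p) (snd p)) \<partial>(\<Pi>\<^sub>M i\<in>I. leb J))"
proof -
  interpret JJ: product_sigma_finite "\<lambda>_. leb J"
    by (simp add: product_sigma_finite_def leb.sigma_finite J)
  let ?T = "\<lambda>x. \<lambda>p\<in>I \<times> J. x (fst p) (snd p)"
  have T: "?T \<in> measurable (\<Pi>\<^sub>M i\<in>I. leb J) (leb (I \<times> J))"
  proof (rule measurable_restrict)
    fix p assume "p \<in> I \<times> J"
    then have p: "fst p \<in> I" "snd p \<in> J" by auto
    show "(\<lambda>x. x (fst p) (snd p)) \<in> measurable (\<Pi>\<^sub>M i\<in>I. leb J) lborel"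
      using measurable_compose[OF measurable_component_singleton[OF p(1)] measurable_component_singleton[OF p(2)]] .
  qed
  have "distr (\<Pi>\<^sub>M i\<in>I. leb J) (leb (I \<times> J)) ?T = leb (I \<times> J)"
  proof (rule leb.PiM_eqI)
    fix A assume A: "\<And>p. p \<in> I \<times> J \<Longrightarrow> A p \<in> sets (lborel :: real measure)"
    have eq: "?T -` Pi\<^sub>E (I \<times> J) A \<inter> space (\<Pi>\<^sub>M i\<in>I. leb J) = Pi\<^sub>E I (\<lambda>i. Pi\<^sub>E J (\<lambda>j. A (i, j)))"
      by (auto simp: space_PiM PiE_iff extensional_def)
    have "emeasure (distr (\<Pi>\<^sub>M i\<in>I. leb J) (leb (I \<times> J)) ?T) (Pi\<^sub>E (I \<times> J) A)
      = emeasure (\<Pi>\<^sub>M i\<in>I. leb J) (Pi\<^sub>E I (\<lambda>i. Pi\<^sub>E J (\<lambda>j. A (i, j))))"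
      using T A I J by (subst emeasure_distr) (auto simp: eq intro!: sets_PiM_I_finite)
    also have "\<dots> = (\<Prod>i\<in>I. emeasure (leb J) (Pi\<^sub>E J (\<lambda>j. A (i, j))))"
      using A I J by (intro JJ.emeasure_PiM) (auto intro!: sets_PiM_I_finite)
    also have "\<dots> = (\<Prod>i\<in>I. \<Prod>j\<in>J. emeasure lborel (A (i, j)))"
      using A J by (intro prod.cong refl leb.emeasure_PiM) auto
    also have "\<dots> = (\<Prod>p\<in>I \<times> J. emeasure lborel (A p))"
      by (simp add: prod.cartesian_product)
    finally show "emeasure (distr (\<Pi>\<^sub>M i\<in>I. leb J) (leb (I \<times> J)) ?T) (Pi\<^sub>E (I \<times> J) A) = (\<Prod>p\<in>I \<times> J. emeasure lborel (A p))" .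
  qed (use I J in auto)
  then have "(\<integral>\<^sup>+z. f z \<partial>leb (I \<times> J)) = (\<integral>\<^sup>+z. f z \<partial>distr (\<Pi>\<^sub>M i\<in>I. leb J) (leb (I \<times> J)) ?T)" by simp
  also have "\<dots> = (\<integral>\<^sup>+x. f (?T x) \<partial>(\<Pi>\<^sub>M i\<in>I. leb J))"
    by (rule nn_integral_distr[OF T]) simp
  finally show ?thesis .
qed

section \<open>The distance for Gaussian rows\<close>

lemma prod_std_normal_density:
  assumes "finite Q"
  shows "(\<Prod>p\<in>Q. ennreal (std_normal_density (z p))) = ennreal ((1 / sqrt (2 * pi)) ^ card Q * exp (- (\<Sum>p\<in>Q. (z p)\<^sup>2) / 2))"
proof -
  have "(\<Prod>p\<in>Q. ennreal (std_normal_density (z p))) = ennreal (\<Prod>p\<in>Q. std_normal_density (z p))"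
    by (rule prod_ennreal) simp
  also have "(\<Prod>p\<in>Q. std_normal_density (z p)) = (1 / sqrt (2 * pi)) ^ card Q * exp (- (\<Sum>p\<in>Q. (z p)\<^sup>2) / 2)"
    using assms by (simp add: std_normal_density_def prod_dividef sum_negf[symmetric] sum_divide_distrib exp_sum power_divide)
  finally show ?thesis .
qed

text \<open>Multiplying an equation and its right side by the same nonzero number keeps the
  solution.\<close>

lemma plane_dist_scale_rows:
  assumes x: "row_det d x \<noteq> 0" and s: "\<And>i. i < d \<Longrightarrow> c i \<noteq> 0"
  shows "row_det d (\<lambda>i j. c i * x i j) \<noteq> 0" "plane_dist d (\<lambda>i j. c i * x i j) (\<lambda>i. c i * a i) = plane_dist d x a"
proof -
  have *: "(\<Sum>j<d. c i * x i j * w j) = c i * (\<Sum>j<d. x i j * w j)" for w i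
    by (simp add: sum_distrib_left mult.assoc)
  show row_det: "row_det d (\<lambda>i j. c i * x i j) \<noteq> 0"
    using x s unfolding row_det_eq_0_iff * by auto
  show "plane_dist d (\<lambda>i j. c i * x i j) (\<lambda>i. c i * a i) = plane_dist d x a"
    by (rule plane_dist_transfer[OF x row_det, symmetric]) (simp add: *)
qed

lemma hyper_reflect_apply:
  "i \<in> I \<Longrightarrow> hyper_reflect I w x i = x i - 2 * (\<Sum>k\<in>I. w k * x k) / (\<Sum>k\<in>I. (w k)\<^sup>2) * w i"
  by (simp add: hyper_reflect_def)

lemma hyper_reflect_sum:
  assumes "finite J"
  shows "hyper_reflect I v (\<lambda>i. \<Sum>j\<in>J. x i j * w j) = (\<lambda>i\<in>I. \<Sum>j\<in>J. hyper_reflect I v (\<lambda>i. x i j) i * w j)"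
proof
  fix i
  define P where "P j = (\<Sum>k\<in>I. v k * x k j)" for j
  define S where "S = (\<Sum>k\<in>I. (v k)\<^sup>2)"
  have "(\<Sum>k\<in>I. v k * (\<Sum>j\<in>J. x k j * w j)) = (\<Sum>j\<in>J. P j * w j)"
    unfolding sum_distrib_left sum_distrib_right P_def by (subst sum.swap) (simp add: mult_ac)
  moreover have "2 * (\<Sum>j\<in>J. P j * w j) / S * v i = (\<Sum>j\<in>J. 2 * P j / S * v i * w j)"
    by (simp add: sum_distrib_left sum_distrib_right sum_divide_distrib mult_ac)
  ultimately show "hyper_reflect I v (\<lambda>i. \<Sum>j\<in>J. x i j * w j) i = (\<lambda>i\<in>I. \<Sum>j\<in>J. hyper_reflect I v (\<lambda>i. x i j) i * w j) i"
    by (simp add: hyper_reflect_def P_def[symmetric] S_def[symmetric] left_diff_distrib sum_subtractf)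
qed

text \<open>The reflection acts on the row index, so it multiplies the system \<open>x w = a\<close>
  from the left by an orthogonal matrix; the solution stays the same if \<open>a\<close> is
  reflected too.\<close>

lemma plane_dist_reflect_rows:
  assumes x: "row_det d x \<noteq> 0"
  shows "row_det d (\<lambda>i j. hyper_reflect {..<d} v (\<lambda>i. x i j) i) \<noteq> 0"
    "plane_dist d (\<lambda>i j. hyper_reflect {..<d} v (\<lambda>i. x i j) i) (hyper_reflect {..<d} v a) = plane_dist d x a"
proof -
  have *: "(\<Sum>j<d. hyper_reflect {..<d} v (\<lambda>i. x i j) i * w j) = hyper_reflect {..<d} v (\<lambda>i. \<Sum>j<d. x i j * w j) i" if "i < d" for i w
    using that by (simp add: hyper_reflect_sum)
  show row_det: "row_det d (\<lambda>i j. hyper_reflect {..<d} v (\<lambda>i. x i j) i) \<noteq> 0"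
  proof
    assume "row_det d (\<lambda>i j. hyper_reflect {..<d} v (\<lambda>i. x i j) i) = 0"
    then obtain w where w: "\<exists>j<d. w j \<noteq> 0"
      and W: "\<forall>i<d. (\<Sum>j<d. hyper_reflect {..<d} v (\<lambda>i. x i j) i * w j) = 0"
      unfolding row_det_eq_0_iff by auto
    have 0: "hyper_reflect {..<d} v (\<lambda>i. \<Sum>j<d. x i j * w j) i = 0" if "i < d" for i
      using W[rule_format, OF that] unfolding *[OF that] .
    have "(\<Sum>i<d. (\<Sum>j<d. x i j * w j) * (\<Sum>j<d. x i j * w j)) = 0"
      by (subst hyper_reflect_inner[symmetric, where w=v]) (simp_all add: 0)
    then have "\<forall>i<d. (\<Sum>j<d. x i j * w j) = 0"
      by (subst (asm) sum_nonneg_eq_0_iff) auto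
    with w x show False unfolding row_det_eq_0_iff by blast
  qed
  show "plane_dist d (\<lambda>i j. hyper_reflect {..<d} v (\<lambda>i. x i j) i) (hyper_reflect {..<d} v a) = plane_dist d x a"
  proof (rule plane_dist_transfer[OF x row_det, symmetric])
    fix w i assume i: "i < d" and w: "\<And>i. i < d \<Longrightarrow> (\<Sum>j<d. x i j * w j) = a i"
    have "hyper_reflect {..<d} v (\<lambda>i. \<Sum>j<d. x i j * w j) = hyper_reflect {..<d} v a"
      by (rule hyper_reflect_cong) (simp add: w)
    then show "(\<Sum>j<d. hyper_reflect {..<d} v (\<lambda>i. x i j) i * w j) = hyper_reflect {..<d} v a i"
      using *[OF i] by simp
  qed
qed

lemma plane_dist_leb_measurable[measurable]:
  "(\<lambda>z. plane_dist d (\<lambda>i j. z (i, j)) a) \<in> borel_measurable (leb ({..<d} \<times> {..<d}))"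
  by (rule plane_dist_measurable) measurable

text \<open>Substituting \<open>z p / sqrt (s (fst p))\<close> for \<open>z p\<close> makes all
  entries standard normal; undoing the scaling in the equations turns the right side 1 into
  \<open>sqrt (s i)\<close>.\<close>

lemma nn_integral_plane_dist_scale:
  fixes \<phi> :: "real \<Rightarrow> ennreal"
  assumes [measurable]: "\<phi> \<in> borel_measurable borel" and s: "\<And>i. i < d \<Longrightarrow> 0 < s i"
  defines "Q \<equiv> {..<d} \<times> {..<d}"
  shows "(\<integral>\<^sup>+z. \<phi> (plane_dist d (\<lambda>i j. z (i, j)) (\<lambda>_. 1)) *
      (\<Prod>p\<in>Q. ennreal (sqrt (s (fst p)) * std_normal_density (sqrt (s (fst p)) * z p))) \<partial>leb Q)
    = (\<integral>\<^sup>+z. \<phi> (plane_dist d (\<lambda>i j. z (i, j)) (\<lambda>i. sqrt (s i))) * (\<Prod>p\<in>Q. ennreal (std_normal_density (z p))) \<partial>leb Q)"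
    (is "integral\<^sup>N _ ?f = integral\<^sup>N _ ?g")
proof -
  have Q: "finite Q" by (simp add: Q_def)
  have f[measurable]: "?f \<in> borel_measurable (leb Q)" unfolding Q_def by measurable
  define T where "T = (\<lambda>z::nat \<times> nat \<Rightarrow> real. \<lambda>p\<in>Q. 1 / sqrt (s (fst p)) * z p + 0)"
  have [measurable]: "T \<in> measurable (leb Q) (leb Q)" unfolding T_def by measurable
  have "(\<integral>\<^sup>+z. ?f z \<partial>leb Q) = (\<Prod>p\<in>Q. ennreal \<bar>1 / sqrt (s (fst p))\<bar>) * (\<integral>\<^sup>+z. ?f (T z) \<partial>leb Q)"
    unfolding T_def using s by (intro nn_integral_leb_affine[OF Q f]) (auto simp: Q_def less_imp_neq[symmetric])
  also have "\<dots> = (\<integral>\<^sup>+z. (\<Prod>p\<in>Q. ennreal \<bar>1 / sqrt (s (fst p))\<bar>) * ?f (T z) \<partial>leb Q)"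
    using measurable_compose[OF \<open>T \<in> measurable (leb Q) (leb Q)\<close> f] by (rule nn_integral_cmult[symmetric])
  also have "\<dots> = (\<integral>\<^sup>+z. ?g z \<partial>leb Q)"
  proof (rule nn_integral_cong_AE)
    have "AE z in leb Q. row_det d (\<lambda>i j. z (i, j)) \<noteq> 0" unfolding Q_def by (rule AE_leb_row_det)
    then show "AE z in leb Q. (\<Prod>p\<in>Q. ennreal \<bar>1 / sqrt (s (fst p))\<bar>) * ?f (T z) = ?g z"
    proof eventually_elim
      case (elim z)
      have "plane_dist d (\<lambda>i j. T z (i, j)) (\<lambda>_. 1) = plane_dist d (\<lambda>i j. 1 / sqrt (s i) * z (i, j)) (\<lambda>i. 1 / sqrt (s i) * sqrt (s i))"
        using s by (intro plane_dist_cong) (auto simp: T_def Q_def less_imp_neq[symmetric])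
      also have "\<dots> = plane_dist d (\<lambda>i j. z (i, j)) (\<lambda>i. sqrt (s i))"
        using s by (intro plane_dist_scale_rows[OF elim]) (auto simp: less_imp_neq[symmetric])
      finally have h: "plane_dist d (\<lambda>i j. T z (i, j)) (\<lambda>_. 1) = plane_dist d (\<lambda>i j. z (i, j)) (\<lambda>i. sqrt (s i))" .
      have P: "(\<Prod>p\<in>Q. ennreal \<bar>1 / sqrt (s (fst p))\<bar>) *
          (\<Prod>p\<in>Q. ennreal (sqrt (s (fst p)) * std_normal_density (sqrt (s (fst p)) * T z p)))
        = (\<Prod>p\<in>Q. ennreal (std_normal_density (z p)))"
        unfolding prod.distrib[symmetric]
      proof (rule prod.cong[OF refl])
        fix p assume p: "p \<in> Q"
        with s have "0 < s (fst p)" by (auto simp: Q_def)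
        with p show "ennreal \<bar>1 / sqrt (s (fst p))\<bar> * ennreal (sqrt (s (fst p)) * std_normal_density (sqrt (s (fst p)) * T z p))
          = ennreal (std_normal_density (z p))"
          by (simp add: T_def ennreal_mult'[symmetric])
      qed
      show ?case unfolding h by (subst mult.left_commute) (simp only: P)
    qed
  qed
  finally show ?thesis .
qed

text \<open>The standard Gaussian density of a matrix depends only on the sum of the squares of its
  entries, so each column may be reflected by the map that sends \<open>a\<close> to a multiple of
  the first basis vector.\<close>

lemma nn_integral_plane_dist_rotate:
  fixes \<phi> :: "real \<Rightarrow> ennreal"
  assumes [measurable]: "\<phi> \<in> borel_measurable borel" and d: "0 < d"
  defines "Q \<equiv> {..<d} \<times> {..<d}"
  shows "(\<integral>\<^sup>+z. \<phi> (plane_dist d (\<lambda>i j. z (i, j)) a) * (\<Prod>p\<in>Q. ennreal (std_normal_density (z p))) \<partial>leb Q)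
    = (\<integral>\<^sup>+z. \<phi> (plane_dist d (\<lambda>i j. z (i, j)) (\<lambda>i. if i = 0 then sqrt (nsq d a) else 0))
        * (\<Prod>p\<in>Q. ennreal (std_normal_density (z p))) \<partial>leb Q)"
    (is "integral\<^sup>N _ ?g = integral\<^sup>N _ ?f")
proof -
  have Q: "finite Q" by (simp add: Q_def)
  let ?e = "\<lambda>i::nat. if i = 0 then sqrt (nsq d a) else 0"
  let ?v = "\<lambda>i. a i - ?e i"
  have ve: "hyper_reflect {..<d} ?v a = (\<lambda>i\<in>{..<d}. ?e i)"
    using d by (intro hyper_reflect_swap) (auto simp: nsq_def if_distrib[where f="\<lambda>x. x\<^sup>2"] sum_nonneg cong: if_cong)
  define T where "T z = (\<lambda>p\<in>Q. hyper_reflect {..<d} ?v (\<lambda>i. z (i, snd p)) (fst p))" for z :: "nat \<times> nat \<Rightarrow> real"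
  have T[measurable]: "T \<in> measurable (leb Q) (leb Q)"
    unfolding T_def
  proof (rule measurable_restrict)
    fix p assume "p \<in> Q"
    then have p: "fst p < d" "snd p < d" by (auto simp: Q_def)
    have [measurable]: "(\<lambda>z. z (k, snd p)) \<in> borel_measurable (leb Q)" if "k < d" for k
      using measurable_component_singleton[of "(k, snd p)" Q "\<lambda>_. lborel :: real measure"] that p by (simp add: Q_def)
    have eq: "hyper_reflect {..<d} ?v (\<lambda>i. z (i, snd p)) (fst p) =
      z (fst p, snd p) - 2 * (\<Sum>k<d. ?v k * z (k, snd p)) / (\<Sum>k<d. (?v k)\<^sup>2) * ?v (fst p)" for z
      by (rule hyper_reflect_apply) (use p in simp)
    show "(\<lambda>z. hyper_reflect {..<d} ?v (\<lambda>i. z (i, snd p)) (fst p)) \<in> measurable (leb Q) lborel"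
      unfolding eq using p by measurable
  qed
  have f[measurable]: "?f \<in> borel_measurable (leb Q)" unfolding Q_def by measurable
  have iso: "(\<Sum>p\<in>Q. (T z p)\<^sup>2) = (\<Sum>p\<in>Q. (z p)\<^sup>2)" for z
  proof -
    have "(\<Sum>p\<in>Q. (T z p)\<^sup>2) = (\<Sum>(i, j)\<in>Q. (hyper_reflect {..<d} ?v (\<lambda>i. z (i, j)) i)\<^sup>2)"
      by (intro sum.cong) (auto simp: T_def)
    also have "\<dots> = (\<Sum>j<d. \<Sum>i<d. (hyper_reflect {..<d} ?v (\<lambda>i. z (i, j)) i)\<^sup>2)"
      unfolding Q_def sum.cartesian_product[symmetric] by (rule sum.swap)
    also have "\<dots> = (\<Sum>j<d. \<Sum>i<d. (z (i, j))\<^sup>2)"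
      unfolding power2_eq_square by (intro sum.cong refl hyper_reflect_inner) simp
    also have "\<dots> = (\<Sum>(i, j)\<in>Q. (z (i, j))\<^sup>2)"
      unfolding Q_def sum.cartesian_product[symmetric] by (rule sum.swap)
    finally show ?thesis by (simp add: case_prod_beta)
  qed
  have "(\<integral>\<^sup>+z. ?g z \<partial>leb Q) = (\<integral>\<^sup>+z. ?f (T z) \<partial>leb Q)"
  proof (rule nn_integral_cong_AE)
    have "AE z in leb Q. row_det d (\<lambda>i j. z (i, j)) \<noteq> 0" unfolding Q_def by (rule AE_leb_row_det)
    then show "AE z in leb Q. ?g z = ?f (T z)"
    proof eventually_elim
      case (elim z)
      have "plane_dist d (\<lambda>i j. T z (i, j)) ?e = plane_dist d (\<lambda>i j. hyper_reflect {..<d} ?v (\<lambda>i. z (i, j)) i) (hyper_reflect {..<d} ?v a)"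
        unfolding ve by (intro plane_dist_cong) (auto simp: T_def Q_def)
      also have "\<dots> = plane_dist d (\<lambda>i j. z (i, j)) a"
        by (rule plane_dist_reflect_rows[OF elim])
      finally show ?case
        unfolding prod_std_normal_density[OF Q] iso by simp
    qed
  qed
  also have "\<dots> = (\<integral>\<^sup>+z. ?f z \<partial>leb Q)"
  proof (rule nn_integral_leb_isometry[OF Q T _ iso f])
    fix x y assume x: "x \<in> space (leb Q)" and y: "y \<in> space (leb Q)"
    show "T (\<lambda>p\<in>Q. x p - T y p) = (\<lambda>p\<in>Q. T x p - y p)"
    proof
      fix p
      show "T (\<lambda>p\<in>Q. x p - T y p) p = (\<lambda>p\<in>Q. T x p - y p) p"
      proof (cases "p \<in> Q")
        case True
        then obtain i j where p: "p = (i, j)" "i < d" "j < d" by (auto simp: Q_def)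
        have "T (\<lambda>p\<in>Q. x p - T y p) p
          = hyper_reflect {..<d} ?v (\<lambda>i\<in>{..<d}. x (i, j) - hyper_reflect {..<d} ?v (\<lambda>i. y (i, j)) i) i"
          using p by (simp add: T_def Q_def cong: hyper_reflect_cong) (rule fun_cong[OF hyper_reflect_cong], auto)
        also have "\<dots> = hyper_reflect {..<d} ?v (\<lambda>i. x (i, j)) i - hyper_reflect {..<d} ?v (hyper_reflect {..<d} ?v (\<lambda>i. y (i, j))) i"
          unfolding hyper_reflect_diff using p by simp
        also have "hyper_reflect {..<d} ?v (hyper_reflect {..<d} ?v (\<lambda>i. y (i, j)))
          = hyper_reflect {..<d} ?v (hyper_reflect {..<d} ?v (\<lambda>i\<in>{..<d}. y (i, j)))"
          by (intro hyper_reflect_cong fun_cong[OF hyper_reflect_cong]) auto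
        also have "\<dots> = (\<lambda>i\<in>{..<d}. y (i, j))" by (rule hyper_reflect_involution) auto
        finally show ?thesis using p by (simp add: T_def Q_def)
      qed (simp add: T_def)
    qed
  qed
  finally show ?thesis .
qed

text \<open>With this right side the solution is orthogonal to all rows except row 0, hence
  proportional to the cofactors of row 0. Up to \<alpha>, the distance is the length of the
  projection of row 0 on that direction.\<close>

lemma plane_dist_axis:
  assumes d: "0 < d" and \<alpha>: "0 < \<alpha>"
  shows "plane_dist d (x(0 := y)) (\<lambda>i. if i = 0 then \<alpha> else 0)
    = \<bar>\<Sum>j<d. y j * row_cof d x 0 j\<bar> / sqrt (nsq d (row_cof d x 0)) / \<alpha>"
proof -
  have "(\<Sum>i<d. row_cof d (x(0 := y)) i j * (if i = 0 then \<alpha> else 0)) = \<alpha> * row_cof d x 0 j" if "j < d" for j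
    using d that by (simp add: if_distrib[where f="\<lambda>z. _ * z"] row_cof_update_row cong: if_cong)
  then have "(\<Sum>j<d. (\<Sum>i<d. row_cof d (x(0 := y)) i j * (if i = 0 then \<alpha> else 0))\<^sup>2) = \<alpha>\<^sup>2 * nsq d (row_cof d x 0)"
    by (simp add: nsq_def power_mult_distrib sum_distrib_left)
  moreover have "row_det d (x(0 := y)) = (\<Sum>j<d. y j * row_cof d x 0 j)"
    by (subst row_det_row_0[OF d]) (simp add: row_cof_update_row[OF _ d])
  ultimately show ?thesis
    using \<alpha> by (simp add: plane_dist_def real_sqrt_mult mult.commute)
qed

text \<open>The standard Gaussian measure is rotation invariant, so only the length of \<open>c\<close> matters.\<close>

lemma nn_integral_gauss_linear:
  fixes \<phi> :: "real \<Rightarrow> ennreal"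
  assumes [measurable]: "\<phi> \<in> borel_measurable borel" and d: "0 < d" and c: "nsq d c \<noteq> 0"
  shows "(\<integral>\<^sup>+y. \<phi> \<bar>(\<Sum>j<d. y j * c j) / sqrt (nsq d c)\<bar> * (\<Prod>j<d. ennreal (std_normal_density (y j))) \<partial>leb {..<d})
    = (\<integral>\<^sup>+z. \<phi> \<bar>z\<bar> * ennreal (std_normal_density z) \<partial>lborel)"
proof -
  have [measurable]: "0 \<in> {..<d}" using d by simp
  let ?u = "\<lambda>j. c j / sqrt (nsq d c)"
  let ?e = "\<lambda>j::nat. if j = 0 then 1 else (0::real)"
  let ?R = "hyper_reflect {..<d} (\<lambda>i. ?u i - ?e i)"
  let ?f = "\<lambda>y. \<phi> \<bar>y 0\<bar> * (\<Prod>j<d. ennreal (std_normal_density (y j)))"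
  have f: "?f \<in> borel_measurable (leb {..<d})" by measurable
  have nc: "nsq d c > 0" using c nsq_nonneg[of d c] by simp
  have u1: "(\<Sum>i<d. (?u i)\<^sup>2) = 1"
    using nc by (simp add: power_divide sum_divide_distrib[symmetric] nsq_def[symmetric])
  have Ru: "?R ?u = (\<lambda>i\<in>{..<d}. ?e i)"
    using d by (intro hyper_reflect_swap) (simp_all add: u1 if_distrib[where f="\<lambda>x. x\<^sup>2"] cong: if_cong)
  have "(\<Sum>j<d. y j * c j) / sqrt (nsq d c) = ?R y 0" for y
  proof -
    have "(\<Sum>j<d. y j * c j) / sqrt (nsq d c) = (\<Sum>j<d. y j * ?u j)"
      by (simp add: sum_divide_distrib)
    also have "\<dots> = (\<Sum>j<d. ?R y j * ?R ?u j)" by (rule hyper_reflect_inner[symmetric]) simp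
    also have "\<dots> = ?R y 0"
      unfolding Ru using d by (simp add: if_distrib[where f="\<lambda>z. _ * z"] cong: if_cong)
    finally show ?thesis .
  qed
  moreover have "(\<Sum>j<d. (?R y j)\<^sup>2) = (\<Sum>j<d. (y j)\<^sup>2)" for y
    unfolding power2_eq_square by (rule hyper_reflect_inner) simp
  ultimately have "(\<integral>\<^sup>+y. \<phi> \<bar>(\<Sum>j<d. y j * c j) / sqrt (nsq d c)\<bar> * (\<Prod>j<d. ennreal (std_normal_density (y j))) \<partial>leb {..<d})
    = (\<integral>\<^sup>+y. ?f (?R y) \<partial>leb {..<d})"
    by (simp add: prod_std_normal_density)
  also have "\<dots> = (\<integral>\<^sup>+y. ?f y \<partial>leb {..<d})"
    by (rule nn_integral_leb_hyper_reflect) (use f in auto)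
  also have "\<dots> = (\<integral>\<^sup>+y. (\<Prod>j<d. (if j = 0 then \<phi> \<bar>y j\<bar> else 1) * ennreal (std_normal_density (y j))) \<partial>leb {..<d})"
    using d by (simp add: prod.distrib prod.delta)
  also have "\<dots> = (\<Prod>j<d. \<integral>\<^sup>+z. (if j = 0 then \<phi> \<bar>z\<bar> else 1) * ennreal (std_normal_density z) \<partial>lborel)"
    by (intro leb.product_nn_integral_prod) auto
  also have "\<dots> = (\<Prod>j<d. if j = 0 then \<integral>\<^sup>+z. \<phi> \<bar>z\<bar> * ennreal (std_normal_density z) \<partial>lborel else 1)"
  proof (intro prod.cong refl)
    have "(\<integral>\<^sup>+z. ennreal (std_normal_density z) \<partial>lborel) = 1"
      using prob_space.emeasure_space_1[OF prob_space_normal_density[of 1 0]] by (simp add: emeasure_density)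
    then show "(\<integral>\<^sup>+z. (if j = 0 then \<phi> \<bar>z\<bar> else 1) * ennreal (std_normal_density z) \<partial>lborel)
      = (if j = 0 then \<integral>\<^sup>+z. \<phi> \<bar>z\<bar> * ennreal (std_normal_density z) \<partial>lborel else 1)" for j :: nat
      by simp
  qed
  also have "\<dots> = (\<integral>\<^sup>+z. \<phi> \<bar>z\<bar> * ennreal (std_normal_density z) \<partial>lborel)"
    using d by (simp add: prod.delta)
  finally show ?thesis .
qed

lemma nn_integral_gauss_mass:
  fixes d :: nat
  shows "(\<integral>\<^sup>+y. (\<Prod>j<d. ennreal (std_normal_density (y j))) \<partial>leb {..<d}) = 1"
proof -
  have "(\<integral>\<^sup>+z. ennreal (std_normal_density z) \<partial>lborel) = 1"
    using prob_space.emeasure_space_1[OF prob_space_normal_density[of 1 0]] by (simp add: emeasure_density)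
  then show ?thesis by (subst leb.product_nn_integral_prod) auto
qed

lemma sigma_finite_leb_nat: "sigma_finite_measure (leb {..<d::nat})"
  by (rule leb.sigma_finite) simp

interpretation lebn: product_sigma_finite "\<lambda>_::nat. leb {..<d::nat}" for d
  by (simp add: product_sigma_finite_def sigma_finite_leb_nat)

lemma measurable_nested:
  assumes "i \<in> I" "j \<in> J"
  shows "(\<lambda>x. x i j) \<in> borel_measurable (\<Pi>\<^sub>M i\<in>I. leb J)"
proof -
  have "(\<lambda>y. y j) \<in> borel_measurable (leb J)"
    using measurable_component_singleton[OF assms(2), of "\<lambda>_. lborel :: real measure"] by simp
  from measurable_compose[OF measurable_component_singleton[OF assms(1)] this] show ?thesis .
qed

lemma row_det_measurable_nested[measurable]: "row_det d \<in> borel_measurable (\<Pi>\<^sub>M i\<in>{..<d}. leb {..<d})"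
  by (rule row_det_measurable, rule measurable_nested) auto

lemma plane_dist_measurable_nested[measurable]: "(\<lambda>x. plane_dist d x a) \<in> borel_measurable (\<Pi>\<^sub>M i\<in>{..<d}. leb {..<d})"
  by (rule plane_dist_measurable, rule measurable_nested) auto

lemma lessThan_insert_0: "0 < d \<Longrightarrow> {..<d} = insert 0 {1..<d::nat}"
  by auto

lemma measurable_rows_update:
  fixes d :: nat
  assumes d: "0 < d"
  shows "(\<lambda>p. (fst p)(0 := snd p)) \<in> measurable ((\<Pi>\<^sub>M i\<in>{1..<d}. leb {..<d}) \<Otimes>\<^sub>M leb {..<d}) (\<Pi>\<^sub>M i\<in>{..<d}. leb {..<d})"
proof -
  have "(\<lambda>p. (fst p)(0 := snd p)) \<in> measurable ((\<Pi>\<^sub>M i\<in>{1..<d}. leb {..<d}) \<Otimes>\<^sub>M leb {..<d}) (\<Pi>\<^sub>M i\<in>insert 0 {1..<d}. leb {..<d})"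
    by measurable
  also have "(\<Pi>\<^sub>M i\<in>insert 0 {1..<d}. leb {..<d}) = (\<Pi>\<^sub>M i\<in>{..<d}. leb {..<d})"
    by (rule arg_cong[where f="\<lambda>I. Pi\<^sub>M I (\<lambda>_. leb {..<d})", OF lessThan_insert_0[OF d, symmetric]])
  finally show ?thesis .
qed

lemma nn_integral_rows_split:
  fixes d :: nat
  assumes d: "0 < d" and f: "f \<in> borel_measurable (\<Pi>\<^sub>M i\<in>{..<d}. leb {..<d})"
  shows "(\<integral>\<^sup>+x. f x \<partial>(\<Pi>\<^sub>M i\<in>{..<d}. leb {..<d}))
    = (\<integral>\<^sup>+x. \<integral>\<^sup>+y. f (x(0 := y)) \<partial>leb {..<d} \<partial>(\<Pi>\<^sub>M i\<in>{1..<d}. leb {..<d}))"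
proof -
  have *: "(\<Pi>\<^sub>M i\<in>{..<d}. leb {..<d}) = (\<Pi>\<^sub>M i\<in>insert 0 {1..<d}. leb {..<d})"
    by (rule arg_cong[where f="\<lambda>I. Pi\<^sub>M I (\<lambda>_. leb {..<d})", OF lessThan_insert_0[OF d]])
  show ?thesis using f unfolding * by (intro lebn.product_nn_integral_insert) auto
qed

lemma AE_nested_row_det: "AE x in \<Pi>\<^sub>M i\<in>{..<d}. leb {..<d}. row_det d x \<noteq> 0"
proof -
  have dtm[measurable]: "(\<lambda>z. row_det d (\<lambda>i j. z (i, j))) \<in> borel_measurable (leb ({..<d} \<times> {..<d}))"
    by (rule row_det_measurable) measurable
  have "(\<integral>\<^sup>+z. indicator {0} (row_det d (\<lambda>i j. z (i, j))) \<partial>leb ({..<d} \<times> {..<d})) = (0::ennreal)"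
    using AE_leb_row_det[of d] by (subst nn_integral_0_iff_AE) (auto elim: eventually_mono)
  then have "(\<integral>\<^sup>+x. indicator {0} (row_det d (\<lambda>i j. (\<lambda>p\<in>{..<d} \<times> {..<d}. x (fst p) (snd p)) (i, j))) \<partial>(\<Pi>\<^sub>M i\<in>{..<d}. leb {..<d})) = (0::ennreal)"
    by (subst (asm) nn_integral_leb_nested) auto
  also have "(\<lambda>x. row_det d (\<lambda>i j. (\<lambda>p\<in>{..<d} \<times> {..<d}. x (fst p) (snd p)) (i, j))) = row_det d"
    by (intro ext row_det_cong) auto
  finally have "AE x in \<Pi>\<^sub>M i\<in>{..<d}. leb {..<d}. indicator {0} (row_det d x) = (0::ennreal)"
    by (subst (asm) nn_integral_0_iff_AE) auto
  then show ?thesis by eventually_elim (auto simp: indicator_def split: if_splits)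
qed

text \<open>If the cofactors of row 0 all vanish, the determinant is 0 for every choice of row 0,
  which by Fubini happens only for a null set of the other rows.\<close>

lemma AE_rows_row_cof:
  assumes d: "0 < d"
  shows "AE x in \<Pi>\<^sub>M i\<in>{1..<d}. leb {..<d}. nsq d (row_cof d x 0) \<noteq> 0"
proof -
  have [measurable]: "(\<lambda>p. row_det d ((fst p)(0 := snd p))) \<in> borel_measurable ((\<Pi>\<^sub>M i\<in>{1..<d}. leb {..<d}) \<Otimes>\<^sub>M leb {..<d})"
    by (rule measurable_compose[OF measurable_rows_update[OF d] row_det_measurable_nested])
  interpret L: sigma_finite_measure "leb {..<d}" by (rule sigma_finite_leb_nat)
  have "(\<integral>\<^sup>+x. indicator {0} (row_det d x) \<partial>(\<Pi>\<^sub>M i\<in>{..<d}. leb {..<d})) = (0::ennreal)"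
    using AE_nested_row_det[of d]
    by (subst nn_integral_0_iff_AE) (auto elim: eventually_mono)
  then have "(\<integral>\<^sup>+x. \<integral>\<^sup>+y. indicator {0} (row_det d (x(0 := y))) \<partial>leb {..<d} \<partial>(\<Pi>\<^sub>M i\<in>{1..<d}. leb {..<d})) = (0::ennreal)"
    by (subst (asm) nn_integral_rows_split[OF d]) auto
  then have "AE x in \<Pi>\<^sub>M i\<in>{1..<d}. leb {..<d}. (\<integral>\<^sup>+y. indicator {0} (row_det d (x(0 := y))) \<partial>leb {..<d}) = (0::ennreal)"
    by (subst (asm) nn_integral_0_iff_AE) measurable
  then show ?thesis
  proof eventually_elim
    case (elim x)
    show ?case
    proof
      assume "nsq d (row_cof d x 0) = 0"
      then have "row_cof d x 0 j = 0" if "j < d" for j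
        using that by (simp add: nsq_def sum_nonneg_eq_0_iff)
      then have "row_det d (x(0 := y)) = 0" for y
        by (subst row_det_row_0[OF d]) (simp add: row_cof_update_row[OF _ d])
      with elim have "emeasure (leb {..<d}) (space (leb {..<d})) = 0" by simp
      moreover have "emeasure (leb {..<d}) {x \<in> space (leb {..<d}). (\<Sum>i<d. (x i)\<^sup>2) \<le> 1} \<le> emeasure (leb {..<d}) (space (leb {..<d}))"
        by (rule emeasure_mono) auto
      ultimately show False using emeasure_leb_ball(2)[of "{..<d}"] by simp
    qed
  qed
qed

text \<open>Given the other rows, the projection of row 0 on their unit normal is standard normal,
  whatever the normal is. The integral over row 0 is therefore constant, and the other rows
  integrate to 1.\<close>

lemma nn_integral_plane_dist_axis:
  fixes \<phi> :: "real \<Rightarrow> ennreal"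
  assumes \<phi>[measurable]: "\<phi> \<in> borel_measurable borel" and d: "0 < d" and \<alpha>: "0 < \<alpha>"
  shows "(\<integral>\<^sup>+x. \<phi> (plane_dist d x (\<lambda>i. if i = 0 then \<alpha> else 0)) *
      (\<Prod>i<d. \<Prod>j<d. ennreal (std_normal_density (x i j))) \<partial>(\<Pi>\<^sub>M i\<in>{..<d}. leb {..<d}))
    = (\<integral>\<^sup>+z. \<phi> (\<bar>z\<bar> / \<alpha>) * ennreal (std_normal_density z) \<partial>lborel)"
proof -
  let ?g = "\<lambda>y. \<Prod>j<d. ennreal (std_normal_density (y j))"
  let ?K = "\<integral>\<^sup>+z. \<phi> (\<bar>z\<bar> / \<alpha>) * ennreal (std_normal_density z) \<partial>lborel"
  have [measurable]: "?g \<in> borel_measurable (leb {..<d})" by measurable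
  have "(\<integral>\<^sup>+x. \<phi> (plane_dist d x (\<lambda>i. if i = 0 then \<alpha> else 0)) * (\<Prod>i<d. ?g (x i)) \<partial>(\<Pi>\<^sub>M i\<in>{..<d}. leb {..<d}))
    = (\<integral>\<^sup>+x. \<integral>\<^sup>+y. \<phi> (plane_dist d (x(0 := y)) (\<lambda>i. if i = 0 then \<alpha> else 0)) * (\<Prod>i<d. ?g ((x(0 := y)) i))
        \<partial>leb {..<d} \<partial>(\<Pi>\<^sub>M i\<in>{1..<d}. leb {..<d}))"
    by (rule nn_integral_rows_split[OF d]) measurable
  also have "\<dots> = (\<integral>\<^sup>+x. \<integral>\<^sup>+y. \<phi> (plane_dist d (x(0 := y)) (\<lambda>i. if i = 0 then \<alpha> else 0)) * (?g y * (\<Prod>i\<in>{1..<d}. ?g (x i)))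
        \<partial>leb {..<d} \<partial>(\<Pi>\<^sub>M i\<in>{1..<d}. leb {..<d}))"
  proof (intro nn_integral_cong arg_cong2[where f="(*)"] refl)
    show "(\<Prod>i<d. ?g ((x(0 := y)) i)) = ?g y * (\<Prod>i\<in>{1..<d}. ?g (x i))" for x y
      by (subst prod.cong[OF lessThan_insert_0[OF d] refl]) (simp add: prod.insert)
  qed
  also have "\<dots> = (\<integral>\<^sup>+x. \<integral>\<^sup>+y. (\<phi> (\<bar>(\<Sum>j<d. y j * row_cof d x 0 j) / sqrt (nsq d (row_cof d x 0))\<bar> / \<alpha>) * ?g y) * (\<Prod>i\<in>{1..<d}. ?g (x i))
        \<partial>leb {..<d} \<partial>(\<Pi>\<^sub>M i\<in>{1..<d}. leb {..<d}))"
    unfolding plane_dist_axis[OF d \<alpha>] by (intro nn_integral_cong) (simp add: mult.assoc nsq_nonneg)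
  also have "\<dots> = (\<integral>\<^sup>+x. ?K * (\<Prod>i\<in>{1..<d}. ?g (x i)) \<partial>(\<Pi>\<^sub>M i\<in>{1..<d}. leb {..<d}))"
  proof (rule nn_integral_cong_AE)
    show "AE x in \<Pi>\<^sub>M i\<in>{1..<d}. leb {..<d}.
      (\<integral>\<^sup>+y. (\<phi> (\<bar>(\<Sum>j<d. y j * row_cof d x 0 j) / sqrt (nsq d (row_cof d x 0))\<bar> / \<alpha>) * ?g y) * (\<Prod>i\<in>{1..<d}. ?g (x i)) \<partial>leb {..<d})
      = ?K * (\<Prod>i\<in>{1..<d}. ?g (x i))"
      using AE_rows_row_cof[OF d]
    proof eventually_elim
      case (elim x)
      have "(\<integral>\<^sup>+y. \<phi> (\<bar>(\<Sum>j<d. y j * row_cof d x 0 j) / sqrt (nsq d (row_cof d x 0))\<bar> / \<alpha>) * ?g y \<partial>leb {..<d}) = ?K"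
        by (rule nn_integral_gauss_linear[OF _ d elim, of "\<lambda>t. \<phi> (t / \<alpha>)"]) measurable
      then show ?case by (subst nn_integral_multc) auto
    qed
  qed
  also have "\<dots> = ?K * (\<integral>\<^sup>+x. (\<Prod>i\<in>{1..<d}. ?g (x i)) \<partial>(\<Pi>\<^sub>M i\<in>{1..<d}. leb {..<d}))"
    by (rule nn_integral_cmult) measurable
  also have "(\<integral>\<^sup>+x. (\<Prod>i\<in>{1..<d}. ?g (x i)) \<partial>(\<Pi>\<^sub>M i\<in>{1..<d}. leb {..<d})) = (\<Prod>i\<in>{1..<d}. 1)"
    by (subst lebn.product_nn_integral_prod) (auto simp: nn_integral_gauss_mass)
  finally show ?thesis by simp
qed

text \<open>The sum of the \<open>s i\<close> is the squared length of the right side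
  \<open>sqrt (s i)\<close> that standardising the rows produces.\<close>

lemma nn_integral_gauss_height:
  fixes \<phi> :: "real \<Rightarrow> ennreal"
  assumes \<phi>[measurable]: "\<phi> \<in> borel_measurable borel" and d: "0 < d" and s: "\<And>i. i < d \<Longrightarrow> 0 < s i"
  shows "(\<integral>\<^sup>+x. \<phi> (plane_dist d x (\<lambda>_. 1)) * (\<Prod>i<d. \<Prod>j<d. ennreal (sqrt (s i) * std_normal_density (sqrt (s i) * x i j)))
      \<partial>(\<Pi>\<^sub>M i\<in>{..<d}. leb {..<d}))
    = (\<integral>\<^sup>+z. \<phi> (\<bar>z\<bar> / sqrt (\<Sum>i<d. s i)) * ennreal (std_normal_density z) \<partial>lborel)"
proof -
  let ?Q = "{..<d} \<times> {..<d}"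
  let ?M = "\<Pi>\<^sub>M i\<in>{..<d}. leb {..<d}"
  define \<alpha> where "\<alpha> = sqrt (\<Sum>i<d. s i)"
  have \<alpha>: "0 < \<alpha>" unfolding \<alpha>_def using d s by (auto intro!: sum_pos)
  have \<alpha>': "sqrt (nsq d (\<lambda>i. sqrt (s i))) = \<alpha>"
    unfolding \<alpha>_def nsq_def using s by (intro arg_cong[where f=sqrt] sum.cong) (auto simp: less_imp_le)
  have flat: "(\<integral>\<^sup>+x. \<phi> (plane_dist d x a) * (\<Prod>i<d. \<Prod>j<d. w i (x i j)) \<partial>?M)
    = (\<integral>\<^sup>+z. \<phi> (plane_dist d (\<lambda>i j. z (i, j)) a) * (\<Prod>p\<in>?Q. w (fst p) (z p)) \<partial>leb ?Q)"
    if [measurable]: "\<And>i. w i \<in> borel_measurable borel" for a and w :: "nat \<Rightarrow> real \<Rightarrow> ennreal"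
  proof -
    have "(\<integral>\<^sup>+z. \<phi> (plane_dist d (\<lambda>i j. z (i, j)) a) * (\<Prod>p\<in>?Q. w (fst p) (z p)) \<partial>leb ?Q)
      = (\<integral>\<^sup>+x. \<phi> (plane_dist d (\<lambda>i j. (\<lambda>p\<in>?Q. x (fst p) (snd p)) (i, j)) a) * (\<Prod>p\<in>?Q. w (fst p) ((\<lambda>p\<in>?Q. x (fst p) (snd p)) p)) \<partial>?M)"
      by (rule nn_integral_leb_nested) auto
    also have "\<dots> = (\<integral>\<^sup>+x. \<phi> (plane_dist d x a) * (\<Prod>i<d. \<Prod>j<d. w i (x i j)) \<partial>?M)"
    proof (intro nn_integral_cong arg_cong2[where f="(*)"] arg_cong[where f=\<phi>] plane_dist_cong)
      show "(\<Prod>p\<in>?Q. w (fst p) ((\<lambda>p\<in>?Q. x (fst p) (snd p)) p)) = (\<Prod>i<d. \<Prod>j<d. w i (x i j))" for x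
        unfolding prod.cartesian_product by (intro prod.cong) auto
    qed auto
    finally show ?thesis by simp
  qed
  have "(\<integral>\<^sup>+x. \<phi> (plane_dist d x (\<lambda>_. 1)) * (\<Prod>i<d. \<Prod>j<d. ennreal (sqrt (s i) * std_normal_density (sqrt (s i) * x i j))) \<partial>?M)
    = (\<integral>\<^sup>+z. \<phi> (plane_dist d (\<lambda>i j. z (i, j)) (\<lambda>_. 1)) *
      (\<Prod>p\<in>?Q. ennreal (sqrt (s (fst p)) * std_normal_density (sqrt (s (fst p)) * z p))) \<partial>leb ?Q)"
    by (rule flat) measurable
  also have "\<dots> = (\<integral>\<^sup>+z. \<phi> (plane_dist d (\<lambda>i j. z (i, j)) (\<lambda>i. sqrt (s i))) * (\<Prod>p\<in>?Q. ennreal (std_normal_density (z p))) \<partial>leb ?Q)"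
    by (rule nn_integral_plane_dist_scale[OF \<phi> s])
  also have "\<dots> = (\<integral>\<^sup>+z. \<phi> (plane_dist d (\<lambda>i j. z (i, j)) (\<lambda>i. if i = 0 then \<alpha> else 0)) * (\<Prod>p\<in>?Q. ennreal (std_normal_density (z p))) \<partial>leb ?Q)"
    unfolding \<alpha>'[symmetric] by (rule nn_integral_plane_dist_rotate[OF \<phi> d])
  also have "\<dots> = (\<integral>\<^sup>+x. \<phi> (plane_dist d x (\<lambda>i. if i = 0 then \<alpha> else 0)) * (\<Prod>i<d. \<Prod>j<d. ennreal (std_normal_density (x i j))) \<partial>?M)"
    by (rule flat[symmetric]) measurable
  also have "\<dots> = (\<integral>\<^sup>+z. \<phi> (\<bar>z\<bar> / \<alpha>) * ennreal (std_normal_density z) \<partial>lborel)"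
    by (rule nn_integral_plane_dist_axis[OF \<phi> d \<alpha>])
  finally show ?thesis by (simp add: \<alpha>_def)
qed

lemma prod_row_density:
  assumes s: "0 < s"
  shows "(\<Prod>j<d. ennreal (sqrt s * std_normal_density (sqrt s * y j)))
    = ennreal ((sqrt s / sqrt (2 * pi)) ^ d) * ennreal (exp (- (s * nsq d y / 2)))"
proof -
  have "(\<Prod>j<d. ennreal (sqrt s * std_normal_density (sqrt s * y j)))
    = (\<Prod>j<d. ennreal (sqrt s) * ennreal (std_normal_density (sqrt s * y j)))"
    using s by (intro prod.cong refl) (simp add: ennreal_mult')
  also have "\<dots> = ennreal (sqrt s ^ d) * ennreal ((1 / sqrt (2 * pi)) ^ d * exp (- (\<Sum>j<d. (sqrt s * y j)\<^sup>2) / 2))"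
    using s by (simp add: prod.distrib prod_std_normal_density ennreal_power)
  also have "(\<Sum>j<d. (sqrt s * y j)\<^sup>2) = s * nsq d y"
    using s by (simp add: nsq_def power_mult_distrib sum_distrib_left)
  finally show ?thesis
    using s by (simp add: ennreal_mult'[symmetric] power_divide)
qed

section \<open>Even moments of the distance as Laplace transforms\<close>

lemma nn_integral_erlang:
  assumes l: "0 < l"
  shows "(\<integral>\<^sup>+\<tau>. indicator {0<..} \<tau> * ennreal (\<tau> ^ k * exp (- (l * \<tau>))) \<partial>lborel) = ennreal (fact k / l ^ Suc k)"
proof -
  have "1 = (\<integral>\<^sup>+\<tau>. ennreal (erlang_density k l \<tau>) \<partial>lborel)"
    using prob_space.emeasure_space_1[OF prob_space_erlang_density[OF l, of k]] by (simp add: emeasure_density)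
  also have "\<dots> = (\<integral>\<^sup>+\<tau>. ennreal (l ^ Suc k / fact k) * (indicator {0<..} \<tau> * ennreal (\<tau> ^ k * exp (- (l * \<tau>)))) \<partial>lborel)"
  proof (rule nn_integral_cong_AE)
    have "AE \<tau> in lborel. \<tau> \<noteq> (0::real)" by (rule AE_lborel_singleton)
    then show "AE \<tau> in lborel. ennreal (erlang_density k l \<tau>) = ennreal (l ^ Suc k / fact k) * (indicator {0<..} \<tau> * ennreal (\<tau> ^ k * exp (- (l * \<tau>))))"
      by eventually_elim (use l in \<open>auto simp: erlang_density_def indicator_def ennreal_mult'[symmetric] mult_ac\<close>)
  qed
  also have "\<dots> = ennreal (l ^ Suc k / fact k) * (\<integral>\<^sup>+\<tau>. indicator {0<..} \<tau> * ennreal (\<tau> ^ k * exp (- (l * \<tau>))) \<partial>lborel)"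
    by (rule nn_integral_cmult) measurable
  finally have "ennreal (fact k / l ^ Suc k) * 1 = ennreal (fact k / l ^ Suc k) * ennreal (l ^ Suc k / fact k) *
    (\<integral>\<^sup>+\<tau>. indicator {0<..} \<tau> * ennreal (\<tau> ^ k * exp (- (l * \<tau>))) \<partial>lborel)" by (simp add: mult.assoc)
  moreover have "ennreal (fact k / l ^ Suc k) * ennreal (l ^ Suc k / fact k) = 1"
    using l by (simp add: ennreal_mult'[symmetric])
  ultimately show ?thesis by simp
qed

text \<open>The double factorial \<open>(2 q - 1)!!\<close>, which is the moment of order
  \<open>2 q\<close> of the standard normal law.\<close>

definition normal_moment :: "nat \<Rightarrow> real"
  where "normal_moment q = fact (2 * q) / (2 ^ q * fact q)"

lemma nn_integral_normal_even_moment: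
  "(\<integral>\<^sup>+z. ennreal (\<bar>z\<bar> ^ (2 * q)) * ennreal (std_normal_density z) \<partial>lborel) = ennreal (normal_moment q)"
proof -
  have "has_bochner_integral lborel (\<lambda>x. std_normal_density x * x ^ (2 * q)) (normal_moment q)"
    using std_normal_moment_even[of q] by (simp add: normal_moment_def)
  then have "(\<integral>\<^sup>+z. ennreal (std_normal_density z * z ^ (2 * q)) \<partial>lborel) = ennreal (normal_moment q)"
    by (subst nn_integral_eq_integral) (auto simp: has_bochner_integral_iff)
  then show ?thesis
    by (simp add: ennreal_mult'[symmetric] mult.commute power_even_abs)
qed

text \<open>For \<open>q > 0\<close> the integral of
  \<open>\<tau> ^ (q - 1) * exp (- (S / 2 * \<tau>))\<close> over the positive axis is
  \<open>fact (q - 1) * (2 / S) ^ q\<close>; this constant makes it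
  \<open>normal_moment q / S ^ q\<close>.\<close>

definition height_const :: "nat \<Rightarrow> real"
  where "height_const q = normal_moment q / (2 ^ q * fact (q - 1))"

lemma height_const_pos: "0 < height_const q"
  by (simp add: normal_moment_def height_const_def)

lemma ennreal_cancel:
  fixes K :: ennreal
  shows "K \<noteq> 0 \<Longrightarrow> K \<noteq> \<infinity> \<Longrightarrow> K * a = K * b \<Longrightarrow> a = b"
  by (simp add: ennreal_mult_cancel_left)

lemma ennreal_factor_finite:
  fixes K :: ennreal
  shows "K \<noteq> 0 \<Longrightarrow> K * a = ennreal r \<Longrightarrow> a < \<infinity>"
  by (cases "a = \<infinity>") (auto simp: ennreal_mult_top less_top)

text \<open>
  The factor \<open>(\<Sum>i<d. s i) powr (-q)\<close> is the Laplace transform of a power of \<open>\<tau>\<close>, and multiplying by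
  \<open>exp (- \<tau> (\<Sum>i<d. s i) / 2)\<close> shifts every squared radius by \<open>\<tau>\<close>.
\<close>

lemma nn_integral_height_moment_gauss:
  assumes d: "0 < d" and q: "0 < q" and s: "\<And>i. i < d \<Longrightarrow> 0 < s i"
  defines "M \<equiv> \<Pi>\<^sub>M i\<in>{..<d}. leb {..<d}"
  shows "(\<integral>\<^sup>+x. ennreal (plane_dist d x (\<lambda>_. 1) ^ (2 * q)) * (\<Prod>i<d. ennreal (exp (- (s i * nsq d (x i) / 2)))) \<partial>M)
    = (\<integral>\<^sup>+\<tau>. \<integral>\<^sup>+x. indicator {0<..} \<tau> * ennreal (height_const q * \<tau> ^ (q - 1)) *
        (\<Prod>i<d. ennreal (exp (- (s i * (nsq d (x i) + \<tau>) / 2)))) \<partial>M \<partial>lborel)" (is "?L = ?R")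
    and "(\<integral>\<^sup>+x. ennreal (plane_dist d x (\<lambda>_. 1) ^ (2 * q)) * (\<Prod>i<d. ennreal (exp (- (s i * nsq d (x i) / 2)))) \<partial>M) < \<infinity>"
proof -
  define S where "S = (\<Sum>i<d. s i)"
  have S: "0 < S" unfolding S_def using d s by (intro sum_pos) auto
  \<comment> \<open>\<open>K\<close> turns the exponential weights \<open>W\<close> into Gaussian
    densities. As these have total mass 1, \<open>K\<close> appears alike on both sides and can be
    cancelled.\<close>
  define K where "K = (\<Prod>i<d. ennreal ((sqrt (s i) / sqrt (2 * pi)) ^ d))"
  have Kr: "K = ennreal (\<Prod>i<d. (sqrt (s i) / sqrt (2 * pi)) ^ d)"
    unfolding K_def using s by (intro prod_ennreal) (auto intro!: zero_le_power divide_nonneg_nonneg less_imp_le)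
  have "0 < (\<Prod>i<d. (sqrt (s i) / sqrt (2 * pi)) ^ d)"
    using s by (intro prod_pos) auto
  then have K0: "K \<noteq> 0" unfolding Kr by (simp only: ennreal_eq_0_iff not_le)
  have Kt: "K \<noteq> \<infinity>" unfolding Kr by simp
  have [measurable]: "(\<lambda>x. plane_dist d x (\<lambda>_. 1)) \<in> borel_measurable M" unfolding M_def by measurable
  have nm[measurable]: "(\<lambda>x. nsq d (x i)) \<in> borel_measurable M" if "i \<in> {..<d}" for i
    unfolding M_def using that by measurable
  define W where "W x = (\<Prod>i<d. ennreal (exp (- (s i * nsq d (x i) / 2))))" for x
  have [measurable]: "W \<in> borel_measurable M" unfolding W_def by measurable
  define h where "h x = ennreal (plane_dist d x (\<lambda>_. 1) ^ (2 * q))" for x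
  have [measurable]: "h \<in> borel_measurable M" unfolding h_def by measurable
  have dens: "(\<Prod>i<d. \<Prod>j<d. ennreal (sqrt (s i) * std_normal_density (sqrt (s i) * x i j))) = K * W x" for x
    unfolding K_def W_def prod.distrib[symmetric] using s by (intro prod.cong refl prod_row_density) auto
  have Lh: "?L = (\<integral>\<^sup>+x. h x * W x \<partial>M)" by (simp only: h_def W_def)
  have "K * (\<integral>\<^sup>+x. h x * W x \<partial>M) = (\<integral>\<^sup>+x. K * (h x * W x) \<partial>M)"
    by (rule nn_integral_cmult[symmetric]) measurable
  also have "\<dots> = (\<integral>\<^sup>+x. ennreal (plane_dist d x (\<lambda>_. 1) ^ (2 * q)) * (\<Prod>i<d. \<Prod>j<d. ennreal (sqrt (s i) * std_normal_density (sqrt (s i) * x i j))) \<partial>M)"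
    unfolding dens h_def[symmetric] by (simp only: mult.left_commute)
  also have "\<dots> = (\<integral>\<^sup>+z. ennreal ((\<bar>z\<bar> / sqrt S) ^ (2 * q)) * ennreal (std_normal_density z) \<partial>lborel)"
    unfolding M_def S_def by (rule nn_integral_gauss_height[OF _ d s]) measurable
  also have "\<dots> = (\<integral>\<^sup>+z. ennreal (1 / S ^ q) * (ennreal (\<bar>z\<bar> ^ (2 * q)) * ennreal (std_normal_density z)) \<partial>lborel)"
  proof (rule nn_integral_cong)
    fix z :: real
    have "(\<bar>z\<bar> / sqrt S) ^ (2 * q) = 1 / S ^ q * \<bar>z\<bar> ^ (2 * q)"
      using S by (simp add: power_divide power_mult)
    then show "ennreal ((\<bar>z\<bar> / sqrt S) ^ (2 * q)) * ennreal (std_normal_density z)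
      = ennreal (1 / S ^ q) * (ennreal (\<bar>z\<bar> ^ (2 * q)) * ennreal (std_normal_density z))"
      using S by (simp only: ennreal_mult' mult.assoc zero_le_divide_1_iff zero_le_power less_imp_le)
  qed
  also have "\<dots> = ennreal (1 / S ^ q) * ennreal (normal_moment q)"
    by (subst nn_integral_cmult) (auto simp: nn_integral_normal_even_moment)
  finally have L: "K * ?L = ennreal (normal_moment q / S ^ q)"
    unfolding Lh using S by (simp add: ennreal_mult'[symmetric])
  have mass: "K * (\<integral>\<^sup>+x. W x \<partial>M) = 1"
  proof -
    have "K * (\<integral>\<^sup>+x. W x \<partial>M) = (\<integral>\<^sup>+x. K * W x \<partial>M)"
      by (rule nn_integral_cmult[symmetric]) measurable
    also have "\<dots> = (\<integral>\<^sup>+x. (\<lambda>_. 1) (plane_dist d x (\<lambda>_. 1)) * (\<Prod>i<d. \<Prod>j<d. ennreal (sqrt (s i) * std_normal_density (sqrt (s i) * x i j))) \<partial>M)"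
      unfolding dens by simp
    also have "\<dots> = (\<integral>\<^sup>+z. (\<lambda>_. 1) (\<bar>z\<bar> / sqrt (\<Sum>i<d. s i)) * ennreal (std_normal_density z) \<partial>lborel)"
      unfolding M_def by (rule nn_integral_gauss_height[OF _ d s]) measurable
    also have "\<dots> = 1"
      using prob_space.emeasure_space_1[OF prob_space_normal_density[of 1 0]] by (simp add: emeasure_density)
    finally show ?thesis .
  qed
  have shift: "(\<Prod>i<d. ennreal (exp (- (s i * (nsq d (x i) + \<tau>) / 2)))) = ennreal (exp (- (S / 2 * \<tau>))) * W x" for x \<tau>
  proof -
    have "- (S / 2 * \<tau>) = (\<Sum>i<d. - (s i * \<tau> / 2))"
      by (simp add: S_def sum_negf sum_distrib_right sum_divide_distrib)
    then have "ennreal (exp (- (S / 2 * \<tau>))) = (\<Prod>i<d. ennreal (exp (- (s i * \<tau> / 2))))"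
      by (simp add: exp_sum prod_ennreal)
    moreover have "ennreal (exp (- (s i * (nsq d (x i) + \<tau>) / 2)))
      = ennreal (exp (- (s i * \<tau> / 2))) * ennreal (exp (- (s i * nsq d (x i) / 2)))" for i
    proof -
      have "- (s i * (nsq d (x i) + \<tau>) / 2) = - (s i * \<tau> / 2) + - (s i * nsq d (x i) / 2)"
        by (simp add: field_simps)
      then show ?thesis by (simp only: exp_add ennreal_mult' exp_ge_zero)
    qed
    ultimately show ?thesis by (simp only: W_def prod.distrib)
  qed
  let ?c = "\<lambda>\<tau>. indicator {0<..} \<tau> * ennreal (height_const q * \<tau> ^ (q - 1))"
  have "K * ?R = K * (\<integral>\<^sup>+\<tau>. ?c \<tau> * ennreal (exp (- (S / 2 * \<tau>))) * (\<integral>\<^sup>+x. W x \<partial>M) \<partial>lborel)"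
    unfolding shift mult.assoc[symmetric] by (subst nn_integral_cmult) auto
  also have "\<dots> = (\<integral>\<^sup>+\<tau>. K * (?c \<tau> * ennreal (exp (- (S / 2 * \<tau>))) * (\<integral>\<^sup>+x. W x \<partial>M)) \<partial>lborel)"
    by (rule nn_integral_cmult[symmetric]) measurable
  also have "\<dots> = (\<integral>\<^sup>+\<tau>. ?c \<tau> * ennreal (exp (- (S / 2 * \<tau>))) * (K * (\<integral>\<^sup>+x. W x \<partial>M)) \<partial>lborel)"
    by (simp only: mult.left_commute)
  also have "\<dots> = (\<integral>\<^sup>+\<tau>. ennreal (height_const q) * (indicator {0<..} \<tau> * ennreal (\<tau> ^ (q - 1) * exp (- (S / 2 * \<tau>)))) \<partial>lborel)"
    unfolding mass
  proof (rule nn_integral_cong)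
    fix \<tau> :: real
    show "?c \<tau> * ennreal (exp (- (S / 2 * \<tau>))) * 1 = ennreal (height_const q) * (indicator {0<..} \<tau> * ennreal (\<tau> ^ (q - 1) * exp (- (S / 2 * \<tau>))))"
      using height_const_pos[of q] by (cases "\<tau> > 0") (simp_all add: ennreal_mult' mult.assoc)
  qed
  also have "\<dots> = ennreal (height_const q) * ennreal (fact (q - 1) / (S / 2) ^ Suc (q - 1))"
    using S by (subst nn_integral_cmult, measurable) (simp only: nn_integral_erlang half_gt_zero)
  also have "\<dots> = ennreal (height_const q * (fact (q - 1) / (S / 2) ^ Suc (q - 1)))"
    using height_const_pos[of q] by (simp only: ennreal_mult' less_imp_le)
  also have "height_const q * (fact (q - 1) / (S / 2) ^ Suc (q - 1)) = normal_moment q / S ^ q"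
    using S q by (simp add: height_const_def power_divide)
  finally have R: "K * ?R = ennreal (normal_moment q / S ^ q)" .
  show "?L = ?R"
    by (rule ennreal_cancel[OF K0 Kt]) (simp only: L R)
  show "?L < \<infinity>"
    by (rule ennreal_factor_finite[OF K0 L])
qed

text \<open>The product of \<open>d\<close> sums expands into terms indexed by maps \<kappa>, to
  each of which the Gaussian identity applies. The coefficients \<open>b k\<close> may have either
  sign, so the terms are added as real integrals; this is why finiteness is required for every
  \<kappa>.\<close>

lemma nn_integral_exp_combination:
  fixes tA :: "nat \<Rightarrow> 'a \<Rightarrow> real" and tB :: "nat \<Rightarrow> 'b \<Rightarrow> real" and b lam :: "nat \<Rightarrow> real" and m :: nat
  defines "F \<equiv> \<lambda>t. \<Sum>k\<le>m. b k * exp (- (lam k * t))"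
  assumes A[measurable]: "wA \<in> borel_measurable A" "\<And>i. i \<in> {..<d} \<Longrightarrow> tA i \<in> borel_measurable A"
    and B[measurable]: "wB \<in> borel_measurable B" "\<And>i. i \<in> {..<d} \<Longrightarrow> tB i \<in> borel_measurable B"
    and w0: "\<And>x. x \<in> space A \<Longrightarrow> 0 \<le> wA x" "\<And>x. x \<in> space B \<Longrightarrow> 0 \<le> wB x"
    and F0: "\<And>x i. x \<in> space A \<Longrightarrow> i < d \<Longrightarrow> 0 \<le> F (tA i x)" "\<And>x i. x \<in> space B \<Longrightarrow> i < d \<Longrightarrow> 0 \<le> F (tB i x)"
    and eq: "\<And>\<kappa>::nat \<Rightarrow> nat. (\<integral>\<^sup>+x. ennreal (wA x * (\<Prod>i<d. exp (- (lam (\<kappa> i) * tA i x)))) \<partial>A)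
      = (\<integral>\<^sup>+x. ennreal (wB x * (\<Prod>i<d. exp (- (lam (\<kappa> i) * tB i x)))) \<partial>B)"
    and fin: "\<And>\<kappa>::nat \<Rightarrow> nat. (\<integral>\<^sup>+x. ennreal (wA x * (\<Prod>i<d. exp (- (lam (\<kappa> i) * tA i x)))) \<partial>A) < \<infinity>"
  shows "(\<integral>\<^sup>+x. ennreal (wA x * (\<Prod>i<d. F (tA i x))) \<partial>A) = (\<integral>\<^sup>+x. ennreal (wB x * (\<Prod>i<d. F (tB i x))) \<partial>B)"
proof -
  define gA where "gA \<kappa> x = wA x * (\<Prod>i<d. exp (- (lam (\<kappa> i) * tA i x)))" for \<kappa> :: "nat \<Rightarrow> nat" and x
  define gB where "gB \<kappa> x = wB x * (\<Prod>i<d. exp (- (lam (\<kappa> i) * tB i x)))" for \<kappa> :: "nat \<Rightarrow> nat" and x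
  define c where "c \<kappa> = (\<Prod>i<d. b (\<kappa> i))" for \<kappa> :: "nat \<Rightarrow> nat"
  have [measurable]: "gA \<kappa> \<in> borel_measurable A" "gB \<kappa> \<in> borel_measurable B" for \<kappa>
    unfolding gA_def gB_def by measurable
  have g0: "x \<in> space A \<Longrightarrow> 0 \<le> gA \<kappa> x" "y \<in> space B \<Longrightarrow> 0 \<le> gB \<kappa> y" for x y \<kappa>
    unfolding gA_def gB_def by (auto intro!: mult_nonneg_nonneg w0 prod_nonneg)
  have e: "(\<integral>\<^sup>+x. ennreal (gA \<kappa> x) \<partial>A) = (\<integral>\<^sup>+x. ennreal (gB \<kappa> x) \<partial>B)"
    and f: "(\<integral>\<^sup>+x. ennreal (gA \<kappa> x) \<partial>A) < \<infinity>" for \<kappa>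
    using eq[of \<kappa>] fin[of \<kappa>] by (simp_all add: gA_def gB_def)
  have iA: "integrable A (gA \<kappa>)" and iB: "integrable B (gB \<kappa>)" for \<kappa>
    using e f g0 by (auto intro!: integrableI_nonneg)
  have "ennreal (integral\<^sup>L A (gA \<kappa>)) = ennreal (integral\<^sup>L B (gB \<kappa>))" for \<kappa>
    using e[of \<kappa>] nn_integral_eq_integral[OF iA[of \<kappa>]] nn_integral_eq_integral[OF iB[of \<kappa>]] g0 by simp
  then have ie: "integral\<^sup>L A (gA \<kappa>) = integral\<^sup>L B (gB \<kappa>)" for \<kappa>
    using g0 by (subst (asm) ennreal_inj) (auto intro!: integral_nonneg_AE)
  have expA: "wA x * (\<Prod>i<d. F (tA i x)) = (\<Sum>\<kappa>\<in>PiE {..<d} (\<lambda>_. {..m}). c \<kappa> * gA \<kappa> x)" for x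
    unfolding F_def by (subst prod_sum_PiE) (auto simp: gA_def c_def sum_distrib_left prod.distrib mult_ac)
  have expB: "wB x * (\<Prod>i<d. F (tB i x)) = (\<Sum>\<kappa>\<in>PiE {..<d} (\<lambda>_. {..m}). c \<kappa> * gB \<kappa> x)" for x
    unfolding F_def by (subst prod_sum_PiE) (auto simp: gB_def c_def sum_distrib_left prod.distrib mult_ac)
  have intA: "integrable A (\<lambda>x. wA x * (\<Prod>i<d. F (tA i x)))"
    unfolding expA by (intro Bochner_Integration.integrable_sum integrable_mult_right iA)
  have intB: "integrable B (\<lambda>x. wB x * (\<Prod>i<d. F (tB i x)))"
    unfolding expB by (intro Bochner_Integration.integrable_sum integrable_mult_right iB)
  have "(\<integral>\<^sup>+x. ennreal (wA x * (\<Prod>i<d. F (tA i x))) \<partial>A) = ennreal (integral\<^sup>L A (\<lambda>x. wA x * (\<Prod>i<d. F (tA i x))))"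
    by (rule nn_integral_eq_integral)
      (auto intro!: intA mult_nonneg_nonneg prod_nonneg w0 F0)
  also have "integral\<^sup>L A (\<lambda>x. wA x * (\<Prod>i<d. F (tA i x))) = integral\<^sup>L B (\<lambda>x. wB x * (\<Prod>i<d. F (tB i x)))"
    unfolding expA expB by (simp add: iA iB ie Bochner_Integration.integral_sum)
  also have "ennreal (integral\<^sup>L B (\<lambda>x. wB x * (\<Prod>i<d. F (tB i x)))) = (\<integral>\<^sup>+x. ennreal (wB x * (\<Prod>i<d. F (tB i x))) \<partial>B)"
    by (rule nn_integral_eq_integral[symmetric])
      (auto intro!: intB mult_nonneg_nonneg prod_nonneg w0 F0)
  finally show ?thesis .
qed

section \<open>Concentrating the radii\<close>

text \<open>
  \<open>bump\<close> attains its maximum only at \<open>1\<close>, and its powers are linear combinations of the functions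
  \<open>exp (- s t)\<close>.  An identity known for all Gaussian weights thus carries over to the weights
  \<open>bump t ^ m\<close>, which force all squared radii to \<open>1\<close> as \<open>m\<close> grows.
\<close>

definition bump :: "real \<Rightarrow> real"
  where "bump t = 4 * exp (- (ln 2 * t)) * (1 - exp (- (ln 2 * t)))"

lemma bump_measurable[measurable]: "bump \<in> borel_measurable borel"
  unfolding bump_def by measurable

text \<open>With \<open>u = 2 powr (- t)\<close> the function is \<open>4 * u * (1 - u)\<close>,
  equal to 1 exactly for \<open>u = 1 / 2\<close>, that is \<open>t = 1\<close>. This is the origin
  of \<open>ln 2\<close>.\<close>

lemma bump_square: "bump t = 1 - (1 - 2 * exp (- (ln 2 * t)))\<^sup>2"
  by (simp add: bump_def power2_eq_square algebra_simps)

lemma bump_le_1: "bump t \<le> 1"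
  by (simp add: bump_square)

lemma bump_nonneg: "0 \<le> t \<Longrightarrow> 0 \<le> bump t"
  by (simp add: bump_def)

lemma bump_1: "bump 1 = 1"
  by (simp add: bump_def exp_minus)

lemma bump_le_exp: "0 \<le> t \<Longrightarrow> bump t \<le> 4 * exp (- (ln 2 * t))"
  by (simp add: bump_def mult_left_le)

lemma bump_isCont: "isCont bump t"
  unfolding bump_def by (intro continuous_intros)

lemma bump_away:
  assumes "0 < \<delta>"
  obtains \<eta> where "0 < \<eta>" "\<eta> < 1" "\<And>t. \<delta> \<le> \<bar>t - 1\<bar> \<Longrightarrow> bump t \<le> \<eta>"
proof -
  have half: "2 * exp (- (ln 2 * t)) = exp (- (ln 2 * (t - 1)))" for t :: real
    by (simp add: right_diff_distrib exp_diff exp_minus field_simps)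
  \<comment> \<open>\<open>c\<close> is the least distance of \<open>2 powr (1 - t)\<close> from 1
    when \<open>t\<close> is at least \<delta> away from 1; the two entries belong to the two
    sides.\<close>
  define c where "c = min (1 - exp (- (ln 2 * \<delta>))) (exp (ln 2 * \<delta>) - 1)"
  have "exp (- (ln 2 * \<delta>)) < 1" "1 < exp (ln 2 * \<delta>)" using assms by simp_all
  then have c: "0 < c" unfolding c_def by simp
  have "c \<le> 1 - exp (- (ln 2 * \<delta>))" unfolding c_def by simp
  then have c1: "c \<le> 1" using exp_gt_zero[of "- (ln 2 * \<delta>)"] by linarith
  show thesis
  proof (rule that[of "max (1 / 2) (1 - c\<^sup>2)"])
    show "max (1 / 2) (1 - c\<^sup>2) < 1" using c by simp
    fix t :: real assume t: "\<delta> \<le> \<bar>t - 1\<bar>"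
    have "c \<le> \<bar>1 - 2 * exp (- (ln 2 * t))\<bar>"
    proof (cases "t \<ge> 1")
      case True
      then have "exp (- (ln 2 * (t - 1))) \<le> exp (- (ln 2 * \<delta>))" using t by simp
      then show ?thesis unfolding half c_def by linarith
    next
      case False
      then have "exp (ln 2 * \<delta>) \<le> exp (- (ln 2 * (t - 1)))"
        using t by (simp add: minus_mult_right)
      then show ?thesis unfolding half c_def by linarith
    qed
    then have "c\<^sup>2 \<le> \<bar>1 - 2 * exp (- (ln 2 * t))\<bar>\<^sup>2" using c by (intro power_mono) auto
    then show "bump t \<le> max (1 / 2) (1 - c\<^sup>2)" unfolding bump_square by simp
  qed auto
qed

lemma power_bump_expansion:
  fixes u :: real
  shows "(4 * u * (1 - u)) ^ m = (\<Sum>k\<le>m. (4 ^ m * real (m choose k) * (- 1) ^ k) * u ^ (m + k))"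
proof -
  have "(4 * u * (1 - u)) ^ m = 4 ^ m * u ^ m * (- u + 1) ^ m"
    by (simp add: power_mult_distrib)
  also have "(- u + 1) ^ m = (\<Sum>k\<le>m. real (m choose k) * (- u) ^ k * 1 ^ (m - k))"
    by (rule binomial_ring)
  also have "4 ^ m * u ^ m * \<dots> = (\<Sum>k\<le>m. (4 ^ m * real (m choose k) * (- 1) ^ k) * u ^ (m + k))"
    unfolding sum_distrib_left
  proof (intro sum.cong refl)
    fix k
    show "4 ^ m * u ^ m * (real (m choose k) * (- u) ^ k * 1 ^ (m - k))
      = 4 ^ m * real (m choose k) * (- 1) ^ k * u ^ (m + k)"
      using power_minus[of u k] by (simp add: power_add)
  qed
  finally show ?thesis .
qed

text \<open>The rates \<open>ln 2 * real (m + k)\<close> are positive for \<open>m > 0\<close>, as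
  Gaussian weights require.\<close>

lemma bump_power_expansion:
  "bump t ^ m = (\<Sum>k\<le>m. (4 ^ m * real (m choose k) * (- 1) ^ k) * exp (- ((ln 2 * real (m + k)) * t)))"
proof -
  have "exp (- ((ln 2 * real n) * t)) = exp (- (ln 2 * t)) ^ n" for n :: nat
    unfolding exp_of_nat_mult[symmetric] by (simp add: mult_ac)
  then show ?thesis
    unfolding bump_def power_bump_expansion by (simp only:)
qed

section \<open>Radial laws weighted by powers of \<open>bump\<close>\<close>

definition bump_mass :: "nat \<Rightarrow> nat \<Rightarrow> ennreal"
  where "bump_mass d m = (\<integral>\<^sup>+t. ennreal (bump t ^ m) \<partial>radial d)"

text \<open>The squared radius under the weight \<open>bump t ^ m\<close>: a probability measure for
  \<open>d \<ge> 2\<close> and \<open>m > 0\<close>, tending to the point mass at 1 as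
  \<open>m\<close> grows.\<close>

definition bump_law :: "nat \<Rightarrow> nat \<Rightarrow> real measure"
  where "bump_law d m = density (radial d) (\<lambda>t. ennreal (bump t ^ m) / bump_mass d m)"

lemma sets_bump_law[measurable_cong, simp]: "sets (bump_law d m) = sets borel"
  by (simp add: bump_law_def)

lemma space_bump_law[simp]: "space (bump_law d m) = UNIV"
  by (simp add: bump_law_def)

lemma AE_radial_pos: "AE t in radial d. 0 < t"
  unfolding radial_def by (subst AE_density) (auto intro!: AE_I2 simp: indicator_def)

lemma radial_interval_pos:
  assumes d: "0 < d" and ab: "0 < a" "a < b"
  shows "0 < emeasure (radial d) {a<..b}" "emeasure (radial d) {a<..b} < \<infinity>"
proof -
  have "emeasure (radial d) {..a} + emeasure (radial d) {a<..b} = emeasure (radial d) ({..a} \<union> {a<..b})"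
    by (rule plus_emeasure) auto
  also have "{..a} \<union> {a<..b} = {..b}" using ab by auto
  finally have U: "emeasure (radial d) {..b} = emeasure (radial d) {..a} + emeasure (radial d) {a<..b}" ..
  have fin: "emeasure (radial d) {..b} < \<infinity>"
    using ball_vol_finite[of d] by (simp add: emeasure_radial_atMost[OF d] ennreal_mult_less_top)
  have "emeasure (radial d) {a<..b} \<le> emeasure (radial d) {..b}" by (rule emeasure_mono) auto
  then show "emeasure (radial d) {a<..b} < \<infinity>" using fin by (rule order_le_less_trans)
  show "0 < emeasure (radial d) {a<..b}"
  proof (rule ccontr)
    assume "\<not> ?thesis"
    then have 0: "emeasure (radial d) {a<..b} = 0" by (simp only: not_gr_zero not_not)
    have B: "ball_vol d \<noteq> 0" "ball_vol d \<noteq> \<infinity>"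
      using ball_vol_pos[of d] ball_vol_finite[of d] by auto
    have b: "0 < b" using ab by linarith
    have "ball_vol d * ennreal (b powr (d / 2)) = ball_vol d * ennreal (a powr (d / 2))"
      using U unfolding 0 emeasure_radial_atMost[OF d] if_P[OF b] if_P[OF ab(1)] add_0_right .
    then have "ennreal (b powr (d / 2)) = ennreal (a powr (d / 2))"
      by (rule ennreal_cancel[OF B])
    then have "b powr (d / 2) = a powr (d / 2)" by (subst (asm) ennreal_inj) auto
    moreover have "a powr (d / 2) < b powr (d / 2)" using ab d by (intro powr_less_mono2) auto
    ultimately show False by simp
  qed
qed

text \<open>The exponential decay of \<open>bump\<close> beats the polynomial growth of the radial
  density and of \<open>(1 + \<bar>t\<bar>) ^ N\<close>. A single power of \<open>bump\<close>
  suffices; further powers are bounded separately.\<close>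

lemma bump_moment_finite:
  assumes d: "2 \<le> d"
  shows "(\<integral>\<^sup>+t. ennreal ((1 + \<bar>t\<bar>) ^ N * bump t) \<partial>radial d) < \<infinity>"
proof -
  let ?n = "N + d"
  have "(\<integral>\<^sup>+t. ennreal ((1 + \<bar>t\<bar>) ^ N * bump t) \<partial>radial d)
    = (\<integral>\<^sup>+t. ball_vol d * ennreal (d / 2 * t powr (d / 2 - 1)) * indicator {0<..} t * ennreal ((1 + \<bar>t\<bar>) ^ N * bump t) \<partial>lborel)"
    unfolding radial_def by (rule nn_integral_density) measurable
  also have "\<dots> \<le> (\<integral>\<^sup>+t. ball_vol d * ennreal (d / 2 * 4 * 2 ^ ?n) *
      (indicator {0<..} t * ennreal (t ^ 0 * exp (- (ln 2 * t))) + indicator {0<..} t * ennreal (t ^ ?n * exp (- (ln 2 * t)))) \<partial>lborel)"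
  proof (rule nn_integral_mono)
    fix t :: real
    show "ball_vol d * ennreal (d / 2 * t powr (d / 2 - 1)) * indicator {0<..} t * ennreal ((1 + \<bar>t\<bar>) ^ N * bump t)
      \<le> ball_vol d * ennreal (d / 2 * 4 * 2 ^ ?n) *
      (indicator {0<..} t * ennreal (t ^ 0 * exp (- (ln 2 * t))) + indicator {0<..} t * ennreal (t ^ ?n * exp (- (ln 2 * t))))"
    proof (cases "0 < t")
      case True
      let ?e = "exp (- (ln 2 * t))"
      have "t powr (d / 2 - 1) \<le> (1 + t) powr (d / 2 - 1)" using True d by (intro powr_mono2) auto
      also have "\<dots> \<le> (1 + t) powr (real d)" using True by (intro powr_mono) auto
      also have "\<dots> = (1 + t) ^ d" using True by (simp add: powr_realpow)
      finally have p: "t powr (d / 2 - 1) \<le> (1 + t) ^ d" .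
      have q: "(1 + t) ^ ?n \<le> 2 ^ ?n * (1 + t ^ ?n)"
      proof (cases "t \<le> 1")
        case True
        have "(1 + t) ^ ?n \<le> 2 ^ ?n" using True \<open>0 < t\<close> by (intro power_mono) auto
        also have "\<dots> \<le> 2 ^ ?n * (1 + t ^ ?n)" using \<open>0 < t\<close> by simp
        finally show ?thesis .
      next
        case False
        have "(1 + t) ^ ?n \<le> (2 * t) ^ ?n" using False by (intro power_mono) auto
        also have "\<dots> \<le> 2 ^ ?n * (1 + t ^ ?n)" by (simp add: power_mult_distrib)
        finally show ?thesis .
      qed
      have "t powr (d / 2 - 1) * ((1 + t) ^ N * bump t) \<le> (1 + t) ^ d * ((1 + t) ^ N * (4 * ?e))"
        using True p bump_le_exp[of t] bump_nonneg[of t] by (intro mult_mono) auto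
      also have "\<dots> = 4 * ?e * (1 + t) ^ ?n" by (simp add: power_add)
      also have "\<dots> \<le> 4 * ?e * (2 ^ ?n * (1 + t ^ ?n))" using q by (intro mult_left_mono) auto
      finally have "d / 2 * (t powr (d / 2 - 1) * ((1 + t) ^ N * bump t)) \<le> d / 2 * (4 * ?e * (2 ^ ?n * (1 + t ^ ?n)))"
        by (rule mult_left_mono) simp
      also have "d / 2 * (4 * ?e * (2 ^ ?n * (1 + t ^ ?n))) = d / 2 * 4 * 2 ^ ?n * (t ^ 0 * ?e + t ^ ?n * ?e)"
        by (simp only: power_0 ring_distribs mult_ac mult_1_left mult_1_right)
      finally have le: "d / 2 * t powr (d / 2 - 1) * ((1 + t) ^ N * bump t) \<le> d / 2 * 4 * 2 ^ ?n * (t ^ 0 * ?e + t ^ ?n * ?e)"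
        by (simp only: mult.assoc)
      have "ennreal (d / 2 * t powr (d / 2 - 1)) * ennreal ((1 + \<bar>t\<bar>) ^ N * bump t)
        = ennreal (d / 2 * t powr (d / 2 - 1) * ((1 + t) ^ N * bump t))"
        using True bump_nonneg[of t] by (subst ennreal_mult[symmetric]) auto
      also have "\<dots> \<le> ennreal (d / 2 * 4 * 2 ^ ?n * (t ^ 0 * ?e + t ^ ?n * ?e))"
        using le by (rule ennreal_leI)
      also have "\<dots> = ennreal (d / 2 * 4 * 2 ^ ?n) * ennreal (t ^ 0 * ?e + t ^ ?n * ?e)"
        by (rule ennreal_mult') simp
      also have "ennreal (t ^ 0 * ?e + t ^ ?n * ?e) = ennreal (t ^ 0 * ?e) + ennreal (t ^ ?n * ?e)"
        using True by (intro ennreal_plus) auto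
      finally have "ball_vol d * (ennreal (d / 2 * t powr (d / 2 - 1)) * ennreal ((1 + \<bar>t\<bar>) ^ N * bump t))
        \<le> ball_vol d * (ennreal (d / 2 * 4 * 2 ^ ?n) * (ennreal (t ^ 0 * ?e) + ennreal (t ^ ?n * ?e)))"
        by (rule mult_left_mono) simp
      moreover have "indicator {0<..} t = (1::ennreal)" using True by simp
      ultimately show ?thesis by (simp only: mult.assoc mult_1_left mult_1_right)
    qed simp
  qed
  also have "\<dots> = ball_vol d * ennreal (d / 2 * 4 * 2 ^ ?n) * (ennreal (fact 0 / (ln 2) ^ Suc 0) + ennreal (fact ?n / (ln 2) ^ Suc ?n))"
  proof -
    have l: "0 < ln (2::real)" by simp
    show ?thesis
      by (subst nn_integral_cmult, measurable, subst nn_integral_add, measurable) (simp only: nn_integral_erlang[OF l])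
  qed
  also have "\<dots> < \<infinity>" using ball_vol_finite[of d] by (simp add: ennreal_mult_less_top)
  finally show ?thesis .
qed

lemma bump_mass_bounds:
  assumes d: "2 \<le> d"
  shows "0 < bump_mass d m" "0 < m \<Longrightarrow> bump_mass d m < \<infinity>"
proof -
  \<comment> \<open>On the interval from 1/2 to 1 the number \<open>u = 2 powr (- t)\<close> lies
    between \<open>1 / 2\<close> and \<open>2 powr (- 1 / 2)\<close>, so
    \<open>4 * u * (1 - u)\<close> is at least this constant.\<close>
  define c where "c = 2 * (1 - exp (- (ln 2 / 2)) :: real)"
  have c: "0 < c" by (simp add: c_def)
  have gc: "c \<le> bump t" if "1 / 2 < t" "t \<le> 1" for t
  proof -
    let ?u = "exp (- (ln 2 * t))"
    have "exp (- ln 2) \<le> ?u" using that by simp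
    then have "1 / 2 \<le> ?u" by (simp add: exp_minus)
    moreover have "?u \<le> exp (- (ln 2 / 2))" using that by simp
    ultimately have "4 * (1 / 2) * (1 - exp (- (ln 2 / 2))) \<le> 4 * ?u * (1 - ?u)"
      by (intro mult_mono) auto
    then show ?thesis by (simp add: bump_def c_def)
  qed
  have "0 < emeasure (radial d) {1/2<..1}" using d by (intro radial_interval_pos) auto
  then have "0 < ennreal (c ^ m) * emeasure (radial d) {1/2<..1}"
    using c by (simp add: ennreal_zero_less_mult_iff)
  also have "\<dots> = (\<integral>\<^sup>+t. ennreal (c ^ m) * indicator {1/2<..1} t \<partial>radial d)"
    by (rule nn_integral_cmult_indicator[symmetric]) simp
  also have "\<dots> \<le> bump_mass d m"
    unfolding bump_mass_def
  proof (rule nn_integral_mono)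
    fix t :: real
    show "ennreal (c ^ m) * indicator {1/2<..1} t \<le> ennreal (bump t ^ m)"
    proof (cases "1 / 2 < t \<and> t \<le> 1")
      case True
      then have "c ^ m \<le> bump t ^ m" using gc c by (intro power_mono) auto
      with True show ?thesis by (simp add: ennreal_leI)
    next
      case False
      then have "indicator {1/2<..1} t = (0 :: ennreal)" by (simp add: indicator_def)
      then show ?thesis by simp
    qed
  qed
  finally show "0 < bump_mass d m" .
  assume m: "0 < m"
  have "bump_mass d m \<le> (\<integral>\<^sup>+t. ennreal ((1 + \<bar>t\<bar>) ^ 0 * bump t) \<partial>radial d)"
    unfolding bump_mass_def
  proof (rule nn_integral_mono_AE)
    show "AE t in radial d. ennreal (bump t ^ m) \<le> ennreal ((1 + \<bar>t\<bar>) ^ 0 * bump t)"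
      using AE_radial_pos[of d]
    proof eventually_elim
      case (elim t)
      then have "bump t ^ m \<le> bump t ^ 1" using m bump_nonneg[of t] bump_le_1[of t] by (intro power_decreasing) auto
      then show ?case by (intro ennreal_leI) simp
    qed
  qed
  also have "\<dots> < \<infinity>" by (rule bump_moment_finite[OF d])
  finally show "bump_mass d m < \<infinity>" .
qed

lemma nn_integral_bump_law:
  assumes [measurable]: "f \<in> borel_measurable borel"
  shows "(\<integral>\<^sup>+t. f t \<partial>bump_law d m) = (\<integral>\<^sup>+t. ennreal (bump t ^ m) * f t \<partial>radial d) / bump_mass d m"
proof -
  have "(\<integral>\<^sup>+t. f t \<partial>bump_law d m) = (\<integral>\<^sup>+t. ennreal (bump t ^ m) / bump_mass d m * f t \<partial>radial d)"
    unfolding bump_law_def by (rule nn_integral_density) measurable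
  also have "\<dots> = (\<integral>\<^sup>+t. ennreal (bump t ^ m) * f t / bump_mass d m \<partial>radial d)"
    by (simp add: divide_ennreal_def mult_ac)
  also have "\<dots> = (\<integral>\<^sup>+t. ennreal (bump t ^ m) * f t \<partial>radial d) / bump_mass d m"
    by (rule nn_integral_divide) measurable
  finally show ?thesis .
qed

lemma prob_space_bump_law:
  assumes "2 \<le> d" "0 < m"
  shows "prob_space (bump_law d m)"
proof
  have "emeasure (bump_law d m) UNIV = (\<integral>\<^sup>+t. 1 \<partial>bump_law d m)" by simp
  also have "\<dots> = bump_mass d m / bump_mass d m" by (subst nn_integral_bump_law) (auto simp: bump_mass_def)
  also have "\<dots> = 1" using bump_mass_bounds(1)[OF assms(1), of m] bump_mass_bounds(2)[OF assms] by (intro ennreal_divide_self) auto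
  finally show "emeasure (bump_law d m) (space (bump_law d m)) = 1" by simp
qed

text \<open>Away from 1 \<open>bump\<close> is at most \<eta>, while on an interval ending at 1 it
  is at least some larger \<eta>'. Numerator and normalising mass then have a ratio of order
  \<open>(\<eta> / \<eta>') ^ m\<close>. One power of \<open>bump\<close> is kept to make the
  numerator finite, so the bound is stated for \<open>Suc m\<close>.\<close>

lemma bump_law_tail:
  assumes d: "2 \<le> d" and \<delta>: "0 < \<delta>"
  shows "(\<lambda>m. \<integral>\<^sup>+t. ennreal ((1 + \<bar>t\<bar>) ^ N) * indicator {t. \<delta> \<le> \<bar>t - 1\<bar>} t \<partial>bump_law d m) \<longlonglongrightarrow> 0"
proof -
  obtain \<eta> where \<eta>: "0 < \<eta>" "\<eta> < 1" "\<And>t. \<delta> \<le> \<bar>t - 1\<bar> \<Longrightarrow> bump t \<le> \<eta>"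
    using bump_away[OF \<delta>] by blast
  \<comment> \<open>Any number strictly between \<eta> and the maximum 1 of \<open>bump\<close>
    would do.\<close>
  define \<eta>' where "\<eta>' = (1 + \<eta>) / 2"
  have \<eta>': "\<eta> < \<eta>'" "\<eta>' < 1" using \<eta> by (auto simp: \<eta>'_def)
  have "\<forall>\<^sub>F t in nhds 1. \<eta>' < bump t"
    using order_tendstoD(1)[OF bump_isCont[of 1, unfolded isCont_def tendsto_at_iff_tendsto_nhds]] \<eta>'
    by (simp only: bump_1)
  then obtain e where e: "0 < e" "\<And>t. dist t 1 < e \<Longrightarrow> \<eta>' < bump t"
    unfolding eventually_nhds_metric by auto
  define a where "a = max (1 / 2) (1 - e / 2)"
  have a: "0 < a" "a < 1" "\<And>t. a < t \<Longrightarrow> t \<le> 1 \<Longrightarrow> \<eta>' \<le> bump t"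
  proof -
    show "0 < a" "a < 1" using e by (auto simp: a_def)
    fix t assume "a < t" "t \<le> 1"
    then have "dist t 1 < e" using e(1) by (auto simp: a_def dist_real_def)
    then show "\<eta>' \<le> bump t" using e(2) by (simp add: less_imp_le)
  qed
  define r where "r = enn2real (emeasure (radial d) {a<..1})"
  have r: "0 < r" "emeasure (radial d) {a<..1} = ennreal r"
    using radial_interval_pos[of d a 1] d a by (auto simp: r_def enn2real_positive_iff)
  define A where "A = enn2real (\<integral>\<^sup>+t. ennreal ((1 + \<bar>t\<bar>) ^ N * bump t) \<partial>radial d)"
  have A: "(\<integral>\<^sup>+t. ennreal ((1 + \<bar>t\<bar>) ^ N * bump t) \<partial>radial d) = ennreal A"
    using bump_moment_finite[OF d, of N] by (simp add: A_def)
  have A0: "0 \<le> A" by (simp add: A_def)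
  have le: "(\<integral>\<^sup>+t. ennreal ((1 + \<bar>t\<bar>) ^ N) * indicator {t. \<delta> \<le> \<bar>t - 1\<bar>} t \<partial>bump_law d (Suc m)) \<le> ennreal (A / (\<eta>' * r) * (\<eta> / \<eta>') ^ m)" for m
  proof -
    have num: "(\<integral>\<^sup>+t. ennreal (bump t ^ Suc m) * (ennreal ((1 + \<bar>t\<bar>) ^ N) * indicator {t. \<delta> \<le> \<bar>t - 1\<bar>} t) \<partial>radial d) \<le> ennreal (\<eta> ^ m * A)"
    proof -
      have "(\<integral>\<^sup>+t. ennreal (bump t ^ Suc m) * (ennreal ((1 + \<bar>t\<bar>) ^ N) * indicator {t. \<delta> \<le> \<bar>t - 1\<bar>} t) \<partial>radial d)
        \<le> (\<integral>\<^sup>+t. ennreal (\<eta> ^ m) * ennreal ((1 + \<bar>t\<bar>) ^ N * bump t) \<partial>radial d)"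
      proof (rule nn_integral_mono_AE)
        show "AE t in radial d. ennreal (bump t ^ Suc m) * (ennreal ((1 + \<bar>t\<bar>) ^ N) * indicator {t. \<delta> \<le> \<bar>t - 1\<bar>} t)
          \<le> ennreal (\<eta> ^ m) * ennreal ((1 + \<bar>t\<bar>) ^ N * bump t)"
          using AE_radial_pos[of d]
        proof eventually_elim
          case (elim t)
          show ?case
          proof (cases "\<delta> \<le> \<bar>t - 1\<bar>")
            case True
            have "bump t ^ m * bump t * (1 + \<bar>t\<bar>) ^ N \<le> \<eta> ^ m * bump t * (1 + \<bar>t\<bar>) ^ N"
              using elim \<eta>(3)[OF True] bump_nonneg[of t] by (intro mult_right_mono power_mono) auto
            then have "ennreal (bump t ^ m * bump t * (1 + \<bar>t\<bar>) ^ N) \<le> ennreal (\<eta> ^ m * bump t * (1 + \<bar>t\<bar>) ^ N)"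
              by (rule ennreal_leI)
            moreover have "ennreal (bump t ^ Suc m) * ennreal ((1 + \<bar>t\<bar>) ^ N) = ennreal (bump t ^ m * bump t * (1 + \<bar>t\<bar>) ^ N)"
              using elim bump_nonneg[of t] by (subst ennreal_mult[symmetric]) (simp_all add: mult.commute[of "bump t"])
            moreover have "ennreal (\<eta> ^ m) * ennreal ((1 + \<bar>t\<bar>) ^ N * bump t) = ennreal (\<eta> ^ m * bump t * (1 + \<bar>t\<bar>) ^ N)"
              using elim \<eta>(1) bump_nonneg[of t] by (subst ennreal_mult[symmetric]) (simp_all add: mult.assoc mult.commute[of "bump t"])
            moreover have "indicator {t. \<delta> \<le> \<bar>t - 1\<bar>} t = (1::ennreal)" using True by simp
            ultimately show ?thesis by (simp only: mult_1_right)
          next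
            case False
            then have "indicator {t. \<delta> \<le> \<bar>t - 1\<bar>} t = (0::ennreal)" by simp
            then show ?thesis by simp
          qed
        qed
      qed
      also have "\<dots> = ennreal (\<eta> ^ m) * ennreal A"
        by (subst nn_integral_cmult, measurable) (simp only: A)
      also have "\<dots> = ennreal (\<eta> ^ m * A)"
        using \<eta>(1) A0 by (simp add: ennreal_mult)
      finally show ?thesis .
    qed
    have den: "ennreal (\<eta>' ^ Suc m * r) \<le> bump_mass d (Suc m)"
    proof -
      have "ennreal (\<eta>' ^ Suc m * r) = (\<integral>\<^sup>+t. ennreal (\<eta>' ^ Suc m) * indicator {a<..1} t \<partial>radial d)"
        using \<eta> \<eta>' r by (subst nn_integral_cmult_indicator) (auto simp: ennreal_mult')
      also have "\<dots> \<le> bump_mass d (Suc m)"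
        unfolding bump_mass_def
      proof (rule nn_integral_mono)
        fix t :: real
        show "ennreal (\<eta>' ^ Suc m) * indicator {a<..1} t \<le> ennreal (bump t ^ Suc m)"
        proof (cases "a < t \<and> t \<le> 1")
          case True
          then have "\<eta>' ^ Suc m \<le> bump t ^ Suc m" using a(3)[of t] \<eta> \<eta>' by (intro power_mono) auto
          with True show ?thesis by (simp add: ennreal_leI del: power_Suc)
        next
          case False
          then have "indicator {a<..1} t = (0 :: ennreal)" by (simp add: indicator_def)
          then show ?thesis by simp
        qed
      qed
      finally show ?thesis .
    qed
    obtain z where z: "bump_mass d (Suc m) = ennreal z" "0 \<le> z"
      using bump_mass_bounds(2)[OF d, of "Suc m"] by (cases "bump_mass d (Suc m)") auto
    have y: "0 < \<eta>' ^ Suc m * r" using \<eta> \<eta>' r by simp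
    have yz: "\<eta>' ^ Suc m * r \<le> z" using den z by (simp del: power_Suc)
    have "(\<integral>\<^sup>+t. ennreal ((1 + \<bar>t\<bar>) ^ N) * indicator {t. \<delta> \<le> \<bar>t - 1\<bar>} t \<partial>bump_law d (Suc m))
      \<le> ennreal (\<eta> ^ m * A) / ennreal z"
      by (subst nn_integral_bump_law, measurable) (simp only: z(1)[symmetric] divide_right_mono_ennreal num)
    also have "\<dots> = ennreal (\<eta> ^ m * A / z)"
      using \<eta> A0 y yz by (intro divide_ennreal) auto
    also have "\<dots> \<le> ennreal (\<eta> ^ m * A / (\<eta>' ^ Suc m * r))"
      using \<eta> A0 y yz by (intro ennreal_leI divide_left_mono) auto
    also have "\<eta> ^ m * A / (\<eta>' ^ Suc m * r) = A / (\<eta>' * r) * (\<eta> / \<eta>') ^ m"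
      by (simp add: power_divide mult_ac)
    finally show ?thesis .
  qed
  have "(\<lambda>m. A / (\<eta>' * r) * (\<eta> / \<eta>') ^ m) \<longlonglongrightarrow> A / (\<eta>' * r) * 0"
    using \<eta> \<eta>' by (intro tendsto_intros LIMSEQ_realpow_zero) auto
  then have "(\<lambda>m. ennreal (A / (\<eta>' * r) * (\<eta> / \<eta>') ^ m)) \<longlonglongrightarrow> ennreal 0"
    by (intro tendsto_ennrealI) simp
  then have "(\<lambda>m. \<integral>\<^sup>+t. ennreal ((1 + \<bar>t\<bar>) ^ N) * indicator {t. \<delta> \<le> \<bar>t - 1\<bar>} t \<partial>bump_law d (Suc m)) \<longlonglongrightarrow> 0"
    unfolding ennreal_0
    by (rule tendsto_sandwich[OF always_eventually always_eventually tendsto_const, rotated 2]) (simp_all only: le zero_le simp_thms)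
  then show ?thesis by (rule LIMSEQ_imp_Suc)
qed

text \<open>Where \<open>\<bar>t - 1\<bar> < 1\<close> the integrand is at most
  \<open>3 ^ N\<close>; the rest is a tail and eventually below 1.\<close>

lemma bump_law_mass_bound:
  assumes d: "2 \<le> d"
  shows "\<forall>\<^sub>F m in sequentially. (\<integral>\<^sup>+t. ennreal ((1 + \<bar>t\<bar>) ^ N) \<partial>bump_law d m) \<le> ennreal (3 ^ N + 1)"
proof -
  have "\<forall>\<^sub>F m in sequentially. (\<integral>\<^sup>+t. ennreal ((1 + \<bar>t\<bar>) ^ N) * indicator {t. 1 \<le> \<bar>t - 1\<bar>} t \<partial>bump_law d m) < 1"
    by (rule order_tendstoD(2)[OF bump_law_tail[OF d]]) auto
  then show ?thesis using eventually_gt_at_top[of 0]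
  proof eventually_elim
    case (elim m)
    interpret prob_space "bump_law d m" by (rule prob_space_bump_law[OF d]) (use elim in simp)
    have "(\<integral>\<^sup>+t. ennreal ((1 + \<bar>t\<bar>) ^ N) \<partial>bump_law d m)
      \<le> (\<integral>\<^sup>+t. ennreal (3 ^ N) + ennreal ((1 + \<bar>t\<bar>) ^ N) * indicator {t. 1 \<le> \<bar>t - 1\<bar>} t \<partial>bump_law d m)"
    proof (rule nn_integral_mono)
      fix t :: real
      show "ennreal ((1 + \<bar>t\<bar>) ^ N) \<le> ennreal (3 ^ N) + ennreal ((1 + \<bar>t\<bar>) ^ N) * indicator {t. 1 \<le> \<bar>t - 1\<bar>} t"
      proof (cases "1 \<le> \<bar>t - 1\<bar>")
        case False
        then have "(1 + \<bar>t\<bar>) ^ N \<le> 3 ^ N" by (intro power_mono) auto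
        with False show ?thesis by (simp add: ennreal_leI)
      qed simp
    qed
    also have "\<dots> = ennreal (3 ^ N) + (\<integral>\<^sup>+t. ennreal ((1 + \<bar>t\<bar>) ^ N) * indicator {t. 1 \<le> \<bar>t - 1\<bar>} t \<partial>bump_law d m)"
      using emeasure_space_1 by (subst nn_integral_add) auto
    also have "\<dots> \<le> ennreal (3 ^ N) + 1" using elim by (intro add_left_mono) auto
    finally show ?case by simp
  qed
qed

lemma bump_law_product_sigma_finite:
  assumes "2 \<le> d" "0 < m"
  shows "product_sigma_finite (\<lambda>_. bump_law d m)"
  using prob_space_imp_sigma_finite[OF prob_space_bump_law[OF assms]] by (simp add: product_sigma_finite_def)

text \<open>If all coordinates are near 1, \<psi> is near \<open>c\<close>. Otherwise some
  coordinate is far from 1, and summing over its index bounds the error by terms with one tail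
  factor and bounded other factors.\<close>

lemma bump_law_PiM_concentration:
  fixes \<psi> :: "('i \<Rightarrow> real) \<Rightarrow> real"
  assumes d: "2 \<le> d" and I: "finite I" and c: "0 \<le> c"
    and \<psi>[measurable]: "\<psi> \<in> borel_measurable (\<Pi>\<^sub>M i\<in>I. borel)"
    and \<psi>0: "\<And>t. 0 \<le> \<psi> t" and \<psi>1: "\<And>t. \<psi> t \<le> (\<Prod>i\<in>I. (1 + \<bar>t i\<bar>) ^ N)"
    and cont: "\<And>e. 0 < e \<Longrightarrow> \<exists>\<delta>>0. \<forall>t. (\<forall>i\<in>I. \<bar>t i - 1\<bar> < \<delta>) \<longrightarrow> \<bar>\<psi> t - c\<bar> \<le> e"
  shows "(\<lambda>m. \<integral>\<^sup>+t. ennreal (\<psi> t) \<partial>(\<Pi>\<^sub>M i\<in>I. bump_law d m)) \<longlonglongrightarrow> ennreal c"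
proof -
  define E where "E m = (\<integral>\<^sup>+t. ennreal \<bar>\<psi> t - c\<bar> \<partial>(\<Pi>\<^sub>M i\<in>I. bump_law d m))" for m
  have sets: "sets (\<Pi>\<^sub>M i\<in>I. bump_law d m) = sets (\<Pi>\<^sub>M i\<in>I. borel :: real measure)" for m
    by (intro sets_PiM_cong) auto
  have \<psi>'[measurable]: "\<psi> \<in> borel_measurable (\<Pi>\<^sub>M i\<in>I. bump_law d m)" for m
    using \<psi> by (simp cong: measurable_cong_sets add: sets)
  define B where "B = ennreal (3 ^ N + 1)"
  have bound: "\<forall>\<^sub>F m in sequentially. E m \<le> ennreal e + ennreal (1 + c) *
      (\<Sum>i\<in>I. (\<integral>\<^sup>+t. ennreal ((1 + \<bar>t\<bar>) ^ N) * indicator {t. \<delta> \<le> \<bar>t - 1\<bar>} t \<partial>bump_law d m) * B ^ card (I - {i}))"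
    if e: "0 < e" and \<delta>: "\<And>t. (\<forall>i\<in>I. \<bar>t i - 1\<bar> < \<delta>) \<Longrightarrow> \<bar>\<psi> t - c\<bar> \<le> e" for e \<delta>
    using bump_law_mass_bound[OF d, of N] eventually_gt_at_top[of 0]
  proof eventually_elim
    case (elim m)
    interpret K: product_sigma_finite "\<lambda>_::'i. bump_law d m" by (rule bump_law_product_sigma_finite[OF d]) (use elim in simp)
    interpret P: prob_space "\<Pi>\<^sub>M i\<in>I. bump_law d m" by (intro prob_space_PiM prob_space_bump_law d) (use elim in simp)
    \<comment> \<open>For fixed \<open>i\<close> only the factor with \<open>j = i\<close> carries
      the tail indicator.\<close>
    define w where "w i j s = ennreal ((1 + \<bar>s\<bar>) ^ N) * (if j = i then indicator {t. \<delta> \<le> \<bar>t - 1\<bar>} s else 1)" for i j :: 'i and s :: real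
    have [measurable]: "w i j \<in> borel_measurable borel" for i j unfolding w_def by measurable
    have "E m \<le> (\<integral>\<^sup>+t. ennreal e + ennreal (1 + c) * (\<Sum>i\<in>I. \<Prod>j\<in>I. w i j (t j)) \<partial>(\<Pi>\<^sub>M i\<in>I. bump_law d m))"
      unfolding E_def
    proof (rule nn_integral_mono)
      fix t :: "'i \<Rightarrow> real"
      show "ennreal \<bar>\<psi> t - c\<bar> \<le> ennreal e + ennreal (1 + c) * (\<Sum>i\<in>I. \<Prod>j\<in>I. w i j (t j))"
      proof (cases "\<forall>i\<in>I. \<bar>t i - 1\<bar> < \<delta>")
        case True
        have "ennreal \<bar>\<psi> t - c\<bar> \<le> ennreal e + 0" using \<delta>[OF True] by (simp add: ennreal_leI)
        also have "\<dots> \<le> ennreal e + ennreal (1 + c) * (\<Sum>i\<in>I. \<Prod>j\<in>I. w i j (t j))" by (intro add_left_mono) simp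
        finally show ?thesis .
      next
        case False
        then obtain i where i: "i \<in> I" "\<delta> \<le> \<bar>t i - 1\<bar>" by (auto simp: not_less)
        define P where "P = (\<Prod>j\<in>I. (1 + \<bar>t j\<bar>) ^ N)"
        have P1: "1 \<le> P" unfolding P_def by (intro prod_ge_1 one_le_power) auto
        have "\<bar>\<psi> t - c\<bar> \<le> P + c" using \<psi>0[of t] \<psi>1[of t] c by (simp add: P_def)
        also have "\<dots> \<le> (1 + c) * P" using c P1 by (simp add: distrib_right mult_le_cancel_left1)
        finally have "ennreal \<bar>\<psi> t - c\<bar> \<le> ennreal ((1 + c) * P)" by (rule ennreal_leI)
        also have "\<dots> = ennreal (1 + c) * ennreal P" using c by (intro ennreal_mult') simp
        also have "ennreal P = (\<Prod>j\<in>I. w i j (t j))"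
          unfolding P_def w_def using i(2) by (subst prod_ennreal[symmetric]) (auto intro!: prod.cong)
        also have "\<dots> \<le> (\<Sum>i\<in>I. \<Prod>j\<in>I. w i j (t j))"
          by (rule member_le_sum[OF i(1) _ I]) simp
        also have "ennreal (1 + c) * \<dots> \<le> ennreal e + ennreal (1 + c) * \<dots>"
          by simp
        finally show ?thesis by (simp add: mult_left_mono)
      qed
    qed
    also have "\<dots> = ennreal e + (\<integral>\<^sup>+t. ennreal (1 + c) * (\<Sum>i\<in>I. \<Prod>j\<in>I. w i j (t j)) \<partial>(\<Pi>\<^sub>M i\<in>I. bump_law d m))"
      by (subst nn_integral_add) (simp_all add: P.emeasure_space_1)
    also have "(\<integral>\<^sup>+t. ennreal (1 + c) * (\<Sum>i\<in>I. \<Prod>j\<in>I. w i j (t j)) \<partial>(\<Pi>\<^sub>M i\<in>I. bump_law d m))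
      = ennreal (1 + c) * (\<Sum>i\<in>I. \<integral>\<^sup>+t. (\<Prod>j\<in>I. w i j (t j)) \<partial>(\<Pi>\<^sub>M i\<in>I. bump_law d m))"
      by (subst nn_integral_cmult, measurable, subst nn_integral_sum, measurable)
    also have "\<dots> \<le> ennreal (1 + c) *
      (\<Sum>i\<in>I. (\<integral>\<^sup>+t. ennreal ((1 + \<bar>t\<bar>) ^ N) * indicator {t. \<delta> \<le> \<bar>t - 1\<bar>} t \<partial>bump_law d m) * B ^ card (I - {i}))"
    proof (intro mult_left_mono sum_mono zero_le)
      fix i assume i: "i \<in> I"
      have "(\<integral>\<^sup>+t. (\<Prod>j\<in>I. w i j (t j)) \<partial>(\<Pi>\<^sub>M i\<in>I. bump_law d m)) = (\<Prod>j\<in>I. \<integral>\<^sup>+s. w i j s \<partial>bump_law d m)"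
        by (rule K.product_nn_integral_prod[OF I]) measurable
      also have "\<dots> = (\<integral>\<^sup>+s. w i i s \<partial>bump_law d m) * (\<Prod>j\<in>I - {i}. \<integral>\<^sup>+s. w i j s \<partial>bump_law d m)"
        by (rule prod.remove[OF I i])
      also have "\<dots> \<le> (\<integral>\<^sup>+s. w i i s \<partial>bump_law d m) * (\<Prod>j\<in>I - {i}. B)"
      proof (intro mult_left_mono prod_mono_ennreal zero_le)
        fix j assume "j \<in> I - {i}"
        then have "w i j = (\<lambda>s. ennreal ((1 + \<bar>s\<bar>) ^ N))" by (auto simp: w_def)
        then show "(\<integral>\<^sup>+s. w i j s \<partial>bump_law d m) \<le> B" using elim by (simp add: B_def)
      qed
      finally show "(\<integral>\<^sup>+t. (\<Prod>j\<in>I. w i j (t j)) \<partial>(\<Pi>\<^sub>M i\<in>I. bump_law d m))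
        \<le> (\<integral>\<^sup>+t. ennreal ((1 + \<bar>t\<bar>) ^ N) * indicator {t. \<delta> \<le> \<bar>t - 1\<bar>} t \<partial>bump_law d m) * B ^ card (I - {i})"
        by (simp add: w_def)
    qed
    finally show ?case by (simp add: add_left_mono)
  qed
  have E0: "E \<longlonglongrightarrow> 0"
  proof (rule order_tendstoI)
    fix a :: ennreal assume a: "0 < a"
    obtain e where e: "0 < e" "ennreal e + ennreal e \<le> a"
    proof (cases a)
      case (real r)
      with a show ?thesis by (intro that[of "r / 2"]) (auto simp: ennreal_plus[symmetric] simp del: ennreal_plus)
    qed (auto intro: that[of 1])
    obtain \<delta> where \<delta>: "0 < \<delta>" "\<And>t. (\<forall>i\<in>I. \<bar>t i - 1\<bar> < \<delta>) \<Longrightarrow> \<bar>\<psi> t - c\<bar> \<le> e" using cont[OF e(1)] by blast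
    define S where "S m = ennreal (1 + c) *
      (\<Sum>i\<in>I. (\<integral>\<^sup>+t. ennreal ((1 + \<bar>t\<bar>) ^ N) * indicator {t. \<delta> \<le> \<bar>t - 1\<bar>} t \<partial>bump_law d m) * B ^ card (I - {i}))" for m
    have "S \<longlonglongrightarrow> ennreal (1 + c) * (\<Sum>i\<in>I. 0 * B ^ card (I - {i}))"
      unfolding S_def
      by (intro ennreal_tendsto_cmult tendsto_sum tendsto_mult_ennreal bump_law_tail[OF d \<delta>(1)] tendsto_const)
        (auto simp: B_def ennreal_power simp del: ennreal_plus)
    then have "S \<longlonglongrightarrow> 0" by simp
    then have "\<forall>\<^sub>F m in sequentially. S m < ennreal e" by (rule order_tendstoD(2)) (use e in simp)
    moreover have "\<forall>\<^sub>F m in sequentially. E m \<le> ennreal e + S m"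
      unfolding S_def by (rule bound) (use e(1) \<delta>(2) in auto)
    ultimately show "\<forall>\<^sub>F m in sequentially. E m < a"
    proof eventually_elim
      case (elim m)
      have "E m \<le> ennreal e + S m" using elim by simp
      also have "\<dots> < ennreal e + ennreal e" using elim by (simp add: ennreal_add_left_cancel_less)
      finally show ?case using e(2) by simp
    qed
  qed simp
  \<comment> \<open>Subtraction of extended nonnegative reals is truncated, so closeness is split
    into an upper and a lower bound.\<close>
  have up: "\<forall>\<^sub>F m in sequentially. (\<integral>\<^sup>+t. ennreal (\<psi> t) \<partial>(\<Pi>\<^sub>M i\<in>I. bump_law d m)) \<le> ennreal c + E m"
    and low: "\<forall>\<^sub>F m in sequentially. ennreal c - E m \<le> (\<integral>\<^sup>+t. ennreal (\<psi> t) \<partial>(\<Pi>\<^sub>M i\<in>I. bump_law d m))"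
  proof -
    have P: "prob_space (\<Pi>\<^sub>M i\<in>I. bump_law d m)" if "0 < m" for m
      by (intro prob_space_PiM prob_space_bump_law d that)
    show "\<forall>\<^sub>F m in sequentially. (\<integral>\<^sup>+t. ennreal (\<psi> t) \<partial>(\<Pi>\<^sub>M i\<in>I. bump_law d m)) \<le> ennreal c + E m"
      using eventually_gt_at_top[of 0]
    proof eventually_elim
      case (elim m)
      interpret prob_space "\<Pi>\<^sub>M i\<in>I. bump_law d m" by (rule P[OF elim])
      have "(\<integral>\<^sup>+t. ennreal (\<psi> t) \<partial>(\<Pi>\<^sub>M i\<in>I. bump_law d m)) \<le> (\<integral>\<^sup>+t. ennreal c + ennreal \<bar>\<psi> t - c\<bar> \<partial>(\<Pi>\<^sub>M i\<in>I. bump_law d m))"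
        using c by (intro nn_integral_mono) (auto simp: ennreal_plus[symmetric] simp del: ennreal_plus intro!: ennreal_leI)
      also have "\<dots> = ennreal c + E m"
        unfolding E_def by (subst nn_integral_add) (simp_all add: emeasure_space_1)
      finally show ?case .
    qed
    show "\<forall>\<^sub>F m in sequentially. ennreal c - E m \<le> (\<integral>\<^sup>+t. ennreal (\<psi> t) \<partial>(\<Pi>\<^sub>M i\<in>I. bump_law d m))"
      using eventually_gt_at_top[of 0]
    proof eventually_elim
      case (elim m)
      interpret prob_space "\<Pi>\<^sub>M i\<in>I. bump_law d m" by (rule P[OF elim])
      have "ennreal c = (\<integral>\<^sup>+t. ennreal c \<partial>(\<Pi>\<^sub>M i\<in>I. bump_law d m))"
        by (simp add: emeasure_space_1)
      also have "\<dots> \<le> (\<integral>\<^sup>+t. ennreal \<bar>\<psi> t - c\<bar> + ennreal (\<psi> t) \<partial>(\<Pi>\<^sub>M i\<in>I. bump_law d m))"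
        using \<psi>0 by (intro nn_integral_mono) (auto simp: ennreal_plus[symmetric] simp del: ennreal_plus intro!: ennreal_leI)
      also have "\<dots> = E m + (\<integral>\<^sup>+t. ennreal (\<psi> t) \<partial>(\<Pi>\<^sub>M i\<in>I. bump_law d m))"
        unfolding E_def by (rule nn_integral_add) measurable
      finally show ?case by (simp add: ennreal_minus_le_iff)
    qed
  qed
  have "(\<lambda>m. ennreal c - E m) \<longlonglongrightarrow> ennreal c - 0"
    by (rule tendsto_diff_ennreal_general[OF tendsto_const E0]) simp
  moreover have "(\<lambda>m. ennreal c + E m) \<longlonglongrightarrow> ennreal c + 0"
    by (intro tendsto_add tendsto_const E0)
  ultimately show ?thesis
    using tendsto_sandwich[OF low up] by simp
qed

lemma bump_law_concentration:
  fixes \<psi> :: "real \<Rightarrow> real"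
  assumes d: "2 \<le> d" and [measurable]: "\<psi> \<in> borel_measurable borel"
    and \<psi>: "\<And>t. 0 \<le> \<psi> t" "\<And>t. \<psi> t \<le> 1" and cont: "isCont \<psi> 1"
  shows "(\<lambda>m. \<integral>\<^sup>+t. ennreal (\<psi> t) \<partial>bump_law d m) \<longlonglongrightarrow> ennreal (\<psi> 1)"
proof -
  have "(\<lambda>m. \<integral>\<^sup>+t. ennreal (\<psi> (t 0)) \<partial>(\<Pi>\<^sub>M i\<in>{0::nat}. bump_law d m)) \<longlonglongrightarrow> ennreal (\<psi> 1)"
  proof (rule bump_law_PiM_concentration[OF d, where N=0])
    fix e :: real assume "0 < e"
    with cont obtain \<delta> where "0 < \<delta>" "\<forall>x. \<bar>x - 1\<bar> < \<delta> \<longrightarrow> \<bar>\<psi> x - \<psi> 1\<bar> < e"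
      unfolding continuous_at_eps_delta dist_real_def by blast
    then show "\<exists>\<delta>>0. \<forall>t. (\<forall>i\<in>{0::nat}. \<bar>t i - 1\<bar> < \<delta>) \<longrightarrow> \<bar>\<psi> (t 0) - \<psi> 1\<bar> \<le> e"
      by (intro exI[of _ \<delta>]) (auto simp: less_imp_le)
  qed (use \<psi> in auto)
  moreover have "\<forall>\<^sub>F m in sequentially. (\<integral>\<^sup>+t. ennreal (\<psi> (t 0)) \<partial>(\<Pi>\<^sub>M i\<in>{0::nat}. bump_law d m)) = (\<integral>\<^sup>+t. ennreal (\<psi> t) \<partial>bump_law d m)"
    using eventually_gt_at_top[of 0]
  proof eventually_elim
    case (elim m)
    interpret K: product_sigma_finite "\<lambda>_::nat. bump_law d m" by (rule bump_law_product_sigma_finite[OF d elim])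
    show ?case by (rule K.product_nn_integral_singleton[of "\<lambda>t. ennreal (\<psi> t)"]) measurable
  qed
  ultimately show ?thesis by (rule Lim_transform_eventually)
qed

section \<open>Both sides of the moment identity in terms of radial laws\<close>

lemma nn_integral_leb_radial:
  assumes d: "0 < d" and [measurable]: "F \<in> borel_measurable borel"
  shows "(\<integral>\<^sup>+y. F (nsq d y) \<partial>leb {..<d}) = (\<integral>\<^sup>+t. F t \<partial>radial d)"
proof -
  interpret S: prob_space "uniform_sphere d" by (rule prob_space_uniform_sphere)
  interpret R: sigma_finite_measure "radial d" by (rule sigma_finite_radial[OF d])
  interpret SR: pair_sigma_finite "uniform_sphere d" "radial d" ..
  have "(\<integral>\<^sup>+y. F (nsq d y) \<partial>leb {..<d}) = (\<integral>\<^sup>+p. F (snd p) \<partial>distr (leb {..<d}) (borel \<Otimes>\<^sub>M borel) (\<lambda>x. (dir d x, nsq d x)))"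
    by (subst nn_integral_distr) auto
  also have "\<dots> = (\<integral>\<^sup>+t. \<integral>\<^sup>+\<theta>. F t \<partial>uniform_sphere d \<partial>radial d)"
    unfolding distr_leb_polar[OF d] by (subst SR.nn_integral_snd[symmetric]) auto
  also have "\<dots> = (\<integral>\<^sup>+t. F t \<partial>radial d)"
    using S.emeasure_space_1 by simp
  finally show ?thesis .
qed

text \<open>The ratio of the densities of \<open>radial d\<close> at \<open>t - \<tau>\<close> and at \<open>t\<close>.\<close>

definition shift_weight :: "nat \<Rightarrow> real \<Rightarrow> real \<Rightarrow> real"
  where "shift_weight d \<tau> t = (if \<tau> < t then (1 - \<tau> / t) powr (d / 2 - 1) else 0)"

lemma shift_weight_measurable[measurable]: "(\<lambda>p. shift_weight d (fst p) (snd p)) \<in> borel_measurable (borel \<Otimes>\<^sub>M borel)"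
  unfolding shift_weight_def by measurable

lemma shift_weight_measurable'[measurable]: "shift_weight d \<tau> \<in> borel_measurable borel"
  unfolding shift_weight_def by measurable

lemma shift_weight_bounds:
  assumes "2 \<le> d" "0 \<le> \<tau>"
  shows "0 \<le> shift_weight d \<tau> t" "shift_weight d \<tau> t \<le> 1"
proof -
  show "0 \<le> shift_weight d \<tau> t" by (simp add: shift_weight_def)
  show "shift_weight d \<tau> t \<le> 1"
  proof (cases "\<tau> < t")
    case True
    then have "0 \<le> 1 - \<tau> / t" "1 - \<tau> / t \<le> 1" using assms by (auto simp: field_simps)
    then have "(1 - \<tau> / t) powr (d / 2 - 1) \<le> 1" using assms by (intro powr_le1) auto
    with True show ?thesis by (simp add: shift_weight_def)
  qed (simp add: shift_weight_def)
qed

text \<open>At \<tau> = 1 the weight can jump at 1, as it does for \<open>d = 2\<close>; this single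
  value is a null set in the later integration over \<tau>.\<close>

lemma shift_weight_isCont:
  assumes "0 < \<tau>" "\<tau> \<noteq> 1"
  shows "isCont (shift_weight d \<tau>) 1"
proof (cases "\<tau> < 1")
  case True
  have "isCont (\<lambda>t. (1 - \<tau> / t) powr (d / 2 - 1)) 1"
    using True by (intro continuous_intros) auto
  moreover have "\<forall>\<^sub>F t in nhds 1. shift_weight d \<tau> t = (1 - \<tau> / t) powr (d / 2 - 1)"
    using eventually_nhds_in_open[of "{\<tau><..}" 1] True by (auto elim!: eventually_mono simp: shift_weight_def)
  ultimately show ?thesis by (simp add: isCont_cong)
next
  case False
  then have "\<forall>\<^sub>F t in nhds 1. shift_weight d \<tau> t = 0"
    using eventually_nhds_in_open[of "{..<\<tau>}" 1] assms by (auto elim!: eventually_mono simp: shift_weight_def)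
  then show ?thesis by (subst isCont_cong[where g="\<lambda>_. 0"]) auto
qed

text \<open>Substituting \<open>u = t + \<tau>\<close> moves the shift from \<open>bump\<close> to
  the radial density, and the ratio of the shifted to the original density is
  \<open>shift_weight\<close>.\<close>

lemma radial_shift:
  assumes d: "2 \<le> d" and \<tau>: "0 \<le> \<tau>" and m: "0 < m"
  shows "(\<integral>\<^sup>+t. ennreal (bump (t + \<tau>) ^ m) \<partial>radial d) = bump_mass d m * (\<integral>\<^sup>+t. ennreal (shift_weight d \<tau> t) \<partial>bump_law d m)"
proof -
  let ?V = "\<lambda>t. ball_vol d * ennreal (d / 2 * t powr (d / 2 - 1)) * indicator {0<..} t"
  have G: "bump_mass d m \<noteq> 0" "bump_mass d m \<noteq> \<infinity>" using bump_mass_bounds(1)[OF d, of m] bump_mass_bounds(2)[OF d m] by auto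
  have "(\<integral>\<^sup>+t. ennreal (bump (t + \<tau>) ^ m) \<partial>radial d) = (\<integral>\<^sup>+t. ?V t * ennreal (bump (t + \<tau>) ^ m) \<partial>lborel)"
    unfolding radial_def by (rule nn_integral_density) measurable
  also have "\<dots> = (\<integral>\<^sup>+u. ?V (u - \<tau>) * ennreal (bump u ^ m) \<partial>lborel)"
    by (subst nn_integral_real_affine[where c=1 and t=\<tau> and f="\<lambda>u. ?V (u - \<tau>) * ennreal (bump u ^ m)"]) (auto simp: add.commute)
  also have "\<dots> = (\<integral>\<^sup>+u. ?V u * (ennreal (bump u ^ m) * ennreal (shift_weight d \<tau> u)) \<partial>lborel)"
  proof (rule nn_integral_cong)
    fix u :: real
    show "?V (u - \<tau>) * ennreal (bump u ^ m) = ?V u * (ennreal (bump u ^ m) * ennreal (shift_weight d \<tau> u))"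
    proof (cases "\<tau> < u")
      case True
      have "(u - \<tau>) = u * (1 - \<tau> / u)" using True \<tau> by (simp add: field_simps)
      then have "(u - \<tau>) powr (d / 2 - 1) = (u * (1 - \<tau> / u)) powr (d / 2 - 1)" by (simp only:)
      also have "\<dots> = u powr (d / 2 - 1) * (1 - \<tau> / u) powr (d / 2 - 1)"
        using True \<tau> by (simp add: powr_mult)
      finally have "(u - \<tau>) powr (d / 2 - 1) = u powr (d / 2 - 1) * (1 - \<tau> / u) powr (d / 2 - 1)" .
      then have "d / 2 * (u - \<tau>) powr (d / 2 - 1) = d / 2 * u powr (d / 2 - 1) * shift_weight d \<tau> u"
        using True by (simp add: shift_weight_def)
      then have "ennreal (d / 2 * (u - \<tau>) powr (d / 2 - 1)) = ennreal (d / 2 * u powr (d / 2 - 1)) * ennreal (shift_weight d \<tau> u)"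
        by (simp only:) (rule ennreal_mult', simp)
      moreover have "indicator {0<..} (u - \<tau>) = (1::ennreal)" "indicator {0<..} u = (1::ennreal)" using True \<tau> by auto
      ultimately show ?thesis by (simp only: mult_ac mult_1_left)
    next
      case False
      then have "indicator {0<..} (u - \<tau>) = (0::ennreal)" by simp
      moreover have "ennreal (shift_weight d \<tau> u) = 0" using False by (simp add: shift_weight_def)
      ultimately show ?thesis by (simp only: mult_zero_right mult_zero_left)
    qed
  qed
  also have "\<dots> = (\<integral>\<^sup>+t. ennreal (bump t ^ m) * ennreal (shift_weight d \<tau> t) \<partial>radial d)"
    unfolding radial_def by (rule nn_integral_density[symmetric]) measurable
  also have "\<dots> = bump_mass d m * ((\<integral>\<^sup>+t. ennreal (bump t ^ m) * ennreal (shift_weight d \<tau> t) \<partial>radial d) / bump_mass d m)"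
    using G by (simp add: ennreal_times_divide) (metis ennreal_mult_divide_eq infinity_ennreal_def mult.commute)
  finally show ?thesis by (subst nn_integral_bump_law) measurable
qed

lemma nn_integral_PiM_radial_bump_law:
  assumes d: "2 \<le> d" and m: "0 < m" and [measurable]: "\<Phi> \<in> borel_measurable (\<Pi>\<^sub>M i\<in>{..<n::nat}. borel)"
  shows "(\<integral>\<^sup>+t. \<Phi> t * (\<Prod>i<n. ennreal (bump (t i) ^ m)) \<partial>(\<Pi>\<^sub>M i\<in>{..<n}. radial d))
    = bump_mass d m ^ n * (\<integral>\<^sup>+t. \<Phi> t \<partial>(\<Pi>\<^sub>M i\<in>{..<n}. bump_law d m))"
proof -
  have G: "bump_mass d m \<noteq> 0" "bump_mass d m \<noteq> \<infinity>" using bump_mass_bounds(1)[OF d, of m] bump_mass_bounds(2)[OF d m] by auto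
  have R: "product_sigma_finite (\<lambda>_::nat. radial d)"
    using sigma_finite_radial[of d] d by (simp add: product_sigma_finite_def)
  have sets: "sets (\<Pi>\<^sub>M i\<in>{..<n}. radial d) = sets (\<Pi>\<^sub>M i\<in>{..<n}. borel :: real measure)"
    by (intro sets_PiM_cong) auto
  have \<Phi>[measurable]: "\<Phi> \<in> borel_measurable (\<Pi>\<^sub>M i\<in>{..<n}. radial d)"
    using assms(3) by (simp cong: measurable_cong_sets add: sets)
  have "(\<Pi>\<^sub>M i\<in>{..<n}. bump_law d m) = density (\<Pi>\<^sub>M i\<in>{..<n}. radial d) (\<lambda>t. \<Prod>i<n. ennreal (bump (t i) ^ m) / bump_mass d m)"
    unfolding bump_law_def using bump_law_product_sigma_finite[OF d m] by (intro PiM_density R) (auto simp: bump_law_def)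
  then have "(\<integral>\<^sup>+t. \<Phi> t \<partial>(\<Pi>\<^sub>M i\<in>{..<n}. bump_law d m))
    = (\<integral>\<^sup>+t. (\<Prod>i<n. ennreal (bump (t i) ^ m) / bump_mass d m) * \<Phi> t \<partial>(\<Pi>\<^sub>M i\<in>{..<n}. radial d))"
    by (simp only:) (rule nn_integral_density, measurable)
  also have "bump_mass d m ^ n * \<dots> = (\<integral>\<^sup>+t. bump_mass d m ^ n * ((\<Prod>i<n. ennreal (bump (t i) ^ m) / bump_mass d m) * \<Phi> t) \<partial>(\<Pi>\<^sub>M i\<in>{..<n}. radial d))"
    by (rule nn_integral_cmult[symmetric]) measurable
  also have "\<dots> = (\<integral>\<^sup>+t. \<Phi> t * (\<Prod>i<n. ennreal (bump (t i) ^ m)) \<partial>(\<Pi>\<^sub>M i\<in>{..<n}. radial d))"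
  proof (rule nn_integral_cong)
    fix t :: "nat \<Rightarrow> real"
    have 1: "bump_mass d m * (ennreal (bump (t i) ^ m) / bump_mass d m) = ennreal (bump (t i) ^ m)" for i
      using G by (metis ennreal_mult_divide_eq ennreal_times_divide infinity_ennreal_def mult.commute)
    have "bump_mass d m ^ n * (\<Prod>i<n. ennreal (bump (t i) ^ m) / bump_mass d m) = (\<Prod>i<n. bump_mass d m * (ennreal (bump (t i) ^ m) / bump_mass d m))"
      by (simp only: prod.distrib prod_constant card_lessThan)
    then show "bump_mass d m ^ n * ((\<Prod>i<n. ennreal (bump (t i) ^ m) / bump_mass d m) * \<Phi> t) = \<Phi> t * (\<Prod>i<n. ennreal (bump (t i) ^ m))"
      by (simp only: 1 mult.assoc[symmetric]) (simp only: mult.commute)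
  qed
  finally show ?thesis ..
qed

lemma sqrt_nsq_dir: "j < d \<Longrightarrow> sqrt (nsq d x) * dir d x j = x j"
proof (cases "nsq d x = 0")
  case True
  moreover assume "j < d"
  ultimately have "x j = 0" by (simp add: nsq_def sum_nonneg_eq_0_iff)
  with True show ?thesis by simp
next
  case False
  assume "j < d"
  with False show ?thesis by (simp add: dir_def euclid_norm_nsq)
qed

lemma sphere_coord_measurable:
  assumes "i \<in> I"
  shows "(\<lambda>\<theta>. \<theta> i j) \<in> borel_measurable (\<Pi>\<^sub>M i\<in>I. uniform_sphere d)"
proof -
  have "(\<lambda>y. y j) \<in> borel_measurable (uniform_sphere d)"
    using measurable_coord[of j] by (simp cong: measurable_cong_sets)
  from measurable_compose[OF measurable_component_singleton[OF assms] this] show ?thesis .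
qed

lemma plane_dist_polar_measurable:
  "(\<lambda>p. plane_dist d (\<lambda>i j. sqrt (snd p i) * fst p i j) a)
    \<in> borel_measurable ((\<Pi>\<^sub>M i\<in>{..<d}. uniform_sphere d) \<Otimes>\<^sub>M (\<Pi>\<^sub>M i\<in>{..<d}. borel))"
proof (rule plane_dist_measurable)
  fix i j assume ij: "i < d" "j < d"
  have [measurable]: "(\<lambda>\<theta>. \<theta> i j) \<in> borel_measurable (\<Pi>\<^sub>M i\<in>{..<d}. uniform_sphere d)"
    using ij by (intro sphere_coord_measurable) simp
  have [measurable]: "i \<in> {..<d}" using ij by simp
  show "(\<lambda>p. sqrt (snd p i) * fst p i j) \<in> borel_measurable ((\<Pi>\<^sub>M i\<in>{..<d}. uniform_sphere d) \<Otimes>\<^sub>M (\<Pi>\<^sub>M i\<in>{..<d}. borel))"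
    by measurable
qed

text \<open>Every row is written as \<open>sqrt (t i) * \<theta> i\<close>; the weights involve the
  radii only and turn the radial measures into multiples of \<open>bump_law\<close>.\<close>

lemma height_moment_lhs:
  assumes d: "2 \<le> d" and m: "0 < m"
  shows "(\<integral>\<^sup>+x. ennreal (plane_dist d x (\<lambda>_. 1) ^ (2 * q) * (\<Prod>i<d. bump (nsq d (x i)) ^ m)) \<partial>(\<Pi>\<^sub>M i\<in>{..<d}. leb {..<d}))
    = bump_mass d m ^ d * (\<integral>\<^sup>+t. \<integral>\<^sup>+\<theta>. ennreal (plane_dist d (\<lambda>i j. sqrt (t i) * \<theta> i j) (\<lambda>_. 1) ^ (2 * q))
      \<partial>(\<Pi>\<^sub>M i\<in>{..<d}. uniform_sphere d) \<partial>(\<Pi>\<^sub>M i\<in>{..<d}. bump_law d m))"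
proof -
  interpret S: prob_space "\<Pi>\<^sub>M i\<in>{..<d}. uniform_sphere d" by (intro prob_space_PiM prob_space_uniform_sphere)
  let ?h = "\<lambda>p. ennreal (plane_dist d (\<lambda>i j. sqrt (snd p i) * fst p i j) (\<lambda>_. 1) ^ (2 * q))"
  let ?G = "\<lambda>p. ?h p * (\<Prod>i<d. ennreal (bump (snd p i) ^ m))"
  have [measurable]: "(\<lambda>p. plane_dist d (\<lambda>i j. sqrt (snd p i) * fst p i j) (\<lambda>_. 1))
    \<in> borel_measurable ((\<Pi>\<^sub>M i\<in>{..<d}. uniform_sphere d) \<Otimes>\<^sub>M (\<Pi>\<^sub>M i\<in>{..<d}. borel))" by (rule plane_dist_polar_measurable)
  have setsR: "sets ((\<Pi>\<^sub>M i\<in>{..<d}. uniform_sphere d) \<Otimes>\<^sub>M (\<Pi>\<^sub>M i\<in>{..<d}. radial d))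
    = sets ((\<Pi>\<^sub>M i\<in>{..<d}. uniform_sphere d) \<Otimes>\<^sub>M (\<Pi>\<^sub>M i\<in>{..<d}. borel))"
    by (intro sets_pair_measure_cong sets_PiM_cong) auto
  have G: "?G \<in> borel_measurable ((\<Pi>\<^sub>M i\<in>{..<d}. uniform_sphere d) \<Otimes>\<^sub>M (\<Pi>\<^sub>M i\<in>{..<d}. borel))"
    by measurable
  have h': "(\<lambda>\<theta>. ennreal (plane_dist d (\<lambda>i j. sqrt (t i) * \<theta> i j) (\<lambda>_. 1) ^ (2 * q))) \<in> borel_measurable (\<Pi>\<^sub>M i\<in>{..<d}. uniform_sphere d)"
    if "t \<in> space (\<Pi>\<^sub>M i\<in>{..<d}. borel)" for t
  proof -
    have "(\<lambda>\<theta>. plane_dist d (\<lambda>i j. sqrt (t i) * \<theta> i j) (\<lambda>_. 1)) \<in> borel_measurable (\<Pi>\<^sub>M i\<in>{..<d}. uniform_sphere d)"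
      by (intro plane_dist_measurable borel_measurable_times borel_measurable_const sphere_coord_measurable) simp
    then show ?thesis by measurable
  qed
  have "(\<integral>\<^sup>+x. ennreal (plane_dist d x (\<lambda>_. 1) ^ (2 * q) * (\<Prod>i<d. bump (nsq d (x i)) ^ m)) \<partial>(\<Pi>\<^sub>M i\<in>{..<d}. leb {..<d}))
    = (\<integral>\<^sup>+x. ?G (\<lambda>i\<in>{..<d}. dir d (x i), \<lambda>i\<in>{..<d}. nsq d (x i)) \<partial>(\<Pi>\<^sub>M i\<in>{..<d}. leb {..<d}))"
  proof (rule nn_integral_cong)
    fix x :: "nat \<Rightarrow> nat \<Rightarrow> real"
    have "plane_dist d (\<lambda>i j. sqrt ((\<lambda>i\<in>{..<d}. nsq d (x i)) i) * (\<lambda>i\<in>{..<d}. dir d (x i)) i j) (\<lambda>_. 1) = plane_dist d x (\<lambda>_. 1)"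
      by (rule plane_dist_cong) (simp_all add: sqrt_nsq_dir)
    moreover have "(\<Prod>i<d. ennreal (bump ((\<lambda>i\<in>{..<d}. nsq d (x i)) i) ^ m)) = ennreal (\<Prod>i<d. bump (nsq d (x i)) ^ m)"
      by (subst prod_ennreal[symmetric]) (auto intro!: prod.cong simp: bump_nonneg nsq_nonneg)
    ultimately show "ennreal (plane_dist d x (\<lambda>_. 1) ^ (2 * q) * (\<Prod>i<d. bump (nsq d (x i)) ^ m))
      = ?G (\<lambda>i\<in>{..<d}. dir d (x i), \<lambda>i\<in>{..<d}. nsq d (x i))"
      by (simp only: fst_conv snd_conv ennreal_mult' plane_dist_nonneg zero_le_power)
  qed
  also have "\<dots> = (\<integral>\<^sup>+t. \<integral>\<^sup>+\<theta>. ?G (\<theta>, t) \<partial>(\<Pi>\<^sub>M i\<in>{..<d}. uniform_sphere d) \<partial>(\<Pi>\<^sub>M i\<in>{..<d}. radial d))"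
  proof (rule nn_integral_PiM_pair)
    show "sigma_finite_measure (uniform_sphere d)"
      by (rule prob_space_imp_sigma_finite[OF prob_space_uniform_sphere])
    show "sigma_finite_measure (radial d)" using d by (intro sigma_finite_radial) simp
    show "sigma_finite_measure (leb {..<d})" by (rule sigma_finite_leb_nat)
    show "dir d \<in> measurable (leb {..<d}) (uniform_sphere d)" "nsq d \<in> measurable (leb {..<d}) (radial d)"
      by (simp_all cong: measurable_cong_sets)
    have "distr (leb {..<d}) (uniform_sphere d \<Otimes>\<^sub>M radial d) (\<lambda>x. (dir d x, nsq d x)) = distr (leb {..<d}) (borel \<Otimes>\<^sub>M borel) (\<lambda>x. (dir d x, nsq d x))"
      by (intro distr_cong sets_pair_measure_cong) auto
    then show "distr (leb {..<d}) (uniform_sphere d \<Otimes>\<^sub>M radial d) (\<lambda>x. (dir d x, nsq d x)) = uniform_sphere d \<Otimes>\<^sub>M radial d"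
      using distr_leb_polar[of d] d by simp
    show "?G \<in> borel_measurable ((\<Pi>\<^sub>M i\<in>{..<d}. uniform_sphere d) \<Otimes>\<^sub>M (\<Pi>\<^sub>M i\<in>{..<d}. radial d))"
      using G by (simp only: measurable_cong_sets[OF setsR refl])
  qed simp
  also have "\<dots> = (\<integral>\<^sup>+t. (\<integral>\<^sup>+\<theta>. ?h (\<theta>, t) \<partial>(\<Pi>\<^sub>M i\<in>{..<d}. uniform_sphere d)) * (\<Prod>i<d. ennreal (bump (t i) ^ m)) \<partial>(\<Pi>\<^sub>M i\<in>{..<d}. radial d))"
  proof (rule nn_integral_cong)
    fix t assume "t \<in> space (\<Pi>\<^sub>M i\<in>{..<d}. radial d)"
    then have "t \<in> space (\<Pi>\<^sub>M i\<in>{..<d}. borel)" by (simp add: space_PiM)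
    from h'[OF this] show "(\<integral>\<^sup>+\<theta>. ?G (\<theta>, t) \<partial>(\<Pi>\<^sub>M i\<in>{..<d}. uniform_sphere d))
      = (\<integral>\<^sup>+\<theta>. ?h (\<theta>, t) \<partial>(\<Pi>\<^sub>M i\<in>{..<d}. uniform_sphere d)) * (\<Prod>i<d. ennreal (bump (t i) ^ m))"
      by (simp only: fst_conv snd_conv) (rule nn_integral_multc)
  qed
  also have "\<dots> = bump_mass d m ^ d * (\<integral>\<^sup>+t. \<integral>\<^sup>+\<theta>. ?h (\<theta>, t) \<partial>(\<Pi>\<^sub>M i\<in>{..<d}. uniform_sphere d) \<partial>(\<Pi>\<^sub>M i\<in>{..<d}. bump_law d m))"
    by (rule nn_integral_PiM_radial_bump_law[OF d m]) measurable
  finally show ?thesis by simp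
qed

text \<open>The Gaussian identity is extended to powers of \<open>bump\<close> with \<tau> as an
  additional variable of integration. For fixed \<tau> the rows separate and contribute equal
  factors, hence the power \<open>d\<close>.\<close>

lemma height_moment_rhs:
  assumes d: "2 \<le> d" and m: "0 < m" and q: "0 < q"
  shows "(\<integral>\<^sup>+x. ennreal (plane_dist d x (\<lambda>_. 1) ^ (2 * q) * (\<Prod>i<d. bump (nsq d (x i)) ^ m)) \<partial>(\<Pi>\<^sub>M i\<in>{..<d}. leb {..<d}))
    = bump_mass d m ^ d * (\<integral>\<^sup>+\<tau>. indicator {0<..} \<tau> * ennreal (height_const q * \<tau> ^ (q - 1)) * (\<integral>\<^sup>+t. ennreal (shift_weight d \<tau> t) \<partial>bump_law d m) ^ d \<partial>lborel)"
proof -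
  let ?M = "\<Pi>\<^sub>M i\<in>{..<d}. leb {..<d}"
  interpret M: sigma_finite_measure ?M by (rule lebn.sigma_finite) simp
  interpret K: prob_space "bump_law d m" by (rule prob_space_bump_law[OF d m])
  have d0: "0 < d" using d by simp
  define wB where "wB p = indicator {0<..} (fst p) * (height_const q * fst p ^ (q - 1))" for p :: "real \<times> (nat \<Rightarrow> nat \<Rightarrow> real)"
  \<comment> \<open>The maximum keeps the shifted radius nonnegative for negative \<tau> too, where
    \<open>wB\<close> vanishes; thus the combination of exponentials is nonnegative
    everywhere.\<close>
  define tB where "tB i p = nsq d (snd p i) + max (fst p) 0" for i and p :: "real \<times> (nat \<Rightarrow> nat \<Rightarrow> real)"
  have [measurable]: "wB \<in> borel_measurable (lborel \<Otimes>\<^sub>M ?M)" unfolding wB_def by measurable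
  have [measurable]: "tB i \<in> borel_measurable (lborel \<Otimes>\<^sub>M ?M)" if "i \<in> {..<d}" for i
    unfolding tB_def using that by measurable
  have wB0: "0 \<le> wB p" for p unfolding wB_def using height_const_pos[of q] by (auto simp: indicator_def)
  have fst: "(\<integral>\<^sup>+p. ennreal (wB p * (\<Prod>i<d. g (tB i p))) \<partial>(lborel \<Otimes>\<^sub>M ?M))
    = (\<integral>\<^sup>+\<tau>. \<integral>\<^sup>+x. indicator {0<..} \<tau> * ennreal (height_const q * \<tau> ^ (q - 1)) * (\<Prod>i<d. ennreal (g (nsq d (x i) + \<tau>))) \<partial>?M \<partial>lborel)"
    if [measurable]: "g \<in> borel_measurable borel" and g0: "\<And>t. 0 \<le> t \<Longrightarrow> 0 \<le> g t" for g :: "real \<Rightarrow> real"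
  proof -
    have "(\<integral>\<^sup>+p. ennreal (wB p * (\<Prod>i<d. g (tB i p))) \<partial>(lborel \<Otimes>\<^sub>M ?M)) = (\<integral>\<^sup>+\<tau>. \<integral>\<^sup>+x. ennreal (wB (\<tau>, x) * (\<Prod>i<d. g (tB i (\<tau>, x)))) \<partial>?M \<partial>lborel)"
      by (rule M.nn_integral_fst[symmetric]) measurable
    also have "\<dots> = (\<integral>\<^sup>+\<tau>. \<integral>\<^sup>+x. indicator {0<..} \<tau> * ennreal (height_const q * \<tau> ^ (q - 1)) * (\<Prod>i<d. ennreal (g (nsq d (x i) + \<tau>))) \<partial>?M \<partial>lborel)"
    proof (intro nn_integral_cong)
      fix \<tau> :: real and x :: "nat \<Rightarrow> nat \<Rightarrow> real"
      show "ennreal (wB (\<tau>, x) * (\<Prod>i<d. g (tB i (\<tau>, x)))) = indicator {0<..} \<tau> * ennreal (height_const q * \<tau> ^ (q - 1)) * (\<Prod>i<d. ennreal (g (nsq d (x i) + \<tau>)))"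
      proof (cases "0 < \<tau>")
        case True
        then have "(\<Prod>i<d. ennreal (g (nsq d (x i) + \<tau>))) = ennreal (\<Prod>i<d. g (tB i (\<tau>, x)))"
          by (subst prod_ennreal[symmetric]) (auto simp: tB_def intro!: g0 add_nonneg_nonneg nsq_nonneg prod.cong)
        moreover have "0 \<le> height_const q * \<tau> ^ (q - 1)" using True height_const_pos[of q] by simp
        moreover have "wB (\<tau>, x) = height_const q * \<tau> ^ (q - 1)" "indicator {0<..} \<tau> = (1::ennreal)" using True by (auto simp: wB_def)
        ultimately show ?thesis by (simp only: ennreal_mult' mult_1_left)
      next
        case False
        then have "wB (\<tau>, x) = 0" "indicator {0<..} \<tau> = (0::ennreal)" by (auto simp: wB_def)
        then show ?thesis by (simp only: mult_zero_left ennreal_0)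
      qed
    qed
    finally show ?thesis .
  qed
  \<comment> \<open>The rates are doubled because the Gaussian weights are written with
    \<open>s i * nsq d (x i) / 2\<close>.\<close>
  have e1: "ennreal (plane_dist d x (\<lambda>_. 1) ^ (2 * q) * (\<Prod>i<d. exp (- ((ln 2 * real (m + \<kappa> i)) * nsq d (x i)))))
    = ennreal (plane_dist d x (\<lambda>_. 1) ^ (2 * q)) * (\<Prod>i<d. ennreal (exp (- ((2 * ln 2 * real (m + \<kappa> i)) * nsq d (x i) / 2))))" for x and \<kappa> :: "nat \<Rightarrow> nat"
  proof -
    have r: "(2 * ln 2 * r) * y / 2 = ln 2 * r * y" for r y :: real by simp
    show ?thesis unfolding r by (simp only: prod_ennreal[OF exp_ge_zero] ennreal_mult'[OF zero_le_power[OF plane_dist_nonneg]])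
  qed
  have s: "0 < 2 * ln 2 * real (m + \<kappa> i)" for \<kappa> :: "nat \<Rightarrow> nat" and i using m by simp
  have "(\<integral>\<^sup>+x. ennreal (plane_dist d x (\<lambda>_. 1) ^ (2 * q) * (\<Prod>i<d. bump (nsq d (x i)) ^ m)) \<partial>?M)
    = (\<integral>\<^sup>+p. ennreal (wB p * (\<Prod>i<d. bump (tB i p) ^ m)) \<partial>(lborel \<Otimes>\<^sub>M ?M))"
    unfolding bump_power_expansion
  proof (rule nn_integral_exp_combination[where m=m and lam="\<lambda>k. ln 2 * real (m + k)" and b="\<lambda>k. 4 ^ m * real (m choose k) * (- 1) ^ k"])
    fix \<kappa> :: "nat \<Rightarrow> nat"
    show "(\<integral>\<^sup>+x. ennreal (plane_dist d x (\<lambda>_. 1) ^ (2 * q) * (\<Prod>i<d. exp (- ((ln 2 * real (m + \<kappa> i)) * nsq d (x i))))) \<partial>?M)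
      = (\<integral>\<^sup>+p. ennreal (wB p * (\<Prod>i<d. exp (- ((ln 2 * real (m + \<kappa> i)) * tB i p)))) \<partial>(lborel \<Otimes>\<^sub>M ?M))"
    proof -
      have "(\<integral>\<^sup>+p. ennreal (wB p * (\<Prod>i<d. exp (- ((ln 2 * real (m + \<kappa> i)) * tB i p)))) \<partial>(lborel \<Otimes>\<^sub>M ?M))
        = (\<integral>\<^sup>+\<tau>. \<integral>\<^sup>+x. ennreal (wB (\<tau>, x) * (\<Prod>i<d. exp (- ((ln 2 * real (m + \<kappa> i)) * tB i (\<tau>, x))))) \<partial>?M \<partial>lborel)"
        by (rule M.nn_integral_fst[symmetric]) measurable
      also have "\<dots> = (\<integral>\<^sup>+\<tau>. \<integral>\<^sup>+x. indicator {0<..} \<tau> * ennreal (height_const q * \<tau> ^ (q - 1)) *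
        (\<Prod>i<d. ennreal (exp (- ((2 * ln 2 * real (m + \<kappa> i)) * (nsq d (x i) + \<tau>) / 2)))) \<partial>?M \<partial>lborel)"
      proof (intro nn_integral_cong)
        fix \<tau> :: real and x :: "nat \<Rightarrow> nat \<Rightarrow> real"
        show "ennreal (wB (\<tau>, x) * (\<Prod>i<d. exp (- ((ln 2 * real (m + \<kappa> i)) * tB i (\<tau>, x)))))
          = indicator {0<..} \<tau> * ennreal (height_const q * \<tau> ^ (q - 1)) * (\<Prod>i<d. ennreal (exp (- ((2 * ln 2 * real (m + \<kappa> i)) * (nsq d (x i) + \<tau>) / 2))))"
        proof (cases "0 < \<tau>")
          case True
          then have "(\<Prod>i<d. ennreal (exp (- ((2 * ln 2 * real (m + \<kappa> i)) * (nsq d (x i) + \<tau>) / 2)))) = ennreal (\<Prod>i<d. exp (- ((ln 2 * real (m + \<kappa> i)) * tB i (\<tau>, x))))"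
            by (subst prod_ennreal[symmetric]) (auto simp: tB_def intro!: prod.cong)
          moreover have "0 \<le> height_const q * \<tau> ^ (q - 1)" using True height_const_pos[of q] by simp
          moreover have "wB (\<tau>, x) = height_const q * \<tau> ^ (q - 1)" "indicator {0<..} \<tau> = (1::ennreal)" using True by (auto simp: wB_def)
          ultimately show ?thesis by (simp only: ennreal_mult' mult_1_left)
        next
          case False
          then have "wB (\<tau>, x) = 0" "indicator {0<..} \<tau> = (0::ennreal)" by (auto simp: wB_def)
          then show ?thesis by (simp only: mult_zero_left ennreal_0)
        qed
      qed
      finally show ?thesis
        unfolding e1 using nn_integral_height_moment_gauss(1)[OF d0 q s[of \<kappa>]] by simp
    qed
    show "(\<integral>\<^sup>+x. ennreal (plane_dist d x (\<lambda>_. 1) ^ (2 * q) * (\<Prod>i<d. exp (- ((ln 2 * real (m + \<kappa> i)) * nsq d (x i))))) \<partial>?M) < \<infinity>"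
      unfolding e1 by (rule nn_integral_height_moment_gauss(2)[OF d0 q s])
  next
    show "(\<lambda>x. plane_dist d x (\<lambda>_. 1) ^ (2 * q)) \<in> borel_measurable ?M" by measurable
    show "0 \<le> (\<Sum>k\<le>m. 4 ^ m * real (m choose k) * (- 1) ^ k * exp (- (ln 2 * real (m + k) * nsq d (x i))))" for x :: "nat \<Rightarrow> nat \<Rightarrow> real" and i
      unfolding bump_power_expansion[symmetric] by (intro zero_le_power bump_nonneg nsq_nonneg)
    show "0 \<le> (\<Sum>k\<le>m. 4 ^ m * real (m choose k) * (- 1) ^ k * exp (- (ln 2 * real (m + k) * tB i p)))" for p i
      unfolding bump_power_expansion[symmetric] by (intro zero_le_power bump_nonneg) (simp add: tB_def nsq_nonneg)
  qed (auto simp: wB0 plane_dist_nonneg)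
  also have "\<dots> = (\<integral>\<^sup>+\<tau>. \<integral>\<^sup>+x. indicator {0<..} \<tau> * ennreal (height_const q * \<tau> ^ (q - 1)) * (\<Prod>i<d. ennreal (bump (nsq d (x i) + \<tau>) ^ m)) \<partial>?M \<partial>lborel)"
    by (rule fst) (auto simp: bump_nonneg)
  also have "\<dots> = (\<integral>\<^sup>+\<tau>. bump_mass d m ^ d * (indicator {0<..} \<tau> * ennreal (height_const q * \<tau> ^ (q - 1)) * (\<integral>\<^sup>+t. ennreal (shift_weight d \<tau> t) \<partial>bump_law d m) ^ d) \<partial>lborel)"
  proof (rule nn_integral_cong)
    fix \<tau> :: real
    show "(\<integral>\<^sup>+x. indicator {0<..} \<tau> * ennreal (height_const q * \<tau> ^ (q - 1)) * (\<Prod>i<d. ennreal (bump (nsq d (x i) + \<tau>) ^ m)) \<partial>?M)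
      = bump_mass d m ^ d * (indicator {0<..} \<tau> * ennreal (height_const q * \<tau> ^ (q - 1)) * (\<integral>\<^sup>+t. ennreal (shift_weight d \<tau> t) \<partial>bump_law d m) ^ d)"
    proof (cases "0 < \<tau>")
      case True
      have "(\<integral>\<^sup>+x. (\<Prod>i<d. ennreal (bump (nsq d (x i) + \<tau>) ^ m)) \<partial>?M) = (\<Prod>i<d. \<integral>\<^sup>+y. ennreal (bump (nsq d y + \<tau>) ^ m) \<partial>leb {..<d})"
        by (rule lebn.product_nn_integral_prod) measurable
      also have "(\<integral>\<^sup>+y. ennreal (bump (nsq d y + \<tau>) ^ m) \<partial>leb {..<d}) = (\<integral>\<^sup>+t. ennreal (bump (t + \<tau>) ^ m) \<partial>radial d)"
        by (rule nn_integral_leb_radial[OF d0]) measurable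
      also have "\<dots> = bump_mass d m * (\<integral>\<^sup>+t. ennreal (shift_weight d \<tau> t) \<partial>bump_law d m)"
        using True by (intro radial_shift[OF d _ m]) simp
      finally have P: "(\<integral>\<^sup>+x. (\<Prod>i<d. ennreal (bump (nsq d (x i) + \<tau>) ^ m)) \<partial>?M) = bump_mass d m ^ d * (\<integral>\<^sup>+t. ennreal (shift_weight d \<tau> t) \<partial>bump_law d m) ^ d"
        by (simp add: power_mult_distrib)
      have "(\<integral>\<^sup>+x. indicator {0<..} \<tau> * ennreal (height_const q * \<tau> ^ (q - 1)) * (\<Prod>i<d. ennreal (bump (nsq d (x i) + \<tau>) ^ m)) \<partial>?M)
        = indicator {0<..} \<tau> * ennreal (height_const q * \<tau> ^ (q - 1)) * (\<integral>\<^sup>+x. (\<Prod>i<d. ennreal (bump (nsq d (x i) + \<tau>) ^ m)) \<partial>?M)"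
        by (rule nn_integral_cmult) measurable
      then show ?thesis unfolding P by (simp only: mult_ac)
    qed simp
  qed
  also have "\<dots> = bump_mass d m ^ d * (\<integral>\<^sup>+\<tau>. indicator {0<..} \<tau> * ennreal (height_const q * \<tau> ^ (q - 1)) * (\<integral>\<^sup>+t. ennreal (shift_weight d \<tau> t) \<partial>bump_law d m) ^ d \<partial>lborel)"
  proof (rule nn_integral_cmult)
    have [measurable]: "(\<lambda>\<tau>. \<integral>\<^sup>+t. ennreal (shift_weight d \<tau> t) \<partial>bump_law d m) \<in> borel_measurable lborel"
      using K.borel_measurable_nn_integral_fst[of "\<lambda>p. ennreal (shift_weight d (fst p) (snd p))" lborel] by simp
    show "(\<lambda>\<tau>. indicator {0<..} \<tau> * ennreal (height_const q * \<tau> ^ (q - 1)) * (\<integral>\<^sup>+t. ennreal (shift_weight d \<tau> t) \<partial>bump_law d m) ^ d) \<in> borel_measurable lborel"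
      by measurable
  qed
  finally show ?thesis .
qed

section \<open>The distance for rows on the sphere\<close>

lemma AE_uniform_sphere_nsq:
  assumes d: "0 < d"
  shows "AE \<theta> in uniform_sphere d. nsq d \<theta> = 1"
proof (rule AE_I)
  show "{\<theta> \<in> space (uniform_sphere d). nsq d \<theta> \<noteq> 1} \<subseteq> {\<theta>. nsq d \<theta> \<noteq> 1}" by auto
  show N: "{\<theta>. nsq d \<theta> \<noteq> 1} \<in> sets (uniform_sphere d)" by simp
  have d': "0 \<in> {..<d}" using d by simp
  have "emeasure (leb {..<d}) {x \<in> space (leb {..<d}). nsq d x \<le> 1 \<and> dir d x \<in> {\<theta>. nsq d \<theta> \<noteq> 1}} = 0"
  proof (rule emeasure_eq_0[OF _ emeasure_leb_zero_coord[OF d]])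
    show "{x \<in> space (leb {..<d}). x 0 \<in> {0}} \<in> sets (leb {..<d})" using d' by measurable
    show "{x \<in> space (leb {..<d}). nsq d x \<le> 1 \<and> dir d x \<in> {\<theta>. nsq d \<theta> \<noteq> 1}} \<subseteq> {x \<in> space (leb {..<d}). x 0 \<in> {0}}"
    proof
      fix x assume x: "x \<in> {x \<in> space (leb {..<d}). nsq d x \<le> 1 \<and> dir d x \<in> {\<theta>. nsq d \<theta> \<noteq> 1}}"
      have "nsq d (dir d x) = (\<Sum>i<d. (x i)\<^sup>2 / nsq d x)"
        unfolding nsq_def[of d "dir d x"] by (intro sum.cong refl) (simp add: dir_def euclid_norm_nsq power_divide nsq_nonneg)
      also have "\<dots> = nsq d x / nsq d x" by (simp only: sum_divide_distrib[symmetric] nsq_def)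
      finally have "nsq d x = 0" using x by (cases "nsq d x = 0") auto
      then have "x 0 = 0" using d by (simp add: nsq_def sum_nonneg_eq_0_iff)
      with x show "x \<in> {x \<in> space (leb {..<d}). x 0 \<in> {0}}" by simp
    qed
  qed
  then show "emeasure (uniform_sphere d) {\<theta>. nsq d \<theta> \<noteq> 1} = 0"
    using N by (subst emeasure_uniform_sphere) auto
qed

lemma row_det_sphere_measurable[measurable]: "row_det d \<in> borel_measurable (\<Pi>\<^sub>M i\<in>{..<d}. uniform_sphere d)"
  by (rule row_det_measurable, rule sphere_coord_measurable) simp

lemma plane_dist_sphere_measurable[measurable]: "(\<lambda>\<theta>. plane_dist d \<theta> a) \<in> borel_measurable (\<Pi>\<^sub>M i\<in>{..<d}. uniform_sphere d)"
  by (rule plane_dist_measurable, rule sphere_coord_measurable) simp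

text \<open>Scaling rows by their lengths cannot make a matrix singular or nonsingular except at
  zero rows. Polar coordinates thus express the null integral for Lebesgue rows as the spherical
  probability times the total mass of the radial product, which is not 0.\<close>

lemma AE_sphere_row_det:
  assumes d: "0 < d"
  shows "AE \<theta> in \<Pi>\<^sub>M i\<in>{..<d}. uniform_sphere d. row_det d \<theta> \<noteq> 0"
proof -
  have R: "sigma_finite_measure (radial d)" by (rule sigma_finite_radial[OF d])
  interpret R: product_sigma_finite "\<lambda>_::nat. radial d" using R by (simp add: product_sigma_finite_def)
  let ?S = "\<Pi>\<^sub>M i\<in>{..<d}. uniform_sphere d"
  let ?G = "\<lambda>p. indicator {0} (row_det d (fst p)) :: ennreal"
  have Gm: "?G \<in> borel_measurable (?S \<Otimes>\<^sub>M (\<Pi>\<^sub>M i\<in>{..<d}. radial d))" by measurable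
  have "(\<integral>\<^sup>+x. ?G (\<lambda>i\<in>{..<d}. dir d (x i), \<lambda>i\<in>{..<d}. nsq d (x i)) \<partial>(\<Pi>\<^sub>M i\<in>{..<d}. leb {..<d}))
    = (\<integral>\<^sup>+t. \<integral>\<^sup>+\<theta>. ?G (\<theta>, t) \<partial>?S \<partial>(\<Pi>\<^sub>M i\<in>{..<d}. radial d))"
  proof (rule nn_integral_PiM_pair)
    show "sigma_finite_measure (uniform_sphere d)"
      by (rule prob_space_imp_sigma_finite[OF prob_space_uniform_sphere])
    show "sigma_finite_measure (leb {..<d})" by (rule sigma_finite_leb_nat)
    show "dir d \<in> measurable (leb {..<d}) (uniform_sphere d)" "nsq d \<in> measurable (leb {..<d}) (radial d)"
      by (simp_all cong: measurable_cong_sets)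
    have "distr (leb {..<d}) (uniform_sphere d \<Otimes>\<^sub>M radial d) (\<lambda>x. (dir d x, nsq d x)) = distr (leb {..<d}) (borel \<Otimes>\<^sub>M borel) (\<lambda>x. (dir d x, nsq d x))"
      by (intro distr_cong sets_pair_measure_cong) auto
    then show "distr (leb {..<d}) (uniform_sphere d \<Otimes>\<^sub>M radial d) (\<lambda>x. (dir d x, nsq d x)) = uniform_sphere d \<Otimes>\<^sub>M radial d"
      using distr_leb_polar[OF d] by simp
    show "sigma_finite_measure (radial d)" by (rule R)
    show "?G \<in> borel_measurable (?S \<Otimes>\<^sub>M (\<Pi>\<^sub>M i\<in>{..<d}. radial d))" by (rule Gm)
  qed simp
  moreover have "(\<integral>\<^sup>+x. ?G (\<lambda>i\<in>{..<d}. dir d (x i), \<lambda>i\<in>{..<d}. nsq d (x i)) \<partial>(\<Pi>\<^sub>M i\<in>{..<d}. leb {..<d})) = (\<integral>\<^sup>+x. 0 \<partial>(\<Pi>\<^sub>M i\<in>{..<d}. leb {..<d}))"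
  proof (rule nn_integral_cong_AE)
    show "AE x in \<Pi>\<^sub>M i\<in>{..<d}. leb {..<d}. ?G (\<lambda>i\<in>{..<d}. dir d (x i), \<lambda>i\<in>{..<d}. nsq d (x i)) = 0"
      using AE_nested_row_det[of d]
    proof eventually_elim
      case (elim x)
      have "row_det d (\<lambda>i\<in>{..<d}. dir d (x i)) \<noteq> 0"
      proof
        assume "row_det d (\<lambda>i\<in>{..<d}. dir d (x i)) = 0"
        then obtain w where w: "\<exists>j<d. w j \<noteq> 0" "\<And>i. i < d \<Longrightarrow> (\<Sum>j<d. dir d (x i) j * w j) = 0"
          unfolding row_det_eq_0_iff by auto
        have "(\<Sum>j<d. x i j * w j) = 0" if "i < d" for i
        proof -
          have "(\<Sum>j<d. x i j * w j) = (\<Sum>j<d. sqrt (nsq d (x i)) * (dir d (x i) j * w j))"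
            by (intro sum.cong refl) (simp add: sqrt_nsq_dir mult.assoc[symmetric])
          also have "\<dots> = 0" using w(2)[OF that] by (simp add: sum_distrib_left[symmetric])
          finally show ?thesis .
        qed
        with w(1) elim show False unfolding row_det_eq_0_iff by blast
      qed
      then show ?case by simp
    qed
  qed
  ultimately have "(\<integral>\<^sup>+\<theta>. indicator {0} (row_det d \<theta>) \<partial>?S) * emeasure (\<Pi>\<^sub>M i\<in>{..<d}. radial d) (space (\<Pi>\<^sub>M i\<in>{..<d}. radial d)) = 0"
    by simp
  moreover have "emeasure (\<Pi>\<^sub>M i\<in>{..<d}. radial d) (space (\<Pi>\<^sub>M i\<in>{..<d}. radial d)) \<noteq> 0"
  proof -
    have "emeasure (radial d) {1<..2} \<le> emeasure (radial d) UNIV" by (rule emeasure_mono) auto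
    moreover have "0 < emeasure (radial d) {1<..2}" by (rule radial_interval_pos[OF d]) auto
    ultimately have "emeasure (radial d) UNIV \<noteq> 0" by (metis less_le_trans less_numeral_extra(3))
    moreover have "emeasure (\<Pi>\<^sub>M i\<in>{..<d}. radial d) (space (\<Pi>\<^sub>M i\<in>{..<d}. radial d)) = emeasure (radial d) UNIV ^ d"
      unfolding space_PiM by (subst R.emeasure_PiM) simp_all
    ultimately show ?thesis by simp
  qed
  ultimately have "(\<integral>\<^sup>+\<theta>. indicator {0} (row_det d \<theta>) \<partial>?S) = (0::ennreal)" by simp
  then have "AE \<theta> in ?S. indicator {0} (row_det d \<theta>) = (0::ennreal)"
    by (subst (asm) nn_integral_0_iff_AE) auto
  then show ?thesis by eventually_elim (auto simp: indicator_def split: if_splits)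
qed

section \<open>Letting the squared radii tend to 1\<close>

text \<open>Cauchy-Schwarz for \<open>1 = <x i, w>\<close>: a hyperplane is no farther from the
  origin than any of its points. In the singular case the distance is 0 by definition.\<close>

lemma plane_dist_le_norm:
  assumes i: "i < d"
  shows "(plane_dist d x (\<lambda>_. 1))\<^sup>2 \<le> nsq d (x i)"
proof (cases "row_det d x = 0")
  case True
  then show ?thesis by (simp add: plane_dist_def nsq_nonneg)
next
  case False
  let ?w = "sol d x (\<lambda>_. 1)"
  have "1 = (\<Sum>j<d. x i j * ?w j)\<^sup>2" by (simp add: sol[OF False i])
  also have "\<dots> \<le> nsq d (x i) * nsq d ?w" unfolding nsq_def by (rule Cauchy_Schwarz_ineq_sum)
  finally have le: "1 \<le> nsq d (x i) * nsq d ?w" .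
  then have "0 < nsq d ?w" using nsq_nonneg[of d ?w] by (cases "nsq d ?w = 0") auto
  moreover have h2: "(plane_dist d x (\<lambda>_. 1))\<^sup>2 = 1 / nsq d ?w"
    by (subst plane_dist_eq[OF False, of ?w]) (auto simp: sol[OF False] power_divide nsq_nonneg)
  ultimately show ?thesis using le unfolding h2 by (simp add: pos_divide_le_eq)
qed

lemma plane_dist_denominator_pos:
  assumes "row_det d x \<noteq> 0" "0 < d"
  shows "0 < (\<Sum>j<d. (\<Sum>i<d. row_cof d x i j * 1)\<^sup>2)"
proof (rule ccontr)
  assume "\<not> ?thesis"
  moreover have "0 \<le> (\<Sum>j<d. (\<Sum>i<d. row_cof d x i j * 1)\<^sup>2)" by (intro sum_nonneg) simp
  ultimately have "(\<Sum>j<d. (\<Sum>i<d. row_cof d x i j * 1)\<^sup>2) = 0" by linarith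
  then have "(\<Sum>i<d. row_cof d x i j * 1) = 0" if "j < d" for j
    using that by (simp add: sum_nonneg_eq_0_iff)
  then have "sol d x (\<lambda>_. 1) j = 0" if "j < d" for j using that by (simp add: sol_def)
  then have "(\<Sum>j<d. x 0 j * sol d x (\<lambda>_. 1) j) = 0" by simp
  then show False using sol[OF assms(1,2), of "\<lambda>_. 1"] by simp
qed

text \<open>The radii are moved to the right side as \<open>1 / sqrt (t n i)\<close>. The matrix is
  then fixed, and Cramer's formula is continuous in the right side as long as its denominator is not
  0.\<close>

lemma plane_dist_radii_tendsto:
  assumes x: "row_det d x \<noteq> 0" and d: "0 < d" and t: "\<And>i. i < d \<Longrightarrow> (\<lambda>n. t n i) \<longlonglongrightarrow> 1"
    and tpos: "\<And>n i. i < d \<Longrightarrow> 0 < t n i"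
  shows "(\<lambda>n. plane_dist d (\<lambda>i j. sqrt (t n i) * x i j) (\<lambda>_. 1)) \<longlonglongrightarrow> plane_dist d x (\<lambda>_. 1)"
proof -
  have eq: "plane_dist d (\<lambda>i j. sqrt (t n i) * x i j) (\<lambda>_. 1) = plane_dist d x (\<lambda>i. 1 / sqrt (t n i))" for n
  proof -
    have "plane_dist d (\<lambda>i j. sqrt (t n i) * x i j) (\<lambda>_. 1) = plane_dist d (\<lambda>i j. sqrt (t n i) * x i j) (\<lambda>i. sqrt (t n i) * (1 / sqrt (t n i)))"
      using tpos by (intro plane_dist_cong) (auto simp: less_imp_neq[symmetric])
    also have "\<dots> = plane_dist d x (\<lambda>i. 1 / sqrt (t n i))"
      using tpos by (intro plane_dist_scale_rows x) (auto simp: less_imp_neq[symmetric])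
    finally show ?thesis .
  qed
  have lim: "(\<lambda>n. 1 / sqrt (t n i)) \<longlonglongrightarrow> 1" if "i < d" for i
    using tendsto_divide[OF tendsto_const tendsto_real_sqrt[OF t[OF that]], of 1] by simp
  have "sqrt (\<Sum>j<d. (\<Sum>i<d. row_cof d x i j * 1)\<^sup>2) \<noteq> 0"
    by (rule less_imp_neq[OF real_sqrt_gt_zero[OF plane_dist_denominator_pos[OF x d]], symmetric])
  then show ?thesis
    unfolding eq unfolding plane_dist_def
    by (intro tendsto_divide tendsto_const tendsto_real_sqrt tendsto_sum tendsto_power tendsto_mult lim) auto
qed

text \<open>The uniform form that the concentration argument needs; it follows from the sequential
  one by choosing a counterexample for each \<open>1 / Suc n\<close>.\<close>

lemma plane_dist_radii_continuous:
  assumes x: "row_det d x \<noteq> 0" and d: "0 < d" and e: "0 < e"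
  shows "\<exists>\<delta>>0. \<forall>t. (\<forall>i\<in>{..<d}. \<bar>t i - 1\<bar> < \<delta>) \<longrightarrow>
    \<bar>plane_dist d (\<lambda>i j. sqrt (t i) * x i j) (\<lambda>_. 1) ^ k - plane_dist d x (\<lambda>_. 1) ^ k\<bar> \<le> e"
proof (rule ccontr)
  assume neg: "\<not> ?thesis"
  define far where "far t \<longleftrightarrow> e < \<bar>plane_dist d (\<lambda>i j. sqrt (t i) * x i j) (\<lambda>_. 1) ^ k - plane_dist d x (\<lambda>_. 1) ^ k\<bar>" for t
  have "\<exists>t. (\<forall>i\<in>{..<d}. \<bar>t i - 1\<bar> < \<delta>) \<and> far t" if "0 < \<delta>" for \<delta>
    using neg that unfolding far_def not_le[symmetric] by blast
  then have "\<forall>n. \<exists>t. (\<forall>i\<in>{..<d}. \<bar>t i - 1\<bar> < 1 / real (Suc n)) \<and> far t" by simp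
  then obtain t where t': "\<forall>n. (\<forall>i\<in>{..<d}. \<bar>t n i - 1\<bar> < 1 / real (Suc n)) \<and> far (t n)"
    by (rule choice[THEN exE])
  then have t: "\<bar>t n i - 1\<bar> < 1 / real (Suc n)" if "i < d" for n i using that by blast
  have far: "e < \<bar>plane_dist d (\<lambda>i j. sqrt (t n i) * x i j) (\<lambda>_. 1) ^ k - plane_dist d x (\<lambda>_. 1) ^ k\<bar>" for n
    using t' unfolding far_def by blast
  have "0 < t n i" if "i < d" for n i
  proof -
    have "1 / real (Suc n) \<le> 1" by simp
    then show ?thesis using t[OF that, of n] by linarith
  qed
  moreover have "(\<lambda>n. t n i) \<longlonglongrightarrow> 1" if "i < d" for i
  proof -
    have "(\<lambda>n. t n i - 1) \<longlonglongrightarrow> 0"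
    proof (rule tendsto_0_le[OF LIMSEQ_Suc[OF lim_1_over_n[where 'a=real]], of _ 1], rule always_eventually, rule allI)
      fix n
      show "norm (t n i - 1) \<le> norm (1 / real (Suc n)) * 1"
        using t[OF that, of n] by simp
    qed
    then show ?thesis by (simp add: LIM_zero_iff)
  qed
  ultimately have "(\<lambda>n. plane_dist d (\<lambda>i j. sqrt (t n i) * x i j) (\<lambda>_. 1) ^ k) \<longlonglongrightarrow> plane_dist d x (\<lambda>_. 1) ^ k"
    by (intro tendsto_power plane_dist_radii_tendsto x d) auto
  then obtain n where "\<bar>plane_dist d (\<lambda>i j. sqrt (t n i) * x i j) (\<lambda>_. 1) ^ k - plane_dist d x (\<lambda>_. 1) ^ k\<bar> < e"
    using e unfolding LIMSEQ_def dist_real_def by blast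
  with far[of n] show False by simp
qed

text \<open>Row 0 alone bounds the distance; the other factors are at least 1 and give the bound the
  product form required for concentration.\<close>

lemma plane_dist_radii_bound:
  assumes d: "0 < d" and \<theta>: "nsq d (\<theta> 0) = 1"
  shows "plane_dist d (\<lambda>i j. sqrt (t i) * \<theta> i j) (\<lambda>_. 1) ^ (2 * q) \<le> (\<Prod>i<d. (1 + \<bar>t i\<bar>) ^ q)"
proof -
  have "(plane_dist d (\<lambda>i j. sqrt (t i) * \<theta> i j) (\<lambda>_. 1))\<^sup>2 \<le> nsq d (\<lambda>j. sqrt (t 0) * \<theta> 0 j)"
    by (rule plane_dist_le_norm[OF d])
  \<comment> \<open>\<open>sqrt\<close> is an odd function, so the square of
    \<open>sqrt (t 0)\<close> is \<open>\<bar>t 0\<bar>\<close> also for negative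
    \<open>t 0\<close>.\<close>
  also have "\<dots> = \<bar>t 0\<bar> * nsq d (\<theta> 0)"
    by (simp add: nsq_def power_mult_distrib sum_distrib_left power2_eq_square[of "sqrt _"])
  finally have "(plane_dist d (\<lambda>i j. sqrt (t i) * \<theta> i j) (\<lambda>_. 1))\<^sup>2 \<le> 1 + \<bar>t 0\<bar>" using \<theta> by simp
  then have "plane_dist d (\<lambda>i j. sqrt (t i) * \<theta> i j) (\<lambda>_. 1) ^ (2 * q) \<le> (1 + \<bar>t 0\<bar>) ^ q"
    unfolding power_mult by (rule power_mono) simp
  also have "\<dots> \<le> (1 + \<bar>t 0\<bar>) ^ q * (\<Prod>i\<in>{..<d} - {0}. (1 + \<bar>t i\<bar>) ^ q)"
  proof -
    have "1 \<le> (\<Prod>i\<in>{..<d} - {0}. (1 + \<bar>t i\<bar>) ^ q)" by (intro prod_ge_1 one_le_power) auto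
    then have "(1 + \<bar>t 0\<bar>) ^ q * 1 \<le> (1 + \<bar>t 0\<bar>) ^ q * (\<Prod>i\<in>{..<d} - {0}. (1 + \<bar>t i\<bar>) ^ q)"
      by (rule mult_left_mono) simp
    then show ?thesis by simp
  qed
  also have "\<dots> = (\<Prod>i<d. (1 + \<bar>t i\<bar>) ^ q)" using d by (subst prod.remove[of _ 0]) auto
  finally show ?thesis .
qed

text \<open>After Fubini the directions are fixed, and for almost all of them concentration of the
  radii gives the limit. The moment bound for \<open>bump_law\<close> supplies a constant
  majorant.\<close>

lemma height_moment_limit_lhs:
  assumes d: "2 \<le> d"
  shows "(\<lambda>m. \<integral>\<^sup>+t. \<integral>\<^sup>+\<theta>. ennreal (plane_dist d (\<lambda>i j. sqrt (t i) * \<theta> i j) (\<lambda>_. 1) ^ (2 * q))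
      \<partial>(\<Pi>\<^sub>M i\<in>{..<d}. uniform_sphere d) \<partial>(\<Pi>\<^sub>M i\<in>{..<d}. bump_law d m))
    \<longlonglongrightarrow> (\<integral>\<^sup>+\<theta>. ennreal (plane_dist d \<theta> (\<lambda>_. 1) ^ (2 * q)) \<partial>(\<Pi>\<^sub>M i\<in>{..<d}. uniform_sphere d))"
proof -
  have d0: "0 < d" using d by simp
  let ?S = "\<Pi>\<^sub>M i\<in>{..<d}. uniform_sphere d"
  interpret S: prob_space ?S by (intro prob_space_PiM prob_space_uniform_sphere)
  define h where "h \<theta> t = plane_dist d (\<lambda>i j. sqrt (t i) * \<theta> i j) (\<lambda>_. 1) ^ (2 * q)" for \<theta> :: "nat \<Rightarrow> nat \<Rightarrow> real" and t
  have hm: "(\<lambda>p. h (fst p) (snd p)) \<in> borel_measurable (?S \<Otimes>\<^sub>M (\<Pi>\<^sub>M i\<in>{..<d}. borel))"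
    unfolding h_def by (intro borel_measurable_power plane_dist_polar_measurable)
  have hm'[measurable]: "(\<lambda>p. h (fst p) (snd p)) \<in> borel_measurable (?S \<Otimes>\<^sub>M (\<Pi>\<^sub>M i\<in>{..<d}. bump_law d m))" for m
  proof -
    have eq: "sets (?S \<Otimes>\<^sub>M (\<Pi>\<^sub>M i\<in>{..<d}. bump_law d m)) = sets (?S \<Otimes>\<^sub>M (\<Pi>\<^sub>M i\<in>{..<d}. borel))"
      by (intro sets_pair_measure_cong sets_PiM_cong) auto
    show ?thesis unfolding measurable_cong_sets[OF eq refl] by (rule hm)
  qed
  from bump_law_mass_bound[OF d, of q] obtain m0 where m0: "\<And>m. m0 \<le> m \<Longrightarrow> (\<integral>\<^sup>+t. ennreal ((1 + \<bar>t\<bar>) ^ q) \<partial>bump_law d m) \<le> ennreal (3 ^ q + 1)"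
    unfolding eventually_sequentially by blast
  \<comment> \<open>The index is shifted so that the moment bound and \<open>0 < m\<close> hold for
    every \<open>n\<close>.\<close>
  define K where "K n = (\<Pi>\<^sub>M i\<in>{..<d}. bump_law d (n + Suc m0))" for n
  have PK: "prob_space (K n)" for n unfolding K_def by (intro prob_space_PiM prob_space_bump_law d) simp
  have hmK[measurable]: "(\<lambda>p. h (fst p) (snd p)) \<in> borel_measurable (?S \<Otimes>\<^sub>M K n)" for n
    unfolding K_def by (rule hm')
  have good: "AE \<theta> in ?S. row_det d \<theta> \<noteq> 0 \<and> nsq d (\<theta> 0) = 1"
  proof -
    have "AE \<theta> in ?S. nsq d (\<theta> 0) = 1"
      by (rule AE_PiM_component[where M="\<lambda>_. uniform_sphere d" and P="\<lambda>y. nsq d y = 1"])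
        (use d0 in \<open>simp_all add: prob_space_uniform_sphere AE_uniform_sphere_nsq\<close>)
    with AE_sphere_row_det[OF d0] show ?thesis by (rule AE_conjI)
  qed
  have "(\<lambda>n. \<integral>\<^sup>+\<theta>. \<integral>\<^sup>+t. ennreal (h \<theta> t) \<partial>K n \<partial>?S) \<longlonglongrightarrow> (\<integral>\<^sup>+\<theta>. ennreal (plane_dist d \<theta> (\<lambda>_. 1) ^ (2 * q)) \<partial>?S)"
  proof (rule nn_integral_dominated_convergence[where w="\<lambda>_. ennreal (3 ^ q + 1) ^ d"])
    show "(\<lambda>\<theta>. \<integral>\<^sup>+t. ennreal (h \<theta> t) \<partial>K n) \<in> borel_measurable ?S" for n
    proof -
      interpret prob_space "K n" by (rule PK)
      show ?thesis
        using borel_measurable_nn_integral_fst[of "\<lambda>p. ennreal (h (fst p) (snd p))" ?S] by simp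
    qed
    show "AE \<theta> in ?S. (\<integral>\<^sup>+t. ennreal (h \<theta> t) \<partial>K n) \<le> ennreal (3 ^ q + 1) ^ d" for n
      using good
    proof eventually_elim
      case (elim \<theta>)
      interpret beta_kernel: product_sigma_finite "\<lambda>_::nat. bump_law d (n + Suc m0)" by (rule bump_law_product_sigma_finite[OF d]) simp
      have "(\<integral>\<^sup>+t. ennreal (h \<theta> t) \<partial>K n) \<le> (\<integral>\<^sup>+t. (\<Prod>i<d. ennreal ((1 + \<bar>t i\<bar>) ^ q)) \<partial>K n)"
      proof (rule nn_integral_mono)
        fix t :: "nat \<Rightarrow> real"
        have "ennreal (h \<theta> t) \<le> ennreal (\<Prod>i<d. (1 + \<bar>t i\<bar>) ^ q)"
          unfolding h_def by (intro ennreal_leI plane_dist_radii_bound d0) (use elim in simp)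
        then show "ennreal (h \<theta> t) \<le> (\<Prod>i<d. ennreal ((1 + \<bar>t i\<bar>) ^ q))" by (subst prod_ennreal) auto
      qed
      also have "\<dots> = (\<Prod>i<d. \<integral>\<^sup>+s. ennreal ((1 + \<bar>s\<bar>) ^ q) \<partial>bump_law d (n + Suc m0))"
        unfolding K_def by (rule beta_kernel.product_nn_integral_prod) measurable
      also have "\<dots> \<le> (\<Prod>i<d. ennreal (3 ^ q + 1))"
        by (intro prod_mono_ennreal m0) simp
      finally show ?case by simp
    qed
    show "AE \<theta> in ?S. (\<lambda>n. \<integral>\<^sup>+t. ennreal (h \<theta> t) \<partial>K n) \<longlonglongrightarrow> ennreal (plane_dist d \<theta> (\<lambda>_. 1) ^ (2 * q))"
      using good
    proof eventually_elim
      case (elim \<theta>)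
      have "(\<lambda>m. \<integral>\<^sup>+t. ennreal (h \<theta> t) \<partial>(\<Pi>\<^sub>M i\<in>{..<d}. bump_law d m)) \<longlonglongrightarrow> ennreal (plane_dist d \<theta> (\<lambda>_. 1) ^ (2 * q))"
      proof (rule bump_law_PiM_concentration[OF d])
        show "h \<theta> \<in> borel_measurable (\<Pi>\<^sub>M i\<in>{..<d}. borel)"
          unfolding h_def
          by (intro borel_measurable_power plane_dist_measurable borel_measurable_times borel_measurable_const borel_measurable_sqrt measurable_component_singleton) simp
        show "h \<theta> t \<le> (\<Prod>i\<in>{..<d}. (1 + \<bar>t i\<bar>) ^ q)" for t
          unfolding h_def by (intro plane_dist_radii_bound d0) (use elim in simp)
        show "\<exists>\<delta>>0. \<forall>t. (\<forall>i\<in>{..<d}. \<bar>t i - 1\<bar> < \<delta>) \<longrightarrow> \<bar>h \<theta> t - plane_dist d \<theta> (\<lambda>_. 1) ^ (2 * q)\<bar> \<le> e" if "0 < e" for e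
          unfolding h_def by (rule plane_dist_radii_continuous[OF _ d0 that]) (use elim in simp)
      qed (simp_all add: h_def plane_dist_nonneg)
      from LIMSEQ_ignore_initial_segment[OF this, of "Suc m0"] show ?case by (simp add: K_def)
    qed
    show "(\<integral>\<^sup>+\<theta>. ennreal (3 ^ q + 1) ^ d \<partial>?S) < \<infinity>"
      using S.emeasure_space_1 by (simp add: power_less_top_ennreal)
  qed measurable
  moreover have "(\<integral>\<^sup>+t. \<integral>\<^sup>+\<theta>. ennreal (h \<theta> t) \<partial>?S \<partial>K n) = (\<integral>\<^sup>+\<theta>. \<integral>\<^sup>+t. ennreal (h \<theta> t) \<partial>K n \<partial>?S)" for n
  proof -
    interpret K: prob_space "K n" by (rule PK)
    interpret pair_sigma_finite ?S "K n" ..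
    show ?thesis by (rule Fubini') (use hmK[of n] in \<open>simp add: case_prod_beta\<close>)
  qed
  ultimately have "(\<lambda>n. \<integral>\<^sup>+t. \<integral>\<^sup>+\<theta>. ennreal (h \<theta> t) \<partial>?S \<partial>K n) \<longlonglongrightarrow> (\<integral>\<^sup>+\<theta>. ennreal (plane_dist d \<theta> (\<lambda>_. 1) ^ (2 * q)) \<partial>?S)"
    by simp
  then show ?thesis
    unfolding K_def h_def by (rule LIMSEQ_offset)
qed

lemma tendsto_power_ennreal:
  fixes f :: "'a \<Rightarrow> ennreal"
  assumes "(f \<longlongrightarrow> ennreal x) F"
  shows "((\<lambda>y. f y ^ n) \<longlongrightarrow> ennreal x ^ n) F"
proof (induction n)
  case (Suc n)
  have "((\<lambda>y. f y * f y ^ n) \<longlongrightarrow> ennreal x * ennreal x ^ n) F"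
    by (rule tendsto_mult_ennreal[OF assms Suc.IH]) (auto simp: power_eq_top_ennreal)
  then show ?case by simp
qed simp

lemma nn_integral_inverse_square:
  assumes "0 \<le> K"
  shows "(\<integral>\<^sup>+\<tau>. ennreal (K / (1 + \<tau>)\<^sup>2) * indicator {0..} \<tau> \<partial>lborel) < \<infinity>"
proof -
  have "(\<integral>\<^sup>+\<tau>. ennreal (K / (1 + \<tau>)\<^sup>2) * indicator {0..} \<tau> \<partial>lborel) = ennreal (0 - (- K / (1 + 0)))"
  proof (rule nn_integral_FTC_atLeast)
    show "((\<lambda>\<tau>. - K / (1 + \<tau>)) has_real_derivative K / (1 + x)\<^sup>2) (at x)" if "0 \<le> x" for x :: real
      using that by (auto intro!: derivative_eq_intros simp: power2_eq_square)
    show "((\<lambda>\<tau>. - K / (1 + \<tau>)) \<longlongrightarrow> 0) at_top"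
      by real_asymp
  qed (use assms in auto)
  then show ?thesis by simp
qed

text \<open>The weight vanishes unless \<open>t > \<tau>\<close>, so Markov's inequality with the
  moment of order \<open>q + 1\<close> bounds the inner integral by
  \<open>B / (1 + \<tau>) ^ (q + 1)\<close>. Against \<open>\<tau> ^ (q - 1)\<close> this leaves the
  integrable \<open>1 / (1 + \<tau>)\<^sup>2\<close>; since the inner integral is at most 1, its
  power \<open>d\<close> only helps.\<close>

lemma height_moment_limit_rhs:
  assumes d: "2 \<le> d" and q: "0 < q"
  shows "(\<lambda>m. \<integral>\<^sup>+\<tau>. indicator {0<..} \<tau> * ennreal (height_const q * \<tau> ^ (q - 1)) * (\<integral>\<^sup>+t. ennreal (shift_weight d \<tau> t) \<partial>bump_law d m) ^ d \<partial>lborel)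
    \<longlonglongrightarrow> (\<integral>\<^sup>+\<tau>. indicator {0<..} \<tau> * ennreal (height_const q * \<tau> ^ (q - 1)) * ennreal (shift_weight d \<tau> 1) ^ d \<partial>lborel)"
proof -
  define B :: real where "B = 3 ^ (q + 1) + 1"
  have B0: "0 \<le> B" by (simp add: B_def)
  from bump_law_mass_bound[OF d, of "q + 1"] obtain m0 where m0: "\<And>m. m0 \<le> m \<Longrightarrow> (\<integral>\<^sup>+t. ennreal ((1 + \<bar>t\<bar>) ^ (q + 1)) \<partial>bump_law d m) \<le> ennreal B"
    unfolding eventually_sequentially B_def by blast
  let ?r = "\<lambda>n \<tau>. \<integral>\<^sup>+t. ennreal (shift_weight d \<tau> t) \<partial>bump_law d (n + Suc m0)"
  have "(\<lambda>n. \<integral>\<^sup>+\<tau>. indicator {0<..} \<tau> * ennreal (height_const q * \<tau> ^ (q - 1)) * ?r n \<tau> ^ d \<partial>lborel)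
    \<longlonglongrightarrow> (\<integral>\<^sup>+\<tau>. indicator {0<..} \<tau> * ennreal (height_const q * \<tau> ^ (q - 1)) * ennreal (shift_weight d \<tau> 1) ^ d \<partial>lborel)"
  proof (rule nn_integral_dominated_convergence[where w="\<lambda>\<tau>. ennreal (height_const q * B / (1 + \<tau>)\<^sup>2) * indicator {0..} \<tau>"])
    show "(\<lambda>\<tau>. indicator {0<..} \<tau> * ennreal (height_const q * \<tau> ^ (q - 1)) * ?r n \<tau> ^ d) \<in> borel_measurable lborel" for n
    proof -
      interpret K: prob_space "bump_law d (n + Suc m0)" by (rule prob_space_bump_law[OF d]) simp
      have [measurable]: "?r n \<in> borel_measurable lborel"
        using K.borel_measurable_nn_integral_fst[of "\<lambda>p. ennreal (shift_weight d (fst p) (snd p))" lborel] by simp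
      show ?thesis by measurable
    qed
    have [measurable]: "(\<lambda>\<tau>. shift_weight d \<tau> 1) \<in> borel_measurable borel" unfolding shift_weight_def by measurable
    show "(\<lambda>\<tau>. indicator {0<..} \<tau> * ennreal (height_const q * \<tau> ^ (q - 1)) * ennreal (shift_weight d \<tau> 1) ^ d) \<in> borel_measurable lborel"
      by measurable
    show "AE \<tau> in lborel. indicator {0<..} \<tau> * ennreal (height_const q * \<tau> ^ (q - 1)) * ?r n \<tau> ^ d \<le> ennreal (height_const q * B / (1 + \<tau>)\<^sup>2) * indicator {0..} \<tau>" for n
    proof (rule AE_I2)
      fix \<tau> :: real
      interpret K: prob_space "bump_law d (n + Suc m0)" by (rule prob_space_bump_law[OF d]) simp
      show "indicator {0<..} \<tau> * ennreal (height_const q * \<tau> ^ (q - 1)) * ?r n \<tau> ^ d \<le> ennreal (height_const q * B / (1 + \<tau>)\<^sup>2) * indicator {0..} \<tau>"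
      proof (cases "0 < \<tau>")
        case True
        have "?r n \<tau> \<le> (\<integral>\<^sup>+t. 1 \<partial>bump_law d (n + Suc m0))"
          using True shift_weight_bounds[OF d, of \<tau>] by (intro nn_integral_mono) (simp add: ennreal_le_1)
        then have r1: "?r n \<tau> \<le> 1" using K.emeasure_space_1 by simp
        have "?r n \<tau> \<le> (\<integral>\<^sup>+t. ennreal (1 / (1 + \<tau>) ^ (q + 1)) * ennreal ((1 + \<bar>t\<bar>) ^ (q + 1)) \<partial>bump_law d (n + Suc m0))"
        proof (rule nn_integral_mono)
          fix t :: real
          have "shift_weight d \<tau> t \<le> 1 / (1 + \<tau>) ^ (q + 1) * (1 + \<bar>t\<bar>) ^ (q + 1)"
          proof (cases "\<tau> < t")
            case t: True
            have "(1 + \<tau>) ^ (q + 1) \<le> (1 + \<bar>t\<bar>) ^ (q + 1)" using t True by (intro power_mono) auto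
            then have "1 \<le> 1 / (1 + \<tau>) ^ (q + 1) * (1 + \<bar>t\<bar>) ^ (q + 1)"
              using True by (simp only: times_divide_eq_left mult_1_left) (subst le_divide_eq_1_pos, auto)
            with shift_weight_bounds(2)[OF d, of \<tau> t] True show ?thesis by linarith
          next
            case False
            then show ?thesis using True by (simp add: shift_weight_def)
          qed
          then have "ennreal (shift_weight d \<tau> t) \<le> ennreal (1 / (1 + \<tau>) ^ (q + 1) * (1 + \<bar>t\<bar>) ^ (q + 1))" by (rule ennreal_leI)
          also have "\<dots> = ennreal (1 / (1 + \<tau>) ^ (q + 1)) * ennreal ((1 + \<bar>t\<bar>) ^ (q + 1))"
            using True by (intro ennreal_mult') simp
          finally show "ennreal (shift_weight d \<tau> t) \<le> ennreal (1 / (1 + \<tau>) ^ (q + 1)) * ennreal ((1 + \<bar>t\<bar>) ^ (q + 1))" .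
        qed
        also have "\<dots> = ennreal (1 / (1 + \<tau>) ^ (q + 1)) * (\<integral>\<^sup>+t. ennreal ((1 + \<bar>t\<bar>) ^ (q + 1)) \<partial>bump_law d (n + Suc m0))"
          by (rule nn_integral_cmult) measurable
        also have "\<dots> \<le> ennreal (1 / (1 + \<tau>) ^ (q + 1)) * ennreal B"
          by (intro mult_left_mono m0) auto
        also have "\<dots> = ennreal (B / (1 + \<tau>) ^ (q + 1))"
          using True B0 by (subst ennreal_mult[symmetric]) auto
        finally have r2: "?r n \<tau> \<le> ennreal (B / (1 + \<tau>) ^ (q + 1))" .
        have "?r n \<tau> ^ d \<le> ?r n \<tau> ^ 1" using r1 d by (intro power_decreasing) auto
        also have "\<dots> \<le> ennreal (B / (1 + \<tau>) ^ (q + 1))" using r2 by simp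
        finally have "ennreal (height_const q * \<tau> ^ (q - 1)) * ?r n \<tau> ^ d \<le> ennreal (height_const q * \<tau> ^ (q - 1)) * ennreal (B / (1 + \<tau>) ^ (q + 1))"
          by (rule mult_left_mono) simp
        also have "\<dots> = ennreal (height_const q * \<tau> ^ (q - 1) * (B / (1 + \<tau>) ^ (q + 1)))"
          using True height_const_pos[of q] by (intro ennreal_mult'[symmetric]) simp
        also have "\<dots> \<le> ennreal (height_const q * B / (1 + \<tau>)\<^sup>2)"
        proof (rule ennreal_leI)
          have "\<tau> ^ (q - 1) \<le> (1 + \<tau>) ^ (q - 1)" using True by (intro power_mono) auto
          then have "\<tau> ^ (q - 1) / (1 + \<tau>) ^ (q - 1) \<le> 1" using True by (subst divide_le_eq_1_pos) auto
          moreover have "(1 + \<tau>) ^ (q + 1) = (1 + \<tau>) ^ (q - 1) * (1 + \<tau>)\<^sup>2"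
            using q by (simp add: power_add[symmetric])
          then have "height_const q * \<tau> ^ (q - 1) * (B / (1 + \<tau>) ^ (q + 1)) = height_const q * B / (1 + \<tau>)\<^sup>2 * (\<tau> ^ (q - 1) / (1 + \<tau>) ^ (q - 1))"
            by (simp add: mult_ac)
          moreover have "0 \<le> height_const q * B / (1 + \<tau>)\<^sup>2" using height_const_pos[of q] B0 by simp
          ultimately show "height_const q * \<tau> ^ (q - 1) * (B / (1 + \<tau>) ^ (q + 1)) \<le> height_const q * B / (1 + \<tau>)\<^sup>2"
            by (simp only: mult_left_le)
        qed
        finally show ?thesis using True by simp
      qed simp
    qed
    show "(\<integral>\<^sup>+\<tau>. ennreal (height_const q * B / (1 + \<tau>)\<^sup>2) * indicator {0..} \<tau> \<partial>lborel) < \<infinity>"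
      using height_const_pos[of q] B0 by (intro nn_integral_inverse_square) simp
    show "(\<lambda>\<tau>. ennreal (height_const q * B / (1 + \<tau>)\<^sup>2) * indicator {0..} \<tau>) \<in> borel_measurable lborel"
      by measurable
    have "AE \<tau> in lborel. \<tau> \<noteq> (1::real)" by (rule AE_lborel_singleton)
    then show "AE \<tau> in lborel. (\<lambda>n. indicator {0<..} \<tau> * ennreal (height_const q * \<tau> ^ (q - 1)) * ?r n \<tau> ^ d)
      \<longlonglongrightarrow> indicator {0<..} \<tau> * ennreal (height_const q * \<tau> ^ (q - 1)) * ennreal (shift_weight d \<tau> 1) ^ d"
    proof eventually_elim
      case (elim \<tau>)
      show ?case
      proof (cases "0 < \<tau>")
        case True
        have "(\<lambda>m. \<integral>\<^sup>+t. ennreal (shift_weight d \<tau> t) \<partial>bump_law d m) \<longlonglongrightarrow> ennreal (shift_weight d \<tau> 1)"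
          using True elim by (intro bump_law_concentration d shift_weight_bounds shift_weight_isCont) auto
        then have "(\<lambda>n. ?r n \<tau>) \<longlonglongrightarrow> ennreal (shift_weight d \<tau> 1)" by (rule LIMSEQ_ignore_initial_segment)
        then show ?thesis
          using True by (intro ennreal_tendsto_cmult tendsto_power_ennreal) auto
      qed simp
    qed
  qed
  then show ?thesis by (rule LIMSEQ_offset)
qed

text \<open>For radii 1 each of the \<open>d\<close> rows gives the factor
  \<open>(1 - \<tau>) powr (d / 2 - 1)\<close> on \<open>\<tau> < 1\<close>, so the integral is a
  Beta integral with second parameter \<open>(d / 2 - 1) * d + 1\<close>.\<close>

lemma nn_integral_shift_weight_Beta:
  assumes d: "2 \<le> d" and q: "0 < q"
  shows "(\<integral>\<^sup>+\<tau>. indicator {0<..} \<tau> * ennreal (height_const q * \<tau> ^ (q - 1)) * ennreal (shift_weight d \<tau> 1) ^ d \<partial>lborel)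
    = ennreal (height_const q * Beta (real q) ((d / 2 - 1) * d + 1))"
proof -
  let ?b = "(d / 2 - 1) * d + 1 :: real"
  have b: "0 < ?b" using d by (intro add_nonneg_pos mult_nonneg_nonneg) auto
  have I: "((\<lambda>t. t powr (real q - 1) * (1 - t) powr (?b - 1)) has_integral Beta (real q) ?b) {0..1}"
    using q b by (intro has_integral_Beta_real) auto
  have "(\<integral>\<^sup>+\<tau>. indicator {0<..} \<tau> * ennreal (height_const q * \<tau> ^ (q - 1)) * ennreal (shift_weight d \<tau> 1) ^ d \<partial>lborel)
    = (\<integral>\<^sup>+\<tau>. ennreal (height_const q) * ennreal (indicator {0..1} \<tau> * (\<tau> powr (real q - 1) * (1 - \<tau>) powr (?b - 1))) \<partial>lborel)"
  proof (rule nn_integral_cong_AE)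
    have "AE \<tau> in lborel. \<tau> \<noteq> (1::real)" "AE \<tau> in lborel. \<tau> \<noteq> (0::real)" by (rule AE_lborel_singleton)+
    then show "AE \<tau> in lborel. indicator {0<..} \<tau> * ennreal (height_const q * \<tau> ^ (q - 1)) * ennreal (shift_weight d \<tau> 1) ^ d
      = ennreal (height_const q) * ennreal (indicator {0..1} \<tau> * (\<tau> powr (real q - 1) * (1 - \<tau>) powr (?b - 1)))"
    proof eventually_elim
      case (elim \<tau>)
      show ?case
      proof (cases "0 < \<tau> \<and> \<tau> < 1")
        case True
        then have "shift_weight d \<tau> 1 ^ d = (1 - \<tau>) powr (?b - 1)"
          by (simp add: shift_weight_def powr_realpow[symmetric] powr_powr)
        moreover have "\<tau> ^ (q - 1) = \<tau> powr (real q - 1)"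
          using True q by (simp add: powr_realpow[symmetric] of_nat_diff)
        ultimately have "ennreal (height_const q * \<tau> ^ (q - 1)) * ennreal (shift_weight d \<tau> 1) ^ d
          = ennreal (height_const q * (\<tau> powr (real q - 1) * (1 - \<tau>) powr (?b - 1)))"
          using True height_const_pos[of q] shift_weight_bounds(1)[OF d, of \<tau> 1]
          by (simp add: ennreal_power ennreal_mult'[symmetric] mult.assoc)
        with True height_const_pos[of q] show ?thesis by (simp add: ennreal_mult')
      next
        case False
        with elim have "\<tau> < 0 \<or> 1 < \<tau>" by linarith
        then show ?thesis using d by (auto simp: shift_weight_def)
      qed
    qed
  qed
  also have "\<dots> = ennreal (height_const q) * ennreal (Beta (real q) ?b)"
    using nn_integral_has_integral_lebesgue[OF _ I] by (subst nn_integral_cmult) auto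
  also have "\<dots> = ennreal (height_const q * Beta (real q) ?b)"
    using height_const_pos[of q] by (intro ennreal_mult'[symmetric]) simp
  finally show ?thesis .
qed

text \<open>Both sides of the weighted identity carry the factor \<open>bump_mass d m ^ d\<close>.
  It is cancelled before \<open>m\<close> tends to infinity.\<close>

theorem sphere_height_moment:
  assumes d: "2 \<le> d" and q: "0 < q"
  shows "(\<integral>\<^sup>+\<theta>. ennreal (plane_dist d \<theta> (\<lambda>_. 1) ^ (2 * q)) \<partial>(\<Pi>\<^sub>M i\<in>{..<d}. uniform_sphere d))
    = ennreal (height_const q * Beta (real q) ((d / 2 - 1) * d + 1))"
proof -
  have "\<forall>\<^sub>F m in sequentially. (\<integral>\<^sup>+t. \<integral>\<^sup>+\<theta>. ennreal (plane_dist d (\<lambda>i j. sqrt (t i) * \<theta> i j) (\<lambda>_. 1) ^ (2 * q))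
      \<partial>(\<Pi>\<^sub>M i\<in>{..<d}. uniform_sphere d) \<partial>(\<Pi>\<^sub>M i\<in>{..<d}. bump_law d m))
    = (\<integral>\<^sup>+\<tau>. indicator {0<..} \<tau> * ennreal (height_const q * \<tau> ^ (q - 1)) * (\<integral>\<^sup>+t. ennreal (shift_weight d \<tau> t) \<partial>bump_law d m) ^ d \<partial>lborel)"
    using eventually_gt_at_top[of 0]
  proof eventually_elim
    case (elim m)
    have G: "bump_mass d m ^ d \<noteq> 0" "bump_mass d m ^ d \<noteq> \<infinity>"
      using bump_mass_bounds(1)[OF d, of m] bump_mass_bounds(2)[OF d elim] by (auto simp: power_eq_top_ennreal)
    show ?case
      by (rule ennreal_cancel[OF G trans[OF height_moment_lhs[OF d elim, symmetric] height_moment_rhs[OF d elim q]]])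
  qed
  from Lim_transform_eventually[OF height_moment_limit_lhs[OF d, of q] this] height_moment_limit_rhs[OF d q]
  show ?thesis unfolding nn_integral_shift_weight_Beta[OF d q, symmetric] by (rule LIMSEQ_unique)
qed

section \<open>Determination by moments, and symmetric beta laws\<close>

text \<open>For laws on \<open>[-1, 1]\<close> the absolute moments are at most 1, so the Taylor
  remainder of the characteristic function is at most \<open>2 * \<bar>t\<bar> ^ n / fact n\<close>
  and vanishes in the limit.\<close>

lemma moments_determine:
  assumes M: "real_distribution M" and N: "real_distribution N"
    and bM: "AE x in M. \<bar>x\<bar> \<le> 1" and bN: "AE x in N. \<bar>x\<bar> \<le> 1"
    and eq: "\<And>k. (LINT x|M. x ^ k) = (LINT x|N. x ^ k)"
  shows "M = N"
proof (rule Levy_uniqueness[OF M N], rule ext)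
  fix t :: real
  interpret M: real_distribution M by fact
  interpret N: real_distribution N by fact
  have approx: "cmod (char L t - (\<Sum>k\<le>n. (\<i> * complex_of_real t) ^ k / fact k * complex_of_real (LINT x|L. x ^ k))) \<le> 2 * \<bar>t\<bar> ^ n / fact n"
    if L: "real_distribution L" and b: "AE x in L. \<bar>x\<bar> \<le> 1" for L n
  proof -
    interpret L: real_distribution L by fact
    have b': "AE x in L. \<bar>x ^ k\<bar> \<le> 1" for k
      using b by eventually_elim (simp add: power_abs power_le_one)
    have int: "integrable L (\<lambda>x. x ^ k)" for k
      using b'[of k] by (intro L.integrable_const_bound[of _ 1]) auto
    have "(LINT x|L. \<bar>x\<bar> ^ n) \<le> (LINT x|L. 1)"
      using b'[of n] integrable_abs[OF int[of n]] by (intro integral_mono_AE) (auto simp: power_abs)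
    then have le: "(LINT x|L. \<bar>x\<bar> ^ n) \<le> 1" using L.prob_space by simp
    have "cmod (char L t - (\<Sum>k\<le>n. (\<i> * complex_of_real t) ^ k / fact k * complex_of_real (LINT x|L. x ^ k)))
      \<le> 2 * \<bar>t\<bar> ^ n / fact n * (LINT x|L. \<bar>x\<bar> ^ n)"
      by (rule L.char_approx1) (rule int)
    also have "\<dots> \<le> 2 * \<bar>t\<bar> ^ n / fact n * 1" by (rule mult_left_mono[OF le]) simp
    finally show ?thesis by simp
  qed
  have le: "cmod (char M t - char N t) \<le> 4 * (\<bar>t\<bar> ^ n / fact n)" for n
  proof -
    let ?S = "\<Sum>k\<le>n. (\<i> * complex_of_real t) ^ k / fact k * complex_of_real (LINT x|M. x ^ k)"
    have "cmod (char M t - char N t) \<le> cmod (char M t - ?S) + cmod (char N t - ?S)"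
      using norm_triangle_ineq4[of "char M t - ?S" "char N t - ?S"] by simp
    also have "\<dots> \<le> 2 * \<bar>t\<bar> ^ n / fact n + 2 * \<bar>t\<bar> ^ n / fact n"
      using approx[OF M bM, of n] approx[OF N bN, of n] unfolding eq by (rule add_mono)
    finally show ?thesis by simp
  qed
  have "(\<lambda>n. \<bar>t\<bar> ^ n / fact n) \<longlonglongrightarrow> 0"
    using summable_LIMSEQ_zero[OF summable_exp[of "\<bar>t\<bar>"]] by (simp add: divide_inverse mult.commute)
  then have "(\<lambda>n. 4 * (\<bar>t\<bar> ^ n / fact n)) \<longlonglongrightarrow> 4 * 0" by (rule tendsto_mult_left)
  then have "cmod (char M t - char N t) \<le> 4 * 0"
    by (rule LIMSEQ_le_const) (use le in blast)
  then show "char M t = char N t" by simp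
qed

text \<open>The unnormalised symmetric beta density on \<open>(-1, 1)\<close>. It occurs with two
  exponents: \<open>d / 2 - 3 / 2\<close> for one coordinate of a random point, and
  \<open>height_exponent d\<close> for the signed distance of the hyperplane.\<close>

definition beta_kernel :: "real \<Rightarrow> real \<Rightarrow> real"
  where "beta_kernel p t = indicator {-1<..<1} t * (1 - t\<^sup>2) powr p"

definition beta_norm :: "real \<Rightarrow> real"
  where "beta_norm p = (LINT t|lborel. beta_kernel p t)"

definition beta_law :: "real \<Rightarrow> real measure"
  where "beta_law p = density lborel (\<lambda>t. ennreal (beta_kernel p t / beta_norm p))"

text \<open>The moment of order \<open>2 q\<close> of \<open>beta_law (e - 3 / 2)\<close>.\<close>

primrec beta_moment :: "real \<Rightarrow> nat \<Rightarrow> real"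
  where "beta_moment e 0 = 1" | "beta_moment e (Suc q) = beta_moment e q * ((real q + 1 / 2) / (real q + e))"

lemma beta_kernel_measurable[measurable]: "beta_kernel p \<in> borel_measurable borel"
  unfolding beta_kernel_def by measurable

lemma beta_kernel_nonneg: "0 \<le> beta_kernel p t"
  by (simp add: beta_kernel_def)

lemma beta_kernel_le:
  assumes "0 < p"
  shows "beta_kernel p t \<le> indicator {-1..1} t"
proof (cases "-1 < t \<and> t < 1")
  case True
  then have "0 \<le> 1 - t\<^sup>2" by (simp add: abs_square_le_1 abs_le_iff)
  then have "(1 - t\<^sup>2) powr p \<le> 1" using assms by (intro powr_le1) auto
  with True show ?thesis by (simp add: beta_kernel_def)
qed (auto simp: beta_kernel_def)

lemma integrable_beta_kernel:
  assumes p: "0 < p"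
  shows "integrable lborel (\<lambda>t. t ^ k * beta_kernel p t)"
proof (rule Bochner_Integration.integrable_bound[of lborel "indicator {-1..1} :: real \<Rightarrow> real"])
  show "AE t in lborel. norm (t ^ k * beta_kernel p t) \<le> norm (indicator {-1..1} t :: real)"
  proof (rule AE_I2)
    fix t :: real
    show "norm (t ^ k * beta_kernel p t) \<le> norm (indicator {-1..1} t :: real)"
    proof (cases "-1 \<le> t \<and> t \<le> 1")
      case True
      then have "\<bar>t\<bar> ^ k \<le> 1" by (intro power_le_one) auto
      then have "\<bar>t\<bar> ^ k * beta_kernel p t \<le> 1 * indicator {-1..1} t"
        by (intro mult_mono beta_kernel_le p) (auto simp: beta_kernel_nonneg)
      then show ?thesis by (simp add: abs_mult power_abs beta_kernel_nonneg)
    next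
      case False
      then have "beta_kernel p t = 0" by (auto simp: beta_kernel_def)
      then show ?thesis by simp
    qed
  qed
qed auto

lemma beta_norm_pos:
  assumes p: "0 < p"
  shows "0 < beta_norm p"
proof -
  have int: "integrable lborel (beta_kernel p)" using integrable_beta_kernel[OF p, of 0] by simp
  define c where "c = (1 - (1/2)\<^sup>2 :: real) powr p"
  have c: "0 < c" by (simp add: c_def power2_eq_square)
  have "(LINT t|lborel. c * indicator {-1/2..1/2::real} t) \<le> beta_norm p"
    unfolding beta_norm_def
  proof (rule integral_mono[OF _ int])
    show "integrable lborel (\<lambda>t. c * indicator {-1/2..1/2::real} t)" by simp
    fix t :: real
    show "c * indicator {-1/2..1/2} t \<le> beta_kernel p t"
    proof (cases "-1/2 \<le> t \<and> t \<le> 1/2")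
      case True
      then have "t\<^sup>2 \<le> (1/2)\<^sup>2" by (intro abs_le_square_iff[THEN iffD1]) (auto simp: abs_le_iff)
      then have "c \<le> (1 - t\<^sup>2) powr p" unfolding c_def using p by (intro powr_mono2) (auto simp: power2_eq_square)
      with True show ?thesis by (simp add: beta_kernel_def)
    next
      case False
      then have "indicator {-1/2..1/2} t = (0::real)" by auto
      then show ?thesis by (simp add: beta_kernel_nonneg)
    qed
  qed
  with c show ?thesis by simp
qed

text \<open>Integrate the derivative of
  \<open>t ^ (2 * q + 1) * (1 - t\<^sup>2) powr (p + 1)\<close>, which vanishes at both endpoints.
  After division by 2 the factors are \<open>q + 1 / 2\<close> and \<open>q + (p + 3 / 2)\<close>,
  which explains the parameter of \<open>beta_moment\<close>.\<close>

lemma beta_kernel_even_moment_step: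
  assumes p: "0 < p"
  shows "(2 * real q + 1) * (LINT t|lborel. t ^ (2 * q) * beta_kernel p t)
    = (2 * real q + 2 * p + 3) * (LINT t|lborel. t ^ (2 * Suc q) * beta_kernel p t)"
proof -
  let ?f = "\<lambda>t::real. (1 - t\<^sup>2) powr p * ((2 * real q + 1) * t ^ (2 * q) - (2 * real q + 2 * p + 3) * t ^ (2 * Suc q))"
  let ?F = "\<lambda>t::real. t ^ (2 * q + 1) * (1 - t\<^sup>2) powr (p + 1)"
  let ?g = "\<lambda>t. (2 * real q + 1) * (t ^ (2 * q) * beta_kernel p t) - (2 * real q + 2 * p + 3) * (t ^ (2 * Suc q) * beta_kernel p t)"
  have "(?f has_integral ?F 1 - ?F (-1)) {-1..1}"
  proof (rule fundamental_theorem_of_calculus_interior)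
    have "continuous_on {-1..1} (\<lambda>t::real. (1 - t\<^sup>2) powr (p + 1))"
      using p by (intro continuous_on_powr' continuous_intros) (auto simp: abs_square_le_1 abs_le_iff)
    then show "continuous_on {-1..1} ?F"
      by (rule continuous_on_mult[rotated]) (intro continuous_on_power continuous_on_id)
    fix t :: real assume t: "t \<in> {-1<..<1}"
    then have pos: "0 < 1 - t\<^sup>2" by (simp add: abs_square_less_1 abs_less_iff)
    have A: "((\<lambda>t. t ^ (2 * q + 1)) has_real_derivative real (2 * q + 1) * t ^ (2 * q)) (at t)"
      using DERIV_pow[of "2 * q + 1" t] by simp
    have B: "((\<lambda>t. (1 - t\<^sup>2) powr (p + 1)) has_real_derivative (p + 1) * (1 - t\<^sup>2) powr p * (- (2 * t))) (at t)"
      using pos by (auto intro!: derivative_eq_intros)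
    have "(?F has_real_derivative real (2 * q + 1) * t ^ (2 * q) * (1 - t\<^sup>2) powr (p + 1)
      + (p + 1) * (1 - t\<^sup>2) powr p * (- (2 * t)) * t ^ (2 * q + 1)) (at t)"
      by (rule DERIV_mult[OF A B])
    moreover have "real (2 * q + 1) * t ^ (2 * q) * (1 - t\<^sup>2) powr (p + 1)
      + (p + 1) * (1 - t\<^sup>2) powr p * (- (2 * t)) * t ^ (2 * q + 1) = ?f t"
    proof -
      have alg: "(2 * c + 1) * T * (P * (1 - t * t)) + (p + 1) * P * (- (2 * t)) * (T * t)
        = P * ((2 * c + 1) * T - (2 * c + 2 * p + 3) * (T * (t * t)))" for c T P :: real
        by (simp add: algebra_simps)
      have "(1 - t\<^sup>2) powr (p + 1) = (1 - t\<^sup>2) powr p * (1 - t * t)" using pos by (simp add: powr_add power2_eq_square)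
      moreover have "t ^ (2 * q + 1) = t ^ (2 * q) * t" "t ^ (2 * Suc q) = t ^ (2 * q) * (t * t)" by simp_all
      moreover have "real (2 * q + 1) = 2 * real q + 1" by simp
      ultimately show ?thesis by (simp only: alg)
    qed
    ultimately show "(?F has_vector_derivative ?f t) (at t)"
      by (simp add: has_real_derivative_iff_has_vector_derivative)
  qed simp
  then have "(?f has_integral 0) {-1..1}" using p by simp
  then have "((\<lambda>t. if t \<in> {-1..1} then ?f t else 0) has_integral 0) UNIV"
    by (subst has_integral_restrict_UNIV)
  also have "(\<lambda>t. if t \<in> {-1..1} then ?f t else 0) = ?g"
  proof
    fix t :: real
    consider "-1 < t \<and> t < 1" | "t = 1 \<or> t = -1" | "t < -1 \<or> 1 < t" by linarith
    then show "(if t \<in> {-1..1} then ?f t else 0) = ?g t"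
      by cases (auto simp: beta_kernel_def right_diff_distrib mult_ac)
  qed
  finally have 1: "(?g has_integral 0) UNIV" .
  have int: "integrable lborel ?g" by (intro Bochner_Integration.integrable_diff integrable_mult_right integrable_beta_kernel p)
  have "integral\<^sup>L lborel ?g = 0"
    using has_integral_unique[OF 1 has_integral_integral_lborel[OF int]] by simp
  moreover have "integral\<^sup>L lborel ?g = (2 * real q + 1) * (LINT t|lborel. t ^ (2 * q) * beta_kernel p t)
    - (2 * real q + 2 * p + 3) * (LINT t|lborel. t ^ (2 * Suc q) * beta_kernel p t)"
    unfolding Bochner_Integration.integral_diff[OF integrable_mult_right[OF integrable_beta_kernel[OF p, of "2 * q"]] integrable_mult_right[OF integrable_beta_kernel[OF p, of "2 * Suc q"]]]
    by (simp only: integral_mult_right_zero)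
  ultimately show ?thesis by (simp only: right_minus_eq)
qed

lemma beta_kernel_even_moment:
  assumes p: "0 < p"
  shows "(LINT t|lborel. t ^ (2 * q) * beta_kernel p t) = beta_norm p * beta_moment (p + 3 / 2) q"
proof (induction q)
  case (Suc q)
  have "(2 * real q + 2 * p + 3) * (LINT t|lborel. t ^ (2 * Suc q) * beta_kernel p t)
    = (2 * real q + 1) * (beta_norm p * beta_moment (p + 3 / 2) q)"
    using beta_kernel_even_moment_step[OF p, of q] Suc.IH by simp
  moreover have "0 < 2 * real q + 2 * p + 3" using p by simp
  ultimately have "(LINT t|lborel. t ^ (2 * Suc q) * beta_kernel p t) = (2 * real q + 1) * (beta_norm p * beta_moment (p + 3 / 2) q) / (2 * real q + 2 * p + 3)"
    by (simp add: eq_divide_eq mult.commute)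
  also have "\<dots> = beta_norm p * beta_moment (p + 3 / 2) q * ((2 * real q + 1) / (2 * real q + 2 * p + 3))" by simp
  also have "(2 * real q + 1) / (2 * real q + 2 * p + 3) = (real q + 1 / 2) / (real q + (p + 3 / 2))"
    using p by (simp add: field_simps)
  finally show ?case by (simp add: mult.assoc)
qed (simp add: beta_norm_def)

lemma beta_kernel_odd_moment: "(LINT t|lborel. t ^ (2 * q + 1) * beta_kernel p t) = 0"
proof -
  have "(LINT t|lborel. t ^ (2 * q + 1) * beta_kernel p t) = (LINT t|lborel. (0 + (-1) * t) ^ (2 * q + 1) * beta_kernel p (0 + (-1) * t))"
    by (subst lborel_integral_real_affine[where c="-1" and t=0]) auto
  also have "\<dots> = (LINT t|lborel. - (t ^ (2 * q + 1) * beta_kernel p t))"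
    by (intro Bochner_Integration.integral_cong refl) (auto simp: beta_kernel_def indicator_def)
  also have "\<dots> = - (LINT t|lborel. t ^ (2 * q + 1) * beta_kernel p t)" by simp
  finally show ?thesis by simp
qed

lemma sets_beta_law[measurable_cong, simp]: "sets (beta_law p) = sets borel"
  by (simp add: beta_law_def)

lemma space_beta_law[simp]: "space (beta_law p) = UNIV"
  by (simp add: beta_law_def)

lemma integral_beta_law:
  fixes f :: "real \<Rightarrow> real"
  assumes p: "0 < p" and [measurable]: "f \<in> borel_measurable borel"
  shows "(LINT t|beta_law p. f t) = (LINT t|lborel. f t * beta_kernel p t) / beta_norm p"
proof -
  have "(LINT t|beta_law p. f t) = (LINT t|lborel. (beta_kernel p t / beta_norm p) * f t)"
    unfolding beta_law_def using beta_norm_pos[OF p] by (subst integral_density) (auto simp: beta_kernel_nonneg)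
  also have "\<dots> = (LINT t|lborel. f t * beta_kernel p t / beta_norm p)"
    by (intro Bochner_Integration.integral_cong refl) simp
  finally show ?thesis by simp
qed

lemma prob_space_beta_law:
  assumes p: "0 < p"
  shows "prob_space (beta_law p)"
proof
  have "emeasure (beta_law p) UNIV = (\<integral>\<^sup>+t. ennreal (beta_kernel p t / beta_norm p) \<partial>lborel)"
    by (simp add: beta_law_def emeasure_density)
  also have "\<dots> = ennreal (LINT t|lborel. beta_kernel p t / beta_norm p)"
    using integrable_beta_kernel[OF p, of 0] beta_norm_pos[OF p] by (intro nn_integral_eq_integral) (auto simp: beta_kernel_nonneg)
  also have "(LINT t|lborel. beta_kernel p t / beta_norm p) = 1"
    using beta_norm_pos[OF p] by (simp add: beta_norm_def)
  finally show "emeasure (beta_law p) (space (beta_law p)) = 1" by simp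
qed

lemma beta_law_moments:
  assumes p: "0 < p"
  shows "(LINT t|beta_law p. t ^ (2 * q)) = beta_moment (p + 3 / 2) q" "(LINT t|beta_law p. t ^ (2 * q + 1)) = 0"
  using beta_norm_pos[OF p] beta_kernel_odd_moment[of q p] by (simp_all add: integral_beta_law[OF p] beta_kernel_even_moment[OF p])

lemma beta_law_bounded: "AE t in beta_law p. \<bar>t\<bar> \<le> 1"
  unfolding beta_law_def by (subst AE_density) (auto intro!: AE_I2 simp: beta_kernel_def indicator_def split: if_splits)

text \<open>Passing from \<open>q\<close> to \<open>Suc q\<close> multiplies both sides by
  \<open>(q + 1 / 2) / (q + e)\<close>. This links the Gamma quotients from the sphere with the
  recursion for beta laws.\<close>

lemma beta_moment_Gamma:
  assumes e: "0 < e"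
  shows "normal_moment q / 2 ^ q * (Gamma e / Gamma (real q + e)) = beta_moment e q"
proof (induction q)
  case 0
  then show ?case using Gamma_real_pos[OF e] by (simp add: normal_moment_def)
next
  case (Suc q)
  have "normal_moment (Suc q) = normal_moment q * (2 * real q + 1)"
  proof -
    have "(fact (2 * Suc q) :: real) * (2 ^ q * fact q) = (fact (2 * q) * (2 * real q + 1)) * (2 ^ Suc q * fact (Suc q))"
      by (simp add: algebra_simps)
    then show ?thesis unfolding normal_moment_def times_divide_eq_left by (subst frac_eq_eq) auto
  qed
  have "Gamma (real (Suc q) + e) = (real q + e) * Gamma (real q + e)"
  proof -
    have "real q + e \<notin> \<int>\<^sub>\<le>\<^sub>0" using e by (auto elim!: nonpos_Ints_cases)
    from Gamma_plus1[OF this] show ?thesis by (simp add: add_ac)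
  qed
  have "normal_moment (Suc q) / 2 ^ Suc q * (Gamma e / Gamma (real (Suc q) + e))
    = normal_moment q / 2 ^ q * (Gamma e / Gamma (real q + e)) * ((2 * real q + 1) / 2 / (real q + e))"
  proof -
    have "(a * b) / (2 * c) * (g / (r * h)) = a / c * (g / h) * (b / 2 / r)" for a b c g r h :: real by (simp add: mult_ac)
    then show ?thesis
      by (simp only: \<open>normal_moment (Suc q) = _\<close> \<open>Gamma (real (Suc q) + e) = _\<close> power_Suc)
  qed
  also have "\<dots> = beta_moment e q * ((2 * real q + 1) / 2 / (real q + e))" by (simp only: Suc.IH)
  also have "(2 * real q + 1) / 2 = real q + 1 / 2" by simp
  finally show ?case by simp
qed

lemma beta_moment_nonneg: "0 < e \<Longrightarrow> 0 \<le> beta_moment e q"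
  by (induction q) auto

text \<open>The factorial in \<open>height_const\<close> cancels \<open>Gamma q\<close> in the Beta
  function. The order 0 is the total mass and is treated separately.\<close>

lemma sphere_height_even_moment:
  assumes d: "2 \<le> d"
  shows "(\<integral>\<^sup>+\<theta>. ennreal (plane_dist d \<theta> (\<lambda>_. 1) ^ (2 * q)) \<partial>(\<Pi>\<^sub>M i\<in>{..<d}. uniform_sphere d))
    = ennreal (beta_moment ((d / 2 - 1) * d + 1) q)"
proof (cases "q = 0")
  case True
  interpret prob_space "\<Pi>\<^sub>M i\<in>{..<d}. uniform_sphere d" by (intro prob_space_PiM prob_space_uniform_sphere)
  show ?thesis using True emeasure_space_1 by simp
next
  case False
  let ?e = "(d / 2 - 1) * d + 1 :: real"
  have e: "0 < ?e" using d by (intro add_nonneg_pos mult_nonneg_nonneg) auto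
  have G: "Gamma (real q) = fact (q - 1)"
    using False Gamma_fact[of "q - 1", where 'a=real] by (simp add: of_nat_diff)
  have "height_const q * Beta (real q) ?e = normal_moment q / 2 ^ q * (Gamma ?e / Gamma (real q + ?e))"
    by (simp add: height_const_def Beta_def G)
  then show ?thesis
    using sphere_height_moment[OF d, of q] False beta_moment_Gamma[OF e, of q] by simp
qed

lemma ennreal_mult3: "0 \<le> a \<Longrightarrow> 0 \<le> b \<Longrightarrow> ennreal a * (ennreal b * ennreal c) = ennreal (a * (b * c))"
  by (simp add: ennreal_mult')

section \<open>The laws of a coordinate and of the distance\<close>

text \<open>Variance 1/2 makes the joint density proportional to \<open>exp (- nsq d x)\<close>, so
  that the radial integral is a plain Gamma integral.\<close>

lemma nn_integral_normal_even_moment_scaled: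
  "(\<integral>\<^sup>+z. ennreal (z ^ (2 * q)) * ennreal (sqrt 2 * std_normal_density (sqrt 2 * z)) \<partial>lborel) = ennreal (normal_moment q / 2 ^ q)"
proof -
  have "ennreal (normal_moment q) = (\<integral>\<^sup>+z. ennreal (\<bar>z\<bar> ^ (2 * q)) * ennreal (std_normal_density z) \<partial>lborel)"
    by (rule nn_integral_normal_even_moment[symmetric])
  also have "\<dots> = ennreal \<bar>sqrt 2\<bar> * (\<integral>\<^sup>+z. ennreal (\<bar>0 + sqrt 2 * z\<bar> ^ (2 * q)) * ennreal (std_normal_density (0 + sqrt 2 * z)) \<partial>lborel)"
    by (rule nn_integral_real_affine) auto
  also have "\<dots> = (\<integral>\<^sup>+z. ennreal \<bar>sqrt 2\<bar> * (ennreal (\<bar>0 + sqrt 2 * z\<bar> ^ (2 * q)) * ennreal (std_normal_density (0 + sqrt 2 * z))) \<partial>lborel)"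
    by (rule nn_integral_cmult[symmetric]) measurable
  also have "\<dots> = (\<integral>\<^sup>+z. ennreal (2 ^ q) * (ennreal (z ^ (2 * q)) * ennreal (sqrt 2 * std_normal_density (sqrt 2 * z))) \<partial>lborel)"
  proof (rule nn_integral_cong)
    fix z :: real
    have "\<bar>0 + sqrt 2 * z\<bar> ^ (2 * q) = 2 ^ q * z ^ (2 * q)"
      by (simp add: power_even_abs power_mult_distrib power_mult)
    then have "ennreal \<bar>sqrt 2\<bar> * (ennreal (\<bar>0 + sqrt 2 * z\<bar> ^ (2 * q)) * ennreal (std_normal_density (0 + sqrt 2 * z)))
      = ennreal (\<bar>sqrt 2\<bar> * ((2 ^ q * z ^ (2 * q)) * std_normal_density (0 + sqrt 2 * z)))"
      by (simp only:) (rule ennreal_mult3, simp_all)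
    also have "\<bar>sqrt 2\<bar> * ((2 ^ q * z ^ (2 * q)) * std_normal_density (0 + sqrt 2 * z))
      = 2 ^ q * (z ^ (2 * q) * (sqrt 2 * std_normal_density (sqrt 2 * z)))" by simp
    also have "ennreal \<dots> = ennreal (2 ^ q) * (ennreal (z ^ (2 * q)) * ennreal (sqrt 2 * std_normal_density (sqrt 2 * z)))"
      by (rule ennreal_mult3[symmetric]) simp_all
    finally show "ennreal \<bar>sqrt 2\<bar> * (ennreal (\<bar>0 + sqrt 2 * z\<bar> ^ (2 * q)) * ennreal (std_normal_density (0 + sqrt 2 * z)))
      = ennreal (2 ^ q) * (ennreal (z ^ (2 * q)) * ennreal (sqrt 2 * std_normal_density (sqrt 2 * z)))" .
  qed
  also have "\<dots> = ennreal (2 ^ q) * (\<integral>\<^sup>+z. ennreal (z ^ (2 * q)) * ennreal (sqrt 2 * std_normal_density (sqrt 2 * z)) \<partial>lborel)"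
    by (rule nn_integral_cmult) measurable
  finally have "ennreal (2 ^ q) * (\<integral>\<^sup>+z. ennreal (z ^ (2 * q)) * ennreal (sqrt 2 * std_normal_density (sqrt 2 * z)) \<partial>lborel) = ennreal (2 ^ q) * ennreal (normal_moment q / 2 ^ q)"
    by (simp add: ennreal_mult'[symmetric])
  then show ?thesis by (rule ennreal_cancel[rotated 2]) auto
qed

lemma radial_Gamma:
  assumes d: "0 < d"
  shows "(\<integral>\<^sup>+t. ennreal (t ^ q * exp (- t)) \<partial>radial d) = ball_vol d * ennreal (d / 2 * Gamma (real q + d / 2))"
proof -
  have x: "0 < real q + d / 2" using d by simp
  have "(\<integral>\<^sup>+t. ennreal (t ^ q * exp (- t)) \<partial>radial d)
    = (\<integral>\<^sup>+t. ball_vol d * ennreal (d / 2 * t powr (d / 2 - 1)) * indicator {0<..} t * ennreal (t ^ q * exp (- t)) \<partial>lborel)"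
    unfolding radial_def by (rule nn_integral_density) measurable
  also have "\<dots> = (\<integral>\<^sup>+t. (ball_vol d * ennreal (d / 2)) * ennreal (indicator {0..} t * (t powr (real q + d / 2 - 1) / exp t)) \<partial>lborel)"
  proof (rule nn_integral_cong_AE)
    have "AE t in lborel. t \<noteq> (0::real)" by (rule AE_lborel_singleton)
    then show "AE t in lborel. ball_vol d * ennreal (d / 2 * t powr (d / 2 - 1)) * indicator {0<..} t * ennreal (t ^ q * exp (- t))
      = (ball_vol d * ennreal (d / 2)) * ennreal (indicator {0..} t * (t powr (real q + d / 2 - 1) / exp t))"
    proof eventually_elim
      case (elim t)
      show ?case
      proof (cases "0 < t")
        case True
        have "t powr (real q + d / 2 - 1) = t ^ q * t powr (d / 2 - 1)"
          using True by (simp add: powr_realpow[symmetric] powr_add[symmetric] add_diff_eq)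
        then have "ennreal (d / 2 * t powr (d / 2 - 1)) * ennreal (t ^ q * exp (- t)) = ennreal (d / 2) * ennreal (t powr (real q + d / 2 - 1) / exp t)"
          using True by (simp add: ennreal_mult'[symmetric] exp_minus field_simps)
        with True show ?thesis by (simp add: mult.assoc)
      next
        case False
        with elim have "indicator {0<..} t = (0::ennreal)" "indicator {0..} t = (0::real)" by auto
        then show ?thesis by (simp only: mult_zero_left mult_zero_right ennreal_0)
      qed
    qed
  qed
  also have "\<dots> = ball_vol d * ennreal (d / 2) * ennreal (Gamma (real q + d / 2))"
    using nn_integral_has_integral_lebesgue[OF _ Gamma_integral_real[OF x]] by (subst nn_integral_cmult) auto
  finally show ?thesis by (simp add: mult.assoc ennreal_mult'[symmetric])
qed

lemma sphere_coord_measurable1: "(\<lambda>\<theta>. \<theta> j) \<in> borel_measurable (uniform_sphere d)"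
  using measurable_coord[of j] by (simp cong: measurable_cong_sets)

text \<open>A Gaussian coordinate is the product of the length of the vector and a coordinate of its
  direction, and these are independent. The moment on the sphere is thus a quotient of a normal and
  a radial moment.\<close>

lemma sphere_coord_even_moment:
  assumes d: "0 < d"
  shows "(\<integral>\<^sup>+\<theta>. ennreal (\<theta> 0 ^ (2 * q)) \<partial>uniform_sphere d) = ennreal (beta_moment (d / 2) q)"
proof -
  interpret S: prob_space "uniform_sphere d" by (rule prob_space_uniform_sphere)
  interpret R: sigma_finite_measure "radial d" by (rule sigma_finite_radial[OF d])
  interpret SR: pair_sigma_finite "uniform_sphere d" "radial d" ..
  have em: "(\<lambda>t::real. ennreal (t ^ q * exp (- t))) \<in> borel_measurable (radial d)" for q by measurable
  have em': "(\<lambda>t::real. ennreal a * ennreal (t ^ q * exp (- t))) \<in> borel_measurable (radial d)" for a q by measurable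
  note [measurable] = measurable_coord[of 0] sphere_coord_measurable1[of 0 d]
  define c where "c = (sqrt 2 / sqrt (2 * pi)) ^ d"
  have c: "0 < c" by (simp add: c_def)
  define E where "E q = (\<integral>\<^sup>+\<theta>. ennreal (\<theta> 0 ^ (2 * q)) \<partial>uniform_sphere d)" for q
  have step: "ennreal (normal_moment q / 2 ^ q) = E q * (ennreal c * (ball_vol d * ennreal (d / 2 * Gamma (real q + d / 2))))" for q
  proof -
    have zero: "0 \<in> {..<d}" using d by simp
    have one: "(\<integral>\<^sup>+z. ennreal (sqrt 2 * std_normal_density (sqrt 2 * z)) \<partial>lborel) = 1"
      using nn_integral_normal_even_moment_scaled[of 0] by (simp add: normal_moment_def)
    have "(\<integral>\<^sup>+x. (\<Prod>j<d. (if j = 0 then ennreal (x j ^ (2 * q)) else 1) * ennreal (sqrt 2 * std_normal_density (sqrt 2 * x j))) \<partial>leb {..<d})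
      = (\<Prod>j<d. \<integral>\<^sup>+z. (if j = 0 then ennreal (z ^ (2 * q)) else 1) * ennreal (sqrt 2 * std_normal_density (sqrt 2 * z)) \<partial>lborel)"
      by (rule leb.product_nn_integral_prod) auto
    also have "\<dots> = (\<Prod>j<d. if j = 0 then ennreal (normal_moment q / 2 ^ q) else 1)"
      by (intro prod.cong refl) (simp add: nn_integral_normal_even_moment_scaled one)
    also have "\<dots> = ennreal (normal_moment q / 2 ^ q)" using d by (simp add: prod.delta)
    finally have "ennreal (normal_moment q / 2 ^ q)
      = (\<integral>\<^sup>+x. (\<Prod>j<d. (if j = 0 then ennreal (x j ^ (2 * q)) else 1) * ennreal (sqrt 2 * std_normal_density (sqrt 2 * x j))) \<partial>leb {..<d})" ..
    also have "\<dots> = (\<integral>\<^sup>+x. ennreal (dir d x 0 ^ (2 * q)) * (ennreal c * ennreal (nsq d x ^ q * exp (- nsq d x))) \<partial>leb {..<d})"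
    proof (rule nn_integral_cong)
      fix x :: "nat \<Rightarrow> real"
      have "(\<Prod>j<d. if j = 0 then ennreal (x j ^ (2 * q)) else 1) = ennreal (x 0 ^ (2 * q))"
        using d by (simp add: prod.delta)
      also have "x 0 ^ (2 * q) = dir d x 0 ^ (2 * q) * nsq d x ^ q"
      proof -
        have "x 0 = sqrt (nsq d x) * dir d x 0" using d by (simp add: sqrt_nsq_dir)
        then have "x 0 ^ (2 * q) = (sqrt (nsq d x)) ^ (2 * q) * dir d x 0 ^ (2 * q)"
          by (metis power_mult_distrib)
        also have "(sqrt (nsq d x)) ^ (2 * q) = nsq d x ^ q" by (simp add: power_mult nsq_nonneg)
        finally show ?thesis by simp
      qed
      finally have 1: "(\<Prod>j<d. if j = 0 then ennreal (x j ^ (2 * q)) else 1) = ennreal (dir d x 0 ^ (2 * q) * nsq d x ^ q)" .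
      have 2: "(\<Prod>j<d. ennreal (sqrt 2 * std_normal_density (sqrt 2 * x j))) = ennreal c * ennreal (exp (- nsq d x))"
        using prod_row_density[of 2 x d] by (simp add: c_def)
      have 0: "0 \<le> dir d x 0 ^ (2 * q)" "0 \<le> nsq d x ^ q" by (simp_all add: nsq_nonneg)
      show "(\<Prod>j<d. (if j = 0 then ennreal (x j ^ (2 * q)) else 1) * ennreal (sqrt 2 * std_normal_density (sqrt 2 * x j)))
        = ennreal (dir d x 0 ^ (2 * q)) * (ennreal c * ennreal (nsq d x ^ q * exp (- nsq d x)))"
        unfolding prod.distrib 1 2 ennreal_mult'[OF 0(1)] ennreal_mult'[OF 0(2)] by (simp only: mult_ac)
    qed
    also have "\<dots> = (\<integral>\<^sup>+p. ennreal (fst p 0 ^ (2 * q)) * (ennreal c * ennreal (snd p ^ q * exp (- snd p))) \<partial>distr (leb {..<d}) (borel \<Otimes>\<^sub>M borel) (\<lambda>x. (dir d x, nsq d x)))"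
      by (subst nn_integral_distr) auto
    also have "\<dots> = (\<integral>\<^sup>+t. \<integral>\<^sup>+\<theta>. ennreal (\<theta> 0 ^ (2 * q)) * (ennreal c * ennreal (t ^ q * exp (- t))) \<partial>uniform_sphere d \<partial>radial d)"
      unfolding distr_leb_polar[OF d] by (subst SR.nn_integral_snd[symmetric]) auto
    also have "\<dots> = (\<integral>\<^sup>+t. E q * (ennreal c * ennreal (t ^ q * exp (- t))) \<partial>radial d)"
      unfolding E_def by (intro nn_integral_cong nn_integral_multc) measurable
    also have "\<dots> = E q * (\<integral>\<^sup>+t. ennreal c * ennreal (t ^ q * exp (- t)) \<partial>radial d)"
      by (rule nn_integral_cmult[OF em'])
    also have "(\<integral>\<^sup>+t. ennreal c * ennreal (t ^ q * exp (- t)) \<partial>radial d) = ennreal c * (\<integral>\<^sup>+t. ennreal (t ^ q * exp (- t)) \<partial>radial d)"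
      by (rule nn_integral_cmult[OF em])
    finally show ?thesis unfolding radial_Gamma[OF d] .
  qed
  obtain V where V: "ball_vol d = ennreal V" "0 < V"
    using ball_vol_pos[of d] ball_vol_finite[of d] by (cases "ball_vol d") auto
  define K where "K = c * V * (d / 2)"
  have K: "0 < K" using c V d by (simp add: K_def)
  have G: "0 < Gamma (real q + d / 2)" for q using d by (intro Gamma_real_pos) simp
  have step': "ennreal (normal_moment q / 2 ^ q) = E q * ennreal (K * Gamma (real q + d / 2))" for q
    unfolding step V K_def using c V(2) G[of q] by (simp add: ennreal_mult'[symmetric] mult.assoc)
  \<comment> \<open>The case \<open>q = 0\<close> fixes \<open>K\<close>, so the volume of the ball
    never has to be computed.\<close>
  have "E 0 = 1" using S.emeasure_space_1 by (simp add: E_def)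
  then have "K * Gamma (d / 2) = 1"
    using step'[of 0] K G[of 0] by (simp add: normal_moment_def)
  then have KG: "K = 1 / Gamma (d / 2)" using G[of 0] by (simp add: field_simps)
  have "ennreal (K * Gamma (real q + d / 2)) * E q = ennreal (K * Gamma (real q + d / 2)) * ennreal (beta_moment (d / 2) q)"
  proof -
    have "normal_moment q / 2 ^ q = K * Gamma (real q + d / 2) * beta_moment (d / 2) q"
    proof -
      have "a = 1 / g * h * b" if "a * (g / h) = b" "0 < g" "0 < h" for a b g h :: real
        using that by (auto simp: field_simps)
      from this[OF beta_moment_Gamma[of "d / 2" q]] show ?thesis using d G[of q] G[of 0] by (simp add: KG)
    qed
    moreover have "0 \<le> K * Gamma (real q + d / 2)" using K G[of q] by simp
    ultimately show ?thesis using step'[of q] by (metis ennreal_mult' mult.commute)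
  qed
  then have "E q = ennreal (beta_moment (d / 2) q)"
    by (rule ennreal_cancel[rotated 2]) (use K G[of q] in \<open>auto simp: ennreal_eq_0_iff not_le\<close>)
  then show ?thesis by (simp add: E_def)
qed

text \<open>The reflection exchanging \<open>u\<close> and the first basis vector preserves the uniform distribution on the ball.\<close>

lemma uniform_sphere_inner:
  assumes d: "0 < d" and u: "nsq d u = 1" and [measurable]: "G \<in> borel_measurable borel"
  shows "(\<integral>\<^sup>+\<theta>. G (\<Sum>i<d. \<theta> i * u i) \<partial>uniform_sphere d) = (\<integral>\<^sup>+\<theta>. G (\<theta> 0) \<partial>uniform_sphere d)"
proof -
  note [measurable] = measurable_coord
  let ?B = "{x \<in> space (leb {..<d}). nsq d x \<le> 1}"
  have B[measurable]: "?B \<in> sets (leb {..<d})" by measurable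
  have eq: "(\<integral>\<^sup>+\<theta>. F \<theta> \<partial>uniform_sphere d) = (\<integral>\<^sup>+x. F (dir d x) * indicator ?B x \<partial>leb {..<d}) / ball_vol d"
    if [measurable]: "F \<in> borel_measurable borel" for F :: "(nat \<Rightarrow> real) \<Rightarrow> ennreal"
  proof -
    have "(\<integral>\<^sup>+\<theta>. F \<theta> \<partial>uniform_sphere d) = (\<integral>\<^sup>+x. F (dir d x) \<partial>uniform_measure (leb {..<d}) ?B)"
      unfolding uniform_sphere_def uniform_ball_def euclid_norm_le_1_iff dir_def[symmetric]
      by (subst nn_integral_distr) auto
    also have "\<dots> = (\<integral>\<^sup>+x. F (dir d x) * indicator ?B x \<partial>leb {..<d}) / ball_vol d"
      by (subst nn_integral_uniform_measure) (auto simp: ball_vol_def mult.commute)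
    finally show ?thesis .
  qed
  let ?e = "\<lambda>i::nat. if i = 0 then 1 else (0::real)"
  let ?R = "hyper_reflect {..<d} (\<lambda>i. u i - ?e i)"
  have Ru: "?R u = (\<lambda>i\<in>{..<d}. ?e i)"
    using d u by (intro hyper_reflect_swap) (simp_all add: nsq_def if_distrib[where f="\<lambda>x. x\<^sup>2"] cong: if_cong)
  have nR: "nsq d (?R x) = nsq d x" for x
    unfolding nsq_def power2_eq_square by (rule hyper_reflect_inner) simp
  have R0: "?R x 0 = (\<Sum>i<d. x i * u i)" for x
  proof -
    have "(\<Sum>i<d. x i * u i) = (\<Sum>i<d. ?R x i * ?R u i)" by (rule hyper_reflect_inner[symmetric]) simp
    also have "\<dots> = ?R x 0"
      unfolding Ru using d by (simp add: if_distrib[where f="\<lambda>z. _ * z"] cong: if_cong)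
    finally show ?thesis ..
  qed
  have dirR: "(\<Sum>i<d. dir d x i * u i) = dir d (?R x) 0" for x
    using d by (simp add: dir_def euclid_norm_nsq nR R0 sum_divide_distrib)
  have "(\<integral>\<^sup>+x. G (\<Sum>i<d. dir d x i * u i) * indicator ?B x \<partial>leb {..<d})
    = (\<integral>\<^sup>+x. (\<lambda>y. G (dir d y 0) * indicator ?B y) (?R x) \<partial>leb {..<d})"
    by (intro nn_integral_cong) (auto simp: dirR nR indicator_def hyper_reflect_space)
  also have "\<dots> = (\<integral>\<^sup>+x. G (dir d x 0) * indicator ?B x \<partial>leb {..<d})"
    by (rule nn_integral_leb_hyper_reflect) measurable
  finally show ?thesis
    by (subst (1 2) eq) measurable
qed

text \<open>Moments are computed as nonnegative extended integrals but compared as real ones;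
  boundedness by 1 gives integrability.\<close>

lemma nn_to_integral_bounded:
  assumes P: "prob_space P" and f[measurable]: "f \<in> borel_measurable P" and f0: "AE x in P. 0 \<le> f x" and f1: "AE x in P. f x \<le> 1"
    and c: "0 \<le> c" and nn: "(\<integral>\<^sup>+x. ennreal (f x) \<partial>P) = ennreal c"
  shows "(LINT x|P. f x) = c"
proof -
  interpret prob_space P by fact
  have "integrable P f"
    using f0 f1 by (intro integrable_const_bound[of _ 1] f) (auto elim: AE_mp)
  from nn_integral_eq_integral[OF this f0] nn have "ennreal (LINT x|P. f x) = ennreal c" by simp
  then show ?thesis using c integral_nonneg_AE[OF f0] by simp
qed

lemma real_distribution_distr:
  assumes "prob_space P" "f \<in> borel_measurable P"
  shows "real_distribution (distr P borel f)"
proof -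
  interpret prob_space P by fact
  show ?thesis by (rule real_distribution_distr) (use assms in simp)
qed

lemma AE_sphere_coord_bounded:
  assumes d: "0 < d" and j: "j < d"
  shows "AE \<theta> in uniform_sphere d. \<bar>\<theta> j\<bar> \<le> 1"
  using AE_uniform_sphere_nsq[OF d]
proof eventually_elim
  case (elim \<theta>)
  have "(\<theta> j)\<^sup>2 \<le> nsq d \<theta>" unfolding nsq_def using j by (intro member_le_sum) auto
  then show ?case using elim by (simp add: abs_square_le_1)
qed

text \<open>The even moments agree by the two computations, and the odd ones vanish on both sides by
  symmetry. \<open>4 \<le> d\<close> makes the exponent of the beta law positive.\<close>

lemma distr_sphere_coord:
  assumes d: "4 \<le> d"
  shows "distr (uniform_sphere d) borel (\<lambda>\<theta>. \<theta> 0) = beta_law (d / 2 - 3 / 2)"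
proof (rule moments_determine)
  have d0: "0 < d" using d by simp
  have p: "0 < d / 2 - 3 / 2" using d by simp
  note m0 = sphere_coord_measurable1[of 0 d]
  show "real_distribution (distr (uniform_sphere d) borel (\<lambda>\<theta>. \<theta> 0))"
    by (rule real_distribution_distr[OF prob_space_uniform_sphere m0])
  have P: "prob_space (beta_law (d / 2 - 3 / 2))" by (rule prob_space_beta_law[OF p])
  show "real_distribution (beta_law (d / 2 - 3 / 2))"
    using P by (simp add: real_distribution_def real_distribution_axioms_def)
  show "AE x in distr (uniform_sphere d) borel (\<lambda>\<theta>. \<theta> 0). \<bar>x\<bar> \<le> 1"
    using AE_sphere_coord_bounded[OF d0 d0] m0 by (subst AE_distr_iff) auto
  show "AE x in beta_law (d / 2 - 3 / 2). \<bar>x\<bar> \<le> 1" by (rule beta_law_bounded)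
  fix k
  have eq: "(LINT x|distr (uniform_sphere d) borel (\<lambda>\<theta>. \<theta> 0). x ^ k) = (LINT \<theta>|uniform_sphere d. \<theta> 0 ^ k)"
    using m0 by (subst integral_distr) auto
  show "(LINT x|distr (uniform_sphere d) borel (\<lambda>\<theta>. \<theta> 0). x ^ k) = (LINT x|beta_law (d / 2 - 3 / 2). x ^ k)"
  proof (cases "even k")
    case True
    then obtain q where k: "k = 2 * q" by (auto elim: evenE)
    have "(LINT \<theta>|uniform_sphere d. \<theta> 0 ^ (2 * q)) = beta_moment (d / 2) q"
    proof (rule nn_to_integral_bounded[OF prob_space_uniform_sphere])
      show "(\<lambda>\<theta>. \<theta> 0 ^ (2 * q)) \<in> borel_measurable (uniform_sphere d)" using m0 by (rule borel_measurable_power)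
      show "AE \<theta> in uniform_sphere d. \<theta> 0 ^ (2 * q) \<le> 1"
        using AE_sphere_coord_bounded[OF d0 d0]
      proof eventually_elim
        case (elim \<theta>)
        then have "\<bar>\<theta> 0\<bar> ^ (2 * q) \<le> 1" by (intro power_le_one) auto
        then show ?case by (simp add: power_even_abs)
      qed
    qed (use sphere_coord_even_moment[OF d0, of q] d in \<open>auto intro: beta_moment_nonneg\<close>)
    then show ?thesis unfolding eq unfolding k using beta_law_moments(1)[OF p, of q] by simp
  next
    case False
    then obtain q where k: "k = 2 * q + 1" by (auto elim: oddE)
    \<comment> \<open>The inner product with the negative first basis vector is
      \<open>- \<theta> 0\<close>, so the invariance under unit vectors shows the symmetry of the
      law.\<close>
    let ?u = "\<lambda>i::nat. if i = 0 then -1 else (0::real)"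
    have "nsq d ?u = 1" using d0 by (simp add: nsq_def if_distrib[where f="\<lambda>x. x\<^sup>2"] cong: if_cong)
    have sum: "(\<Sum>i<d. \<theta> i * ?u i) = - \<theta> 0" for \<theta> :: "nat \<Rightarrow> real"
      using d0 by (simp add: if_distrib[where f="\<lambda>z. _ * z"] cong: if_cong)
    have "distr (uniform_sphere d) borel (\<lambda>\<theta>. - \<theta> 0) = distr (uniform_sphere d) borel (\<lambda>\<theta>. \<theta> 0)"
    proof (rule measure_eqI)
      fix A assume "A \<in> sets (distr (uniform_sphere d) borel (\<lambda>\<theta>. - \<theta> 0))"
      then have A[measurable]: "A \<in> sets borel" by simp
      have m0': "(\<lambda>\<theta>. - \<theta> 0) \<in> borel_measurable (uniform_sphere d)" using m0 by (rule borel_measurable_uminus)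
      have "emeasure (distr (uniform_sphere d) borel (\<lambda>\<theta>. - \<theta> 0)) A = (\<integral>\<^sup>+\<theta>. indicator A (- \<theta> 0) \<partial>uniform_sphere d)"
        using A m0' by (subst nn_integral_indicator[symmetric], simp) (subst nn_integral_distr, auto)
      also have "\<dots> = (\<integral>\<^sup>+\<theta>. indicator A (\<theta> 0) \<partial>uniform_sphere d)"
        using uniform_sphere_inner[OF d0 \<open>nsq d ?u = 1\<close>, of "indicator A"] A unfolding sum by simp
      also have "\<dots> = emeasure (distr (uniform_sphere d) borel (\<lambda>\<theta>. \<theta> 0)) A"
        using A m0 by (subst nn_integral_indicator[symmetric], simp) (subst nn_integral_distr, auto)
      finally show "emeasure (distr (uniform_sphere d) borel (\<lambda>\<theta>. - \<theta> 0)) A = emeasure (distr (uniform_sphere d) borel (\<lambda>\<theta>. \<theta> 0)) A" .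
    qed simp
    then have "(LINT x|distr (uniform_sphere d) borel (\<lambda>\<theta>. - \<theta> 0). x ^ k) = (LINT x|distr (uniform_sphere d) borel (\<lambda>\<theta>. \<theta> 0). x ^ k)"
      by simp
    also have "(LINT x|distr (uniform_sphere d) borel (\<lambda>\<theta>. - \<theta> 0). x ^ k) = (LINT \<theta>|uniform_sphere d. (- \<theta> 0) ^ k)"
      using m0 by (subst integral_distr) auto
    also have "\<dots> = - (LINT \<theta>|uniform_sphere d. \<theta> 0 ^ k)" using False by simp
    finally have "(LINT \<theta>|uniform_sphere d. \<theta> 0 ^ k) = 0" unfolding eq by simp
    then show ?thesis unfolding eq unfolding k using beta_law_moments(2)[OF p, of q] by simp
  qed
qed

text \<open>This is \<open>(d\<^sup>2 - 2 d - 1) / 2\<close>.\<close>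

definition height_exponent :: "nat \<Rightarrow> real"
  where "height_exponent d = (d / 2 - 1) * d - 1 / 2"

lemma height_exponent_pos: "3 \<le> d \<Longrightarrow> 0 < height_exponent d"
proof -
  assume d: "3 \<le> d"
  have "(1 / 2) * 3 \<le> (d / 2 - 1) * real d" using d by (intro mult_mono) auto
  then show ?thesis by (simp add: height_exponent_def)
qed

text \<open>The Gaussian computation gives even moments only, which are all the moments of the
  square. Since the distance is nonnegative, its law can be recovered from that of the
  square.\<close>

lemma distr_sphere_height_square:
  assumes d: "3 \<le> d"
  shows "distr (\<Pi>\<^sub>M i\<in>{..<d}. uniform_sphere d) borel (\<lambda>\<theta>. (plane_dist d \<theta> (\<lambda>_. 1))\<^sup>2) = distr (beta_law (height_exponent d)) borel (\<lambda>t. t\<^sup>2)"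
proof (rule moments_determine)
  let ?S = "\<Pi>\<^sub>M i\<in>{..<d}. uniform_sphere d"
  have p: "0 < height_exponent d" by (rule height_exponent_pos[OF d])
  have d0: "0 < d" using d by simp
  have S: "prob_space ?S" by (intro prob_space_PiM prob_space_uniform_sphere)
  have hm: "(\<lambda>\<theta>. (plane_dist d \<theta> (\<lambda>_. 1))\<^sup>2) \<in> borel_measurable ?S" by measurable
  show "real_distribution (distr ?S borel (\<lambda>\<theta>. (plane_dist d \<theta> (\<lambda>_. 1))\<^sup>2))"
    by (rule real_distribution_distr[OF S hm])
  show "real_distribution (distr (beta_law (height_exponent d)) borel (\<lambda>t. t\<^sup>2))"
    by (rule real_distribution_distr[OF prob_space_beta_law[OF p]]) measurable
  have b: "AE \<theta> in ?S. (plane_dist d \<theta> (\<lambda>_. 1))\<^sup>2 \<le> 1"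
  proof -
    have "AE \<theta> in ?S. nsq d (\<theta> 0) = 1"
      by (rule AE_PiM_component[where M="\<lambda>_. uniform_sphere d" and P="\<lambda>y. nsq d y = 1"])
        (use d0 in \<open>simp_all add: prob_space_uniform_sphere AE_uniform_sphere_nsq\<close>)
    then show ?thesis by eventually_elim (use plane_dist_le_norm[OF d0] in metis)
  qed
  then show "AE x in distr ?S borel (\<lambda>\<theta>. (plane_dist d \<theta> (\<lambda>_. 1))\<^sup>2). \<bar>x\<bar> \<le> 1"
    using hm by (subst AE_distr_iff) auto
  show "AE x in distr (beta_law (height_exponent d)) borel (\<lambda>t. t\<^sup>2). \<bar>x\<bar> \<le> 1"
    using beta_law_bounded[of "height_exponent d"] by (subst AE_distr_iff) (auto simp: abs_square_le_1)
  fix k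
  have "(LINT \<theta>|?S. plane_dist d \<theta> (\<lambda>_. 1) ^ (2 * k)) = beta_moment ((d / 2 - 1) * d + 1) k"
  proof (rule nn_to_integral_bounded[OF S])
    show "(\<lambda>\<theta>. plane_dist d \<theta> (\<lambda>_. 1) ^ (2 * k)) \<in> borel_measurable ?S" by measurable
    show "AE \<theta> in ?S. plane_dist d \<theta> (\<lambda>_. 1) ^ (2 * k) \<le> 1"
      using b by eventually_elim (simp add: power_mult power_le_one)
    have "0 < (d / 2 - 1) * d + (1::real)" using p by (simp add: height_exponent_def)
    then show "0 \<le> beta_moment ((d / 2 - 1) * d + 1) k" by (rule beta_moment_nonneg)
  qed (use sphere_height_even_moment[of d k] d in \<open>auto simp: plane_dist_nonneg\<close>)
  also have "\<dots> = (LINT t|beta_law (height_exponent d). t ^ (2 * k))"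
    unfolding beta_law_moments(1)[OF p] by (simp add: height_exponent_def add.commute)
  finally have "(LINT \<theta>|?S. plane_dist d \<theta> (\<lambda>_. 1) ^ (2 * k)) = (LINT t|beta_law (height_exponent d). t ^ (2 * k))" .
  then show "(LINT x|distr ?S borel (\<lambda>\<theta>. (plane_dist d \<theta> (\<lambda>_. 1))\<^sup>2). x ^ k) = (LINT x|distr (beta_law (height_exponent d)) borel (\<lambda>t. t\<^sup>2). x ^ k)"
    using hm by (subst (1 2) integral_distr) (auto simp: power_mult)
qed

lemma nn_integral_sphere_height:
  assumes d: "3 \<le> d" and [measurable]: "g \<in> borel_measurable borel"
  shows "(\<integral>\<^sup>+\<theta>. g (plane_dist d \<theta> (\<lambda>_. 1)) \<partial>(\<Pi>\<^sub>M i\<in>{..<d}. uniform_sphere d)) = (\<integral>\<^sup>+t. g \<bar>t\<bar> \<partial>beta_law (height_exponent d))"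
proof -
  let ?S = "\<Pi>\<^sub>M i\<in>{..<d}. uniform_sphere d"
  have hm: "(\<lambda>\<theta>. (plane_dist d \<theta> (\<lambda>_. 1))\<^sup>2) \<in> borel_measurable ?S" by measurable
  have "(\<integral>\<^sup>+\<theta>. g (plane_dist d \<theta> (\<lambda>_. 1)) \<partial>?S) = (\<integral>\<^sup>+x. g (sqrt x) \<partial>distr ?S borel (\<lambda>\<theta>. (plane_dist d \<theta> (\<lambda>_. 1))\<^sup>2))"
    using hm by (subst nn_integral_distr) (auto simp: plane_dist_nonneg)
  also have "\<dots> = (\<integral>\<^sup>+t. g \<bar>t\<bar> \<partial>beta_law (height_exponent d))"
    unfolding distr_sphere_height_square[OF d] by (subst nn_integral_distr) auto
  finally show ?thesis .
qed

lemma nn_integral_beta_law_symmetric: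
  assumes [measurable]: "g \<in> borel_measurable borel"
  shows "(\<integral>\<^sup>+t. g (- t) \<partial>beta_law p) = (\<integral>\<^sup>+t. g t \<partial>beta_law p)"
proof -
  have "(\<integral>\<^sup>+t. g t \<partial>beta_law p) = (\<integral>\<^sup>+t. ennreal (beta_kernel p t / beta_norm p) * g t \<partial>lborel)"
    unfolding beta_law_def by (rule nn_integral_density) measurable
  also have "\<dots> = (\<integral>\<^sup>+t. ennreal (beta_kernel p (0 + (-1) * t) / beta_norm p) * g (0 + (-1) * t) \<partial>lborel)"
    by (subst nn_integral_real_affine[where c="-1" and t=0]) auto
  also have "\<dots> = (\<integral>\<^sup>+t. ennreal (beta_kernel p t / beta_norm p) * g (- t) \<partial>lborel)"
    by (intro nn_integral_cong) (auto simp: beta_kernel_def indicator_def)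
  also have "\<dots> = (\<integral>\<^sup>+t. g (- t) \<partial>beta_law p)"
    unfolding beta_law_def by (rule nn_integral_density[symmetric]) measurable
  finally show ?thesis ..
qed

text \<open>The facet height is \<open>plane_dist\<close> or \<open>-plane_dist\<close>, so both signs are needed.\<close>

lemma nn_integral_sphere_height_signed:
  assumes d: "3 \<le> d" and [measurable]: "g \<in> borel_measurable borel"
  shows "(\<integral>\<^sup>+\<theta>. g (plane_dist d \<theta> (\<lambda>_. 1)) + g (- plane_dist d \<theta> (\<lambda>_. 1)) \<partial>(\<Pi>\<^sub>M i\<in>{..<d}. uniform_sphere d))
    = 2 * (\<integral>\<^sup>+t. g t \<partial>beta_law (height_exponent d))"
proof -
  have "(\<integral>\<^sup>+\<theta>. g (plane_dist d \<theta> (\<lambda>_. 1)) + g (- plane_dist d \<theta> (\<lambda>_. 1)) \<partial>(\<Pi>\<^sub>M i\<in>{..<d}. uniform_sphere d))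
    = (\<integral>\<^sup>+t. g \<bar>t\<bar> + g (- \<bar>t\<bar>) \<partial>beta_law (height_exponent d))"
    by (rule nn_integral_sphere_height[OF d, of "\<lambda>h. g h + g (- h)"]) measurable
  also have "\<dots> = (\<integral>\<^sup>+t. g t + g (- t) \<partial>beta_law (height_exponent d))"
    by (intro nn_integral_cong) (auto simp: abs_if add.commute)
  also have "\<dots> = (\<integral>\<^sup>+t. g t \<partial>beta_law (height_exponent d)) + (\<integral>\<^sup>+t. g (- t) \<partial>beta_law (height_exponent d))"
    by (rule nn_integral_add) measurable
  finally show ?thesis by (simp add: nn_integral_beta_law_symmetric mult_2)
qed

section \<open>Facets and supporting hyperplanes\<close>

lemma sum_fun_eval: "(\<Sum>i\<in>A. f i) m = (\<Sum>i\<in>A. f i m)" for f :: "'i \<Rightarrow> 'a \<Rightarrow> real"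
  by (induction A rule: infinite_finite_induct) (auto simp: zero_fun_def plus_fun_def)

lemma scaleR_fun_eval: "(c *\<^sub>R f) m = c * f m" for f :: "'a \<Rightarrow> real"
  by (simp add: scaleR_fun_def)

lemma linear_euclid_inner: "linear (\<lambda>y. euclid_inner d y v)"
  by (rule linearI) (auto simp: euclid_inner_def plus_fun_def scaleR_fun_def sum.distrib sum_distrib_left algebra_simps)

text \<open>A convex combination whose value is the upper bound \<open>c\<close> can give positive
  weight only to points where \<open>L\<close> itself equals \<open>c\<close>.\<close>

lemma hyperplane_section_convex_hull:
  fixes S :: "'a::real_vector set" and L :: "'a \<Rightarrow> real"
  assumes S: "finite S" and L: "linear L" and le: "\<And>x. x \<in> S \<Longrightarrow> L x \<le> c"
  shows "convex hull S \<inter> {y. L y = c} = convex hull {x \<in> S. L x = c}"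
    and "y \<in> convex hull S \<Longrightarrow> L y \<le> c"
proof -
  have lc: "L (\<Sum>x\<in>T. u x *\<^sub>R x) = (\<Sum>x\<in>T. u x * L x)" for u T
    using L by (simp add: linear_sum linear_scale)
  show "L y \<le> c" if "y \<in> convex hull S" for y
  proof -
    from that obtain u where u: "\<And>x. x \<in> S \<Longrightarrow> 0 \<le> u x" "sum u S = 1" "y = (\<Sum>x\<in>S. u x *\<^sub>R x)"
      unfolding convex_hull_finite[OF S] by auto
    have "L y \<le> (\<Sum>x\<in>S. u x * c)"
      unfolding u(3) lc using u(1) le by (intro sum_mono mult_left_mono) auto
    then show ?thesis using u(2) by (simp add: sum_distrib_right[symmetric])
  qed
  show "convex hull S \<inter> {y. L y = c} = convex hull {x \<in> S. L x = c}"
  proof (intro subset_antisym subsetI)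
    fix y assume y: "y \<in> convex hull S \<inter> {y. L y = c}"
    then obtain u where u: "\<And>x. x \<in> S \<Longrightarrow> 0 \<le> u x" "sum u S = 1" "y = (\<Sum>x\<in>S. u x *\<^sub>R x)"
      unfolding convex_hull_finite[OF S] by auto
    have "(\<Sum>x\<in>S. u x * (c - L x)) = (\<Sum>x\<in>S. u x) * c - L y"
      unfolding u(3) lc by (simp add: right_diff_distrib sum_subtractf sum_distrib_right)
    then have "(\<Sum>x\<in>S. u x * (c - L x)) = 0" using y u(2) by simp
    then have z: "u x * (c - L x) = 0" if "x \<in> S" for x
      using that S u(1) le by (subst (asm) sum_nonneg_eq_0_iff) (auto intro!: mult_nonneg_nonneg)
    let ?T = "{x \<in> S. L x = c}"
    have T: "finite ?T" "?T \<subseteq> S" using S by auto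
    have out: "u x = 0" if "x \<in> S - ?T" for x using z[of x] that by auto
    have "sum u ?T = 1" using sum.mono_neutral_left[OF S T(2), of u] out u(2) by simp
    moreover have "(\<Sum>x\<in>?T. u x *\<^sub>R x) = y"
      unfolding u(3) by (rule sum.mono_neutral_left[OF S T(2)]) (use out in auto)
    ultimately show "y \<in> convex hull ?T"
      unfolding convex_hull_finite[OF T(1)] using u(1) by auto
  next
    fix y assume y: "y \<in> convex hull {x \<in> S. L x = c}"
    have T: "finite {x \<in> S. L x = c}" using S by auto
    from y obtain u where u: "sum u {x \<in> S. L x = c} = 1" "y = (\<Sum>x\<in>{x \<in> S. L x = c}. u x *\<^sub>R x)"
      unfolding convex_hull_finite[OF T] by auto
    have "L y = (\<Sum>x\<in>{x \<in> S. L x = c}. u x * c)" unfolding u(2) lc by (intro sum.cong) auto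
    then have "L y = c" using u(1) by (simp add: sum_distrib_right[symmetric])
    moreover have "y \<in> convex hull S" using y hull_mono[of "{x \<in> S. L x = c}" S convex] by auto
    ultimately show "y \<in> convex hull S \<inter> {y. L y = c}" by simp
  qed
qed

lemma hyperplane_section_face_of:
  fixes P :: "'a::real_vector set" and L :: "'a \<Rightarrow> real"
  assumes P: "convex P" and L: "linear L" and le: "\<And>x. x \<in> P \<Longrightarrow> L x \<le> c"
  shows "P \<inter> {y. L y = c} face_of P"
  unfolding face_of_def
proof (intro conjI ballI impI)
  have "convex {y. L y = c}"
    unfolding convex_def using L by (auto simp: linear_add linear_scale distrib_right[symmetric])
  then show "convex (P \<inter> {y. L y = c})" using P by (rule convex_Int[rotated])
  fix a b x assume ab: "a \<in> P" "b \<in> P" and x: "x \<in> P \<inter> {y. L y = c}" "x \<in> open_segment a b"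
  from x(2) obtain t where t: "0 < t" "t < 1" "x = (1 - t) *\<^sub>R a + t *\<^sub>R b"
    by (auto simp: in_segment)
  have Lx: "(1 - t) * L a + t * L b = c"
    using x(1) L unfolding t(3) by (simp add: linear_add linear_scale)
  have "(1 - t) * (c - L a) + t * (c - L b) = 0"
    using Lx by (simp add: algebra_simps)
  moreover have "0 \<le> (1 - t) * (c - L a)" "0 \<le> t * (c - L b)" using t le[OF ab(1)] le[OF ab(2)] by auto
  ultimately have "(1 - t) * (c - L a) = 0" "t * (c - L b) = 0" by linarith+
  then show "a \<in> P \<inter> {y. L y = c}" "b \<in> P \<inter> {y. L y = c}" using t ab by auto
qed auto

text \<open>The deterministic geometry under general position: the first \<open>d\<close> vectors
  are linearly independent, so their hyperplane misses the origin and is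
  \<open>{y. L y = 1}\<close>, and no other point lies on it.\<close>

locale simplex_cut =
  fixes d n :: nat and x :: "nat \<Rightarrow> nat \<Rightarrow> real"
  assumes d: "2 \<le> d" and dn: "d < n"
    and eu: "\<And>i. i \<in> {1..n} \<Longrightarrow> x i \<in> euclid d"
    and nd: "row_det d (\<lambda>i. x (Suc i)) \<noteq> 0"
    and generic: "\<And>j. j \<in> {d<..n} \<Longrightarrow> (\<Sum>k<d. x j k * sol d (\<lambda>i. x (Suc i)) (\<lambda>_. 1) k) \<noteq> 1"
begin

definition r :: "nat \<Rightarrow> nat \<Rightarrow> real" where "r i = x (Suc i)"
definition v :: "nat \<Rightarrow> real" where "v k = (if k < d then sol d r (\<lambda>_. 1) k else 0)"
definition L :: "(nat \<Rightarrow> real) \<Rightarrow> real" where "L y = euclid_inner d y v"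
definition F where "F = convex hull (x ` {1..d})"
definition P where "P = convex hull (x ` {1..n})"
definition h0 :: real where "h0 = plane_dist d r (\<lambda>_. 1)"

lemma nd': "row_det d r \<noteq> 0" using nd by (simp add: r_def[abs_def])

lemma linear_L: "linear L"
  unfolding L_def by (rule linear_euclid_inner)

lemma L_eq: "L y = (\<Sum>k<d. y k * sol d r (\<lambda>_. 1) k)"
  by (simp add: L_def euclid_inner_def v_def)

lemma L_vertex: "i \<in> {1..d} \<Longrightarrow> L (x i) = 1"
  using sol[OF nd', of "i - 1" "\<lambda>_. 1"] by (auto simp: L_eq r_def)

lemma L_generic: "j \<in> {d<..n} \<Longrightarrow> L (x j) \<noteq> 1"
  using generic by (simp add: L_eq r_def[abs_def])

text \<open>The coordinates of \<open>y\<close> in the basis formed by the rows of \<open>r\<close>,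
  read off from the adjugate. Their sum is \<open>L y\<close>, so they sum to 1 exactly on the
  hyperplane.\<close>

definition bary :: "(nat \<Rightarrow> real) \<Rightarrow> nat \<Rightarrow> real"
  where "bary y i = (\<Sum>l<d. y l * row_cof d r i l) / row_det d r"

lemma bary_sum:
  assumes "y \<in> euclid d"
  shows "(\<Sum>i<d. bary y i *\<^sub>R r i) = y"
proof
  fix m
  have eval: "(\<Sum>i<d. bary y i *\<^sub>R r i) m = (\<Sum>i<d. bary y i * r i m)"
    by (simp add: sum_fun_eval scaleR_fun_eval)
  show "(\<Sum>i<d. bary y i *\<^sub>R r i) m = y m"
  proof (cases "m < d")
    case True
    have "(\<Sum>i<d. bary y i * r i m) = (\<Sum>i<d. \<Sum>l<d. y l * (row_cof d r i l * r i m)) / row_det d r"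
      by (simp add: bary_def sum_divide_distrib sum_distrib_right mult.assoc)
    also have "(\<Sum>i<d. \<Sum>l<d. y l * (row_cof d r i l * r i m)) = (\<Sum>l<d. y l * (\<Sum>i<d. row_cof d r i l * r i m))"
      unfolding sum_distrib_left by (rule sum.swap)
    also have "\<dots> = (\<Sum>l<d. y l * (if l = m then row_det d r else 0))"
      using True by (intro sum.cong refl) (simp add: row_cof_left_inverse)
    also have "\<dots> = y m * row_det d r"
      using True by (simp add: if_distrib[where f="\<lambda>z. _ * z"] cong: if_cong)
    finally show ?thesis using nd' eval by simp
  next
    case False
    have "r i m = 0" if "i < d" for i
      using eu[of "Suc i"] that dn False by (auto simp: r_def euclid_def)
    moreover have "y m = 0" using assms False by (simp add: euclid_def)
    ultimately show ?thesis by (simp add: eval)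
  qed
qed

lemma bary_L:
  assumes "y \<in> euclid d"
  shows "(\<Sum>i<d. bary y i) = L y"
proof -
  have "L y = L (\<Sum>i<d. bary y i *\<^sub>R r i)" using bary_sum[OF assms] by simp
  also have "\<dots> = (\<Sum>i<d. bary y i * L (r i))"
    using linear_L by (simp add: linear_sum linear_scale)
  also have "\<dots> = (\<Sum>i<d. bary y i)"
    by (intro sum.cong refl) (simp add: r_def L_vertex)
  finally show ?thesis ..
qed

lemma rows_independent:
  assumes "(\<Sum>i<d. c i *\<^sub>R r i) = 0" "k < d"
  shows "c k = 0"
proof -
  have z: "(\<Sum>i<d. c i * r i j) = 0" for j
    using fun_cong[OF assms(1), of j] by (simp add: sum_fun_eval scaleR_fun_eval zero_fun_def)
  have "0 = (\<Sum>j<d. (\<Sum>i<d. c i * r i j) * row_cof d r k j)" by (simp add: z)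
  also have "\<dots> = (\<Sum>i<d. c i * (\<Sum>j<d. r i j * row_cof d r k j))"
    unfolding sum_distrib_left sum_distrib_right mult.assoc by (rule sum.swap)
  also have "\<dots> = (\<Sum>i<d. c i * (if i = k then row_det d r else 0))"
    using assms(2) by (intro sum.cong refl) (simp add: row_cof_right_inverse)
  also have "\<dots> = c k * row_det d r"
    using assms(2) by (simp add: if_distrib[where f="\<lambda>z. _ * z"] cong: if_cong)
  finally show ?thesis using nd' by simp
qed

lemma inj_rows: "inj_on r {..<d}"
proof (rule inj_onI)
  fix i k assume ik: "i \<in> {..<d}" "k \<in> {..<d}" "r i = r k"
  show "i = k"
  proof (rule ccontr)
    assume "i \<noteq> k"
    define c where "c l = (if l = i then 1 else 0) - (if l = k then 1 else (0::real))" for l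
    have "(\<Sum>l<d. c l *\<^sub>R r l) = (\<Sum>l<d. if l = i then r l else 0) - (\<Sum>l<d. if l = k then r l else 0)"
      unfolding sum_subtractf[symmetric] c_def by (intro sum.cong refl) (auto simp: scaleR_diff_left)
    also have "\<dots> = 0" using ik by simp
    finally have "c i = 0" by (rule rows_independent) (use ik in simp)
    with \<open>i \<noteq> k\<close> show False by (simp add: c_def)
  qed
qed

lemma vertices_eq: "x ` {1..d} = r ` {..<d}"
proof -
  have "{1..d} = Suc ` {..<d}" by (auto simp: image_Suc_lessThan)
  then show ?thesis by (simp add: image_image r_def)
qed

lemma has_aff_dim_F: "has_aff_dim F (d - 1)"
  unfolding has_aff_dim_def F_def vertices_eq
proof (intro exI[of _ "r ` {..<d}"] conjI)
  show "finite (r ` {..<d})" by simp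
  show "affine hull (r ` {..<d}) = affine hull (convex hull (r ` {..<d}))" by (simp add: affine_hull_convex_hull)
  show "card (r ` {..<d}) = d - 1 + 1" using inj_rows d by (simp add: card_image)
  show "\<not> affine_dependent (r ` {..<d})"
  proof
    assume "affine_dependent (r ` {..<d})"
    then have "dependent (r ` {..<d})" by (rule affine_dependent_imp_dependent)
    then obtain u y where u: "y \<in> r ` {..<d}" "u y \<noteq> 0" "(\<Sum>w\<in>r ` {..<d}. u w *\<^sub>R w) = 0"
      by (subst (asm) dependent_finite) auto
    have z: "(\<Sum>i<d. u (r i) *\<^sub>R r i) = 0"
      using u(3) by (simp add: sum.reindex[OF inj_rows])
    have "u (r i) = 0" if "i < d" for i
      by (rule rows_independent[of "\<lambda>i. u (r i)", OF z that])
    with u show False by auto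
  qed
qed

lemma P_euclid: "P \<subseteq> euclid d"
  unfolding P_def
proof (rule hull_minimal)
  show "x ` {1..n} \<subseteq> euclid d" using eu by auto
  show "convex (euclid d)" by (auto simp: convex_def euclid_def plus_fun_def scaleR_fun_def)
qed

lemma vertex_in_P: "i \<in> {1..n} \<Longrightarrow> x i \<in> P"
  unfolding P_def by (intro hull_inc) auto

lemma vertex_in_F: "i \<in> {1..d} \<Longrightarrow> x i \<in> F"
  unfolding F_def by (intro hull_inc) auto

lemma L_F:
  assumes "y \<in> F"
  shows "L y = 1"
proof -
  have eq: "{y \<in> x ` {1..d}. L y = 1} = x ` {1..d}" using L_vertex by blast
  have "L z \<le> 1" if "z \<in> x ` {1..d}" for z using L_vertex that by fastforce
  then have "convex hull (x ` {1..d}) \<inter> {y. L y = 1} = convex hull (x ` {1..d})"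
    using hyperplane_section_convex_hull(1)[of "x ` {1..d}" L 1, OF _ linear_L] unfolding eq by blast
  then show ?thesis using assms unfolding F_def by blast
qed

lemma all_indices: "{1..n} = {1..d} \<union> {d<..n}" using dn by auto

lemma section_below:
  assumes "\<And>j. j \<in> {d<..n} \<Longrightarrow> L (x j) < 1"
  shows "P \<inter> {y. L y = 1} = F" "y \<in> P \<Longrightarrow> L y \<le> 1"
proof -
  have fin: "finite (x ` {1..n})" by simp
  have le: "L y \<le> 1" if "y \<in> x ` {1..n}" for y
    using that assms L_vertex unfolding all_indices by (auto simp: less_imp_le)
  have "{y \<in> x ` {1..n}. L y = 1} = x ` {1..d}"
    using assms L_vertex unfolding all_indices by (auto simp: less_imp_neq)
  then show "P \<inter> {y. L y = 1} = F"
    using hyperplane_section_convex_hull(1)[OF fin linear_L le] by (simp add: P_def F_def)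
  show "y \<in> P \<Longrightarrow> L y \<le> 1"
    unfolding P_def using le by (rule hyperplane_section_convex_hull(2)[OF fin linear_L])
qed

lemma section_above:
  assumes "\<And>j. j \<in> {d<..n} \<Longrightarrow> 1 < L (x j)"
  shows "P \<inter> {y. L y = 1} = F" "y \<in> P \<Longrightarrow> 1 \<le> L y"
proof -
  have lin: "linear (\<lambda>y. - L y)" using linear_L by (rule linear_compose_neg)
  have fin: "finite (x ` {1..n})" by simp
  have le: "- L y \<le> - 1" if "y \<in> x ` {1..n}" for y
    using that assms L_vertex unfolding all_indices by (auto simp: less_imp_le)
  have "{y \<in> x ` {1..n}. - L y = - 1} = x ` {1..d}"
    using assms L_vertex unfolding all_indices by (force simp: less_imp_neq[symmetric])
  moreover have "{y. L y = 1} = {y. - L y = - 1}" by auto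
  ultimately show "P \<inter> {y. L y = 1} = F"
    using hyperplane_section_convex_hull(1)[OF fin lin le] unfolding P_def F_def by simp
  have "- L y \<le> - 1" if "y \<in> P" for y
    using le that unfolding P_def by (rule hyperplane_section_convex_hull(2)[OF fin lin])
  then show "y \<in> P \<Longrightarrow> 1 \<le> L y" by simp
qed

lemma convex_P: "convex P" by (simp add: P_def convex_convex_hull)

lemma facet_below:
  assumes "\<And>j. j \<in> {d<..n} \<Longrightarrow> L (x j) < 1"
  shows "is_facet d F P"
  using hyperplane_section_face_of[OF convex_P linear_L section_below(2)[OF assms]] section_below(1)[OF assms] has_aff_dim_F
  by (simp add: is_facet_def)

lemma facet_above:
  assumes "\<And>j. j \<in> {d<..n} \<Longrightarrow> 1 < L (x j)"
  shows "is_facet d F P"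
proof -
  have lin: "linear (\<lambda>y. - L y)" using linear_L by (rule linear_compose_neg)
  have "P \<inter> {y. - L y = - 1} face_of P"
    by (rule hyperplane_section_face_of[OF convex_P lin]) (use section_above(2)[OF assms] in simp)
  moreover have "{y. - L y = - 1} = {y. L y = 1}" by auto
  ultimately show ?thesis using section_above(1)[OF assms] has_aff_dim_F by (simp add: is_facet_def)
qed

end

section \<open>Facets by the position of the other points, and their heights\<close>

context simplex_cut begin

text \<open>
  If \<open>x j\<close> and \<open>x k\<close> lie on different sides of the hyperplane through \<open>F\<close>, then the centroid of
  \<open>F\<close> is an inner point of a segment in \<open>P\<close> that ends at \<open>x j\<close>.
\<close>

lemma facet_one_side:
  assumes facet: "is_facet d F P" and j: "j \<in> {d<..n}" "1 < L (x j)" and k: "k \<in> {d<..n}" "L (x k) < 1"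
  shows False
proof -
  have d0: "0 < d" using d by simp
  have xj: "x j \<in> euclid d" "x j \<in> P" and xk: "x k \<in> euclid d" "x k \<in> P"
    using j k eu vertex_in_P by auto
  define \<alpha> \<beta> where "\<alpha> = bary (x j)" and "\<beta> = bary (x k)"
  \<comment> \<open>With this weight \<open>x j + \<kappa> x k\<close> has the
    \<open>L\<close>-value \<open>1 + \<kappa>\<close>, so the mean of the two points with weights 1
    and \<kappa> lies on the hyperplane of \<open>F\<close>.\<close>
  define \<kappa> where "\<kappa> = (L (x j) - 1) / (1 - L (x k))"
  have \<kappa>: "0 < \<kappa>" "\<kappa> * (1 - L (x k)) = L (x j) - 1" using j k by (auto simp: \<kappa>_def)
  \<comment> \<open>These are the coefficients of \<open>c - x j - \<kappa> x k\<close> in the rows,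
    where \<open>c\<close> is the centroid. Going from \<open>c\<close> away from \<open>x j\<close>
    by \<epsilon> changes the weights \<open>1 / d\<close> by \<open>\<epsilon> * g i\<close> and
    puts weight \<open>\<epsilon> * \<kappa>\<close> on \<open>x k\<close>.\<close>
  define g where "g i = 1 / real d - \<alpha> i - \<kappa> * \<beta> i" for i
  define B where "B = (\<Sum>i<d. \<bar>g i\<bar>) + 1"
  have B: "\<bar>g i\<bar> \<le> B" if "i < d" for i
  proof -
    have "\<bar>g i\<bar> \<le> (\<Sum>i<d. \<bar>g i\<bar>)" using that by (intro member_le_sum) auto
    then show ?thesis by (simp add: B_def)
  qed
  have B0: "0 < B" unfolding B_def by (intro add_nonneg_pos sum_nonneg) auto
  \<comment> \<open>Small enough that \<open>1 / d + \<epsilon> * g i\<close> stays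
    nonnegative.\<close>
  define \<epsilon> where "\<epsilon> = 1 / (real d * B)"
  have \<epsilon>: "0 < \<epsilon>" using B0 d0 by (simp add: \<epsilon>_def)
  define c where "c = (\<Sum>i<d. (1 / real d) *\<^sub>R r i)"
  define \<phi> where "\<phi> i = 1 / real d + \<epsilon> * g i" for i
  have \<phi>0: "0 \<le> \<phi> i" if "i < d" for i
  proof -
    have "\<epsilon> * (- g i) \<le> \<epsilon> * B" using \<epsilon> B[OF that] by (intro mult_left_mono) auto
    also have "\<dots> = 1 / real d" using B0 d0 by (simp add: \<epsilon>_def)
    finally show ?thesis by (simp add: \<phi>_def)
  qed
  have sum_g: "(\<Sum>i<d. g i) = - \<kappa>"
  proof -
    have "(\<Sum>i<d. g i) = 1 - L (x j) - \<kappa> * L (x k)"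
      unfolding g_def sum_subtractf sum_distrib_left[symmetric] \<alpha>_def \<beta>_def bary_L[OF xj(1)] bary_L[OF xk(1)]
      using d0 by simp
    also have "\<dots> = - \<kappa>" using \<kappa>(2) by (simp add: algebra_simps)
    finally show ?thesis .
  qed
  have sum_\<phi>: "(\<Sum>i<d. \<phi> i) + \<epsilon> * \<kappa> = 1"
    unfolding \<phi>_def sum.distrib sum_distrib_left[symmetric] sum_g using d0 by simp
  define y where "y = (\<Sum>i<d. \<phi> i *\<^sub>R r i) + (\<epsilon> * \<kappa>) *\<^sub>R x k"
  have y_eq: "y = c - \<epsilon> *\<^sub>R (x j - c)"
  proof -
    have "(\<Sum>i<d. \<phi> i *\<^sub>R r i) = (\<Sum>i<d. (1 / real d) *\<^sub>R r i + \<epsilon> *\<^sub>R ((1 / real d) *\<^sub>R r i) - \<epsilon> *\<^sub>R (\<alpha> i *\<^sub>R r i) - (\<epsilon> * \<kappa>) *\<^sub>R (\<beta> i *\<^sub>R r i))"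
      by (intro sum.cong refl) (simp add: \<phi>_def g_def scaleR_add_left scaleR_diff_left right_diff_distrib mult.assoc)
    also have "\<dots> = c + \<epsilon> *\<^sub>R c - \<epsilon> *\<^sub>R (\<Sum>i<d. \<alpha> i *\<^sub>R r i) - (\<epsilon> * \<kappa>) *\<^sub>R (\<Sum>i<d. \<beta> i *\<^sub>R r i)"
      unfolding c_def scaleR_sum_right sum.distrib sum_subtractf ..
    also have "\<dots> = c + \<epsilon> *\<^sub>R c - \<epsilon> *\<^sub>R x j - (\<epsilon> * \<kappa>) *\<^sub>R x k"
      unfolding \<alpha>_def \<beta>_def bary_sum[OF xj(1)] bary_sum[OF xk(1)] ..
    finally show ?thesis by (simp add: y_def scaleR_diff_right)
  qed
  have rP: "r i \<in> P" if "i < d" for i using that dn vertex_in_P[of "Suc i"] by (simp add: r_def)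
  have yP: "y \<in> P"
  proof -
    \<comment> \<open>The index \<open>d\<close> stands for the additional point
      \<open>x k\<close>.\<close>
    have "(\<Sum>i\<in>{..<Suc d}. (if i < d then \<phi> i else \<epsilon> * \<kappa>) *\<^sub>R (if i < d then r i else x k)) \<in> P"
      using sum_\<phi> \<phi>0 \<epsilon> \<kappa>(1) rP xk(2)
      by (intro convex_sum convex_P) auto
    also have "(\<Sum>i\<in>{..<Suc d}. (if i < d then \<phi> i else \<epsilon> * \<kappa>) *\<^sub>R (if i < d then r i else x k)) = y"
      by (simp add: y_def)
    finally show ?thesis .
  qed
  have cF: "c \<in> F"
    unfolding c_def
  proof (rule convex_sum)
    show "convex F" by (simp add: F_def convex_convex_hull)
    show "r i \<in> F" if "i \<in> {..<d}" for i using that vertex_in_F[of "Suc i"] by (simp add: r_def)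
  qed (use d0 in auto)
  have c_comb: "c = (1 - 1 / (1 + \<epsilon>)) *\<^sub>R x j + (1 / (1 + \<epsilon>)) *\<^sub>R y"
  proof -
    have "(1 + \<epsilon>) *\<^sub>R c = \<epsilon> *\<^sub>R x j + y"
      unfolding y_eq by (simp add: scaleR_add_left scaleR_diff_right)
    moreover have "(1 / (1 + \<epsilon>)) *\<^sub>R ((1 + \<epsilon>) *\<^sub>R c) = c" using \<epsilon> by simp
    ultimately have "c = (1 / (1 + \<epsilon>)) *\<^sub>R (\<epsilon> *\<^sub>R x j + y)" by simp
    moreover have "1 - 1 / (1 + \<epsilon>) = (1 / (1 + \<epsilon>)) * \<epsilon>" using \<epsilon> by (simp add: field_simps)
    ultimately show ?thesis by (simp add: scaleR_add_right)
  qed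
  have "x j \<noteq> y"
  proof
    assume "x j = y"
    then have "c = x j" using c_comb by (simp add: scaleR_add_left[symmetric])
    with L_F[OF cF] j show False by simp
  qed
  then have "c \<in> open_segment (x j) y"
    using \<epsilon> c_comb by (auto simp: in_segment intro!: exI[of _ "1 / (1 + \<epsilon>)"])
  then have "x j \<in> F"
    using facet xj(2) yP cF unfolding is_facet_def face_of_def by blast
  with L_F j show False by fastforce
qed

lemma is_facet_iff: "is_facet d F P \<longleftrightarrow> (\<forall>j\<in>{d<..n}. L (x j) < 1) \<or> (\<forall>j\<in>{d<..n}. 1 < L (x j))"
proof
  assume f: "is_facet d F P"
  show "(\<forall>j\<in>{d<..n}. L (x j) < 1) \<or> (\<forall>j\<in>{d<..n}. 1 < L (x j))"
  proof (rule ccontr)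
    assume "\<not> ?thesis"
    then obtain j k where "j \<in> {d<..n}" "\<not> L (x j) < 1" "k \<in> {d<..n}" "\<not> 1 < L (x k)" by blast
    then show False using facet_one_side[OF f, of j k] L_generic[of j] L_generic[of k] by linarith
  qed
qed (use facet_below facet_above in blast)

lemma v_norm_pos: "0 < nsq d v"
proof (rule ccontr)
  assume "\<not> ?thesis"
  then have "nsq d v = 0" using nsq_nonneg[of d v] by linarith
  then have "v k = 0" if "k < d" for k using that by (simp add: nsq_def sum_nonneg_eq_0_iff)
  then have "L (x 1) = 0" by (simp add: L_def euclid_inner_def)
  then show False using L_vertex[of 1] d by simp
qed

lemma h0_eq: "h0 = 1 / sqrt (nsq d v)"
  unfolding h0_def
proof (rule plane_dist_eq[OF nd'])
  fix i assume i: "i < d"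
  have "(\<Sum>j<d. r i j * v j) = (\<Sum>j<d. r i j * sol d r (\<lambda>_. 1) j)" by (simp add: v_def)
  then show "(\<Sum>j<d. r i j * v j) = 1" using sol[OF nd' i, of "\<lambda>_. 1"] by simp
qed

lemma h0_pos: "0 < h0"
  unfolding h0_eq using v_norm_pos by simp

text \<open>\<open>s\<close> is the sign of the height. For \<open>s = -1\<close> the polytope lies
  on the side of the hyperplane that does not contain the origin, and the outer unit normal is
  \<open>- h0\<close> times \<open>v\<close>.\<close>

lemma height_exists:
  assumes s: "s = 1 \<or> s = -1" and sec: "P \<inter> {y. L y = 1} = F" and side: "\<And>y. y \<in> P \<Longrightarrow> s * L y \<le> s"
  shows "has_height d F P (s * h0)"
  unfolding has_height_def
proof (intro bexI conjI)
  let ?u = "\<lambda>k. s * h0 * v k"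
  have inner: "euclid_inner d y ?u = s * h0 * L y" for y
    by (simp add: euclid_inner_def L_def sum_distrib_left mult_ac)
  have s2: "s * s = 1" using s by auto
  have "nsq d ?u = (s * h0)\<^sup>2 * nsq d v"
    by (simp add: nsq_def power_mult_distrib sum_distrib_left)
  also have "\<dots> = 1" using v_norm_pos s2 by (simp add: h0_eq power_mult_distrib power_divide power2_eq_square[of s])
  finally show "?u \<in> unit_sphere d"
    by (simp add: unit_sphere_def euclid_norm_nsq euclid_def v_def)
  have "s * h0 * L y = s * h0 \<longleftrightarrow> L y = 1" for y using s h0_pos by auto
  then show "P \<inter> {y \<in> euclid d. euclid_inner d y ?u = s * h0} = F"
    using sec P_euclid unfolding inner by auto
  show "P \<subseteq> {y \<in> euclid d. euclid_inner d y ?u \<le> s * h0}"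
  proof
    fix y assume y: "y \<in> P"
    have "h0 * (s * L y) \<le> h0 * s" using side[OF y] h0_pos by (intro mult_left_mono) auto
    with y P_euclid show "y \<in> {y \<in> euclid d. euclid_inner d y ?u \<le> s * h0}"
      unfolding inner by (auto simp: mult_ac)
  qed
qed

text \<open>All \<open>d\<close> vertices satisfy \<open><r i, u> = h\<close>, so linear
  independence forces \<open>u = h v\<close> on the first \<open>d\<close> coordinates. Unit length
  then fixes \<open>h\<close> up to sign.\<close>

lemma height_unique:
  assumes "has_height d F P h"
  shows "\<bar>h\<bar> = h0" "j \<in> {1..n} \<Longrightarrow> h * L (x j) \<le> h"
proof -
  from assms obtain u where u: "u \<in> unit_sphere d" and sec: "P \<inter> {y \<in> euclid d. euclid_inner d y u = h} = F"
    and side: "P \<subseteq> {y \<in> euclid d. euclid_inner d y u \<le> h}"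
    unfolding has_height_def by blast
  have beta_law: "nsq d u = 1" using u by (simp add: unit_sphere_def euclid_norm_nsq)
  have ru: "(\<Sum>j<d. r i j * u j) = h" if "i < d" for i
    using sec vertex_in_F[of "Suc i"] that by (auto simp: r_def euclid_inner_def)
  \<comment> \<open>Otherwise \<open>u\<close> would be orthogonal to a basis and hence 0 instead of
    a unit vector.\<close>
  have "h \<noteq> 0"
  proof
    assume "h = 0"
    then have "\<forall>i<d. (\<Sum>j<d. r i j * u j) = 0" using ru by simp
    then have "\<forall>j<d. u j = 0" using nd' row_det_eq_0_iff[of d r] by blast
    then show False using beta_law by (simp add: nsq_def)
  qed
  have uv: "u k = h * v k" if "k < d" for k
  proof -
    have "u k / h = sol d r (\<lambda>_. 1) k"
      using ru \<open>h \<noteq> 0\<close> by (intro sol_unique[OF nd' that]) (simp add: sum_divide_distrib[symmetric])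
    then show ?thesis using that \<open>h \<noteq> 0\<close> by (simp add: v_def field_simps)
  qed
  have "nsq d u = h\<^sup>2 * nsq d v"
    using uv by (simp add: nsq_def power_mult_distrib sum_distrib_left)
  then have "h\<^sup>2 = h0\<^sup>2" using beta_law v_norm_pos by (simp add: h0_eq power_divide field_simps)
  then show "\<bar>h\<bar> = h0" using h0_pos by (simp add: power2_eq_iff abs_if) linarith
  have inner: "euclid_inner d y u = h * L y" for y
    using uv by (simp add: euclid_inner_def L_def sum_distrib_left mult_ac)
  show "j \<in> {1..n} \<Longrightarrow> h * L (x j) \<le> h"
    using side vertex_in_P[of j] unfolding inner by auto
qed

text \<open>The sign of the height is decided by any further point, and \<open>d < n\<close>
  provides \<open>x n\<close>. For the same reason the two alternatives exclude each other.\<close>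

lemma facet_height_iff:
  "is_facet d F P \<and> (\<exists>h\<in>A. has_height d F P h) \<longleftrightarrow>
    (h0 \<in> A \<and> (\<forall>j\<in>{d<..n}. L (x j) < 1)) \<or> (- h0 \<in> A \<and> (\<forall>j\<in>{d<..n}. 1 < L (x j)))"
proof -
  have n: "n \<in> {d<..n}" "n \<in> {1..n}" using dn by auto
  have below: "has_height d F P h \<longleftrightarrow> h = h0" if b: "\<forall>j\<in>{d<..n}. L (x j) < 1" for h
  proof
    assume "has_height d F P h"
    from height_unique(1)[OF this] height_unique(2)[OF this n(2)] show "h = h0"
      using bspec[OF b n(1)] h0_pos by (auto simp: abs_if mult_le_cancel_left1 split: if_splits)
  next
    assume "h = h0"
    then show "has_height d F P h"
      using height_exists[of 1] section_below b by auto
  qed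
  have above: "has_height d F P h \<longleftrightarrow> h = - h0" if b: "\<forall>j\<in>{d<..n}. 1 < L (x j)" for h
  proof
    assume "has_height d F P h"
    from height_unique(1)[OF this] height_unique(2)[OF this n(2)] show "h = - h0"
      using bspec[OF b n(1)] h0_pos by (auto simp: abs_if mult_le_cancel_left2 split: if_splits)
  next
    assume "h = - h0"
    then show "has_height d F P h"
      using height_exists[of "-1"] section_above b by auto
  qed
  show ?thesis
  proof (cases "\<forall>j\<in>{d<..n}. L (x j) < 1")
    case True
    then have "\<not> (\<forall>j\<in>{d<..n}. 1 < L (x j))" using n(1) by fastforce
    with True show ?thesis unfolding is_facet_iff below[OF True] by blast
  next
    case F: False
    show ?thesis
    proof (cases "\<forall>j\<in>{d<..n}. 1 < L (x j)")
      case True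
      with F show ?thesis unfolding is_facet_iff above[OF True] by blast
    next
      case False
      with F show ?thesis unfolding is_facet_iff by blast
    qed
  qed
qed

end

section \<open>The conditional law of the height\<close>

lemma emeasure_beta_law_singleton: "emeasure (beta_law p) {t} = 0"
proof -
  have "emeasure (beta_law p) {t} = (\<integral>\<^sup>+x. ennreal (beta_kernel p x / beta_norm p) * indicator {t} x \<partial>lborel)"
    unfolding beta_law_def by (rule emeasure_density) auto
  also have "\<dots> = 0"
    using AE_lborel_singleton[of t] by (subst nn_integral_0_iff_AE) (auto elim!: eventually_mono)
  finally show ?thesis .
qed

lemma AE_uniform_sphere_euclid: "AE \<theta> in uniform_sphere d. \<theta> \<in> euclid d"
proof -
  have "AE \<theta> in uniform_sphere d. d \<le> i \<longrightarrow> \<theta> i = 0" for i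
  proof (cases "d \<le> i")
    case True
    have "AE x in uniform_ball d. dir d x i = 0" using True by (simp add: dir_def)
    then show ?thesis
      unfolding uniform_sphere_def dir_def[symmetric] using True
      using measurable_coord[of i] by (subst AE_distr_iff) (auto simp: uniform_ball_def)
  qed simp
  then have "AE \<theta> in uniform_sphere d. \<forall>i. d \<le> i \<longrightarrow> \<theta> i = 0" by (simp add: AE_all_countable)
  then show ?thesis by (simp add: euclid_def)
qed

text \<open>The probability of the spherical cap \<open>{\<theta>. \<langle>\<theta>, u\<rangle> \<le> t}\<close> for a unit vector \<open>u\<close>.\<close>

definition cap_cdf :: "nat \<Rightarrow> real \<Rightarrow> real"
  where "cap_cdf d t = measure (beta_law (d / 2 - 3 / 2)) {..t}"

lemma cap_cdf_nonneg: "0 \<le> cap_cdf d t"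
  by (simp add: cap_cdf_def)

lemma cap_cdf_le_1: "4 \<le> d \<Longrightarrow> cap_cdf d t \<le> 1"
  unfolding cap_cdf_def by (rule prob_space.prob_le_1, rule prob_space_beta_law) simp

lemma cap_cdf_measurable[measurable]:
  assumes d: "4 \<le> d"
  shows "cap_cdf d \<in> borel_measurable borel"
proof (rule borel_measurable_mono, rule monoI)
  interpret prob_space "beta_law (d / 2 - 3 / 2)" by (rule prob_space_beta_law) (use d in simp)
  show "cap_cdf d s \<le> cap_cdf d t" if "s \<le> t" for s t
    unfolding cap_cdf_def using that by (intro finite_measure_mono) auto
qed

text \<open>With the unit vector \<open>u = h w\<close> the conditions compare
  \<open><\<theta>, u>\<close> with \<open>h\<close>. The beta law of this inner product has no
  atoms and is symmetric, so the cap beyond \<open>h\<close> has probability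
  \<open>cap_cdf d (- h)\<close>.\<close>

lemma sphere_half_spaces:
  assumes d: "4 \<le> d" and w: "0 < nsq d w"
  defines "h \<equiv> 1 / sqrt (nsq d w)"
  shows "emeasure (uniform_sphere d) {\<theta>. (\<Sum>k<d. \<theta> k * w k) < 1} = ennreal (cap_cdf d h)" (is ?less)
    and "emeasure (uniform_sphere d) {\<theta>. 1 < (\<Sum>k<d. \<theta> k * w k)} = ennreal (cap_cdf d (- h))" (is ?greater)
    and "emeasure (uniform_sphere d) {\<theta>. (\<Sum>k<d. \<theta> k * w k) = 1} = 0" (is ?eq)
proof -
  let ?p = "d / 2 - 3 / 2"
  have p: "0 < ?p" using d by simp
  interpret N: prob_space "beta_law ?p" by (rule prob_space_beta_law[OF p])
  have h: "0 < h" using w by (simp add: h_def)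
  have "nsq d (\<lambda>k. h * w k) = h\<^sup>2 * nsq d w"
    by (simp add: nsq_def power_mult_distrib sum_distrib_left)
  then have u: "nsq d (\<lambda>k. h * w k) = 1"
    using w by (simp add: h_def power_divide)
  note [measurable] = measurable_coord
  have law: "emeasure (uniform_sphere d) {\<theta>. (\<Sum>k<d. \<theta> k * (h * w k)) \<in> B} = emeasure (beta_law ?p) B"
    if [measurable]: "B \<in> sets borel" for B
  proof -
    have m: "{\<theta>::nat \<Rightarrow> real. (\<Sum>k<d. \<theta> k * (h * w k)) \<in> B} \<in> sets borel" by measurable
    have "emeasure (uniform_sphere d) {\<theta>. (\<Sum>k<d. \<theta> k * (h * w k)) \<in> B}
      = (\<integral>\<^sup>+\<theta>. indicator {\<theta>. (\<Sum>k<d. \<theta> k * (h * w k)) \<in> B} \<theta> \<partial>uniform_sphere d)"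
      using m by simp
    also have "\<dots> = (\<integral>\<^sup>+\<theta>. indicator B (\<Sum>k<d. \<theta> k * (h * w k)) \<partial>uniform_sphere d)"
      by (intro nn_integral_cong) (simp add: indicator_def)
    also have "\<dots> = (\<integral>\<^sup>+\<theta>. indicator B (\<theta> 0) \<partial>uniform_sphere d)"
      by (rule uniform_sphere_inner) (use d u in auto)
    also have "\<dots> = (\<integral>\<^sup>+t. indicator B t \<partial>distr (uniform_sphere d) borel (\<lambda>\<theta>. \<theta> 0))"
      using sphere_coord_measurable1[of 0 d] by (subst nn_integral_distr) auto
    also have "\<dots> = emeasure (beta_law ?p) B" unfolding distr_sphere_coord[OF d] by simp
    finally show ?thesis .
  qed
  have scale: "(\<Sum>k<d. \<theta> k * (h * w k)) = h * (\<Sum>k<d. \<theta> k * w k)" for \<theta>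
    by (simp add: sum_distrib_left mult.left_commute)
  have atMost: "emeasure (beta_law ?p) {..<t} = ennreal (cap_cdf d t)" for t
  proof -
    have "{..t} = {..<t} \<union> {t}" by auto
    then have "emeasure (beta_law ?p) {..t} = emeasure (beta_law ?p) {..<t} + emeasure (beta_law ?p) {t}"
      by (simp add: plus_emeasure)
    then show ?thesis by (simp add: emeasure_beta_law_singleton cap_cdf_def N.emeasure_eq_measure)
  qed
  have "{\<theta>. (\<Sum>k<d. \<theta> k * w k) < 1} = {\<theta>. (\<Sum>k<d. \<theta> k * (h * w k)) \<in> {..<h}}"
    using h unfolding scale by auto
  then show ?less using law[of "{..<h}"] by (simp add: atMost)
  have "{\<theta>. (\<Sum>k<d. \<theta> k * w k) = 1} = {\<theta>. (\<Sum>k<d. \<theta> k * (h * w k)) \<in> {h}}"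
    using h unfolding scale by auto
  then show ?eq using law[of "{h}"] by (simp add: emeasure_beta_law_singleton)
  have "emeasure (beta_law ?p) {h<..} = (\<integral>\<^sup>+t. indicator {h<..} t \<partial>beta_law ?p)" by simp
  also have "\<dots> = (\<integral>\<^sup>+t. indicator {h<..} (- t) \<partial>beta_law ?p)"
    by (rule nn_integral_beta_law_symmetric[symmetric]) simp
  also have "\<dots> = (\<integral>\<^sup>+t. indicator {..<- h} t \<partial>beta_law ?p)"
    by (intro nn_integral_cong) (auto simp: indicator_def)
  also have "\<dots> = ennreal (cap_cdf d (- h))" by (simp add: atMost)
  finally have upper: "emeasure (beta_law ?p) {h<..} = ennreal (cap_cdf d (- h))" .
  have "{\<theta>. 1 < (\<Sum>k<d. \<theta> k * w k)} = {\<theta>. (\<Sum>k<d. \<theta> k * (h * w k)) \<in> {h<..}}"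
    using h unfolding scale by auto
  then show ?greater using law[of "{h<..}"] by (simp add: upper)
qed

text \<open>Points are numbered from \<open>1\<close>, rows of matrices from \<open>0\<close>; hence the \<open>Suc\<close>.\<close>

definition simplex_normal :: "nat \<Rightarrow> (nat \<Rightarrow> nat \<Rightarrow> real) \<Rightarrow> nat \<Rightarrow> real"
  where "simplex_normal d x = sol d (\<lambda>i. x (Suc i)) (\<lambda>_. 1)"

definition simplex_height :: "nat \<Rightarrow> (nat \<Rightarrow> nat \<Rightarrow> real) \<Rightarrow> real"
  where "simplex_height d x = plane_dist d (\<lambda>i. x (Suc i)) (\<lambda>_. 1)"

text \<open>A measurable substitute for a facet with height in \<open>A\<close>, equivalent to it in
  general position and hence almost surely. The two alternatives are the two sides on which the
  remaining points can lie.\<close>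

definition facet_event :: "nat \<Rightarrow> nat \<Rightarrow> real set \<Rightarrow> (nat \<Rightarrow> nat \<Rightarrow> real) \<Rightarrow> bool"
  where "facet_event d n A x \<longleftrightarrow>
    (simplex_height d x \<in> A \<and> (\<forall>j\<in>{d<..n}. (\<Sum>k<d. x j k * simplex_normal d x k) < 1)) \<or>
    (- simplex_height d x \<in> A \<and> (\<forall>j\<in>{d<..n}. 1 < (\<Sum>k<d. x j k * simplex_normal d x k)))"

lemma simplex_normal_nsq:
  assumes "row_det d (\<lambda>i. x (Suc i)) \<noteq> 0" "0 < d"
  shows "0 < nsq d (simplex_normal d x)" "simplex_height d x = 1 / sqrt (nsq d (simplex_normal d x))"
proof -
  show "simplex_height d x = 1 / sqrt (nsq d (simplex_normal d x))"
    unfolding simplex_height_def simplex_normal_def by (rule plane_dist_eq[OF assms(1)]) (rule sol[OF assms(1)])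
  have "nsq d (simplex_normal d x) \<noteq> 0"
  proof
    assume "nsq d (simplex_normal d x) = 0"
    then have "simplex_normal d x k = 0" if "k < d" for k using that by (simp add: nsq_def sum_nonneg_eq_0_iff)
    then show False using sol[OF assms, of "\<lambda>_. 1"] by (simp add: simplex_normal_def)
  qed
  then show "0 < nsq d (simplex_normal d x)" using nsq_nonneg[of d "simplex_normal d x"] by linarith
qed

lemma
  assumes "\<And>i. i \<in> {1..d} \<Longrightarrow> x i = y i"
  shows simplex_normal_cong: "simplex_normal d x = simplex_normal d y" and simplex_height_cong: "simplex_height d x = simplex_height d y"
proof -
  have e: "x (Suc i) j = y (Suc i) j" if "i < d" "j < d" for i j using assms[of "Suc i"] that by simp
  have "row_det d (\<lambda>i. x (Suc i)) = row_det d (\<lambda>i. y (Suc i))" by (rule row_det_cong[OF e])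
  then show "simplex_normal d x = simplex_normal d y"
    unfolding simplex_normal_def sol_def[abs_def] using row_cof_cong[OF e] by simp
  show "simplex_height d x = simplex_height d y" unfolding simplex_height_def by (rule plane_dist_cong[OF e]) auto
qed

lemma
  assumes "d \<le> n"
  shows simplex_normal_measurable: "k < d \<Longrightarrow> (\<lambda>x. simplex_normal d x k) \<in> borel_measurable (\<Pi>\<^sub>M i\<in>{1..n}. uniform_sphere d)"
    and simplex_height_measurable: "simplex_height d \<in> borel_measurable (\<Pi>\<^sub>M i\<in>{1..n}. uniform_sphere d)"
proof -
  have e: "(\<lambda>x. x (Suc i) j) \<in> borel_measurable (\<Pi>\<^sub>M i\<in>{1..n}. uniform_sphere d)" if "i < d" "j < d" for i j
    by (rule sphere_coord_measurable) (use that assms in auto)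
  have [measurable]: "(\<lambda>x. row_det d (\<lambda>i. x (Suc i))) \<in> borel_measurable (\<Pi>\<^sub>M i\<in>{1..n}. uniform_sphere d)"
    by (rule row_det_measurable[OF e])
  have [measurable]: "(\<lambda>x. row_cof d (\<lambda>i. x (Suc i)) i k) \<in> borel_measurable (\<Pi>\<^sub>M i\<in>{1..n}. uniform_sphere d)"
    if "i < d" "k < d" for i k by (rule row_cof_measurable[OF e that])
  show "k < d \<Longrightarrow> (\<lambda>x. simplex_normal d x k) \<in> borel_measurable (\<Pi>\<^sub>M i\<in>{1..n}. uniform_sphere d)"
    unfolding simplex_normal_def sol_def by measurable
  show "simplex_height d \<in> borel_measurable (\<Pi>\<^sub>M i\<in>{1..n}. uniform_sphere d)"
    unfolding simplex_height_def[abs_def] by (rule plane_dist_measurable[OF e])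
qed

lemma inner_simplex_normal_measurable:
  assumes "d \<le> n" "j \<in> {1..n}"
  shows "(\<lambda>x. \<Sum>k<d. x j k * simplex_normal d x k) \<in> borel_measurable (\<Pi>\<^sub>M i\<in>{1..n}. uniform_sphere d)"
  by (intro borel_measurable_sum borel_measurable_times sphere_coord_measurable simplex_normal_measurable) (use assms in auto)

lemma facet_event_measurable:
  assumes "d < n" and [measurable]: "A \<in> sets borel"
  shows "Measurable.pred (\<Pi>\<^sub>M i\<in>{1..n}. uniform_sphere d) (facet_event d n A)"
proof -
  have [measurable]: "simplex_height d \<in> borel_measurable (\<Pi>\<^sub>M i\<in>{1..n}. uniform_sphere d)"
    using assms by (intro simplex_height_measurable) auto
  have [measurable]: "(\<lambda>x. \<Sum>k<d. x j k * simplex_normal d x k) \<in> borel_measurable (\<Pi>\<^sub>M i\<in>{1..n}. uniform_sphere d)"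
    if "j \<in> {d<..n}" for j
    using assms that by (intro inner_simplex_normal_measurable) auto
  show ?thesis unfolding facet_event_def[abs_def] by measurable
qed

section \<open>Conditioning on the first \<open>d\<close> points\<close>

lemma distr_sphere_rows:
  assumes "d \<le> n"
  shows "distr (\<Pi>\<^sub>M i\<in>{1..n}. uniform_sphere d) (\<Pi>\<^sub>M i\<in>{..<d}. uniform_sphere d) (\<lambda>x. \<lambda>i\<in>{..<d}. x (Suc i))
    = (\<Pi>\<^sub>M i\<in>{..<d}. uniform_sphere d)"
  using assms by (intro distr_PiM_reindex prob_space_uniform_sphere) auto

lemma rows_measurable:
  assumes "d \<le> n"
  shows "(\<lambda>x. \<lambda>i\<in>{..<d}. x (Suc i)) \<in> measurable (\<Pi>\<^sub>M i\<in>{1..n}. uniform_sphere d) (\<Pi>\<^sub>M i\<in>{..<d}. uniform_sphere d)"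
  using assms by (intro measurable_restrict measurable_component_singleton) auto

lemma AE_sphere_rows_row_det:
  assumes "0 < d" "d \<le> n"
  shows "AE x in \<Pi>\<^sub>M i\<in>{1..n}. uniform_sphere d. row_det d (\<lambda>i. x (Suc i)) \<noteq> 0"
proof -
  have "AE x in \<Pi>\<^sub>M i\<in>{1..n}. uniform_sphere d. row_det d (\<lambda>i\<in>{..<d}. x (Suc i)) \<noteq> 0"
    by (rule AE_distrD[OF rows_measurable[OF assms(2)]], subst distr_sphere_rows[OF assms(2)], rule AE_sphere_row_det[OF assms(1)])
  moreover have "row_det d (\<lambda>i\<in>{..<d}. x (Suc i)) = row_det d (\<lambda>i. x (Suc i))" for x :: "nat \<Rightarrow> nat \<Rightarrow> real"
    by (rule row_det_cong) simp
  ultimately show ?thesis by simp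
qed

lemma nn_integral_sphere_split:
  assumes "d < n" and f: "f \<in> borel_measurable (\<Pi>\<^sub>M i\<in>{1..n}. uniform_sphere d)"
  shows "(\<integral>\<^sup>+x. f x \<partial>(\<Pi>\<^sub>M i\<in>{1..n}. uniform_sphere d))
    = (\<integral>\<^sup>+x. (\<integral>\<^sup>+y. f (merge {1..d} {d<..n} (x, y)) \<partial>(\<Pi>\<^sub>M i\<in>{d<..n}. uniform_sphere d))
        \<partial>(\<Pi>\<^sub>M i\<in>{1..d}. uniform_sphere d))"
proof -
  interpret S: product_sigma_finite "\<lambda>_::nat. uniform_sphere d"
    using prob_space_imp_sigma_finite[OF prob_space_uniform_sphere] by (simp add: product_sigma_finite_def)
  have un: "{1..d} \<union> {d<..n} = {1..n}" using assms(1) by auto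
  have dis: "{1..d} \<inter> {d<..n} = {}" by auto
  show ?thesis
    by (rule S.product_nn_integral_fold[OF dis finite_atLeastAtMost finite_greaterThanAtMost, unfolded un, OF f])
qed

lemma merge_rows:
  fixes x y :: "nat \<Rightarrow> nat \<Rightarrow> real"
  shows "simplex_normal d (merge {1..d} {d<..n} (x, y)) = simplex_normal d x" "simplex_height d (merge {1..d} {d<..n} (x, y)) = simplex_height d x"
    and "j \<in> {d<..n} \<Longrightarrow> merge {1..d} {d<..n} (x, y) j = y j"
proof -
  have e: "merge {1..d} {d<..n} (x, y) i = x i" if "i \<in> {1..d}" for i using that by (simp add: merge_def)
  show "simplex_normal d (merge {1..d} {d<..n} (x, y)) = simplex_normal d x" by (rule simplex_normal_cong[OF e])
  show "simplex_height d (merge {1..d} {d<..n} (x, y)) = simplex_height d x" by (rule simplex_height_cong[OF e])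
  show "j \<in> {d<..n} \<Longrightarrow> merge {1..d} {d<..n} (x, y) j = y j" by (simp add: merge_def)
qed

text \<open>Given the first \<open>d\<close> points their hyperplane is fixed, and a further
  independent point lies on it with probability 0.\<close>

lemma AE_sphere_generic:
  assumes d: "4 \<le> d" "d < n" and j: "j \<in> {d<..n}"
  shows "AE x in \<Pi>\<^sub>M i\<in>{1..n}. uniform_sphere d. (\<Sum>k<d. x j k * simplex_normal d x k) \<noteq> 1"
proof -
  let ?f = "\<lambda>x. indicator {1} (\<Sum>k<d. x j k * simplex_normal d x k) :: ennreal"
  have m: "(\<lambda>x. \<Sum>k<d. x j k * simplex_normal d x k) \<in> borel_measurable (\<Pi>\<^sub>M i\<in>{1..n}. uniform_sphere d)"
    using d j by (intro inner_simplex_normal_measurable) auto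
  have fm: "?f \<in> borel_measurable (\<Pi>\<^sub>M i\<in>{1..n}. uniform_sphere d)"
    by (rule measurable_compose[OF m]) simp
  have d0: "0 < d" "d \<le> d" using d by auto
  have "(\<integral>\<^sup>+x. ?f x \<partial>(\<Pi>\<^sub>M i\<in>{1..n}. uniform_sphere d))
    = (\<integral>\<^sup>+x. (\<integral>\<^sup>+y. indicator {1} (\<Sum>k<d. y j k * simplex_normal d x k) \<partial>(\<Pi>\<^sub>M i\<in>{d<..n}. uniform_sphere d))
        \<partial>(\<Pi>\<^sub>M i\<in>{1..d}. uniform_sphere d))"
    unfolding nn_integral_sphere_split[OF d(2) fm] merge_rows(1) merge_rows(3)[OF j] ..
  also have "\<dots> = (\<integral>\<^sup>+x. 0 \<partial>(\<Pi>\<^sub>M i\<in>{1..d}. uniform_sphere d))"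
  proof (rule nn_integral_cong_AE)
    show "AE x in \<Pi>\<^sub>M i\<in>{1..d}. uniform_sphere d.
      (\<integral>\<^sup>+y. indicator {1} (\<Sum>k<d. y j k * simplex_normal d x k) \<partial>(\<Pi>\<^sub>M i\<in>{d<..n}. uniform_sphere d)) = 0"
      using AE_sphere_rows_row_det[OF d0]
    proof eventually_elim
      case (elim x)
      let ?g = "\<lambda>\<theta>. indicator {1} (\<Sum>k<d. \<theta> k * simplex_normal d x k) :: ennreal"
      note [measurable] = measurable_coord
      have bump: "?g \<in> borel_measurable borel" by measurable
      then have g: "?g \<in> borel_measurable (uniform_sphere d)" by (simp cong: measurable_cong_sets)
      have "(\<integral>\<^sup>+y. ?g (y j) \<partial>(\<Pi>\<^sub>M i\<in>{d<..n}. uniform_sphere d))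
        = (\<integral>\<^sup>+\<theta>. ?g \<theta> \<partial>distr (\<Pi>\<^sub>M i\<in>{d<..n}. uniform_sphere d) (uniform_sphere d) (\<lambda>y. y j))"
        using g j by (subst nn_integral_distr) auto
      also have "\<dots> = (\<integral>\<^sup>+\<theta>. ?g \<theta> \<partial>uniform_sphere d)"
        using j by (subst distr_PiM_component) (auto intro: prob_space_uniform_sphere)
      also have "\<dots> = (\<integral>\<^sup>+\<theta>. indicator {\<theta>. (\<Sum>k<d. \<theta> k * simplex_normal d x k) = 1} \<theta> \<partial>uniform_sphere d)"
        by (intro nn_integral_cong) (simp add: indicator_def)
      also have "\<dots> = emeasure (uniform_sphere d) {\<theta>. (\<Sum>k<d. \<theta> k * simplex_normal d x k) = 1}"
        by (rule nn_integral_indicator) simp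
      also have "\<dots> = 0" by (rule sphere_half_spaces(3)[OF d(1) simplex_normal_nsq(1)[OF elim d0(1)]])
      finally show ?case .
    qed
  qed
  finally have "(\<integral>\<^sup>+x. ?f x \<partial>(\<Pi>\<^sub>M i\<in>{1..n}. uniform_sphere d)) = 0" by simp
  then have "AE x in \<Pi>\<^sub>M i\<in>{1..n}. uniform_sphere d. ?f x = 0"
    by (rule nn_integral_0_iff_AE[OF fm, THEN iffD1])
  then show ?thesis by eventually_elim (auto simp: indicator_def split: if_splits)
qed

text \<open>Given the first \<open>d\<close> points at distance \<open>h\<close>, the
  \<open>n - d\<close> others are independent and each lies on the origin's side with probability
  \<open>cap_cdf d h\<close>, on the other with \<open>cap_cdf d (- h)\<close>. Adding both signs
  turns the law of \<open>h\<close> into twice the symmetric law.\<close>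

lemma emeasure_facet_event:
  assumes d: "4 \<le> d" "d < n" and A[measurable]: "A \<in> sets borel"
  shows "emeasure (\<Pi>\<^sub>M i\<in>{1..n}. uniform_sphere d) {x \<in> space (\<Pi>\<^sub>M i\<in>{1..n}. uniform_sphere d). facet_event d n A x}
    = 2 * (\<integral>\<^sup>+t. indicator A t * ennreal (cap_cdf d t) ^ (n - d) \<partial>beta_law (height_exponent d))"
proof -
  let ?S = "\<lambda>I. \<Pi>\<^sub>M i\<in>I. uniform_sphere d"
  interpret S: product_sigma_finite "\<lambda>_::nat. uniform_sphere d"
    using prob_space_imp_sigma_finite[OF prob_space_uniform_sphere] by (simp add: product_sigma_finite_def)
  note [measurable] = facet_event_measurable[OF d(2) A] cap_cdf_measurable[OF d(1)]
  have d0: "0 < d" "d \<le> d" using d by auto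
  let ?f = "\<lambda>x. indicator {x. facet_event d n A x} x :: ennreal"
  let ?g = "\<lambda>t. indicator A t * ennreal (cap_cdf d t) ^ (n - d)"
  have f: "?f \<in> borel_measurable (?S {1..n})" by measurable
  have m: "{x \<in> space (?S {1..n}). facet_event d n A x} \<in> sets (?S {1..n})" by measurable
  have "emeasure (?S {1..n}) {x \<in> space (?S {1..n}). facet_event d n A x} = (\<integral>\<^sup>+x. ?f x \<partial>?S {1..n})"
    unfolding nn_integral_indicator[OF m, symmetric] by (intro nn_integral_cong) (simp add: indicator_def)
  also have "\<dots> = (\<integral>\<^sup>+x. (\<integral>\<^sup>+y. ?f (merge {1..d} {d<..n} (x, y)) \<partial>?S {d<..n}) \<partial>?S {1..d})"
    by (rule nn_integral_sphere_split[OF d(2) f])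
  also have "\<dots> = (\<integral>\<^sup>+x. ?g (simplex_height d x) + ?g (- simplex_height d x) \<partial>?S {1..d})"
  proof (rule nn_integral_cong_AE)
    show "AE x in ?S {1..d}. (\<integral>\<^sup>+y. ?f (merge {1..d} {d<..n} (x, y)) \<partial>?S {d<..n}) = ?g (simplex_height d x) + ?g (- simplex_height d x)"
      using AE_sphere_rows_row_det[OF d0]
    proof eventually_elim
      case (elim x)
      note w = simplex_normal_nsq[OF elim d0(1)]
      let ?L = "\<lambda>\<theta>. \<Sum>k<d. \<theta> k * simplex_normal d x k"
      define a where "a = (\<lambda>\<theta>. indicator {\<theta>. ?L \<theta> < 1} \<theta> :: ennreal)"
      define b where "b = (\<lambda>\<theta>. indicator {\<theta>. 1 < ?L \<theta>} \<theta> :: ennreal)"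
      have am[measurable]: "a \<in> borel_measurable (uniform_sphere d)" and beta_moment[measurable]: "b \<in> borel_measurable (uniform_sphere d)"
      proof -
        note [measurable] = measurable_coord
        have "(\<lambda>\<theta>. indicator {\<theta>. ?L \<theta> < 1} \<theta> :: ennreal) \<in> borel_measurable borel" by measurable
        then show "a \<in> borel_measurable (uniform_sphere d)" by (simp add: a_def cong: measurable_cong_sets)
        have "(\<lambda>\<theta>. indicator {\<theta>. 1 < ?L \<theta>} \<theta> :: ennreal) \<in> borel_measurable borel" by measurable
        then show "b \<in> borel_measurable (uniform_sphere d)" by (simp add: b_def cong: measurable_cong_sets)
      qed
      have n: "n \<in> {d<..n}" using d by simp
      have ia: "(\<integral>\<^sup>+\<theta>. a \<theta> \<partial>uniform_sphere d) = ennreal (cap_cdf d (simplex_height d x))"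
        unfolding a_def w(2) sphere_half_spaces(1)[OF d(1) w(1), symmetric] by (rule nn_integral_indicator) simp
      have ib: "(\<integral>\<^sup>+\<theta>. b \<theta> \<partial>uniform_sphere d) = ennreal (cap_cdf d (- simplex_height d x))"
        unfolding b_def w(2) sphere_half_spaces(2)[OF d(1) w(1), symmetric] by (rule nn_integral_indicator) simp
      have ab: "?f (merge {1..d} {d<..n} (x, y)) =
        indicator A (simplex_height d x) * (\<Prod>j\<in>{d<..n}. a (y j)) + indicator A (- simplex_height d x) * (\<Prod>j\<in>{d<..n}. b (y j))" for y
      proof -
        define p where "p \<longleftrightarrow> (\<forall>j\<in>{d<..n}. ?L (y j) < 1)"
        define q where "q \<longleftrightarrow> (\<forall>j\<in>{d<..n}. 1 < ?L (y j))"
        have pa: "(\<Prod>j\<in>{d<..n}. a (y j)) = (if p then 1 else 0)"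
          by (auto simp: a_def p_def indicator_def prod_zero_iff)
        have pb: "(\<Prod>j\<in>{d<..n}. b (y j)) = (if q then 1 else 0)"
          by (auto simp: b_def q_def indicator_def prod_zero_iff)
        have ev: "facet_event d n A (merge {1..d} {d<..n} (x, y)) \<longleftrightarrow> (simplex_height d x \<in> A \<and> p) \<or> (- simplex_height d x \<in> A \<and> q)"
          unfolding facet_event_def merge_rows(1,2) p_def q_def using merge_rows(3)[of _ d n x y] by simp
        \<comment> \<open>There is at least one further point, so the alternatives are disjoint and
          their indicators add.\<close>
        have "\<not> (p \<and> q)" using n unfolding p_def q_def by fastforce
        then show ?thesis unfolding pa pb indicator_def mem_Collect_eq ev by auto
      qed
      have pam: "(\<lambda>y. \<Prod>j\<in>{d<..n}. a (y j)) \<in> borel_measurable (?S {d<..n})"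
        and pbm: "(\<lambda>y. \<Prod>j\<in>{d<..n}. b (y j)) \<in> borel_measurable (?S {d<..n})"
        by (measurable; simp)+
      have "(\<integral>\<^sup>+y. ?f (merge {1..d} {d<..n} (x, y)) \<partial>?S {d<..n})
        = indicator A (simplex_height d x) * (\<integral>\<^sup>+y. (\<Prod>j\<in>{d<..n}. a (y j)) \<partial>?S {d<..n})
          + indicator A (- simplex_height d x) * (\<integral>\<^sup>+y. (\<Prod>j\<in>{d<..n}. b (y j)) \<partial>?S {d<..n})"
        unfolding ab using pam pbm by (simp add: nn_integral_add nn_integral_cmult)
      also have "(\<integral>\<^sup>+y. (\<Prod>j\<in>{d<..n}. a (y j)) \<partial>?S {d<..n}) = ennreal (cap_cdf d (simplex_height d x)) ^ (n - d)"
        by (subst S.product_nn_integral_prod) (simp_all add: ia)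
      also have "(\<integral>\<^sup>+y. (\<Prod>j\<in>{d<..n}. b (y j)) \<partial>?S {d<..n}) = ennreal (cap_cdf d (- simplex_height d x)) ^ (n - d)"
        by (subst S.product_nn_integral_prod) (simp_all add: ib)
      finally show ?case .
    qed
  qed
  also have "\<dots> = (\<integral>\<^sup>+\<theta>. ?g (plane_dist d \<theta> (\<lambda>_. 1)) + ?g (- plane_dist d \<theta> (\<lambda>_. 1)) \<partial>?S {..<d})"
  proof -
    have h: "plane_dist d (\<lambda>i\<in>{..<d}. x (Suc i)) (\<lambda>_. 1) = simplex_height d x" for x :: "nat \<Rightarrow> nat \<Rightarrow> real"
      unfolding simplex_height_def by (rule plane_dist_cong) auto
    have "(\<lambda>\<theta>. ?g (plane_dist d \<theta> (\<lambda>_. 1)) + ?g (- plane_dist d \<theta> (\<lambda>_. 1))) \<in> borel_measurable (distr (?S {1..d}) (?S {..<d}) (\<lambda>x. \<lambda>i\<in>{..<d}. x (Suc i)))"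
      unfolding distr_sphere_rows[OF order.refl] by measurable
    then have "(\<integral>\<^sup>+\<theta>. ?g (plane_dist d \<theta> (\<lambda>_. 1)) + ?g (- plane_dist d \<theta> (\<lambda>_. 1)) \<partial>distr (?S {1..d}) (?S {..<d}) (\<lambda>x. \<lambda>i\<in>{..<d}. x (Suc i)))
      = (\<integral>\<^sup>+x. ?g (simplex_height d x) + ?g (- simplex_height d x) \<partial>?S {1..d})"
      unfolding h[symmetric] by (rule nn_integral_distr[OF rows_measurable[OF order.refl]])
    then show ?thesis unfolding distr_sphere_rows[OF order.refl] ..
  qed
  also have "\<dots> = 2 * (\<integral>\<^sup>+t. ?g t \<partial>beta_law (height_exponent d))"
    by (rule nn_integral_sphere_height_signed) (use d in \<open>auto\<close>)
  finally show ?thesis .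
qed

lemma facet_height_event_iff:
  assumes d: "2 \<le> d" "d < n" and eu: "\<And>i. i \<in> {1..n} \<Longrightarrow> x i \<in> euclid d"
    and nd: "row_det d (\<lambda>i. x (Suc i)) \<noteq> 0"
    and generic: "\<And>j. j \<in> {d<..n} \<Longrightarrow> (\<Sum>k<d. x j k * simplex_normal d x k) \<noteq> 1"
  defines "F \<equiv> convex hull (x ` {1..d})" and "P \<equiv> convex hull (x ` {1..n})"
  shows "is_facet d F P \<and> (\<exists>h\<in>A. has_height d F P h) \<longleftrightarrow> facet_event d n A x"
    and "is_facet d F P \<longleftrightarrow> facet_event d n UNIV x"
proof -
  interpret C: simplex_cut d n x
    by standard (use d eu nd generic in \<open>auto simp: simplex_normal_def\<close>)
  have r: "C.r = (\<lambda>i. x (Suc i))" by (rule ext) (simp add: C.r_def)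
  have L: "C.L y = (\<Sum>k<d. y k * simplex_normal d x k)" for y
    unfolding C.L_eq simplex_normal_def r ..
  have h: "C.h0 = simplex_height d x" unfolding C.h0_def simplex_height_def r ..
  show "is_facet d F P \<and> (\<exists>h\<in>A. has_height d F P h) \<longleftrightarrow> facet_event d n A x"
    unfolding F_def P_def C.F_def[symmetric] C.P_def[symmetric] C.facet_height_iff facet_event_def L h ..
  show "is_facet d F P \<longleftrightarrow> facet_event d n UNIV x"
    unfolding F_def P_def C.F_def[symmetric] C.P_def[symmetric] C.is_facet_iff facet_event_def L by simp
qed

text \<open>
  With \<open>m = n - d\<close>, half the probability that the first \<open>d\<close> points span a facet with height in \<open>A\<close>.
\<close>

definition tilt_mass :: "nat \<Rightarrow> nat \<Rightarrow> real set \<Rightarrow> real"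
  where "tilt_mass d m A = (LINT t|beta_law (height_exponent d). indicator A t * cap_cdf d t ^ m)"

lemma
  assumes d: "4 \<le> d" and A[measurable]: "A \<in> sets borel"
  shows tilt_mass_integrable: "integrable (beta_law (height_exponent d)) (\<lambda>t. indicator A t * cap_cdf d t ^ m)"
    and nn_integral_tilt_mass:
      "(\<integral>\<^sup>+t. indicator A t * ennreal (cap_cdf d t) ^ m \<partial>beta_law (height_exponent d)) = ennreal (tilt_mass d m A)"
proof -
  interpret prob_space "beta_law (height_exponent d)" by (rule prob_space_beta_law, rule height_exponent_pos) (use d in simp)
  note [measurable] = cap_cdf_measurable[OF d]
  show int: "integrable (beta_law (height_exponent d)) (\<lambda>t. indicator A t * cap_cdf d t ^ m)"
  proof (rule integrable_const_bound[of _ 1])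
    show "AE t in beta_law (height_exponent d). norm (indicator A t * cap_cdf d t ^ m) \<le> 1"
      using cap_cdf_le_1[OF d] cap_cdf_nonneg[of d] by (intro AE_I2) (auto simp: indicator_def power_le_one)
    show "(\<lambda>t. indicator A t * cap_cdf d t ^ m) \<in> borel_measurable (beta_law (height_exponent d))" by measurable
  qed
  have "(\<integral>\<^sup>+t. indicator A t * ennreal (cap_cdf d t) ^ m \<partial>beta_law (height_exponent d))
    = (\<integral>\<^sup>+t. ennreal (indicator A t * cap_cdf d t ^ m) \<partial>beta_law (height_exponent d))"
    by (intro nn_integral_cong) (auto simp: indicator_def ennreal_power cap_cdf_nonneg)
  also have "\<dots> = ennreal (tilt_mass d m A)"
    unfolding tilt_mass_def using int by (rule nn_integral_eq_integral) (simp add: cap_cdf_nonneg)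
  finally show "(\<integral>\<^sup>+t. indicator A t * ennreal (cap_cdf d t) ^ m \<partial>beta_law (height_exponent d)) = ennreal (tilt_mass d m A)" .
qed

lemma tilt_mass_nonneg: "0 \<le> tilt_mass d m A"
  unfolding tilt_mass_def by (rule integral_nonneg_AE) (simp add: cap_cdf_nonneg)

lemma tilt_mass_Compl:
  assumes "4 \<le> d" "A \<in> sets borel"
  shows "tilt_mass d m A + tilt_mass d m (- A) = tilt_mass d m UNIV"
proof -
  have "- A \<in> sets borel" using assms(2) by simp
  then have "tilt_mass d m A + tilt_mass d m (- A)
    = (LINT t|beta_law (height_exponent d). indicator A t * cap_cdf d t ^ m + indicator (- A) t * cap_cdf d t ^ m)"
    unfolding tilt_mass_def using assms by (subst Bochner_Integration.integral_add) (auto intro: tilt_mass_integrable)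
  also have "\<dots> = tilt_mass d m UNIV"
    unfolding tilt_mass_def by (intro Bochner_Integration.integral_cong refl) (auto simp: indicator_def)
  finally show ?thesis .
qed

text \<open>
  The event in the definition of the conditional probability is not assumed to be measurable, and
  a non-measurable set has \<open>measure\<close> 0.  Each conditional probability is therefore either \<open>0\<close> or
  the expected value; since both families are probabilities, they agree.
\<close>

lemma typical_height_law:
  assumes d: "4 \<le> d" "d < n" and M: "prob_space M"
    and indep: "prob_space.indep_vars M (\<lambda>_. borel) X {1..n}"
    and unif: "\<And>i. i \<in> {1..n} \<Longrightarrow> distr M borel (X i) = uniform_sphere d"
    and H: "typical_height M n d X N H" and A: "A \<in> sets borel"
  shows "measure N {y \<in> space N. H y \<in> A} = tilt_mass d (n - d) A / tilt_mass d (n - d) UNIV"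
proof -
  interpret M: prob_space M by (rule M)
  let ?S = "\<Pi>\<^sub>M i\<in>{1..n}. uniform_sphere d"
  define Y where "Y \<omega> = (\<lambda>i\<in>{1..n}. X i \<omega>)" for \<omega>
  define F where "F \<omega> = convex hull ((\<lambda>i. X i \<omega>) ` {1..d})" for \<omega>
  define P where "P \<omega> = convex hull ((\<lambda>i. X i \<omega>) ` {1..n})" for \<omega>
  have X: "X i \<in> measurable M borel" if "i \<in> {1..n}" for i
    using indep that unfolding M.indep_vars_def by auto
  have Ym: "Y \<in> measurable M ?S"
    unfolding Y_def by (intro measurable_restrict) (use X in \<open>simp cong: measurable_cong_sets\<close>)
  have YS: "distr M ?S Y = ?S"
  proof -
    have "distr M ?S Y = distr M (\<Pi>\<^sub>M i\<in>{1..n}. borel) (\<lambda>\<omega>. \<lambda>i\<in>{1..n}. X i \<omega>)"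
      unfolding Y_def[abs_def] by (intro distr_cong sets_PiM_cong) auto
    also have "\<dots> = (\<Pi>\<^sub>M i\<in>{1..n}. distr M borel (X i))"
      using indep X d by (subst M.indep_vars_iff_distr_eq_PiM'[symmetric]) auto
    also have "\<dots> = ?S" using unif by (intro PiM_cong) auto
    finally show ?thesis .
  qed
  have aeY: "AE \<omega> in M. Q (Y \<omega>)" if "AE x in ?S. Q x" for Q
    by (rule AE_distrD[OF Ym]) (simp only: YS that)
  have good: "AE x in ?S. (\<forall>i\<in>{1..n}. x i \<in> euclid d) \<and> row_det d (\<lambda>i. x (Suc i)) \<noteq> 0 \<and>
      (\<forall>j\<in>{d<..n}. (\<Sum>k<d. x j k * simplex_normal d x k) \<noteq> 1)"
  proof (intro AE_conjI)
    show "AE x in ?S. \<forall>i\<in>{1..n}. x i \<in> euclid d"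
      by (intro eventually_ball_finite ballI AE_PiM_component prob_space_uniform_sphere AE_uniform_sphere_euclid) simp_all
    show "AE x in ?S. row_det d (\<lambda>i. x (Suc i)) \<noteq> 0" by (rule AE_sphere_rows_row_det) (use d in auto)
    show "AE x in ?S. \<forall>j\<in>{d<..n}. (\<Sum>k<d. x j k * simplex_normal d x k) \<noteq> 1"
      using d by (intro eventually_ball_finite ballI AE_sphere_generic) auto
  qed
  have d2: "2 \<le> d" using d by simp
  have ev: "AE \<omega> in M. (is_facet d (F \<omega>) (P \<omega>) \<and> (\<exists>h\<in>B. has_height d (F \<omega>) (P \<omega>) h) \<longleftrightarrow> facet_event d n B (Y \<omega>)) \<and>
      (is_facet d (F \<omega>) (P \<omega>) \<longleftrightarrow> facet_event d n UNIV (Y \<omega>))" for B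
    using aeY[OF good]
  proof eventually_elim
    case (elim \<omega>)
    have "F \<omega> = convex hull (Y \<omega> ` {1..d})" "P \<omega> = convex hull (Y \<omega> ` {1..n})"
      using d by (auto simp: F_def P_def Y_def intro!: arg_cong[where f="\<lambda>S. convex hull S"] image_cong)
    then show ?case
      using facet_height_event_iff[OF d2 d(2), of "Y \<omega>"] elim by simp
  qed
  define T where "T B = {\<omega> \<in> space M. facet_event d n B (Y \<omega>)}" for B
  have T: "T B \<in> sets M" "measure M (T B) = 2 * tilt_mass d (n - d) B" if B: "B \<in> sets borel" for B
  proof -
    let ?E = "{x \<in> space ?S. facet_event d n B x}"
    have E: "?E \<in> sets ?S" using facet_event_measurable[OF d(2) B] by simp
    have eq: "T B = Y -` ?E \<inter> space M" using measurable_space[OF Ym] by (auto simp: T_def)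
    show "T B \<in> sets M" unfolding eq by (rule measurable_sets[OF Ym E])
    have "emeasure M (T B) = emeasure ?S ?E"
      unfolding eq emeasure_distr[OF Ym E, symmetric] YS ..
    also have "\<dots> = ennreal (2 * tilt_mass d (n - d) B)"
      unfolding emeasure_facet_event[OF d B] nn_integral_tilt_mass[OF d(1) B]
      by (simp add: ennreal_mult tilt_mass_nonneg)
    finally show "measure M (T B) = 2 * tilt_mass d (n - d) B"
      by (simp add: measure_def tilt_mass_nonneg)
  qed
  have dich: "measure M {\<omega> \<in> space M. Q \<omega>} \<in> {0, 2 * tilt_mass d (n - d) B}"
    if B: "B \<in> sets borel" and Q: "AE \<omega> in M. Q \<omega> \<longleftrightarrow> facet_event d n B (Y \<omega>)" for Q B
  proof (cases "{\<omega> \<in> space M. Q \<omega>} \<in> sets M")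
    case True
    have "measure M {\<omega> \<in> space M. Q \<omega>} = measure M (T B)"
      using Q True T(1)[OF B] unfolding T_def by (intro measure_eq_AE) auto
    then show ?thesis using T(2)[OF B] by simp
  qed (simp add: measure_notin_sets)
  define q where "q B = tilt_mass d (n - d) B / tilt_mass d (n - d) UNIV" for B
  define b where "b = measure M {\<omega> \<in> space M. is_facet d (F \<omega>) (P \<omega>)}"
  define a where "a B = measure M {\<omega> \<in> space M. (\<exists>h\<in>B. has_height d (F \<omega>) (P \<omega>) h) \<and> is_facet d (F \<omega>) (P \<omega>)}" for B
  interpret N: prob_space N using H by (simp add: typical_height_def)
  have Hm: "H \<in> borel_measurable N" using H by (simp add: typical_height_def)
  have law: "measure N {y \<in> space N. H y \<in> B} = a B / b" if "B \<in> sets borel" for B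
    using H that unfolding typical_height_def cond_prob_def a_def b_def F_def P_def by simp
  \<comment> \<open>Division by 0 yields 0, so the total mass 1 of the law of \<open>H\<close> rules
    out \<open>b = 0\<close>.\<close>
  have "a UNIV / b = 1" using law[of UNIV] N.prob_space by simp
  then have "b \<noteq> 0" by auto
  moreover have "b \<in> {0, 2 * tilt_mass d (n - d) UNIV}"
    unfolding b_def by (rule dich) (use ev[of UNIV] in \<open>auto elim: eventually_mono\<close>)
  ultimately have b: "b = 2 * tilt_mass d (n - d) UNIV" "tilt_mass d (n - d) UNIV \<noteq> 0" by auto
  have p: "measure N {y \<in> space N. H y \<in> B} \<in> {0, q B}" if B: "B \<in> sets borel" for B
  proof -
    have "a B \<in> {0, 2 * tilt_mass d (n - d) B}"
      unfolding a_def by (rule dich[OF B]) (use ev[of B] in \<open>auto elim!: eventually_mono\<close>)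
    then show ?thesis unfolding law[OF B] b q_def by auto
  qed
  have cA: "- A \<in> sets borel" using A by simp
  have "measure N {y \<in> space N. H y \<in> A} + measure N {y \<in> space N. H y \<in> - A} = 1"
  proof -
    have m: "{y \<in> space N. H y \<in> A} \<in> sets N" using Hm A by measurable
    have "{y \<in> space N. H y \<in> - A} = space N - {y \<in> space N. H y \<in> A}" by auto
    then show ?thesis using N.prob_compl[OF m] by simp
  qed
  moreover have "q A + q (- A) = 1"
    using tilt_mass_Compl[OF d(1) A] b(2) by (simp add: q_def add_divide_distrib[symmetric])
  ultimately show ?thesis using p[OF A] p[OF cA] unfolding q_def by auto
qed

section \<open>Asymptotics\<close>

text \<open>The error in \<open>ln (1 + a) \<approx> a\<close> is at most
  \<open>2 * a\<^sup>2\<close> for small \<open>a\<close>, and \<open>r * a\<^sup>2\<close> tends to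
  0 because \<open>r * a\<close> converges and \<open>a\<close> vanishes.\<close>

lemma powr_one_plus_tendsto_exp:
  fixes a r :: "nat \<Rightarrow> real"
  assumes a: "a \<longlonglongrightarrow> 0" and ra: "(\<lambda>n. r n * a n) \<longlonglongrightarrow> L"
  shows "(\<lambda>n. (1 + a n) powr r n) \<longlonglongrightarrow> exp L"
proof -
  have small: "\<forall>\<^sub>F n in sequentially. \<bar>a n\<bar> < 1 / 2"
    using tendstoD[OF a, of "1 / 2"] by simp
  have "(\<lambda>n. 2 * \<bar>r n * a n\<bar> * \<bar>a n\<bar>) \<longlonglongrightarrow> 2 * \<bar>L\<bar> * \<bar>0\<bar>"
    by (intro tendsto_intros a ra)
  then have "(\<lambda>n. 2 * \<bar>r n * a n\<bar> * \<bar>a n\<bar>) \<longlonglongrightarrow> 0" by simp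
  moreover have "\<forall>\<^sub>F n in sequentially. norm (r n * (ln (1 + a n) - a n)) \<le> 2 * \<bar>r n * a n\<bar> * \<bar>a n\<bar>"
    using small
  proof eventually_elim
    case (elim n)
    have "\<bar>ln (1 + a n) - a n\<bar> \<le> 2 * (a n)\<^sup>2" using elim by (intro abs_ln_one_plus_x_minus_x_bound) auto
    then have "\<bar>r n\<bar> * \<bar>ln (1 + a n) - a n\<bar> \<le> \<bar>r n\<bar> * (2 * (a n)\<^sup>2)" by (rule mult_left_mono) simp
    also have "\<dots> = 2 * \<bar>r n * a n\<bar> * \<bar>a n\<bar>" by (simp add: abs_mult power2_eq_square abs_mult_self_eq)
    finally show ?case by (simp add: abs_mult)
  qed
  ultimately have "(\<lambda>n. r n * (ln (1 + a n) - a n)) \<longlonglongrightarrow> 0" by (rule Lim_null_comparison[rotated])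
  from tendsto_add[OF ra this] have "(\<lambda>n. r n * ln (1 + a n)) \<longlonglongrightarrow> L" by (simp add: algebra_simps)
  then have "(\<lambda>n. exp (r n * ln (1 + a n))) \<longlonglongrightarrow> exp L" by (rule tendsto_exp)
  moreover have "\<forall>\<^sub>F n in sequentially. exp (r n * ln (1 + a n)) = (1 + a n) powr r n"
    using small by eventually_elim (auto simp: powr_def)
  ultimately show ?thesis by (rule Lim_transform_eventually)
qed

lemma beta_kernel_tendsto_exp:
  assumes t: "t \<longlonglongrightarrow> 0" and L: "(\<lambda>n. p n * (t n)\<^sup>2) \<longlonglongrightarrow> L"
  shows "(\<lambda>n. beta_kernel (p n) (t n)) \<longlonglongrightarrow> exp (- L)"
proof -
  have "(\<lambda>n. (1 + - (t n)\<^sup>2) powr p n) \<longlonglongrightarrow> exp (- L)"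
  proof (rule powr_one_plus_tendsto_exp)
    show "(\<lambda>n. - (t n)\<^sup>2) \<longlonglongrightarrow> 0" using tendsto_minus[OF tendsto_power[OF t, of 2]] by simp
    show "(\<lambda>n. p n * - (t n)\<^sup>2) \<longlonglongrightarrow> - L" using tendsto_minus[OF L] by simp
  qed
  moreover have "\<forall>\<^sub>F n in sequentially. (1 + - (t n)\<^sup>2) powr p n = beta_kernel (p n) (t n)"
  proof -
    have "\<forall>\<^sub>F n in sequentially. \<bar>t n\<bar> < 1" using tendstoD[OF t, of 1] by simp
    then show ?thesis
    proof eventually_elim
      case (elim n)
      then have "-1 < t n" "t n < 1" by auto
      then show ?case by (simp add: beta_kernel_def)
    qed
  qed
  ultimately show ?thesis by (rule Lim_transform_eventually)
qed

lemma beta_kernel_le_exp: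
  assumes p: "0 < p"
  shows "beta_kernel p t \<le> exp (- p * t\<^sup>2)"
proof (cases "t \<in> {-1<..<1}")
  case True
  then have t: "0 < 1 - t\<^sup>2" using abs_square_less_1[of t] by (auto simp: abs_if split: if_splits)
  have "p * ln (1 - t\<^sup>2) \<le> p * - t\<^sup>2" using ln_le_minus_one[OF t] p by (intro mult_left_mono) auto
  then show ?thesis using True t by (simp add: beta_kernel_def powr_def)
qed (simp add: beta_kernel_def)

text \<open>The ratio 1/8 serves both exponents: for \<open>d \<ge> 4\<close> one has
  \<open>d / 8 \<le> d / 2 - 3 / 2\<close>, with equality at 4, and
  \<open>d\<^sup>2 / 8 \<le> height_exponent d\<close>.\<close>

lemma beta_kernel_scaled_le:
  assumes p: "r / 8 \<le> p" and r: "0 < r"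
  shows "beta_kernel p (z / sqrt r) \<le> exp (- z\<^sup>2 / 8)"
proof -
  have p0: "0 < p" using p r by simp
  have "(r / 8) * (z\<^sup>2 / r) \<le> p * (z\<^sup>2 / r)" using p r by (intro mult_right_mono) auto
  then have "- p * (z / sqrt r)\<^sup>2 \<le> - z\<^sup>2 / 8" using r by (simp add: power_divide)
  then show ?thesis using beta_kernel_le_exp[OF p0, of "z / sqrt r"] by (meson exp_le_cancel_iff order_trans)
qed

lemma integrable_exp_neg_square:
  assumes a: "0 < (a::real)"
  shows "integrable lborel (\<lambda>y. exp (- a * y\<^sup>2))"
proof -
  define s where "s = sqrt (1 / (2 * a))"
  have s: "0 < s" "2 * s\<^sup>2 = 1 / a" using a by (auto simp: s_def)
  have "integrable lborel (\<lambda>y. sqrt (2 * pi * s\<^sup>2) * normal_density 0 s y)"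
    by (intro integrable_mult_right integrable_normal_density s)
  moreover have "sqrt (2 * pi * s\<^sup>2) * normal_density 0 s y = exp (- a * y\<^sup>2)" for y
    using s a by (simp add: normal_density_def)
  ultimately show ?thesis by simp
qed

text \<open>On the scale \<open>t = z / sqrt d\<close> the kernel tends to
  \<open>exp (- z\<^sup>2 / 2)\<close>. The reciprocal of \<open>beta_norm\<close> is the density of
  a coordinate at 0, which is thus about \<open>sqrt (d / (2 * pi))\<close>.\<close>

lemma beta_norm_asymptotics:
  fixes d :: "nat \<Rightarrow> nat"
  assumes d4: "\<And>n. 4 \<le> d n" and d: "filterlim d at_top sequentially"
  shows "(\<lambda>n. sqrt (d n) * beta_norm (d n / 2 - 3 / 2)) \<longlonglongrightarrow> sqrt (2 * pi)"
proof -
  let ?p = "\<lambda>n. real (d n) / 2 - 3 / 2"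
  have dr: "filterlim (\<lambda>n. real (d n)) at_top sequentially"
    by (rule filterlim_compose[OF filterlim_real_sequentially d])
  have pos: "0 < real (d n)" for n using d4[of n] by simp
  have eq: "sqrt (d n) * beta_norm (?p n) = (LINT z|lborel. beta_kernel (?p n) (z / sqrt (d n)))" for n
    using lborel_integral_real_affine[of "1 / sqrt (d n)" "beta_kernel (?p n)" 0] pos[of n]
    by (simp add: beta_norm_def)
  have "(\<lambda>n. LINT z|lborel. beta_kernel (?p n) (z / sqrt (d n))) \<longlonglongrightarrow> (LINT z|lborel. exp (- z\<^sup>2 / 2))"
  proof (rule integral_dominated_convergence[where w="\<lambda>z. exp (- (1 / 8) * z\<^sup>2)"])
    show "integrable lborel (\<lambda>z::real. exp (- (1 / 8) * z\<^sup>2))" by (rule integrable_exp_neg_square) simp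
    show "AE z in lborel. (\<lambda>n. beta_kernel (?p n) (z / sqrt (d n))) \<longlonglongrightarrow> exp (- z\<^sup>2 / 2)"
    proof (rule AE_I2)
      fix z :: real
      have "(\<lambda>n. beta_kernel (?p n) (z / sqrt (d n))) \<longlonglongrightarrow> exp (- (z\<^sup>2 / 2))"
      proof (rule beta_kernel_tendsto_exp)
        show "(\<lambda>n. z / sqrt (d n)) \<longlonglongrightarrow> 0"
          by (rule filterlim_compose[OF _ dr]) real_asymp
        have "((\<lambda>x. (x / 2 - 3 / 2) * (z\<^sup>2 / x)) \<longlongrightarrow> z\<^sup>2 / 2) at_top" by real_asymp
        from filterlim_compose[OF this dr]
        show "(\<lambda>n. ?p n * (z / sqrt (d n))\<^sup>2) \<longlonglongrightarrow> z\<^sup>2 / 2"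
          using pos by (simp add: power_divide)
      qed
      then show "(\<lambda>n. beta_kernel (?p n) (z / sqrt (d n))) \<longlonglongrightarrow> exp (- z\<^sup>2 / 2)" by simp
    qed
    show "AE z in lborel. norm (beta_kernel (?p n) (z / sqrt (d n))) \<le> exp (- (1 / 8) * z\<^sup>2)" for n
    proof (rule AE_I2)
      fix z :: real
      have "d n / 8 \<le> ?p n" using d4[of n] by simp
      then show "norm (beta_kernel (?p n) (z / sqrt (d n))) \<le> exp (- (1 / 8) * z\<^sup>2)"
        using beta_kernel_scaled_le[OF _ pos] by (simp add: beta_kernel_nonneg)
    qed
  qed measurable
  moreover have "(LINT z|lborel. exp (- z\<^sup>2 / 2)) = sqrt (2 * pi)"
  proof -
    have "(LINT z|lborel. sqrt (2 * pi) * std_normal_density z) = sqrt (2 * pi)"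
      using integral_normal_density[of 1 0] by simp
    then show ?thesis by (simp add: std_normal_density_def)
  qed
  ultimately show ?thesis by (simp add: eq)
qed

section \<open>Caps close to a half-sphere\<close>

text \<open>For \<open>s \<ge> 0\<close> this is \<open>2 * cap_cdf d s - 1\<close>, twice the
  excess over a half-sphere; as the integral of the density over a symmetric interval it is easy to
  bound on both sides.\<close>

definition band :: "nat \<Rightarrow> real \<Rightarrow> real"
  where "band d s = measure (beta_law (d / 2 - 3 / 2)) {-s..s}"

lemma cap_cdf_band:
  assumes d: "4 \<le> d"
  shows "2 * cap_cdf d t = 1 + sgn t * band d \<bar>t\<bar>"
proof -
  let ?N = "beta_law (d / 2 - 3 / 2)"
  interpret prob_space ?N by (rule prob_space_beta_law) (use d in simp)
  have m: "A \<in> sets borel \<Longrightarrow> A \<in> sets ?N" for A by simp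
  have single: "measure ?N {s} = 0" for s by (simp add: measure_def emeasure_beta_law_singleton)
  have open_closed: "measure ?N {..<s} = measure ?N {..s}" for s
  proof -
    have eq: "{..s} = {..<s} \<union> {s}" by auto
    have "measure ?N {..s} = measure ?N {..<s} + measure ?N {s}"
      unfolding eq by (rule finite_measure_Union) auto
    then show ?thesis by (simp add: single)
  qed
  have sym: "measure ?N {s<..} = measure ?N {..<- s}" for s
  proof -
    have "emeasure ?N {s<..} = (\<integral>\<^sup>+t. indicator {s<..} t \<partial>?N)" by simp
    also have "\<dots> = (\<integral>\<^sup>+t. indicator {s<..} (- t) \<partial>?N)"
      by (rule nn_integral_beta_law_symmetric[symmetric]) simp
    also have "\<dots> = (\<integral>\<^sup>+t. indicator {..<- s} t \<partial>?N)"
      by (intro nn_integral_cong) (auto simp: indicator_def)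
    finally show ?thesis by (simp add: measure_def)
  qed
  have compl: "measure ?N {..s} + measure ?N {s<..} = 1" for s
  proof -
    have "{s<..} = space ?N - {..s}" by auto
    then show ?thesis using prob_compl[of "{..s}"] by simp
  qed
  have reflect: "measure ?N {..- s} = 1 - measure ?N {..s}" for s
    using compl[of s] sym[of s] open_closed[of "- s"] by simp
  have nonneg: "2 * measure ?N {..s} = 1 + band d s" if "0 \<le> s" for s
  proof -
    have eq: "{..s} = {..<- s} \<union> {- s..s}" using that by auto
    have "measure ?N {..s} = measure ?N {..<- s} + band d s"
      unfolding eq band_def by (rule finite_measure_Union) auto
    then show ?thesis using reflect[of s] open_closed[of "- s"] by simp
  qed
  consider "t = 0" | "0 < t" | "t < 0" by linarith
  then show ?thesis
  proof cases
    case 1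
    then show ?thesis using reflect[of 0] by (simp add: cap_cdf_def)
  next
    case 2
    then show ?thesis using nonneg[of t] by (simp add: cap_cdf_def)
  next
    case 3
    then show ?thesis using nonneg[of "- t"] reflect[of "- t"] by (simp add: cap_cdf_def)
  qed
qed

text \<open>On \<open>[-s, s]\<close> the kernel lies between its value at \<open>s\<close> and 1.
  For \<open>s\<close> of order \<open>1 / d\<close> that value tends to 1, so both bounds have the
  same asymptotics.\<close>

lemma
  assumes d: "4 \<le> d" and s: "0 \<le> s"
  shows band_le: "band d s \<le> 2 * s / beta_norm (d / 2 - 3 / 2)"
    and band_ge: "2 * s * beta_kernel (d / 2 - 3 / 2) s / beta_norm (d / 2 - 3 / 2) \<le> band d s"
proof -
  let ?p = "d / 2 - 3 / 2"
  have p: "0 < ?p" using d by simp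
  note Z = beta_norm_pos[OF p]
  interpret prob_space "beta_law ?p" by (rule prob_space_beta_law[OF p])
  have "band d s = (LINT t|beta_law ?p. indicator {-s..s} t)" by (simp add: band_def)
  also have "\<dots> = (LINT t|lborel. indicator {-s..s} t * beta_kernel ?p t) / beta_norm ?p" by (rule integral_beta_law[OF p]) simp
  finally have eq: "band d s = (LINT t|lborel. indicator {-s..s} t * beta_kernel ?p t) / beta_norm ?p" .
  have int: "integrable lborel (\<lambda>t. c * indicator {-s..s} t :: real)" for c
    by (intro integrable_mult_right integrable_real_indicator) (auto simp: emeasure_lborel_Icc_eq)
  have kp1: "beta_kernel ?p t \<le> 1" for t by (rule order_trans[OF beta_kernel_le[OF p] indicator_le_1])
  have ik: "integrable lborel (\<lambda>t. indicator {-s..s} t * beta_kernel ?p t)"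
    by (rule Bochner_Integration.integrable_bound[OF int[of 1]])
       (auto intro!: AE_I2 simp: indicator_def beta_kernel_nonneg kp1)
  have val: "(LINT t|lborel. c * indicator {-s..s} t) = c * (2 * s)" for c using s by simp
  have "(LINT t|lborel. indicator {-s..s} t * beta_kernel ?p t) \<le> (LINT t|lborel. 1 * indicator {-s..s} t)"
    by (rule integral_mono[OF ik int]) (simp add: indicator_def kp1)
  then show "band d s \<le> 2 * s / beta_norm ?p" unfolding eq val using Z by (simp add: divide_right_mono)
  have mono: "beta_kernel ?p s \<le> beta_kernel ?p t" if t: "t \<in> {-s..s}" for t
  proof (cases "s < 1")
    case True
    have "t\<^sup>2 \<le> s\<^sup>2" using t power_mono[of "\<bar>t\<bar>" s 2] by (simp add: abs_le_iff)
    moreover have "s\<^sup>2 < 1" using True s abs_square_less_1[of s] by simp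
    ultimately have "(1 - s\<^sup>2) powr ?p \<le> (1 - t\<^sup>2) powr ?p" using p by (intro powr_mono2) auto
    then show ?thesis using t True by (simp add: beta_kernel_def)
  next
    case False
    then show ?thesis using beta_kernel_nonneg[of ?p t] by (simp add: beta_kernel_def)
  qed
  have "(LINT t|lborel. beta_kernel ?p s * indicator {-s..s} t) \<le> (LINT t|lborel. indicator {-s..s} t * beta_kernel ?p t)"
    by (rule integral_mono[OF int ik]) (simp add: indicator_def mono)
  then show "2 * s * beta_kernel ?p s / beta_norm ?p \<le> band d s" unfolding eq val using Z by (simp add: divide_right_mono mult.commute)
qed

section \<open>The limit of the conditional law\<close>

text \<open>Rescaling by \<open>d\<close> and multiplying \<open>cap_cdf\<close> by 2, so that it is
  1 at 0, produces an integrand that converges; the constants involved cancel in the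
  quotient.\<close>

lemma tilt_mass_ratio:
  fixes d m :: nat
  assumes d: "4 \<le> d" and A[measurable]: "A \<in> sets borel"
  defines "g \<equiv> \<lambda>y. (2 * cap_cdf d (y / d)) ^ m * beta_kernel (height_exponent d) (y / d)"
  shows "tilt_mass d m A / tilt_mass d m UNIV = (LINT y|lborel. indicator A (y / d) * g y) / (LINT y|lborel. g y)"
proof -
  have h: "0 < height_exponent d" by (rule height_exponent_pos) (use d in simp)
  have Z: "0 < beta_norm (height_exponent d)" by (rule beta_norm_pos[OF h])
  note [measurable] = cap_cdf_measurable[OF d]
  have eq: "tilt_mass d m B = (LINT y|lborel. indicator B (y / d) * g y) / (d * beta_norm (height_exponent d) * 2 ^ m)"
    if [measurable]: "B \<in> sets borel" for B
  proof -
    have "tilt_mass d m B = (LINT t|lborel. indicator B t * cap_cdf d t ^ m * beta_kernel (height_exponent d) t) / beta_norm (height_exponent d)"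
      unfolding tilt_mass_def by (rule integral_beta_law[OF h]) measurable
    also have "(LINT t|lborel. indicator B t * cap_cdf d t ^ m * beta_kernel (height_exponent d) t)
      = (LINT y|lborel. indicator B (y / d) * cap_cdf d (y / d) ^ m * beta_kernel (height_exponent d) (y / d)) / d"
      using d by (subst lborel_integral_real_affine[where c="1 / d" and t=0]) auto
    also have "(LINT y|lborel. indicator B (y / d) * cap_cdf d (y / d) ^ m * beta_kernel (height_exponent d) (y / d))
      = (LINT y|lborel. indicator B (y / d) * g y / 2 ^ m)"
      by (intro Bochner_Integration.integral_cong refl) (simp add: g_def power_mult_distrib)
    finally show ?thesis by (simp add: mult_ac)
  qed
  show ?thesis unfolding eq[OF A] eq[OF borel_open[OF open_UNIV]] using Z d by simp
qed

text \<open>Pointwise limits come from squeezing \<open>band\<close>. The majorant combines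
  \<open>exp (K * \<bar>y\<bar>)\<close> from the caps with the Gaussian bound on the
  kernel.\<close>

lemma tilt_density_limit:
  fixes d m :: "nat \<Rightarrow> nat"
  assumes d4: "\<And>n. 4 \<le> d n" and d: "filterlim d at_top sequentially"
    and m: "(\<lambda>n. real (m n) / sqrt (d n)) \<longlonglongrightarrow> \<rho>" and A[measurable]: "A \<in> sets borel"
  defines "c \<equiv> \<rho> * sqrt (2 / pi)"
  shows "(\<lambda>n. LINT y|lborel. indicator A y * ((2 * cap_cdf (d n) (y / d n)) ^ m n * beta_kernel (height_exponent (d n)) (y / d n)))
    \<longlonglongrightarrow> (LINT y|lborel. indicator A y * exp (c * y - y\<^sup>2 / 2))"
proof -
  let ?p = "\<lambda>n. real (d n) / 2 - 3 / 2"
  let ?g = "\<lambda>n y. (2 * cap_cdf (d n) (y / d n)) ^ m n * beta_kernel (height_exponent (d n)) (y / d n)"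
  have dr: "filterlim (\<lambda>n. real (d n)) at_top sequentially"
    by (rule filterlim_compose[OF filterlim_real_sequentially d])
  have pos: "0 < real (d n)" for n using d4[of n] by simp
  have Zp: "0 < beta_norm (?p n)" for n by (rule beta_norm_pos) (use d4[of n] in simp)
  \<comment> \<open>\<open>B n * \<bar>y\<bar>\<close> is the upper bound for \<open>band\<close> at
    \<open>\<bar>y\<bar> / d n\<close>; it is asymptotically sharp, and \<open>m n * B n\<close>
    tends to \<open>c\<close>.\<close>
  define B where "B n = 2 / (d n * beta_norm (?p n))" for n
  have B0: "0 < B n" for n using pos[of n] Zp[of n] by (simp add: B_def)
  have sB: "(\<lambda>n. sqrt (d n) * B n) \<longlonglongrightarrow> sqrt (2 / pi)"
  proof -
    have "(\<lambda>n. 2 / (sqrt (d n) * beta_norm (?p n))) \<longlonglongrightarrow> 2 / sqrt (2 * pi)"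
      by (intro tendsto_divide tendsto_const beta_norm_asymptotics d4 d) simp
    moreover have "2 / (sqrt (d n) * beta_norm (?p n)) = sqrt (d n) * B n" for n
      using pos[of n] Zp[of n] by (simp add: B_def field_simps)
    moreover have "2 / sqrt (2 * pi) = sqrt (2 / pi)"
      by (simp add: real_sqrt_mult real_sqrt_divide field_simps)
    ultimately show ?thesis by simp
  qed
  have mB: "(\<lambda>n. m n * B n) \<longlonglongrightarrow> c"
  proof -
    have "(\<lambda>n. (m n / sqrt (d n)) * (sqrt (d n) * B n)) \<longlonglongrightarrow> c"
      unfolding c_def by (intro tendsto_mult m sB)
    moreover have "(m n / sqrt (d n)) * (sqrt (d n) * B n) = m n * B n" for n using pos[of n] by simp
    ultimately show ?thesis by simp
  qed
  have B_lim: "B \<longlonglongrightarrow> 0"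
  proof -
    have "((\<lambda>x. 1 / sqrt x) \<longlongrightarrow> 0) at_top" by real_asymp
    from tendsto_mult[OF filterlim_compose[OF this dr] sB]
    have "(\<lambda>n. 1 / sqrt (d n) * (sqrt (d n) * B n)) \<longlonglongrightarrow> 0" by simp
    moreover have "1 / sqrt (d n) * (sqrt (d n) * B n) = B n" for n using pos[of n] by simp
    ultimately show ?thesis by simp
  qed
  obtain K where K: "m n * B n \<le> K" for n
  proof -
    have "Bseq (\<lambda>n. m n * B n)" using mB by (intro convergent_imp_Bseq convergentI)
    then obtain K where "\<And>n. norm (m n * B n) \<le> K" unfolding Bseq_def by blast
    then show ?thesis using that by (metis abs_le_D1 real_norm_def)
  qed
  define a where "a n y = sgn y * band (d n) (\<bar>y\<bar> / d n)" for n y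
  have cap: "2 * cap_cdf (d n) (y / d n) = 1 + a n y" for n y
    using cap_cdf_band[OF d4, of n "y / d n"] pos[of n] by (simp add: a_def sgn_divide)
  have band_up: "band (d n) (\<bar>y\<bar> / d n) \<le> B n * \<bar>y\<bar>" for n y
    using band_le[OF d4, of "\<bar>y\<bar> / d n" n] by (simp add: B_def)
  have band_low: "B n * \<bar>y\<bar> * beta_kernel (?p n) (\<bar>y\<bar> / d n) \<le> band (d n) (\<bar>y\<bar> / d n)" for n y
    using band_ge[OF d4, of "\<bar>y\<bar> / d n" n] by (simp add: B_def)
  have g_lim: "(\<lambda>n. ?g n y) \<longlonglongrightarrow> exp (c * y - y\<^sup>2 / 2)" for y
  proof -
    have k1: "(\<lambda>n. beta_kernel (?p n) (\<bar>y\<bar> / d n)) \<longlonglongrightarrow> exp (- 0)"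
    proof (rule beta_kernel_tendsto_exp)
      show "(\<lambda>n. \<bar>y\<bar> / d n) \<longlonglongrightarrow> 0" by (rule filterlim_compose[OF _ dr]) real_asymp
      have "((\<lambda>x. (x / 2 - 3 / 2) * (y\<^sup>2 / x\<^sup>2)) \<longlongrightarrow> 0) at_top" by real_asymp
      then have "((\<lambda>x. (x / 2 - 3 / 2) * (\<bar>y\<bar> / x)\<^sup>2) \<longlongrightarrow> 0) at_top" by (simp add: power_divide)
      from filterlim_compose[OF this dr] show "(\<lambda>n. ?p n * (\<bar>y\<bar> / d n)\<^sup>2) \<longlonglongrightarrow> 0" .
    qed
    \<comment> \<open>Used with \<open>r = 1\<close> to see that the base tends to 1, and with
      \<open>r = m\<close> for the exponent of the limit.\<close>
    have band_lim: "(\<lambda>n. r n * band (d n) (\<bar>y\<bar> / d n)) \<longlonglongrightarrow> l * \<bar>y\<bar>"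
      if r: "\<And>n. 0 \<le> r n" "(\<lambda>n. r n * B n) \<longlonglongrightarrow> l" for r l
    proof (rule tendsto_sandwich)
      show "\<forall>\<^sub>F n in sequentially. (r n * B n) * \<bar>y\<bar> * beta_kernel (?p n) (\<bar>y\<bar> / d n) \<le> r n * band (d n) (\<bar>y\<bar> / d n)"
        using mult_left_mono[OF band_low r(1)] by (simp add: mult.assoc)
      show "\<forall>\<^sub>F n in sequentially. r n * band (d n) (\<bar>y\<bar> / d n) \<le> (r n * B n) * \<bar>y\<bar>"
        using mult_left_mono[OF band_up r(1)] by (simp add: mult.assoc)
      have "(\<lambda>n. (r n * B n) * \<bar>y\<bar> * beta_kernel (?p n) (\<bar>y\<bar> / d n)) \<longlonglongrightarrow> l * \<bar>y\<bar> * exp (- 0)"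
        by (intro tendsto_mult tendsto_const r k1)
      then show "(\<lambda>n. (r n * B n) * \<bar>y\<bar> * beta_kernel (?p n) (\<bar>y\<bar> / d n)) \<longlonglongrightarrow> l * \<bar>y\<bar>" by simp
      show "(\<lambda>n. (r n * B n) * \<bar>y\<bar>) \<longlonglongrightarrow> l * \<bar>y\<bar>" by (intro tendsto_intros r)
    qed
    have sy: "sgn y * (l * \<bar>y\<bar>) = l * y" for l by (simp add: mult_sgn_abs mult.left_commute)
    have a0: "(\<lambda>n. a n y) \<longlonglongrightarrow> 0"
      using tendsto_mult[OF tendsto_const band_lim[of "\<lambda>_. 1" 0], of "sgn y"] B_lim by (simp add: a_def)
    have ma: "(\<lambda>n. real (m n) * a n y) \<longlonglongrightarrow> c * y"
      using tendsto_mult[OF tendsto_const band_lim[of "\<lambda>n. real (m n)" c], of "sgn y"] mB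
      by (simp add: a_def mult_sgn_abs mult.left_commute)
    have "(\<lambda>n. (1 + a n y) powr real (m n)) \<longlonglongrightarrow> exp (c * y)"
      by (rule powr_one_plus_tendsto_exp[OF a0 ma])
    moreover have "\<forall>\<^sub>F n in sequentially. (1 + a n y) powr real (m n) = (1 + a n y) ^ m n"
    proof -
      have "\<forall>\<^sub>F n in sequentially. \<bar>a n y\<bar> < 1" using tendstoD[OF a0, of 1] by simp
      then show ?thesis by eventually_elim (auto intro!: powr_realpow)
    qed
    ultimately have f1: "(\<lambda>n. (1 + a n y) ^ m n) \<longlonglongrightarrow> exp (c * y)" by (rule Lim_transform_eventually)
    have f2: "(\<lambda>n. beta_kernel (height_exponent (d n)) (y / d n)) \<longlonglongrightarrow> exp (- (y\<^sup>2 / 2))"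
    proof (rule beta_kernel_tendsto_exp)
      show "(\<lambda>n. y / d n) \<longlonglongrightarrow> 0" by (rule filterlim_compose[OF _ dr]) real_asymp
      have "((\<lambda>x. ((x / 2 - 1) * x - 1 / 2) * (y\<^sup>2 / x\<^sup>2)) \<longlongrightarrow> y\<^sup>2 / 2) at_top" by real_asymp
      from filterlim_compose[OF this dr] show "(\<lambda>n. height_exponent (d n) * (y / d n)\<^sup>2) \<longlonglongrightarrow> y\<^sup>2 / 2"
        by (simp add: height_exponent_def power_divide)
    qed
    from tendsto_mult[OF f1 f2] show ?thesis by (simp add: cap exp_add[symmetric])
  qed
  have g_le: "\<bar>?g n y\<bar> \<le> exp (4 * K\<^sup>2) * exp (- (1 / 16) * y\<^sup>2)" for n y
  proof -
    have c0: "0 \<le> 1 + a n y" unfolding cap[symmetric] by (simp add: cap_cdf_nonneg)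
    have "a n y \<le> \<bar>sgn y\<bar> * band (d n) (\<bar>y\<bar> / d n)"
      unfolding a_def by (rule mult_right_mono[OF abs_ge_self]) (simp add: band_def)
    also have "\<dots> \<le> 1 * (B n * \<bar>y\<bar>)"
      by (rule mult_mono[OF _ band_up]) (auto simp: sgn_if band_def)
    finally have "1 + a n y \<le> exp (B n * \<bar>y\<bar>)" using exp_ge_add_one_self[of "B n * \<bar>y\<bar>"] by linarith
    then have "(1 + a n y) ^ m n \<le> exp (B n * \<bar>y\<bar>) ^ m n" using c0 by (rule power_mono)
    also have "\<dots> = exp ((m n * B n) * \<bar>y\<bar>)" unfolding exp_of_nat_mult[symmetric] by (simp add: mult.assoc)
    also have "\<dots> \<le> exp (K * \<bar>y\<bar>)" using K by (simp add: mult_right_mono)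
    finally have f1: "(1 + a n y) ^ m n \<le> exp (K * \<bar>y\<bar>)" .
    have "(real (d n))\<^sup>2 / 8 \<le> height_exponent (d n)"
    proof -
      have "height_exponent (d n) - (real (d n))\<^sup>2 / 8 = (3 / 8) * (real (d n) - 4) * real (d n) + (real (d n) - 4) / 2 + 3 / 2"
        by (simp add: height_exponent_def power2_eq_square field_simps)
      moreover have "0 \<le> (3 / 8) * (real (d n) - 4) * real (d n)" "0 \<le> (real (d n) - 4) / 2"
        using d4[of n] by auto
      ultimately show ?thesis by linarith
    qed
    then have f2: "beta_kernel (height_exponent (d n)) (y / d n) \<le> exp (- y\<^sup>2 / 8)"
      using beta_kernel_scaled_le[of "(real (d n))\<^sup>2" "height_exponent (d n)" y] pos[of n] by simp
    have "\<bar>?g n y\<bar> = (1 + a n y) ^ m n * beta_kernel (height_exponent (d n)) (y / d n)"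
      using c0 by (simp add: cap abs_mult beta_kernel_nonneg)
    also have "\<dots> \<le> exp (K * \<bar>y\<bar>) * exp (- y\<^sup>2 / 8)"
      using f1 f2 by (intro mult_mono) (auto simp: beta_kernel_nonneg)
    also have "\<dots> = exp (K * \<bar>y\<bar> - y\<^sup>2 / 8)" by (simp add: exp_add[symmetric])
    also have "\<dots> \<le> exp (4 * K\<^sup>2 - (1 / 16) * y\<^sup>2)"
    proof -
      \<comment> \<open>Completing the square gives up half of the Gaussian decay, 1/8 becoming
        1/16, to absorb the linear term.\<close>
      have "0 \<le> (\<bar>y\<bar> / 4 - 2 * K)\<^sup>2" by simp
      also have "(\<bar>y\<bar> / 4 - 2 * K)\<^sup>2 = (1 / 16) * y\<^sup>2 - K * \<bar>y\<bar> + 4 * K\<^sup>2"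
        by (simp add: power2_eq_square algebra_simps)
      finally show ?thesis unfolding exp_le_cancel_iff by linarith
    qed
    also have "\<dots> = exp (4 * K\<^sup>2) * exp (- (1 / 16) * y\<^sup>2)" unfolding exp_add[symmetric] by simp
    finally show ?thesis .
  qed
  note [measurable] = cap_cdf_measurable[OF d4]
  show ?thesis
  proof (rule integral_dominated_convergence[where w="\<lambda>y. exp (4 * K\<^sup>2) * exp (- (1 / 16) * y\<^sup>2)"])
    show "integrable lborel (\<lambda>y. exp (4 * K\<^sup>2) * exp (- (1 / 16) * y\<^sup>2))"
      by (intro integrable_mult_right integrable_exp_neg_square) simp
    show "AE y in lborel. (\<lambda>n. indicator A y * ?g n y) \<longlonglongrightarrow> indicator A y * exp (c * y - y\<^sup>2 / 2)"
      by (intro AE_I2 tendsto_mult tendsto_const g_lim)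
    show "AE y in lborel. norm (indicator A y * ?g n y) \<le> exp (4 * K\<^sup>2) * exp (- (1 / 16) * y\<^sup>2)" for n
      using g_le[of n] by (intro AE_I2) (auto simp: indicator_def)
  qed measurable
qed

text \<open>Completing the square: tilting the Gaussian weight by \<open>exp (c * y)\<close> moves
  its mean to \<open>c\<close>.\<close>

lemma exp_tilt_normal: "exp (c * y - y\<^sup>2 / 2) = exp (c\<^sup>2 / 2) * sqrt (2 * pi) * std_normal_density (y - c)"
proof -
  have "exp (c * y - y\<^sup>2 / 2) = exp (c\<^sup>2 / 2 + - (y - c)\<^sup>2 / 2)"
    by (simp add: power2_eq_square field_simps)
  then show ?thesis unfolding exp_add by (simp add: std_normal_density_def)
qed

lemma typical_height_cdf_limit:
  fixes d m :: "nat \<Rightarrow> nat"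
  assumes d4: "\<And>n. 4 \<le> d n" and d: "filterlim d at_top sequentially"
    and m: "(\<lambda>n. real (m n) / sqrt (d n)) \<longlonglongrightarrow> \<rho>"
  defines "c \<equiv> \<rho> * sqrt (2 / pi)"
  shows "(\<lambda>n. tilt_mass (d n) (m n) {t. d n * t - c \<le> x} / tilt_mass (d n) (m n) UNIV)
    \<longlonglongrightarrow> cdf std_normal_distribution x"
proof -
  define E where "E = exp (c\<^sup>2 / 2) * sqrt (2 * pi)"
  have E: "0 < E" by (simp add: E_def)
  let ?G = "\<lambda>A. LINT y|lborel. indicator A y * exp (c * y - y\<^sup>2 / 2)"
  have G: "?G A = E * (LINT y|lborel. indicator A (c + y) * std_normal_density y)" for A
  proof -
    have "?G A = (LINT y|lborel. E * (indicator A y * std_normal_density (y - c)))"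
      by (intro Bochner_Integration.integral_cong refl) (simp add: exp_tilt_normal E_def)
    also have "\<dots> = E * (LINT y|lborel. indicator A y * std_normal_density (y - c))" by simp
    also have "(LINT y|lborel. indicator A y * std_normal_density (y - c))
      = (LINT y|lborel. indicator A (c + y) * std_normal_density y)"
      by (subst lborel_integral_real_affine[where c=1 and t=c]) auto
    finally show ?thesis .
  qed
  have one: "?G UNIV = E" unfolding G using integral_normal_density[of 1 0] by simp
  have cdf: "?G {..x + c} = E * cdf std_normal_distribution x"
  proof -
    have "(LINT y|lborel. indicator {..x + c} (c + y) * std_normal_density y)
      = (LINT y|lborel. std_normal_density y * indicator {..x} y)"
      by (intro Bochner_Integration.integral_cong refl) (auto simp: indicator_def)
    also have "\<dots> = (LINT y|std_normal_distribution. indicator {..x} y)"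
      by (subst integral_density) auto
    also have "\<dots> = cdf std_normal_distribution x" by (simp add: cdf_def)
    finally show ?thesis unfolding G by simp
  qed
  let ?g = "\<lambda>n y. (2 * cap_cdf (d n) (y / d n)) ^ m n * beta_kernel (height_exponent (d n)) (y / d n)"
  have "(\<lambda>n. (LINT y|lborel. indicator {..x + c} y * ?g n y) / (LINT y|lborel. indicator UNIV y * ?g n y))
    \<longlonglongrightarrow> ?G {..x + c} / ?G UNIV"
    unfolding c_def
    by (intro tendsto_divide tilt_density_limit d4 d m) (use one E in \<open>simp_all add: c_def\<close>)
  moreover have "?G {..x + c} / ?G UNIV = cdf std_normal_distribution x" unfolding one cdf using E by simp
  moreover have "tilt_mass (d n) (m n) {t. d n * t - c \<le> x} / tilt_mass (d n) (m n) UNIV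
    = (LINT y|lborel. indicator {..x + c} y * ?g n y) / (LINT y|lborel. indicator UNIV y * ?g n y)" for n
  proof -
    have "{t. d n * t - c \<le> x} \<in> sets borel"
      by (intro borel_closed closed_Collect_le continuous_intros)
    moreover have "indicator {t. d n * t - c \<le> x} (y / d n) = (indicator {..x + c} y :: real)" for y
      using d4[of n] by (auto simp: indicator_def)
    ultimately show ?thesis using tilt_mass_ratio[OF d4, of "{t. d n * t - c \<le> x}" n "m n"] by simp
  qed
  ultimately show ?thesis by simp
qed

theorem theorem1:
  fixes d :: "nat \<Rightarrow> nat" and \<rho> :: real
    and M :: "nat \<Rightarrow> 'a measure" and X :: "nat \<Rightarrow> nat \<Rightarrow> 'a \<Rightarrow> nat \<Rightarrow> real"
    and N :: "nat \<Rightarrow> 'b measure" and H :: "nat \<Rightarrow> 'b \<Rightarrow> real"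
  assumes d_range: "\<forall>\<^sub>F n in sequentially. 2 \<le> d n \<and> d n < n"
    and d_growth: "(\<exists>c. \<forall>\<^sub>F n in sequentially. d n = c) \<or> filterlim d at_top sequentially"
    and M: "\<And>n. prob_space (M n)"
    and indep: "\<And>n. 2 \<le> d n \<Longrightarrow> d n < n \<Longrightarrow>
      prob_space.indep_vars (M n) (\<lambda>_. borel) (X n) {1..n}"
    and unif: "\<And>n i. 2 \<le> d n \<Longrightarrow> d n < n \<Longrightarrow> i \<in> {1..n} \<Longrightarrow>
      distr (M n) borel (X n i) = uniform_sphere (d n)"
    and H: "\<And>n. 2 \<le> d n \<Longrightarrow> d n < n \<Longrightarrow> typical_height (M n) n (d n) (X n) (N n) (H n)"
    and \<rho>: "0 \<le> \<rho>"
    and lim: "(\<lambda>n. (real n - real (d n)) / sqrt (real (d n))) \<longlonglongrightarrow> \<rho>"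
  shows "weak_conv_m
    (\<lambda>n. distr (N n) borel (\<lambda>y. real (d n) * H n y - \<rho> * sqrt (2 / pi)))
    std_normal_distribution"
proof -
  have d: "filterlim d at_top sequentially"
    using d_growth
  proof
    assume "\<exists>c. \<forall>\<^sub>F n in sequentially. d n = c"
    then obtain c where c: "\<forall>\<^sub>F n in sequentially. d n = c" by blast
    have "\<forall>\<^sub>F n in sequentially. 2 \<le> c" using c d_range by eventually_elim simp
    then have c2: "0 < real c" by simp
    have "filterlim (\<lambda>n. (real n - real c) / sqrt (real c)) at_top sequentially"
      using c2 by real_asymp
    moreover have "(\<lambda>n. (real n - real c) / sqrt (real c)) \<longlonglongrightarrow> \<rho>"
      by (rule Lim_transform_eventually[OF lim]) (use c in eventually_elim, simp)
    ultimately show ?thesis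
      using not_tendsto_and_filterlim_at_infinity[of sequentially] filterlim_at_top_imp_at_infinity
      by fastforce
  qed
  have "\<forall>\<^sub>F n in sequentially. 4 \<le> d n" using d by (simp add: filterlim_at_top)
  then have "\<forall>\<^sub>F n in sequentially. 4 \<le> d n \<and> d n < n" using d_range by eventually_elim simp
  then obtain n0 where n0: "\<And>n. n0 \<le> n \<Longrightarrow> 4 \<le> d n \<and> d n < n"
    unfolding eventually_sequentially by blast
  define c where "c = \<rho> * sqrt (2 / pi)"
  \<comment> \<open>The hypotheses are available from \<open>n0\<close> on only, so the sequence is
    shifted; convergence holds at every \<open>x\<close>, not just at continuity points of the
    limit.\<close>
  have "(\<lambda>n. cdf (distr (N n) borel (\<lambda>y. d n * H n y - c)) x) \<longlonglongrightarrow> cdf std_normal_distribution x" for x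
  proof (rule LIMSEQ_offset[where k=n0])
    let ?s = "\<lambda>n. n + n0"
    have d4: "4 \<le> d (?s n)" and dn: "d (?s n) < ?s n" for n using n0[of "?s n"] by auto
    have "filterlim (\<lambda>n. d (?s n)) at_top sequentially"
      by (rule filterlim_compose[OF d filterlim_add_const_nat_at_top])
    moreover have "(\<lambda>n. real (?s n - d (?s n)) / sqrt (d (?s n))) \<longlonglongrightarrow> \<rho>"
      using LIMSEQ_ignore_initial_segment[OF lim, of n0] dn by (simp add: of_nat_diff less_imp_le)
    ultimately have "(\<lambda>n. tilt_mass (d (?s n)) (?s n - d (?s n)) {t. d (?s n) * t - c \<le> x}
        / tilt_mass (d (?s n)) (?s n - d (?s n)) UNIV) \<longlonglongrightarrow> cdf std_normal_distribution x"
      unfolding c_def by (intro typical_height_cdf_limit d4)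
    moreover have "cdf (distr (N (?s n)) borel (\<lambda>y. d (?s n) * H (?s n) y - c)) x
      = tilt_mass (d (?s n)) (?s n - d (?s n)) {t. d (?s n) * t - c \<le> x} / tilt_mass (d (?s n)) (?s n - d (?s n)) UNIV" for n
    proof -
      let ?k = "?s n"
      have d2: "2 \<le> d ?k" using d4[of n] by simp
      have [measurable]: "H ?k \<in> borel_measurable (N ?k)" using H[OF d2 dn] by (simp add: typical_height_def)
      have "cdf (distr (N ?k) borel (\<lambda>y. d ?k * H ?k y - c)) x
        = measure (N ?k) {y \<in> space (N ?k). H ?k y \<in> {t. d ?k * t - c \<le> x}}"
        unfolding cdf_def by (subst measure_distr) (auto intro!: arg_cong[where f="measure (N ?k)"])
      also have "\<dots> = tilt_mass (d ?k) (?k - d ?k) {t. d ?k * t - c \<le> x} / tilt_mass (d ?k) (?k - d ?k) UNIV"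
        by (rule typical_height_law[OF d4 dn M indep[OF d2 dn] unif[OF d2 dn] H[OF d2 dn]]) measurable
      finally show ?thesis .
    qed
    ultimately show "(\<lambda>n. cdf (distr (N (?s n)) borel (\<lambda>y. d (?s n) * H (?s n) y - c)) x) \<longlonglongrightarrow> cdf std_normal_distribution x"
      by simp
  qed
  then show ?thesis unfolding weak_conv_m_def weak_conv_def c_def by simp
qed

end
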